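(* Let $T>0$, $p\in[1,\infty)$ and let $b:[0,T]\times\mathbb{R}^d\times\mathcal{P}_p(\mathbb{R}^d)\to\mathbb{R}^d$ be a measurable function for which there is a constant $K_b$ such that $|b(t,x,\mu)-b(t,x',\mu')|^p\le K_b(|x-x'|^p+\mathcal{W}_{\mathbb{R}^d,p}(\mu,\mu')^p)$ for all $t\in[0,T]$, $x,x'\in\mathbb{R}^d$, $\mu,\mu'\in\mathcal{P}_p(\mathbb{R}^d)$. Let $(\zeta^i,W^i)_{i\ge1}\subset L^p(\mathbb{R}^d\times C_{T,0})$ be a sequence of i.i.d. random variables with law $\bar\nu:=\mathcal{L}(\zeta^1,W^1)$. Assume that there exists $(x^0,\gamma^0)\in\mathbb{R}^d\times C_{T,0}$ such that $$\log\int_{\mathbb{R}^d\times C_{T,0}}\exp\big(\lambda(|x-x^0|+\|\gamma-\gamma^0\|_\infty)^p\big)\,d\bar\nu(x,\gamma)<+\infty\qquad\forall\lambda>0.$$ For each $N$, let $X^{(N)}=(X^{i,N})_{i=1,\dots,N}$ be the solution to the interacting particle system $$dX^{i,N}_t=b(t,X^{i,N}_t,L^N(X^{(N)}_t))\,dt+dW^i_t,\qquad X^{i,N}_0=\zeta^i,\qquad i=1,\dots,N.$$ Then the empirical law $L^N(X^{(N)})$ satisfies, on $\mathcal{P}_p(C_T)$ with speed $a_N=N$, a large deviations principle with good rate function $$\mu\mapsto H(\mu\mid\Phi(\bar\nu,\mu)),\qquad\mu\in\mathcal{P}_p(C_T).$$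
   Context: $C_T:=C([0,T],\mathbb{R}^d)$ with the supremum norm $\|\cdot\|_\infty$; $C_{T,0}=\{\gamma\in C_T:\gamma_0=0\}$; $\mathbb{R}^d\times C_{T,0}$ has a product norm, e.g. $|x|+\|\gamma\|_\infty$. $\mathcal{P}_p(E)$ is the set of Borel probability measures with finite $p$-th moment, with the $p$-Wasserstein metric $\mathcal{W}_{E,p}$ (and the topology it induces). $L^p(\mathbb{R}^d\times C_{T,0})$ denotes random variables with values in $\mathbb{R}^d\times C_{T,0}$ with finite $p$-th moment. $L^N(y^{(N)}):=\frac1N\sum_{i=1}^N\delta_{y^i}$ for $y^{(N)}=(y^1,\dots,y^N)$. The particle system is solved pathwise, in integrated form. For $\mu\in\mathcal{P}_p(C_T)$ with time marginals $\mu_t$, $S^\mu:\mathbb{R}^d\times C_{T,0}\to C_T$ maps $(x_0,\gamma)$ to the unique solution $x$ of $x_t=x_0+\int_0^t b(s,x_s,\mu_s)\,ds+\gamma_t$; and $\Phi(\nu,\mu):=(S^\mu)_\#\nu$ for $\nu\in\mathcal{P}_p(\mathbb{R}^d\times C_{T,0})$. The relative entropy is $H(\mu\mid\mu')=\int\log\big(\frac{d\mu}{d\mu'}\big)d\mu$ if $\mu\ll\mu'$, and $+\infty$ otherwise. Large deviations principle: let $E$ be a Polish space, $(a_N)$ positive reals with $a_N\to\infty$, $I:E\to[0,\infty]$ lower semicontinuous. A sequence of $E$-valued random variables with laws $\mu^N$ satisfies a large deviations principle with rate function $I$ (and speed $a_N$) if for each Borel $A\subset E$, $-\inf_{A^\circ}I\le\liminf_N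 a_N^{-1}\log\mu^N(A)\le\limsup_N a_N^{-1}\log\mu^N(A)\le-\inf_{\bar A}I$. The rate function is good if its sublevel sets are compact. *)

theory Defs
  imports "HOL-Probability.Probability"
begin

section \<open>Metric spaces and Borel measures\<close>

definition borel_of :: "'a topology \<Rightarrow> 'a measure" where
  "borel_of X = sigma (topspace X) {U. openin X U}"

lemma space_borel_of [simp]: "space (borel_of X) = topspace X"
  unfolding borel_of_def by (rule space_measure_of) (auto dest: openin_subset)

lemma sets_borel_of: "sets (borel_of X) = sigma_sets (topspace X) {U. openin X U}"
  unfolding borel_of_def by (rule sets_measure_of) (auto dest: openin_subset)

lemma sets_borel_of_euclidean: "sets (borel_of euclidean) = sets borel"
  by (simp add: sets_borel_of borel_def)

abbreviation mborel :: "'a metric \<Rightarrow> 'a measure" where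
  "mborel m \<equiv> borel_of (mtopology_of m)"

text \<open>The product of two metric spaces with the metric corresponding to the norm
  \<open>|x| + \<parallel>\<gamma>\<parallel>\<close>; the library's \<^const>\<open>prod_metric\<close> is the Euclidean combination.\<close>

definition sum_metric :: "'a metric \<Rightarrow> 'b metric \<Rightarrow> ('a \<times> 'b) metric" where
  "sum_metric m1 m2 =
     metric (mspace m1 \<times> mspace m2, \<lambda>(x, y) (x', y'). mdist m1 x x' + mdist m2 y y')"

lemma Metric_space_sum_metric:
  "Metric_space (mspace m1 \<times> mspace m2)
     (\<lambda>(x, y) (x', y'). mdist m1 x x' + mdist m2 y y')"
proof -
  interpret A: Metric_space "mspace m1" "mdist m1" by simp
  interpret B: Metric_space "mspace m2" "mdist m2" by simp
  show ?thesis
  proof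
    fix u v w
    show "0 \<le> (case u of (x, y) \<Rightarrow> \<lambda>(x', y'). mdist m1 x x' + mdist m2 y y') v"
      by (simp split: prod.split)
    show "(case u of (x, y) \<Rightarrow> \<lambda>(x', y'). mdist m1 x x' + mdist m2 y y') v =
          (case v of (x, y) \<Rightarrow> \<lambda>(x', y'). mdist m1 x x' + mdist m2 y y') u"
      by (simp add: A.commute B.commute split: prod.split)
    assume u: "u \<in> mspace m1 \<times> mspace m2" and v: "v \<in> mspace m1 \<times> mspace m2"
    show "((case u of (x, y) \<Rightarrow> \<lambda>(x', y'). mdist m1 x x' + mdist m2 y y') v = 0) = (u = v)"
      using u v by (auto simp: add_nonneg_eq_0_iff)
    assume w: "w \<in> mspace m1 \<times> mspace m2"
    show "(case u of (x, y) \<Rightarrow> \<lambda>(x', y'). mdist m1 x x' + mdist m2 y y') w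
        \<le> (case u of (x, y) \<Rightarrow> \<lambda>(x', y'). mdist m1 x x' + mdist m2 y y') v +
          (case v of (x, y) \<Rightarrow> \<lambda>(x', y'). mdist m1 x x' + mdist m2 y y') w"
    proof (cases u, cases v, cases w)
      fix a b a' b' a'' b''
      assume e: "u = (a, b)" "v = (a', b')" "w = (a'', b'')"
      have "mdist m1 a a'' \<le> mdist m1 a a' + mdist m1 a' a''"
        using u v w e by (intro A.triangle) auto
      moreover have "mdist m2 b b'' \<le> mdist m2 b b' + mdist m2 b' b''"
        using u v w e by (intro B.triangle) auto
      ultimately show ?thesis by (simp add: e)
    qed
  qed
qed

lemma mspace_sum_metric [simp]: "mspace (sum_metric m1 m2) = mspace m1 \<times> mspace m2"
  unfolding sum_metric_def
  by (rule Metric_space.mspace_metric[OF Metric_space_sum_metric])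

lemma mdist_sum_metric [simp]:
  "mdist (sum_metric m1 m2) (x, y) (x', y') = mdist m1 x x' + mdist m2 y y'"
  unfolding sum_metric_def
  by (simp add: Metric_space.mdist_metric[OF Metric_space_sum_metric])

section \<open>Wasserstein spaces\<close>

definition finite_moment_measures :: "real \<Rightarrow> 'a metric \<Rightarrow> 'a measure set" where
  "finite_moment_measures p m =
     {\<mu>. prob_space \<mu> \<and> sets \<mu> = sets (mborel m) \<and>
         (\<exists>x0\<in>mspace m. (\<integral>\<^sup>+ x. ennreal (mdist m x x0 powr p) \<partial>\<mu>) < \<infinity>)}"

text \<open>Couplings live on the product \<open>\<sigma>\<close>-algebra, which is the Borel \<open>\<sigma>\<close>-algebra of the
  product space because all metric spaces considered here are separable.\<close>

definition couplings :: "'a measure \<Rightarrow> 'a measure \<Rightarrow> ('a \<times> 'a) measure set" where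
  "couplings \<mu> \<nu> =
     {\<pi>. sets \<pi> = sets (\<mu> \<Otimes>\<^sub>M \<nu>) \<and> distr \<pi> \<mu> fst = \<mu> \<and> distr \<pi> \<nu> snd = \<nu>}"

definition wasserstein :: "real \<Rightarrow> 'a metric \<Rightarrow> 'a measure \<Rightarrow> 'a measure \<Rightarrow> real" where
  "wasserstein p m \<mu> \<nu> =
     enn2real (INF \<pi>\<in>couplings \<mu> \<nu>. \<integral>\<^sup>+ (x, y). ennreal (mdist m x y powr p) \<partial>\<pi>) powr (1 / p)"

definition wasserstein_topology :: "real \<Rightarrow> 'a metric \<Rightarrow> 'a measure topology" where
  "wasserstein_topology p m =
     Metric_space.mtopology (finite_moment_measures p m) (wasserstein p m)"

definition Lp_random_variable ::
    "real \<Rightarrow> 'w measure \<Rightarrow> 'a metric \<Rightarrow> ('w \<Rightarrow> 'a) \<Rightarrow> bool" where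
  "Lp_random_variable p M m X \<longleftrightarrow>
     X \<in> M \<rightarrow>\<^sub>M mborel m \<and>
     (\<exists>x0\<in>mspace m. (\<integral>\<^sup>+ \<omega>. ennreal (mdist m (X \<omega>) x0 powr p) \<partial>M) < \<infinity>)"

definition empirical_measure :: "'a measure \<Rightarrow> nat \<Rightarrow> (nat \<Rightarrow> 'a) \<Rightarrow> 'a measure" where
  "empirical_measure B N y = distr (uniform_count_measure {1..N}) B y"

lemma emeasure_empirical_measure:
  assumes "\<And>i. i \<in> {1..N} \<Longrightarrow> y i \<in> space B" and "A \<in> sets B"
  shows "emeasure (empirical_measure B N y) A =
           ennreal ((\<Sum>i=1..N. indicator A (y i)) / real N)"
proof -
  have y: "y \<in> uniform_count_measure {1..N} \<rightarrow>\<^sub>M B"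
    using assms(1) by (auto simp: measurable_def space_uniform_count_measure
        sets_uniform_count_measure)
  have *: "y -` A \<inter> space (uniform_count_measure {1..N}) = {i\<in>{1..N}. y i \<in> A}"
    by (auto simp: space_uniform_count_measure)
  have "(\<Sum>i=1..N. indicator A (y i) :: real) = real (card {i\<in>{1..N}. y i \<in> A})"
    by (simp add: indicator_def sum.If_cases Int_def)
  moreover have "emeasure (empirical_measure B N y) A =
      ennreal (real (card {i\<in>{1..N}. y i \<in> A}) / real (card {1..N}))"
    unfolding empirical_measure_def emeasure_distr[OF y assms(2)] *
    by (rule emeasure_uniform_count_measure) auto
  ultimately show ?thesis by simp
qed

section \<open>Path spaces and the drift equation\<close>

text \<open>Elements are functions on the whole real line that are \<^const>\<open>undefined\<close> outside
  \<open>[0,T]\<close>; the metric is the supremum distance over \<open>[0,T]\<close>.\<close>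

definition path_metric :: "real \<Rightarrow> (real \<Rightarrow> real^'d) metric" where
  "path_metric T = cfunspace (top_of_set {0..T}) euclidean_metric"

definition path0_metric :: "real \<Rightarrow> (real \<Rightarrow> real^'d) metric" where
  "path0_metric T = submetric (path_metric T) {\<gamma>. \<gamma> 0 = 0}"

abbreviation data_metric :: "real \<Rightarrow> ((real^'d) \<times> (real \<Rightarrow> real^'d)) metric" where
  "data_metric T \<equiv> sum_metric euclidean_metric (path0_metric T)"

text \<open>Integrability is part of the notion of solution, since the Bochner integral of a
  non-integrable function is \<open>0\<close>.\<close>

definition solves_integral_equation ::
    "real \<Rightarrow> (real \<Rightarrow> real^'d \<Rightarrow> real^'d) \<Rightarrow> real^'d \<Rightarrow> (real \<Rightarrow> real^'d) \<Rightarrow> (real \<Rightarrow> real^'d) \<Rightarrow> bool"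
  where
  "solves_integral_equation T f x0 \<gamma> x \<longleftrightarrow>
     x \<in> mspace (path_metric T) \<and>
     set_integrable lborel {0..T} (\<lambda>s. f s (x s)) \<and>
     (\<forall>t\<in>{0..T}. x t = x0 + (LINT s:{0..t}|lborel. f s (x s)) + \<gamma> t)"

definition time_marginal :: "(real \<Rightarrow> real^'d) measure \<Rightarrow> real \<Rightarrow> (real^'d) measure" where
  "time_marginal \<mu> t = distr \<mu> borel (\<lambda>x. x t)"

definition solution_map ::
    "real \<Rightarrow> (real \<Rightarrow> real^'d \<Rightarrow> (real^'d) measure \<Rightarrow> real^'d) \<Rightarrow> (real \<Rightarrow> real^'d) measure
      \<Rightarrow> (real^'d) \<times> (real \<Rightarrow> real^'d) \<Rightarrow> (real \<Rightarrow> real^'d)" where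
  "solution_map T b \<mu> = (\<lambda>(x0, \<gamma>).
     THE x. solves_integral_equation T (\<lambda>s y. b s y (time_marginal \<mu> s)) x0 \<gamma> x)"

definition Phi ::
    "real \<Rightarrow> (real \<Rightarrow> real^'d \<Rightarrow> (real^'d) measure \<Rightarrow> real^'d)
      \<Rightarrow> ((real^'d) \<times> (real \<Rightarrow> real^'d)) measure \<Rightarrow> (real \<Rightarrow> real^'d) measure
      \<Rightarrow> (real \<Rightarrow> real^'d) measure" where
  "Phi T b \<nu> \<mu> = distr \<nu> (mborel (path_metric T)) (solution_map T b \<mu>)"

definition particle_system_solution ::
    "real \<Rightarrow> (real \<Rightarrow> real^'d \<Rightarrow> (real^'d) measure \<Rightarrow> real^'d) \<Rightarrow> nat
      \<Rightarrow> (nat \<Rightarrow> real^'d) \<Rightarrow> (nat \<Rightarrow> real \<Rightarrow> real^'d) \<Rightarrow> (nat \<Rightarrow> real \<Rightarrow> real^'d) \<Rightarrow> bool" where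
  "particle_system_solution T b N z w x \<longleftrightarrow>
     (\<forall>i\<in>{1..N}. solves_integral_equation T
        (\<lambda>s y. b s y (empirical_measure borel N (\<lambda>j. x j s))) (z i) (w i) (x i))"

section \<open>Relative entropy and large deviations\<close>

definition extended_ln :: "ennreal \<Rightarrow> ereal" where
  "extended_ln x =
     (if x = 0 then - \<infinity> else if x = \<infinity> then \<infinity> else ereal (ln (enn2real x)))"

text \<open>The integral of the logarithm is taken with values in \<open>(-\<infinity>, \<infinity>]\<close>: for probability
  measures \<open>\<mu> \<lless> \<mu>'\<close> the negative part of \<open>log (d\<mu>/d\<mu>')\<close> is always \<open>\<mu>\<close>-integrable.  The
  library's \<^const>\<open>KL_divergence\<close> is \<open>0\<close> when the logarithm is not integrable.\<close>

definition relative_entropy :: "'a measure \<Rightarrow> 'a measure \<Rightarrow> ereal" where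
  "relative_entropy \<mu> \<mu>' =
     (if absolutely_continuous \<mu>' \<mu> then
        enn2ereal (\<integral>\<^sup>+ x. ennreal (ln (enn2real (RN_deriv \<mu>' \<mu> x))) \<partial>\<mu>) -
        enn2ereal (\<integral>\<^sup>+ x. ennreal (- ln (enn2real (RN_deriv \<mu>' \<mu> x))) \<partial>\<mu>)
      else \<infinity>)"

definition rate_function :: "'e topology \<Rightarrow> ('e \<Rightarrow> ereal) \<Rightarrow> bool" where
  "rate_function E I \<longleftrightarrow>
     (\<forall>x\<in>topspace E. 0 \<le> I x) \<and> (\<forall>c. closedin E {x\<in>topspace E. I x \<le> c})"

definition good_rate_function :: "'e topology \<Rightarrow> ('e \<Rightarrow> ereal) \<Rightarrow> bool" where
  "good_rate_function E I \<longleftrightarrow>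
     rate_function E I \<and> (\<forall>c::real. compactin E {x\<in>topspace E. I x \<le> ereal c})"

definition satisfies_LDP ::
    "'w measure \<Rightarrow> 'e topology \<Rightarrow> (nat \<Rightarrow> 'w \<Rightarrow> 'e) \<Rightarrow> (nat \<Rightarrow> real) \<Rightarrow> ('e \<Rightarrow> ereal) \<Rightarrow> bool" where
  "satisfies_LDP M E Y a I \<longleftrightarrow>
     rate_function E I \<and>
     (\<forall>N\<ge>1. 0 < a N) \<and> filterlim a at_top sequentially \<and>
     (\<forall>N\<ge>1. Y N \<in> M \<rightarrow>\<^sub>M borel_of E) \<and>
     (\<forall>A\<in>sets (borel_of E).
        - (INF x\<in>E interior_of A. I x)
          \<le> liminf (\<lambda>N. extended_ln (emeasure (distr M (borel_of E) (Y N)) A) / ereal (a N)) \<and>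
        liminf (\<lambda>N. extended_ln (emeasure (distr M (borel_of E) (Y N)) A) / ereal (a N))
          \<le> limsup (\<lambda>N. extended_ln (emeasure (distr M (borel_of E) (Y N)) A) / ereal (a N)) \<and>
        limsup (\<lambda>N. extended_ln (emeasure (distr M (borel_of E) (Y N)) A) / ereal (a N))
          \<le> - (INF x\<in>E closure_of A. I x))"

end

theory Submission
  imports Defs
begin

text \<open>
  For data \<open>\<nu>\<close> on \<open>\<real>\<^sup>d \<times> C\<^sub>T\<^sub>,\<^sub>0\<close> let \<open>\<Psi>(\<nu>)\<close> be the unique fixed point of
  \<open>\<mu> \<mapsto> \<Phi>(\<nu>, \<mu>)\<close>.  The particle system says exactly that the empirical measure of the particles
  is \<open>\<Psi>\<close> of the empirical measure of the data.  The map \<open>\<Psi>\<close> is Lipschitz for the Wasserstein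
  distances and bijective: its inverse \<open>\<Theta>\<close> sends \<open>\<mu>\<close> to its image under \<open>(S\<^sup>\<mu>)\<^sup>-\<^sup>1\<close>, which is
  given explicitly by \<open>x \<mapsto> (x\<^sub>0, x - x\<^sub>0 - \<integral> b(s, x\<^sub>s, \<mu>\<^sub>s) ds)\<close>.  Hence the statement is
  the contraction of Sanov's theorem for the data in the Wasserstein topology, and invariance
  of the entropy under the bijection \<open>S\<^sup>\<mu>\<close> gives
  \<open>H(\<Theta>(\<mu>) | \<nu>) = H(\<mu> | \<Phi>(\<nu>, \<mu>))\<close> for the rate function.

  Sanov's theorem is reduced to finitely many cells.  Under the exponential moment condition,
  moving each point to the representative of its cell costs little \<open>L\<^sup>p\<close> distance, with
  exponentially high probability for the empirical measure and uniformly over all measures of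
  bounded entropy.  On the finitely many cells the upper bound is the method of types and the
  lower bound a tilting argument.  Sublevel sets of the entropy are compact because limits of
  cell masses define a martingale of densities with bounded entropy, which converges in
  \<open>L\<^sup>1\<close>; neither tightness nor completeness of the space is used.
\<close>

section \<open>Norm bounds in \<open>L\<^sup>p\<close>\<close>

text \<open>The hypotheses do not say that \<open>b s 0 \<delta>0\<close> is integrable in time,
  without which no drift equation has a solution. This is recovered from the given solution of the
  one-particle system; \<open>drift_base\<close> collects what holds before that,
  \<open>drift\<close> what needs it. The cells are nested refinements of nearest-point cells of a
  dense sequence whose first point is the centre of the exponential moment. No representative is
  then farther from its point than this centre, so one integrable function dominates all
  quantization errors. One choice of parameters recurs: for an entropy level \<open>c\<close> and an
  error \<open>a\<close>, take \<open>\<theta>\<close> with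
  \<open>c + 1 \<le> \<theta> * a powr p\<close>, then a level \<open>n\<close> with
  \<open>kappa \<theta> n \<le> 1\<close>. It serves all measures of entropy at most
  \<open>c\<close>, by convex duality, and the sample, by Chernoff's bound. Norms occur only as
  upper bounds, through \<open>Lp_le\<close>, so that each bound carries its own finiteness.
  Measure-valued maps are measurable as limits of approximants with discrete values, and fixed
  points come from iterating solution maps in the complete path space.\<close>

definition Lp_le :: "real \<Rightarrow> 'a measure \<Rightarrow> ('a \<Rightarrow> real) \<Rightarrow> real \<Rightarrow> bool" where
  "Lp_le p M f a \<longleftrightarrow> 0 \<le> a \<and> (\<forall>x\<in>space M. 0 \<le> f x) \<and> f \<in> borel_measurable M \<and>
     (\<integral>\<^sup>+ x. ennreal (f x powr p) \<partial>M) \<le> ennreal (a powr p)"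

text \<open>At the endpoint 0 convexity amounts to \<open>v powr p \<le> v\<close> for
  \<open>0 < v < 1\<close>, which holds as \<open>1 \<le> p\<close>; away from it this is convexity
  on the open half-line.\<close>

lemma powr_convex_nonneg:
  fixes p s t u :: real
  assumes p: "1 \<le> p" and s: "0 \<le> s" and t: "0 \<le> t" and u: "0 < u" "u < 1"
  shows "(u * s + (1 - u) * t) powr p \<le> u * s powr p + (1 - u) * t powr p"
proof -
  have shrink: "(v * x) powr p \<le> v * x powr p" if "0 < v" "v < 1" "0 \<le> x" for v x :: real
  proof -
    have "v powr p \<le> v powr 1"
      using that p by (intro powr_mono') auto
    then show ?thesis
      using that by (simp add: powr_mult mult_right_mono)
  qed
  consider "s = 0" | "t = 0" | "0 < s" "0 < t"
    using s t by linarith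
  then show ?thesis
  proof cases
    case 1
    then show ?thesis using shrink[of "1 - u" t] u t p by simp
  next
    case 2
    then show ?thesis using shrink[of u s] u s p by simp
  next
    case 3
    then show ?thesis
      using convex_onD[OF powr_convex[OF p], of u t s] u by (simp add: algebra_simps)
  qed
qed

lemma Lp_le_zeroD:
  assumes "Lp_le p M f 0" and "0 < p"
  shows "AE x in M. f x = 0"
proof -
  have [measurable]: "f \<in> borel_measurable M"
    using assms by (auto simp: Lp_le_def)
  have "(\<integral>\<^sup>+ x. ennreal (f x powr p) \<partial>M) = 0"
    using assms by (simp add: Lp_le_def)
  then have "AE x in M. ennreal (f x powr p) = 0"
    by (subst (asm) nn_integral_0_iff_AE) auto
  then show ?thesis
    by eventually_elim (simp add: ennreal_eq_0_iff)
qed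

lemma Lp_le_cong_AE:
  assumes "Lp_le p M f a" "AE x in M. f x = g x" "g \<in> borel_measurable M" "\<forall>x\<in>space M. 0 \<le> g x"
  shows "Lp_le p M g a"
proof -
  have "(\<integral>\<^sup>+ x. ennreal (g x powr p) \<partial>M) = (\<integral>\<^sup>+ x. ennreal (f x powr p) \<partial>M)"
    by (rule nn_integral_cong_AE) (use assms(2) in auto)
  then show ?thesis using assms by (auto simp: Lp_le_def)
qed

lemma Lp_le_mono:
  assumes "Lp_le p M g b" "AE x in M. f x \<le> g x" "f \<in> borel_measurable M" "\<forall>x\<in>space M. 0 \<le> f x"
    "b \<le> a" "0 < p"
  shows "Lp_le p M f a"
proof -
  have "(\<integral>\<^sup>+ x. ennreal (f x powr p) \<partial>M) \<le> (\<integral>\<^sup>+ x. ennreal (g x powr p) \<partial>M)"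
    by (rule nn_integral_mono_AE)
      (use assms(2) AE_space in eventually_elim, use assms in \<open>auto intro!: ennreal_leI powr_mono2\<close>)
  also have "\<dots> \<le> ennreal (b powr p)"
    using assms by (auto simp: Lp_le_def)
  also have "\<dots> \<le> ennreal (a powr p)"
    using assms by (auto simp: Lp_le_def intro!: ennreal_leI powr_mono2)
  finally show ?thesis using assms by (auto simp: Lp_le_def)
qed

text \<open>Minkowski's inequality. \<open>f + g\<close> is \<open>a + b\<close> times the convex
  combination of \<open>f / a\<close> and \<open>g / b\<close> with weights
  \<open>a / (a + b)\<close> and \<open>b / (a + b)\<close>, to which convexity of the power applies
  pointwise. A bound 0 makes its function vanish almost everywhere, so this case is treated
  apart.\<close>

lemma Lp_le_add:
  assumes f: "Lp_le p M f a" and g: "Lp_le p M g b" and p: "1 \<le> p"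
  shows "Lp_le p M (\<lambda>x. f x + g x) (a + b)"
proof -
  have [measurable]: "f \<in> borel_measurable M" "g \<in> borel_measurable M"
    using f g by (auto simp: Lp_le_def)
  have nonneg: "\<forall>x\<in>space M. 0 \<le> f x" "\<forall>x\<in>space M. 0 \<le> g x" "0 \<le> a" "0 \<le> b"
    using f g by (auto simp: Lp_le_def)
  consider "a = 0" | "b = 0" | "0 < a" "0 < b"
    using nonneg by linarith
  then show ?thesis
  proof cases
    case 1
    then have "AE x in M. f x = 0" using Lp_le_zeroD f p by force
    then have "AE x in M. g x = f x + g x" by eventually_elim simp
    then have "Lp_le p M (\<lambda>x. f x + g x) b" by (rule Lp_le_cong_AE[OF g]) (use nonneg in auto)
    then show ?thesis using 1 by simp
  next
    case 2
    then have "AE x in M. g x = 0" using Lp_le_zeroD g p by force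
    then have "AE x in M. f x = f x + g x" by eventually_elim simp
    then have "Lp_le p M (\<lambda>x. f x + g x) a" by (rule Lp_le_cong_AE[OF f]) (use nonneg in auto)
    then show ?thesis using 2 by simp
  next
    case 3
    define u where "u = a / (a + b)"
    have u: "0 < u" "u < 1" "1 - u = b / (a + b)"
      using 3 by (auto simp: u_def field_simps)
    define c where "c = (a + b) powr p"
    have ab: "(a + b) powr p > 0" "a powr p > 0" "b powr p > 0" using 3 by auto
    have *: "(f x + g x) powr p
        \<le> c * u / a powr p * f x powr p + c * (1 - u) / b powr p * g x powr p"
      if x: "x \<in> space M" for x
    proof -
      have f0: "0 \<le> f x" "0 \<le> g x" using x nonneg by auto
      have eq: "f x + g x = (a + b) * (u * (f x / a) + (1 - u) * (g x / b))"
      proof -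
        have "(a + b) * (u * (f x / a)) = f x" using 3 by (simp add: u_def)
        moreover have "(a + b) * ((1 - u) * (g x / b)) = g x" using 3 unfolding u(3) by simp
        ultimately show ?thesis by (simp only: distrib_left)
      qed
      have "(f x + g x) powr p = c * (u * (f x / a) + (1 - u) * (g x / b)) powr p"
        unfolding c_def eq using 3 u f0 by (subst powr_mult) auto
      also have "\<dots> \<le> c * (u * (f x / a) powr p + (1 - u) * (g x / b) powr p)"
        unfolding c_def using powr_convex_nonneg[OF p, of "f x / a" "g x / b" u] 3 u f0
        by (intro mult_left_mono) auto
      also have "\<dots> = c * u / a powr p * f x powr p + c * (1 - u) / b powr p * g x powr p"
        using 3 f0 by (simp add: powr_divide field_simps)
      finally show ?thesis .
    qed
    have k: "0 \<le> c * u / a powr p" "0 \<le> c * (1 - u) / b powr p"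
      using u(1,2) ab by (simp_all add: c_def)
    have "(\<integral>\<^sup>+ x. ennreal ((f x + g x) powr p) \<partial>M)
        \<le> (\<integral>\<^sup>+ x. ennreal (c * u / a powr p) * ennreal (f x powr p)
             + ennreal (c * (1 - u) / b powr p) * ennreal (g x powr p) \<partial>M)"
    proof (rule nn_integral_mono)
      fix x assume "x \<in> space M"
      then have "ennreal ((f x + g x) powr p)
          \<le> ennreal (c * u / a powr p * f x powr p + c * (1 - u) / b powr p * g x powr p)"
        using * by (intro ennreal_leI) auto
      then show "ennreal ((f x + g x) powr p) \<le> ennreal (c * u / a powr p) * ennreal (f x powr p)
             + ennreal (c * (1 - u) / b powr p) * ennreal (g x powr p)"
        using k by (simp only: ennreal_plus ennreal_mult' mult_nonneg_nonneg powr_ge_zero)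
    qed
    also have "\<dots> = ennreal (c * u / a powr p) * (\<integral>\<^sup>+ x. ennreal (f x powr p) \<partial>M)
        + ennreal (c * (1 - u) / b powr p) * (\<integral>\<^sup>+ x. ennreal (g x powr p) \<partial>M)"
      by (simp add: nn_integral_add nn_integral_cmult)
    also have "\<dots> \<le> ennreal (c * u / a powr p) * ennreal (a powr p)
        + ennreal (c * (1 - u) / b powr p) * ennreal (b powr p)"
      using f g by (intro add_mono mult_left_mono) (auto simp: Lp_le_def)
    also have "\<dots> = ennreal (c * u / a powr p * a powr p + c * (1 - u) / b powr p * b powr p)"
      using k by (simp only: ennreal_plus ennreal_mult' mult_nonneg_nonneg powr_ge_zero)
    also have "\<dots> = ennreal (c * u + c * (1 - u))"
      using 3 by simp
    also have "\<dots> = ennreal ((a + b) powr p)"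
      by (simp add: c_def algebra_simps)
    finally show ?thesis
      using nonneg by (auto simp: Lp_le_def)
  qed
qed

lemma Lp_le_const:
  assumes "prob_space M" "0 \<le> a"
  shows "Lp_le p M (\<lambda>_. a) a"
proof -
  interpret prob_space M by fact
  show ?thesis using assms by (simp add: Lp_le_def emeasure_space_1)
qed

lemma Lp_le_distr:
  assumes "h \<in> M \<rightarrow>\<^sub>M N" "f \<in> borel_measurable N" "\<forall>x\<in>space N. 0 \<le> f x"
  shows "Lp_le p (distr M N h) f a \<longleftrightarrow> Lp_le p M (\<lambda>x. f (h x)) a"
  using assms measurable_space[OF assms(1)] by (auto simp: Lp_le_def nn_integral_distr)

lemma Lp_le_cmult:
  assumes "Lp_le p M f a" "0 \<le> c"
  shows "Lp_le p M (\<lambda>x. c * f x) (c * a)"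
proof -
  have [measurable]: "f \<in> borel_measurable M" using assms by (auto simp: Lp_le_def)
  have "(\<integral>\<^sup>+ x. ennreal ((c * f x) powr p) \<partial>M) = (\<integral>\<^sup>+ x. ennreal (c powr p) * ennreal (f x powr p) \<partial>M)"
    using assms by (intro nn_integral_cong) (auto simp: powr_mult ennreal_mult Lp_le_def)
  also have "\<dots> = ennreal (c powr p) * (\<integral>\<^sup>+ x. ennreal (f x powr p) \<partial>M)"
    by (rule nn_integral_cmult) auto
  also have "\<dots> \<le> ennreal (c powr p) * ennreal (a powr p)"
    using assms by (intro mult_left_mono) (auto simp: Lp_le_def)
  also have "\<dots> = ennreal ((c * a) powr p)"
    using assms by (simp add: powr_mult ennreal_mult Lp_le_def)
  finally show ?thesis using assms by (auto simp: Lp_le_def)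
qed

lemma Lp_le_exists:
  assumes "f \<in> borel_measurable M" "\<forall>x\<in>space M. 0 \<le> f x"
    "(\<integral>\<^sup>+ x. ennreal (f x powr p) \<partial>M) < \<infinity>" and p: "0 < p"
  obtains a where "Lp_le p M f a"
proof -
  define J where "J = enn2real (\<integral>\<^sup>+ x. ennreal (f x powr p) \<partial>M)"
  have J: "0 \<le> J" "(\<integral>\<^sup>+ x. ennreal (f x powr p) \<partial>M) = ennreal J"
    using assms(3) by (simp_all add: J_def)
  have "Lp_le p M f (J powr (1 / p))"
    using assms J by (simp add: Lp_le_def powr_powr)
  then show ?thesis by (rule that)
qed

section \<open>Couplings\<close>

text \<open>The dense sequence is a parameter because its points later become cell representatives,
  and \<open>e 0\<close> the centre of the moment conditions.\<close>

locale separable_metric =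
  fixes m :: "'a metric" and e :: "nat \<Rightarrow> 'a"
  assumes e_in [simp]: "e k \<in> mspace m"
    and e_dense: "x \<in> mspace m \<Longrightarrow> 0 < r \<Longrightarrow> \<exists>k. mdist m x (e k) < r"
begin

lemma mball_sets: "{x \<in> mspace m. mdist m x y < r} \<in> sets (mborel m)" if "y \<in> mspace m"
proof -
  interpret Metric_space "mspace m" "mdist m" by simp
  have "{x \<in> mspace m. mdist m x y < r} = mball y r"
    using that by (auto simp: in_mball commute)
  then have "openin (mtopology_of m) {x \<in> mspace m. mdist m x y < r}"
    by (simp add: mtopology_of_def)
  then show ?thesis
    by (simp add: sets_borel_of sigma_sets.Basic)
qed

lemma dist_const_measurable [measurable (raw)]:
  assumes "y \<in> mspace m" shows "(\<lambda>x. mdist m x y) \<in> borel_measurable (mborel m)"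
  by (rule borel_measurableI_less) (use mball_sets[OF assms] in auto)

text \<open>The set where the distance is below \<open>r\<close> is a countable union over
  \<open>k\<close> of sets given by distances to the fixed point \<open>e k\<close>. Hence it lies
  in the product sigma-algebra, on which couplings live.\<close>

lemma dist_measurable [measurable]:
  "(\<lambda>z. mdist m (fst z) (snd z)) \<in> borel_measurable (mborel m \<Otimes>\<^sub>M mborel m)"
proof (rule borel_measurableI_less)
  fix r :: real
  interpret Metric_space "mspace m" "mdist m" by simp
  let ?P = "mborel m \<Otimes>\<^sub>M mborel m"
  have [measurable]: "(\<lambda>x. mdist m x (e k)) \<in> borel_measurable (mborel m)" for k
    by (rule dist_const_measurable) simp
  have "{z \<in> space ?P. mdist m (fst z) (snd z) < r}
      = (\<Union>k. {z \<in> space ?P. mdist m (fst z) (e k) + mdist m (snd z) (e k) < r})"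
  proof (intro equalityI subsetI)
    fix z assume z: "z \<in> {z \<in> space ?P. mdist m (fst z) (snd z) < r}"
    define s where "s = (r - mdist m (fst z) (snd z)) / 2"
    have zs: "fst z \<in> mspace m" "snd z \<in> mspace m" "0 < s"
      using z by (auto simp: space_pair_measure s_def)
    obtain k where k: "mdist m (snd z) (e k) < s" using e_dense zs by blast
    have "mdist m (fst z) (e k) \<le> mdist m (fst z) (snd z) + mdist m (snd z) (e k)"
      using zs by (intro triangle) auto
    then have "mdist m (fst z) (e k) + mdist m (snd z) (e k) < r"
      using k by (simp add: s_def)
    then show "z \<in> (\<Union>k. {z \<in> space ?P. mdist m (fst z) (e k) + mdist m (snd z) (e k) < r})"
      using z by auto
  next
    fix z assume "z \<in> (\<Union>k. {z \<in> space ?P. mdist m (fst z) (e k) + mdist m (snd z) (e k) < r})"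
    then obtain k where k: "z \<in> space ?P" "mdist m (fst z) (e k) + mdist m (snd z) (e k) < r" by auto
    have "mdist m (fst z) (snd z) \<le> mdist m (fst z) (e k) + mdist m (e k) (snd z)"
      using k by (intro triangle) (auto simp: space_pair_measure)
    then show "z \<in> {z \<in> space ?P. mdist m (fst z) (snd z) < r}"
      using k by (simp add: commute)
  qed
  also have "\<dots> \<in> sets ?P" by measurable
  finally show "{z \<in> space ?P. mdist m (fst z) (snd z) < r} \<in> sets ?P" .
qed

lemma dist_measurable_comp [measurable]:
  assumes "f \<in> M \<rightarrow>\<^sub>M mborel m" "g \<in> M \<rightarrow>\<^sub>M mborel m"
  shows "(\<lambda>x. mdist m (f x) (g x)) \<in> borel_measurable M"
  using measurable_compose[OF measurable_Pair[OF assms] dist_measurable] by simp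

end

lemma coupling_sets:
  assumes "\<pi> \<in> couplings \<mu> \<nu>"
  shows "sets \<pi> = sets (\<mu> \<Otimes>\<^sub>M \<nu>)" "fst \<in> \<pi> \<rightarrow>\<^sub>M \<mu>" "snd \<in> \<pi> \<rightarrow>\<^sub>M \<nu>"
    "distr \<pi> \<mu> fst = \<mu>" "distr \<pi> \<nu> snd = \<nu>"
  using assms by (auto simp: couplings_def cong: measurable_cong_sets)

lemma coupling_prob_space:
  assumes "\<pi> \<in> couplings \<mu> \<nu>" "prob_space \<mu>"
  shows "prob_space \<pi>"
  using prob_space_distrD[of fst \<pi> \<mu>] coupling_sets[OF assms(1)] assms(2) by simp

lemma couplingI:
  assumes f: "f \<in> P \<rightarrow>\<^sub>M \<mu>" and g: "g \<in> P \<rightarrow>\<^sub>M \<nu>" and "distr P \<mu> f = \<mu>" "distr P \<nu> g = \<nu>"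
  shows "distr P (\<mu> \<Otimes>\<^sub>M \<nu>) (\<lambda>x. (f x, g x)) \<in> couplings \<mu> \<nu>"
proof -
  have *: "(\<lambda>x. (f x, g x)) \<in> P \<rightarrow>\<^sub>M \<mu> \<Otimes>\<^sub>M \<nu>" using f g by measurable
  show ?thesis
    using assms by (simp add: couplings_def distr_distr[OF _ *] comp_def)
qed

lemma coupling_swap:
  assumes "\<pi> \<in> couplings \<mu> \<nu>"
  shows "distr \<pi> (\<nu> \<Otimes>\<^sub>M \<mu>) (\<lambda>z. (snd z, fst z)) \<in> couplings \<nu> \<mu>"
  by (rule couplingI) (use coupling_sets[OF assms] in auto)

text \<open>No measurability of the integrand, so that the symmetry of the Wasserstein distance holds
  for arbitrary pairs of measures, as the library's locale of metric spaces demands.\<close>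
lemma nn_integral_distr_le:
  assumes T: "T \<in> M \<rightarrow>\<^sub>M N"
  shows "(\<integral>\<^sup>+ x. f x \<partial>distr M N T) \<le> (\<integral>\<^sup>+ x. f (T x) \<partial>M)"
  unfolding nn_integral_def[of "distr M N T"]
proof (rule SUP_least)
  fix g assume "g \<in> {g. simple_function (distr M N T) g \<and> g \<le> f}"
  then have g: "simple_function (distr M N T) g" "\<And>x. g x \<le> f x"
    by (auto simp: le_fun_def)
  then have meas: "g \<in> borel_measurable N"
    using borel_measurable_simple_function[OF g(1)] by simp
  have "integral\<^sup>S (distr M N T) g = (\<integral>\<^sup>+ x. g x \<partial>distr M N T)"
    using g by (simp add: nn_integral_eq_simple_integral)
  also have "\<dots> = (\<integral>\<^sup>+ x. g (T x) \<partial>M)"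
    using T meas by (intro nn_integral_distr) auto
  also have "\<dots> \<le> (\<integral>\<^sup>+ x. f (T x) \<partial>M)"
    using g by (intro nn_integral_mono) auto
  finally show "integral\<^sup>S (distr M N T) g \<le> (\<integral>\<^sup>+ x. f (T x) \<partial>M)" .
qed

lemma wasserstein_commute: "wasserstein p m \<mu> \<nu> = wasserstein p m \<nu> \<mu>"
proof -
  have "(INF \<pi>\<in>couplings \<nu> \<mu>. \<integral>\<^sup>+ (x, y). ennreal (mdist m x y powr p) \<partial>\<pi>)
      \<le> (INF \<pi>\<in>couplings \<mu> \<nu>. \<integral>\<^sup>+ (x, y). ennreal (mdist m x y powr p) \<partial>\<pi>)" for \<mu> \<nu> :: "'a measure"
  proof (rule INF_greatest)
    fix \<pi> assume \<pi>: "\<pi> \<in> couplings \<mu> \<nu>"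
    have [measurable]: "(\<lambda>z. (snd z, fst z)) \<in> \<pi> \<rightarrow>\<^sub>M \<nu> \<Otimes>\<^sub>M \<mu>"
      using coupling_sets[OF \<pi>] by measurable
    have "(\<integral>\<^sup>+ (x, y). ennreal (mdist m x y powr p) \<partial>distr \<pi> (\<nu> \<Otimes>\<^sub>M \<mu>) (\<lambda>z. (snd z, fst z)))
        \<le> (\<integral>\<^sup>+ (x, y). ennreal (mdist m x y powr p) \<partial>\<pi>)"
      by (rule order_trans[OF nn_integral_distr_le]) (auto simp: case_prod_beta' mdist_commute)
    with coupling_swap[OF \<pi>] show "(INF \<pi>\<in>couplings \<nu> \<mu>. \<integral>\<^sup>+ (x, y). ennreal (mdist m x y powr p) \<partial>\<pi>)
        \<le> (\<integral>\<^sup>+ (x, y). ennreal (mdist m x y powr p) \<partial>\<pi>)"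
      by (rule INF_lower2)
  qed
  then have "(INF \<pi>\<in>couplings \<nu> \<mu>. \<integral>\<^sup>+ (x, y). ennreal (mdist m x y powr p) \<partial>\<pi>)
      = (INF \<pi>\<in>couplings \<mu> \<nu>. \<integral>\<^sup>+ (x, y). ennreal (mdist m x y powr p) \<partial>\<pi>)"
    by (intro antisym)
  then show ?thesis by (simp add: wasserstein_def)
qed

lemma wasserstein_nonneg: "0 \<le> wasserstein p m \<mu> \<nu>"
  by (simp add: wasserstein_def)

lemma wasserstein_le:
  assumes "\<pi> \<in> couplings \<mu> \<nu>" and "Lp_le p \<pi> (\<lambda>z. mdist m (fst z) (snd z)) a" and p: "1 \<le> p"
  shows "wasserstein p m \<mu> \<nu> \<le> a"
proof -
  have a: "0 \<le> a" using assms by (simp add: Lp_le_def)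
  have "(INF \<pi>\<in>couplings \<mu> \<nu>. \<integral>\<^sup>+ (x, y). ennreal (mdist m x y powr p) \<partial>\<pi>) \<le> ennreal (a powr p)"
    using assms by (intro INF_lower2[OF assms(1)]) (auto simp: Lp_le_def case_prod_beta')
  then have "wasserstein p m \<mu> \<nu> \<le> (a powr p) powr (1 / p)"
    unfolding wasserstein_def using p by (intro powr_mono2) (auto intro!: enn2real_leI)
  then show ?thesis using a p by (simp add: powr_powr)
qed

lemma distr_pair_snd:
  assumes "prob_space M" "sigma_finite_measure N"
  shows "distr (M \<Otimes>\<^sub>M N) N snd = N"
proof (rule measure_eqI)
  interpret M: prob_space M by fact
  interpret N: sigma_finite_measure N by fact
  fix A assume A: "A \<in> sets (distr (M \<Otimes>\<^sub>M N) N snd)"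
  then have "snd -` A \<inter> space (M \<Otimes>\<^sub>M N) = space M \<times> A"
    using sets.sets_into_space[of A N] by (auto simp: space_pair_measure)
  with A show "emeasure (distr (M \<Otimes>\<^sub>M N) N snd) A = emeasure N A"
    by (simp add: emeasure_distr N.emeasure_pair_measure_Times M.emeasure_space_1)
qed simp

context separable_metric
begin

lemma coupling_measurable:
  assumes "\<pi> \<in> couplings \<mu> \<nu>" "sets \<mu> = sets (mborel m)" "sets \<nu> = sets (mborel m)"
  shows "fst \<in> \<pi> \<rightarrow>\<^sub>M mborel m" "snd \<in> \<pi> \<rightarrow>\<^sub>M mborel m"
  using coupling_sets(2,3)[OF assms(1)] assms(2,3) by (simp_all cong: measurable_cong_sets)

lemma Lp_le_coupling_fst:
  assumes "\<pi> \<in> couplings \<mu> \<nu>" "f \<in> borel_measurable \<mu>" "\<forall>x\<in>space \<mu>. 0 \<le> f x"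
  shows "Lp_le p \<pi> (\<lambda>z. f (fst z)) a \<longleftrightarrow> Lp_le p \<mu> f a"
  using Lp_le_distr[of fst \<pi> \<mu> f p a] coupling_sets[OF assms(1)] assms by simp

lemma Lp_le_coupling_snd:
  assumes "\<pi> \<in> couplings \<mu> \<nu>" "f \<in> borel_measurable \<nu>" "\<forall>x\<in>space \<nu>. 0 \<le> f x"
  shows "Lp_le p \<pi> (\<lambda>z. f (snd z)) a \<longleftrightarrow> Lp_le p \<nu> f a"
  using Lp_le_distr[of snd \<pi> \<nu> f p a] coupling_sets[OF assms(1)] assms by simp

text \<open>Changing the base point costs the constant \<open>mdist m x0 y\<close>, by Minkowski's
  inequality.\<close>

lemma finite_moment_iff:
  assumes p: "1 \<le> p" and y: "y \<in> mspace m"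
  shows "\<mu> \<in> finite_moment_measures p m \<longleftrightarrow>
    prob_space \<mu> \<and> sets \<mu> = sets (mborel m) \<and> (\<exists>a. Lp_le p \<mu> (\<lambda>x. mdist m x y) a)"
    (is "?L \<longleftrightarrow> ?R")
proof
  assume ?L
  then obtain x0 where x0: "x0 \<in> mspace m" and "prob_space \<mu>" and [simp]: "sets \<mu> = sets (mborel m)"
    and fin: "(\<integral>\<^sup>+ x. ennreal (mdist m x x0 powr p) \<partial>\<mu>) < \<infinity>"
    by (auto simp: finite_moment_measures_def)
  have sp: "space \<mu> = mspace m" using sets_eq_imp_space_eq[of \<mu> "mborel m"] by simp
  have meas: "(\<lambda>x. mdist m x z) \<in> borel_measurable \<mu>" if "z \<in> mspace m" for z
    using dist_const_measurable[OF that] by (simp cong: measurable_cong_sets)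
  obtain a where a: "Lp_le p \<mu> (\<lambda>x. mdist m x x0) a"
    using Lp_le_exists[OF meas[OF x0] _ fin] p by auto
  have "Lp_le p \<mu> (\<lambda>x. mdist m x x0 + mdist m x0 y) (a + mdist m x0 y)"
    by (intro Lp_le_add a Lp_le_const p \<open>prob_space \<mu>\<close>) simp
  then have "Lp_le p \<mu> (\<lambda>x. mdist m x y) (a + mdist m x0 y)"
    by (rule Lp_le_mono) (use p y x0 meas sp mdist_triangle[of _ m x0 y] in auto)
  then show ?R using \<open>prob_space \<mu>\<close> by auto
next
  assume R: ?R
  then obtain a where "Lp_le p \<mu> (\<lambda>x. mdist m x y) a" by auto
  then have "(\<integral>\<^sup>+ x. ennreal (mdist m x y powr p) \<partial>\<mu>) \<le> ennreal (a powr p)"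
    by (simp add: Lp_le_def)
  also have "\<dots> < \<infinity>" by simp
  finally show ?L using R y by (auto simp: finite_moment_measures_def)
qed

lemma finite_momentD:
  assumes "\<mu> \<in> finite_moment_measures p m"
  shows "prob_space \<mu>" "sets \<mu> = sets (mborel m)" "space \<mu> = mspace m"
  using assms sets_eq_imp_space_eq[of \<mu> "mborel m"] by (auto simp: finite_moment_measures_def)

text \<open>\<open>enn2real\<close> would send an infinite infimum of costs to 0. Finite moments
  exclude this: the product coupling has finite cost, by the triangle inequality through a base
  point.\<close>

lemma wasserstein_less:
  assumes p: "1 \<le> p" and \<mu>: "\<mu> \<in> finite_moment_measures p m" and \<nu>: "\<nu> \<in> finite_moment_measures p m"
    and less: "wasserstein p m \<mu> \<nu> < a"
  obtains \<pi> where "\<pi> \<in> couplings \<mu> \<nu>" "Lp_le p \<pi> (\<lambda>z. mdist m (fst z) (snd z)) a"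
proof -
  interpret \<mu>: prob_space \<mu> using finite_momentD[OF \<mu>] by simp
  interpret \<nu>: prob_space \<nu> using finite_momentD[OF \<nu>] by simp
  interpret \<mu>\<nu>: pair_prob_space \<mu> \<nu> ..
  note S = finite_momentD[OF \<mu>] finite_momentD[OF \<nu>]
  let ?c = "\<lambda>\<pi>. \<integral>\<^sup>+ (x, y). ennreal (mdist m x y powr p) \<partial>\<pi>"
  let ?I = "INF \<pi>\<in>couplings \<mu> \<nu>. ?c \<pi>"
  have a: "0 < a" using less wasserstein_nonneg[of p m \<mu> \<nu>] by linarith
  have prod: "\<mu> \<Otimes>\<^sub>M \<nu> \<in> couplings \<mu> \<nu>"
    by (simp add: couplings_def \<nu>.distr_pair_fst distr_pair_snd \<mu>.prob_space_axioms \<nu>.sigma_finite_measure_axioms)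
  obtain y where y: "y \<in> mspace m" using e_in by blast
  have meas: "(\<lambda>x. mdist m x y) \<in> borel_measurable \<mu>" "(\<lambda>x. mdist m x y) \<in> borel_measurable \<nu>"
    using dist_const_measurable[OF y] S by (simp_all cong: measurable_cong_sets)
  have dm: "(\<lambda>z. mdist m (fst z) (snd z)) \<in> borel_measurable \<pi>" if "\<pi> \<in> couplings \<mu> \<nu>" for \<pi>
    using dist_measurable_comp coupling_measurable[OF that] S by blast
  obtain b1 b2 where "Lp_le p \<mu> (\<lambda>x. mdist m x y) b1" "Lp_le p \<nu> (\<lambda>x. mdist m x y) b2"
    using \<mu> \<nu> finite_moment_iff[OF p y] by meson
  then have "Lp_le p (\<mu> \<Otimes>\<^sub>M \<nu>) (\<lambda>z. mdist m (fst z) y) b1" "Lp_le p (\<mu> \<Otimes>\<^sub>M \<nu>) (\<lambda>z. mdist m (snd z) y) b2"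
    using Lp_le_coupling_fst[OF prod meas(1)] Lp_le_coupling_snd[OF prod meas(2)] by auto
  then have "Lp_le p (\<mu> \<Otimes>\<^sub>M \<nu>) (\<lambda>z. mdist m (fst z) y + mdist m (snd z) y) (b1 + b2)"
    using p by (rule Lp_le_add)
  then have "Lp_le p (\<mu> \<Otimes>\<^sub>M \<nu>) (\<lambda>z. mdist m (fst z) (snd z)) (b1 + b2)"
    by (rule Lp_le_mono)
      (use p y S dm[OF prod] mdist_triangle[of _ m y] in \<open>auto simp: space_pair_measure mdist_commute\<close>)
  then have "?c (\<mu> \<Otimes>\<^sub>M \<nu>) \<le> ennreal ((b1 + b2) powr p)" by (simp add: Lp_le_def case_prod_beta')
  then have fin: "?I < \<infinity>"
    by (intro le_less_trans[OF INF_lower[OF prod]]) (simp add: le_less_trans)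
  have "enn2real ?I < a powr p"
  proof (rule ccontr)
    assume "\<not> enn2real ?I < a powr p"
    then have "(a powr p) powr (1 / p) \<le> wasserstein p m \<mu> \<nu>"
      unfolding wasserstein_def using p by (intro powr_mono2) auto
    then show False using less a p by (simp add: powr_powr)
  qed
  moreover have "?I = ennreal (enn2real ?I)" using fin by simp
  ultimately have "?I < ennreal (a powr p)"
    by (metis enn2real_nonneg ennreal_less_iff)
  then obtain \<pi> where "\<pi> \<in> couplings \<mu> \<nu>" "?c \<pi> < ennreal (a powr p)"
    by (auto simp: INF_less_iff)
  then show ?thesis
    using that[of \<pi>] dm a by (auto simp: Lp_le_def case_prod_beta')
qed

end

text \<open>The couplings constructed below are densities with respect to a product measure; fibre
  integrals equal to 1 leave the marginal unchanged.\<close>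

lemma distr_density_fst:
  assumes "sigma_finite_measure N" and h [measurable]: "h \<in> borel_measurable (M \<Otimes>\<^sub>M N)"
    and AE: "AE x in M. (\<integral>\<^sup>+ y. h (x, y) \<partial>N) = 1"
  shows "distr (density (M \<Otimes>\<^sub>M N) h) M fst = M"
proof (rule measure_eqI)
  interpret N: sigma_finite_measure N by fact
  let ?D = "density (M \<Otimes>\<^sub>M N) h"
  fix X assume "X \<in> sets (distr ?D M fst)"
  then have X [measurable]: "X \<in> sets M" by simp
  have "emeasure (distr ?D M fst) X = (\<integral>\<^sup>+ z. indicator X z \<partial>distr ?D M fst)" by simp
  also have "\<dots> = (\<integral>\<^sup>+ w. indicator X (fst w) \<partial>?D)" by (subst nn_integral_distr) auto
  also have "\<dots> = (\<integral>\<^sup>+ w. h w * indicator X (fst w) \<partial>(M \<Otimes>\<^sub>M N))"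
    by (subst nn_integral_density) auto
  also have "\<dots> = (\<integral>\<^sup>+ z. \<integral>\<^sup>+ y. h (z, y) * indicator X z \<partial>N \<partial>M)"
    by (subst N.nn_integral_fst[symmetric]) auto
  also have "\<dots> = (\<integral>\<^sup>+ z. indicator X z \<partial>M)"
  proof (rule nn_integral_cong_AE)
    show "AE z in M. (\<integral>\<^sup>+ y. h (z, y) * indicator X z \<partial>N) = indicator X z"
      using AE AE_space
    proof eventually_elim
      case (elim z)
      then show ?case
        using measurable_Pair2[OF h elim(2)] by (simp add: nn_integral_multc)
    qed
  qed
  finally show "emeasure (distr ?D M fst) X = emeasure M X" by simp
qed simp

lemma distr_density_snd:
  assumes "sigma_finite_measure M" "sigma_finite_measure N"
    and h [measurable]: "h \<in> borel_measurable (M \<Otimes>\<^sub>M N)"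
    and AE: "AE y in N. (\<integral>\<^sup>+ x. h (x, y) \<partial>M) = 1"
  shows "distr (density (M \<Otimes>\<^sub>M N) h) N snd = N"
proof (rule measure_eqI)
  interpret pair_sigma_finite M N using assms by (simp add: pair_sigma_finite_def)
  let ?D = "density (M \<Otimes>\<^sub>M N) h"
  fix X assume "X \<in> sets (distr ?D N snd)"
  then have X [measurable]: "X \<in> sets N" by simp
  have "emeasure (distr ?D N snd) X = (\<integral>\<^sup>+ z. indicator X z \<partial>distr ?D N snd)" by simp
  also have "\<dots> = (\<integral>\<^sup>+ w. indicator X (snd w) \<partial>?D)" by (subst nn_integral_distr) auto
  also have "\<dots> = (\<integral>\<^sup>+ w. h w * indicator X (snd w) \<partial>(M \<Otimes>\<^sub>M N))"
    by (subst nn_integral_density) auto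
  also have "\<dots> = (\<integral>\<^sup>+ y. \<integral>\<^sup>+ z. h (z, y) * indicator X y \<partial>M \<partial>N)"
    by (subst nn_integral_snd[symmetric]) auto
  also have "\<dots> = (\<integral>\<^sup>+ y. indicator X y \<partial>N)"
  proof (rule nn_integral_cong_AE)
    show "AE y in N. (\<integral>\<^sup>+ z. h (z, y) * indicator X y \<partial>M) = indicator X y"
      using AE AE_space
    proof eventually_elim
      case (elim y)
      then show ?case
        using measurable_Pair1[OF h elim(2)] by (simp add: nn_integral_multc)
    qed
  qed
  finally show "emeasure (distr ?D N snd) X = emeasure N X" by simp
qed simp

context separable_metric
begin

text \<open>Couplings \<open>\<pi>\<^sub>1\<close> of \<open>\<mu>, \<nu>\<close> and \<open>\<pi>\<^sub>2\<close> of \<open>\<nu>, \<rho>\<close> are glued without disintegration: conditionally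
  on the cell (of diameter at most \<open>r\<close>) of the middle point, take them independent.\<close>
lemma wasserstein_glue:
  assumes p: "1 \<le> p" and r: "0 < r"
    and \<mu>: "prob_space \<mu>" "sets \<mu> = sets (mborel m)"
    and \<nu>: "prob_space \<nu>" "sets \<nu> = sets (mborel m)"
    and \<rho>: "prob_space \<rho>" "sets \<rho> = sets (mborel m)"
    and \<pi>1: "\<pi>1 \<in> couplings \<mu> \<nu>" "Lp_le p \<pi>1 (\<lambda>z. mdist m (fst z) (snd z)) a"
    and \<pi>2: "\<pi>2 \<in> couplings \<nu> \<rho>" "Lp_le p \<pi>2 (\<lambda>z. mdist m (fst z) (snd z)) b"
  shows "wasserstein p m \<mu> \<rho> \<le> a + b + r"
proof -
  interpret P1: prob_space \<pi>1 by (rule coupling_prob_space[OF \<pi>1(1) \<mu>(1)])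
  interpret P2: prob_space \<pi>2 by (rule coupling_prob_space[OF \<pi>2(1) \<nu>(1)])
  interpret pair_prob_space \<pi>1 \<pi>2 ..
  interpret N: prob_space \<nu> by fact
  \<comment> \<open>The first dense point within \<open>r / 2\<close> names the cell, so two points
    of one cell are at distance at most \<open>r\<close> (see \<open>diam\<close>).\<close>
  define c where "c x = (LEAST k. mdist m x (e k) < r / 2)" for x
  have c_close: "mdist m x (e (c x)) < r / 2" if "x \<in> mspace m" for x
    unfolding c_def using e_dense[OF that, of "r / 2"] r by (auto intro: LeastI_ex)
  have ball [measurable]: "{x \<in> mspace m. mdist m x (e k) < r / 2} \<in> sets (mborel m)" for k
    by (rule mball_sets) simp
  have c_meas [measurable]: "c \<in> mborel m \<rightarrow>\<^sub>M count_space UNIV"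
    unfolding c_def
    by (rule measurable_Least) (use ball in \<open>auto simp: vimage_def Int_def conj_commute pred_def\<close>)
  have diam: "mdist m x y \<le> r" if "x \<in> mspace m" "y \<in> mspace m" "c x = c y" for x y
    using mdist_triangle[of x m "e (c x)" y] c_close[OF that(1)] c_close[OF that(2)] that
    by (simp add: mdist_commute)
  have sp: "space \<nu> = mspace m" "space \<mu> = mspace m" "space \<rho> = mspace m"
    using sets_eq_imp_space_eq[OF \<nu>(2)] sets_eq_imp_space_eq[OF \<mu>(2)] sets_eq_imp_space_eq[OF \<rho>(2)]
    by simp_all
  define A where "A k = {x \<in> mspace m. c x = k}" for k
  have A [measurable]: "A k \<in> sets (mborel m)" for k
    unfolding A_def using measurable_sets[OF c_meas, of "{k}"] by (simp add: vimage_def Int_def conj_commute)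
  note M1 [measurable] = coupling_measurable[OF \<pi>1(1) \<mu>(2) \<nu>(2)]
  note M2 [measurable] = coupling_measurable[OF \<pi>2(1) \<nu>(2) \<rho>(2)]
  have cnu [measurable]: "c \<in> \<nu> \<rightarrow>\<^sub>M count_space UNIV" using c_meas \<nu>(2) by (simp cong: measurable_cong_sets)
  \<comment> \<open>Relative to the product of the two couplings, the middle points must share a
    cell, and dividing by the \<open>\<nu>\<close>-mass of this cell restores both marginals. A cell
    of mass 0 makes the quotient infinite, but by \<open>null\<close> such cells are almost never
    met.\<close>
  define h where "h w = (if c (snd (fst w)) = c (fst (snd w)) then 1 / emeasure \<nu> (A (c (snd (fst w)))) else 0)"
    for w :: "('a \<times> 'a) \<times> ('a \<times> 'a)"
  have h [measurable]: "h \<in> borel_measurable (\<pi>1 \<Otimes>\<^sub>M \<pi>2)"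
  proof -
    have [measurable]: "(\<lambda>w. c (snd (fst w))) \<in> \<pi>1 \<Otimes>\<^sub>M \<pi>2 \<rightarrow>\<^sub>M count_space UNIV"
      "(\<lambda>w. c (fst (snd w))) \<in> \<pi>1 \<Otimes>\<^sub>M \<pi>2 \<rightarrow>\<^sub>M count_space UNIV"
      by measurable
    have [measurable]: "(\<lambda>w. 1 / emeasure \<nu> (A (c (snd (fst w))))) \<in> borel_measurable (\<pi>1 \<Otimes>\<^sub>M \<pi>2)"
      by (rule measurable_compose[of _ _ "count_space UNIV" "\<lambda>k. 1 / emeasure \<nu> (A k)"]) auto
    have "{w \<in> space (\<pi>1 \<Otimes>\<^sub>M \<pi>2). real (c (snd (fst w))) = real (c (fst (snd w)))} \<in> sets (\<pi>1 \<Otimes>\<^sub>M \<pi>2)"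
      by measurable
    then show ?thesis unfolding h_def by (intro measurable_If) auto
  qed
  define \<Gamma> where "\<Gamma> = density (\<pi>1 \<Otimes>\<^sub>M \<pi>2) h"
  have null: "AE x in \<nu>. emeasure \<nu> (A (c x)) \<noteq> 0"
  proof -
    have "AE x in \<nu>. \<forall>k. emeasure \<nu> (A k) = 0 \<longrightarrow> x \<notin> A k"
      by (intro AE_all_countable[THEN iffD2] allI) (auto intro!: AE_not_in simp: null_sets_def \<nu>(2) A)
    then show ?thesis
      using AE_space by eventually_elim (auto simp: A_def sp)
  qed
  have nn1: "(\<integral>\<^sup>+ y. h ((x1, x2), y) \<partial>\<pi>2) = 1"
    if "emeasure \<nu> (A (c x2)) \<noteq> 0" for x1 x2
  proof -
    let ?q = "emeasure \<nu> (A (c x2))"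
    have "(\<integral>\<^sup>+ y. h ((x1, x2), y) \<partial>\<pi>2) = (\<integral>\<^sup>+ y. indicator (A (c x2)) (fst y) * (1 / ?q) \<partial>\<pi>2)"
      using measurable_space[OF M2(1)]
      by (intro nn_integral_cong) (auto simp: h_def A_def)
    also have "\<dots> = (\<integral>\<^sup>+ x. indicator (A (c x2)) x * (1 / ?q) \<partial>distr \<pi>2 \<nu> fst)"
      using coupling_sets(2)[OF \<pi>2(1)] A \<nu>(2) by (subst nn_integral_distr) auto
    also have "\<dots> = ?q * (1 / ?q)"
      using coupling_sets(4)[OF \<pi>2(1)] A \<nu>(2) by (simp add: nn_integral_multc)
    also have "\<dots> = 1"
      using ennreal_divide_self[OF that N.emeasure_finite[of "A (c x2)", THEN top.not_eq_extremum[THEN iffD1]]]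
      by (simp add: ennreal_times_divide)
    finally show ?thesis .
  qed
  have nn2: "(\<integral>\<^sup>+ x. h (x, (x2, x3)) \<partial>\<pi>1) = 1"
    if "emeasure \<nu> (A (c x2)) \<noteq> 0" for x2 x3
  proof -
    let ?q = "emeasure \<nu> (A (c x2))"
    have "(\<integral>\<^sup>+ y. h (y, (x2, x3)) \<partial>\<pi>1) = (\<integral>\<^sup>+ y. indicator (A (c x2)) (snd y) * (1 / ?q) \<partial>\<pi>1)"
      using measurable_space[OF M1(2)]
      by (intro nn_integral_cong) (auto simp: h_def A_def)
    also have "\<dots> = (\<integral>\<^sup>+ x. indicator (A (c x2)) x * (1 / ?q) \<partial>distr \<pi>1 \<nu> snd)"
      using coupling_sets(3)[OF \<pi>1(1)] A \<nu>(2) by (subst nn_integral_distr) auto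
    also have "\<dots> = ?q * (1 / ?q)"
      using coupling_sets(5)[OF \<pi>1(1)] A \<nu>(2) by (simp add: nn_integral_multc)
    also have "\<dots> = 1"
      using ennreal_divide_self[OF that N.emeasure_finite[of "A (c x2)", THEN top.not_eq_extremum[THEN iffD1]]]
      by (simp add: ennreal_times_divide)
    finally show ?thesis .
  qed
  have null1: "AE z in \<pi>1. emeasure \<nu> (A (c (snd z))) \<noteq> 0"
    by (rule AE_distrD[OF coupling_sets(3)[OF \<pi>1(1)]]) (simp only: coupling_sets(5)[OF \<pi>1(1)] null)
  have null2: "AE z in \<pi>2. emeasure \<nu> (A (c (fst z))) \<noteq> 0"
    by (rule AE_distrD[OF coupling_sets(2)[OF \<pi>2(1)]]) (simp only: coupling_sets(4)[OF \<pi>2(1)] null)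
  have [measurable_cong]: "sets \<Gamma> = sets (\<pi>1 \<Otimes>\<^sub>M \<pi>2)" by (simp add: \<Gamma>_def)
  have G1: "distr \<Gamma> \<pi>1 fst = \<pi>1"
    unfolding \<Gamma>_def using null1 nn1 h
    by (intro distr_density_fst P2.sigma_finite_measure_axioms) auto
  have G2: "distr \<Gamma> \<pi>2 snd = \<pi>2"
    unfolding \<Gamma>_def using null2 nn2 h
    by (intro distr_density_snd P1.sigma_finite_measure_axioms P2.sigma_finite_measure_axioms) auto
  interpret G: prob_space \<Gamma>
    using prob_space_distrD[of fst \<Gamma> \<pi>1] G1 P1.prob_space_axioms by simp
  define \<pi> where "\<pi> = distr \<Gamma> (\<mu> \<Otimes>\<^sub>M \<rho>) (\<lambda>w. (fst (fst w), snd (snd w)))"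
  have [measurable]: "fst \<in> \<pi>1 \<rightarrow>\<^sub>M \<mu>" "snd \<in> \<pi>2 \<rightarrow>\<^sub>M \<rho>"
    using coupling_sets[OF \<pi>1(1)] coupling_sets[OF \<pi>2(1)] by auto
  have \<pi>: "\<pi> \<in> couplings \<mu> \<rho>"
    unfolding \<pi>_def
  proof (rule couplingI)
    have "distr \<Gamma> \<mu> (\<lambda>w. fst (fst w)) = distr (distr \<Gamma> \<pi>1 fst) \<mu> fst"
      by (subst distr_distr) (auto simp: comp_def)
    then show "distr \<Gamma> \<mu> (\<lambda>w. fst (fst w)) = \<mu>" using G1 coupling_sets[OF \<pi>1(1)] by simp
    have "distr \<Gamma> \<rho> (\<lambda>w. snd (snd w)) = distr (distr \<Gamma> \<pi>2 snd) \<rho> snd"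
      by (subst distr_distr) (auto simp: comp_def)
    then show "distr \<Gamma> \<rho> (\<lambda>w. snd (snd w)) = \<rho>" using G2 coupling_sets[OF \<pi>2(1)] by simp
  qed auto
  have L1: "Lp_le p \<Gamma> (\<lambda>w. mdist m (fst (fst w)) (snd (fst w))) a"
    using \<pi>1(2) by (subst (asm) G1[symmetric], subst (asm) Lp_le_distr) auto
  have L2: "Lp_le p \<Gamma> (\<lambda>w. mdist m (fst (snd w)) (snd (snd w))) b"
    using \<pi>2(2) by (subst (asm) G2[symmetric], subst (asm) Lp_le_distr) auto
  \<comment> \<open>The summand \<open>r\<close> pays for the jump between the two middle points,
    which lie in one cell.\<close>
  have L3: "Lp_le p \<Gamma> (\<lambda>w. mdist m (fst (fst w)) (snd (fst w)) + mdist m (fst (snd w)) (snd (snd w)) + r) (a + b + r)"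
    using r by (intro Lp_le_add L1 L2 Lp_le_const G.prob_space_axioms p) auto
  have AEc: "AE w in \<Gamma>. c (snd (fst w)) = c (fst (snd w))"
    unfolding \<Gamma>_def by (subst AE_density) (auto simp: h_def)
  have inM: "fst (fst w) \<in> mspace m" "snd (fst w) \<in> mspace m" "fst (snd w) \<in> mspace m" "snd (snd w) \<in> mspace m"
    if "w \<in> space \<Gamma>" for w
    using that measurable_space[OF M1(1)] measurable_space[OF M1(2)] measurable_space[OF M2(1)]
      measurable_space[OF M2(2)] by (auto simp: \<Gamma>_def space_pair_measure)
  have "Lp_le p \<Gamma> (\<lambda>w. mdist m (fst (fst w)) (snd (snd w))) (a + b + r)"
  proof (rule Lp_le_mono[OF L3])
    show "AE w in \<Gamma>. mdist m (fst (fst w)) (snd (snd w))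
        \<le> mdist m (fst (fst w)) (snd (fst w)) + mdist m (fst (snd w)) (snd (snd w)) + r"
      using AEc AE_space
    proof eventually_elim
      case (elim w)
      note i = inM[OF elim(2)]
      show ?case
        using mdist_triangle[OF i(1,2,4)] mdist_triangle[OF i(2,3,4)] diam[OF i(2,3) elim(1)] by linarith
    qed
  qed (use p in auto)
  moreover have "(\<lambda>z. mdist m (fst z) (snd z)) \<in> borel_measurable (\<mu> \<Otimes>\<^sub>M \<rho>)"
    using dist_measurable \<mu>(2) \<rho>(2) by (simp cong: measurable_cong_sets sets_pair_measure_cong)
  ultimately have "Lp_le p \<pi> (\<lambda>z. mdist m (fst z) (snd z)) (a + b + r)"
    unfolding \<pi>_def by (subst Lp_le_distr) auto
  then show ?thesis using \<pi> p by (intro wasserstein_le)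
qed


section \<open>The Wasserstein space as a metric space\<close>

text \<open>Two random variables on one probability space couple their laws; this is how couplings
  enter most of the later estimates.\<close>

lemma wasserstein_distr_le:
  assumes P: "prob_space P" and p: "1 \<le> p"
    and f: "f \<in> P \<rightarrow>\<^sub>M mborel m" and g: "g \<in> P \<rightarrow>\<^sub>M mborel m"
    and L: "Lp_le p P (\<lambda>x. mdist m (f x) (g x)) a"
  shows "wasserstein p m (distr P (mborel m) f) (distr P (mborel m) g) \<le> a"
proof (rule wasserstein_le[OF couplingI _ p])
  let ?\<mu> = "distr P (mborel m) f" and ?\<nu> = "distr P (mborel m) g"
  show f': "f \<in> P \<rightarrow>\<^sub>M ?\<mu>" and g': "g \<in> P \<rightarrow>\<^sub>M ?\<nu>" using f g by simp_all
  show "distr P ?\<mu> f = ?\<mu>" "distr P ?\<nu> g = ?\<nu>" by (auto intro: distr_cong)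
  have "(\<lambda>x. (f x, g x)) \<in> P \<rightarrow>\<^sub>M ?\<mu> \<Otimes>\<^sub>M ?\<nu>" using f' g' by measurable
  moreover have "(\<lambda>z. mdist m (fst z) (snd z)) \<in> borel_measurable (?\<mu> \<Otimes>\<^sub>M ?\<nu>)"
    using dist_measurable by (simp cong: measurable_cong_sets sets_pair_measure_cong)
  ultimately show "Lp_le p (distr P (?\<mu> \<Otimes>\<^sub>M ?\<nu>) (\<lambda>x. (f x, g x))) (\<lambda>z. mdist m (fst z) (snd z)) a"
    using L by (subst Lp_le_distr) auto
qed

lemma finite_moment_distr:
  assumes P: "prob_space P" and p: "1 \<le> p" and f: "f \<in> P \<rightarrow>\<^sub>M mborel m" and y: "y \<in> mspace m"
    and L: "Lp_le p P (\<lambda>x. mdist m (f x) y) a"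
  shows "distr P (mborel m) f \<in> finite_moment_measures p m"
  unfolding finite_moment_iff[OF p y]
  using L f prob_space.prob_space_distr[OF P f] Lp_le_distr[OF f, of "\<lambda>x. mdist m x y" p a]
    dist_const_measurable[OF y] by auto

lemma wasserstein_self:
  assumes "prob_space \<mu>" "sets \<mu> = sets (mborel m)" and p: "1 \<le> p"
  shows "wasserstein p m \<mu> \<mu> = 0"
proof -
  have eq: "distr \<mu> (mborel m) (\<lambda>x. x) = \<mu>" using assms by (intro distr_id2) simp
  have sp: "space \<mu> = mspace m" using sets_eq_imp_space_eq[OF assms(2)] by simp
  have id: "(\<lambda>x. x) \<in> \<mu> \<rightarrow>\<^sub>M mborel m" using assms by (simp cong: measurable_cong_sets)
  have meas: "(\<lambda>x. mdist m x x) \<in> borel_measurable \<mu>" using dist_measurable_comp[OF id id] .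
  have "Lp_le p \<mu> (\<lambda>x. mdist m x x) 0"
    by (rule Lp_le_mono[OF Lp_le_const[OF assms(1), of 0]])
      (use meas sp p in \<open>auto intro!: AE_I2 eq_refl\<close>)
  then have "wasserstein p m \<mu> \<mu> \<le> 0"
    using wasserstein_distr_le[OF assms(1) p id id] eq by simp
  then show ?thesis using wasserstein_nonneg[of p m \<mu> \<mu>] by simp
qed

end

lemma Lp_le_markov:
  assumes L: "Lp_le p M f a" and r: "0 < r" and p: "0 < p"
  shows "emeasure M {x \<in> space M. r \<le> f x} \<le> ennreal ((a / r) powr p)"
proof -
  have [measurable]: "f \<in> borel_measurable M" using L by (simp add: Lp_le_def)
  have "emeasure M {x \<in> space M. r \<le> f x}
      \<le> emeasure M ({x \<in> space M. 1 \<le> ennreal (1 / r powr p) * ennreal (f x powr p)} \<inter> space M)"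
  proof (rule emeasure_mono)
    show "{x \<in> space M. r \<le> f x}
        \<subseteq> {x \<in> space M. 1 \<le> ennreal (1 / r powr p) * ennreal (f x powr p)} \<inter> space M"
    proof safe
      fix x assume x: "x \<in> space M" "r \<le> f x"
      have "r powr p \<le> f x powr p" using x r p by (intro powr_mono2) auto
      then have "1 \<le> 1 / r powr p * f x powr p" using r by (simp add: field_simps)
      then have "ennreal 1 \<le> ennreal (1 / r powr p * f x powr p)" by (rule ennreal_leI)
      then show "1 \<le> ennreal (1 / r powr p) * ennreal (f x powr p)"
        by (simp add: ennreal_mult'[symmetric])
    qed
  qed measurable
  also have "\<dots> \<le> ennreal (1 / r powr p) * (\<integral>\<^sup>+ x. ennreal (f x powr p) * indicator (space M) x \<partial>M)"
    using nn_integral_Markov_inequality[of "\<lambda>x. ennreal (f x powr p)" "space M" M "ennreal (1 / r powr p)"]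
    by (simp add: Int_commute Int_def conj_commute)
  also have "\<dots> \<le> ennreal (1 / r powr p) * ennreal (a powr p)"
    using L by (intro mult_left_mono) (auto simp: Lp_le_def cong: nn_integral_cong)
  also have "\<dots> = ennreal (1 / r powr p * a powr p)" by (simp add: ennreal_mult'[symmetric])
  also have "1 / r powr p * a powr p = (a / r) powr p"
    using L r by (simp add: powr_divide Lp_le_def)
  finally show ?thesis .
qed

context separable_metric
begin

text \<open>\<open>{x. mball x r \<subseteq> U}\<close> exhausts an open \<open>U\<close> as \<open>r \<rightarrow> 0\<close>.\<close>
lemma interior_part_sets:
  "{x \<in> mspace m. mball_of m x r \<subseteq> U} \<in> sets (mborel m)"
proof -
  interpret Metric_space "mspace m" "mdist m" by simp
  have "{x \<in> mspace m. mball_of m x r \<subseteq> U} = mspace m - (\<Union>y\<in>mspace m - U. mball y r)"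
    by (auto simp: commute)
  moreover have "openin mtopology (\<Union>y\<in>mspace m - U. mball y r)" by auto
  then have "(\<Union>y\<in>mspace m - U. mball y r) \<in> sets (mborel m)"
    unfolding sets_borel_of mtopology_of_def by (auto intro: sigma_sets.Basic)
  ultimately show ?thesis
    using sets.compl_sets[of "(\<Union>y\<in>mspace m - U. mball y r)" "mborel m"] by simp
qed

text \<open>Under a coupling, mass starting in \<open>F n\<close> lands in \<open>U\<close> or
  travels at least \<open>1 / Suc n\<close>; by Markov's inequality the travelling part is
  negligible when the cost is small. The sets \<open>F n\<close> increase to
  \<open>U\<close>.\<close>

lemma wasserstein_eq_0_open_le:
  assumes p: "1 \<le> p" and \<mu>: "\<mu> \<in> finite_moment_measures p m" and \<nu>: "\<nu> \<in> finite_moment_measures p m"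
    and 0: "wasserstein p m \<mu> \<nu> = 0" and U: "openin (mtopology_of m) U"
  shows "emeasure \<mu> U \<le> emeasure \<nu> U"
proof -
  interpret Metric_space "mspace m" "mdist m" by simp
  note S = finite_momentD[OF \<mu>] finite_momentD[OF \<nu>]
  have US [measurable]: "U \<in> sets (mborel m)" using U by (simp add: sets_borel_of sigma_sets.Basic)
  define F where "F n = {x \<in> mspace m. mball_of m x (1 / Suc n) \<subseteq> U}" for n :: nat
  have F: "F n \<in> sets \<mu>" for n unfolding F_def using interior_part_sets S by simp
  have "emeasure \<mu> (F n) \<le> emeasure \<nu> U" for n
  proof (rule ennreal_le_epsilon)
    fix \<epsilon> :: real assume \<epsilon>: "0 < \<epsilon>"
    \<comment> \<open>Chosen so that Markov's bound for travelling \<open>1 / Suc n\<close> equals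
      \<open>\<epsilon>\<close>.\<close>
    define a where "a = (1 / Suc n) * \<epsilon> powr (1 / p)"
    have a: "0 < a" "(a / (1 / Suc n)) powr p = \<epsilon>"
      using \<epsilon> p by (auto simp: a_def powr_powr)
    obtain \<pi> where \<pi>: "\<pi> \<in> couplings \<mu> \<nu>" "Lp_le p \<pi> (\<lambda>z. mdist m (fst z) (snd z)) a"
      using wasserstein_less[OF p \<mu> \<nu>] 0 a by metis
    note M [measurable] = coupling_measurable[OF \<pi>(1) S(2) S(5)]
    have [measurable]: "F n \<in> sets (mborel m)" using F S by simp
    have sp: "fst z \<in> mspace m" "snd z \<in> mspace m" if "z \<in> space \<pi>" for z
      using that measurable_space[OF M(1)] measurable_space[OF M(2)] by auto
    have "emeasure \<mu> (F n) = emeasure (distr \<pi> \<mu> fst) (F n)"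
      using coupling_sets(4)[OF \<pi>(1)] by simp
    also have "\<dots> = emeasure \<pi> (fst -` F n \<inter> space \<pi>)"
      using coupling_sets[OF \<pi>(1)] F by (intro emeasure_distr) auto
    also have "\<dots> \<le> emeasure \<pi> ((snd -` U \<inter> space \<pi>) \<union> {z \<in> space \<pi>. 1 / Suc n \<le> mdist m (fst z) (snd z)})"
    proof (rule emeasure_mono)
      show "fst -` F n \<inter> space \<pi> \<subseteq> (snd -` U \<inter> space \<pi>) \<union> {z \<in> space \<pi>. 1 / Suc n \<le> mdist m (fst z) (snd z)}"
      proof
        fix z assume z: "z \<in> fst -` F n \<inter> space \<pi>"
        then show "z \<in> (snd -` U \<inter> space \<pi>) \<union> {z \<in> space \<pi>. 1 / Suc n \<le> mdist m (fst z) (snd z)}"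
          using sp[of z] by (auto simp: F_def subset_iff not_le)
      qed
    qed measurable
    also have "\<dots> \<le> emeasure \<pi> (snd -` U \<inter> space \<pi>) + emeasure \<pi> {z \<in> space \<pi>. 1 / Suc n \<le> mdist m (fst z) (snd z)}"
      by (rule emeasure_subadditive) measurable
    also have "emeasure \<pi> (snd -` U \<inter> space \<pi>) = emeasure (distr \<pi> \<nu> snd) U"
      using coupling_sets[OF \<pi>(1)] US S by (intro emeasure_distr[symmetric]) auto
    also have "\<dots> = emeasure \<nu> U" using coupling_sets(5)[OF \<pi>(1)] by simp
    also have "emeasure \<pi> {z \<in> space \<pi>. 1 / Suc n \<le> mdist m (fst z) (snd z)} \<le> ennreal \<epsilon>"
      using Lp_le_markov[OF \<pi>(2), of "1 / Suc n"] p a by simp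
    finally show "emeasure \<mu> (F n) \<le> emeasure \<nu> U + ennreal \<epsilon>" by (simp add: add_left_mono)
  qed
  moreover have "(SUP n. emeasure \<mu> (F n)) = emeasure \<mu> (\<Union>n. F n)"
  proof (rule SUP_emeasure_incseq)
    show "range F \<subseteq> sets \<mu>" using F by auto
    show "incseq F"
    proof (rule incseq_SucI)
      fix n
      have "1 / real (Suc (Suc n)) \<le> 1 / real (Suc n)" by (simp add: field_simps)
      then show "F n \<le> F (Suc n)" unfolding F_def by (fastforce simp: subset_iff)
    qed
  qed
  moreover have "(\<Union>n. F n) = U"
  proof
    show "(\<Union>n. F n) \<subseteq> U" by (auto simp: F_def subset_iff)
    show "U \<subseteq> (\<Union>n. F n)"
    proof
      fix x assume x: "x \<in> U"
      then have "x \<in> mspace m" using openin_subset[OF U] by auto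
      obtain r where r: "0 < r" "mball x r \<subseteq> U"
        using U x unfolding mtopology_of_def openin_mtopology by blast
      obtain n where "1 / real (Suc n) < r" using nat_approx_posE[OF r(1)] by blast
      then have "x \<in> F n" using r \<open>x \<in> mspace m\<close> by (auto simp: F_def subset_iff)
      then show "x \<in> (\<Union>n. F n)" by auto
    qed
  qed
  ultimately show ?thesis by (metis SUP_le_iff)
qed

lemma wasserstein_eq_0:
  assumes p: "1 \<le> p" and \<mu>: "\<mu> \<in> finite_moment_measures p m" and \<nu>: "\<nu> \<in> finite_moment_measures p m"
    and 0: "wasserstein p m \<mu> \<nu> = 0"
  shows "\<mu> = \<nu>"
proof (rule measure_eqI_generator_eq)
  note S = finite_momentD[OF \<mu>] finite_momentD[OF \<nu>]
  interpret prob_space \<mu> by (rule S)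
  let ?E = "{U. openin (mtopology_of m) U}"
  show "Int_stable ?E" by (auto simp: Int_stable_def)
  show "?E \<subseteq> Pow (mspace m)" using openin_subset by fastforce
  show "sets \<mu> = sigma_sets (mspace m) ?E" "sets \<nu> = sigma_sets (mspace m) ?E"
    using S by (simp_all add: sets_borel_of)
  show "emeasure \<mu> X = emeasure \<nu> X" if "X \<in> ?E" for X
    using that wasserstein_eq_0_open_le[OF p \<mu> \<nu> 0] wasserstein_eq_0_open_le[OF p \<nu> \<mu>] 0
    by (intro antisym) (auto simp: wasserstein_commute)
  show "range (\<lambda>_::nat. mspace m) \<subseteq> ?E" "(\<Union>_::nat. mspace m) = mspace m"
    using openin_topspace[of "mtopology_of m"] by auto
  show "emeasure \<mu> (mspace m) \<noteq> \<infinity>" for i :: nat by simp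
qed

lemma wasserstein_triangle:
  assumes p: "1 \<le> p" and \<mu>: "\<mu> \<in> finite_moment_measures p m"
    and \<nu>: "\<nu> \<in> finite_moment_measures p m" and \<rho>: "\<rho> \<in> finite_moment_measures p m"
  shows "wasserstein p m \<mu> \<rho> \<le> wasserstein p m \<mu> \<nu> + wasserstein p m \<nu> \<rho>"
proof (rule field_le_epsilon)
  fix \<epsilon> :: real assume \<epsilon>: "0 < \<epsilon>"
  obtain \<pi>1 where \<pi>1: "\<pi>1 \<in> couplings \<mu> \<nu>"
      "Lp_le p \<pi>1 (\<lambda>z. mdist m (fst z) (snd z)) (wasserstein p m \<mu> \<nu> + \<epsilon> / 3)"
    using wasserstein_less[OF p \<mu> \<nu>, of "wasserstein p m \<mu> \<nu> + \<epsilon> / 3"] \<epsilon> by auto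
  obtain \<pi>2 where \<pi>2: "\<pi>2 \<in> couplings \<nu> \<rho>"
      "Lp_le p \<pi>2 (\<lambda>z. mdist m (fst z) (snd z)) (wasserstein p m \<nu> \<rho> + \<epsilon> / 3)"
    using wasserstein_less[OF p \<nu> \<rho>, of "wasserstein p m \<nu> \<rho> + \<epsilon> / 3"] \<epsilon> by auto
  have "wasserstein p m \<mu> \<rho>
      \<le> (wasserstein p m \<mu> \<nu> + \<epsilon> / 3) + (wasserstein p m \<nu> \<rho> + \<epsilon> / 3) + \<epsilon> / 3"
    using finite_momentD[OF \<mu>] finite_momentD[OF \<nu>] finite_momentD[OF \<rho>] \<epsilon>
    by (intro wasserstein_glue[OF p _ _ _ _ _ _ _ \<pi>1 \<pi>2]) auto
  then show "wasserstein p m \<mu> \<rho> \<le> wasserstein p m \<mu> \<nu> + wasserstein p m \<nu> \<rho> + \<epsilon>" by simp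
qed

lemma Metric_space_wasserstein:
  assumes p: "1 \<le> p"
  shows "Metric_space (finite_moment_measures p m) (wasserstein p m)"
proof
  show "0 \<le> wasserstein p m \<mu> \<nu>" for \<mu> \<nu> by (rule wasserstein_nonneg)
  show "wasserstein p m \<mu> \<nu> = wasserstein p m \<nu> \<mu>" for \<mu> \<nu> by (rule wasserstein_commute)
  show "(wasserstein p m \<mu> \<nu> = 0) = (\<mu> = \<nu>)"
    if "\<mu> \<in> finite_moment_measures p m" "\<nu> \<in> finite_moment_measures p m" for \<mu> \<nu>
    using that wasserstein_eq_0[OF p] wasserstein_self[OF _ _ p] finite_momentD by metis
qed (rule wasserstein_triangle[OF p])

end

section \<open>Finite quantization\<close>

lemma nn_integral_finite_code:
  fixes F :: "nat \<Rightarrow> real"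
  assumes "prob_space \<nu>" and c: "c \<in> \<nu> \<rightarrow>\<^sub>M count_space UNIV" and C: "finite C" "c ` space \<nu> \<subseteq> C"
    and F: "\<And>l. l \<in> C \<Longrightarrow> 0 \<le> F l"
  shows "(\<integral>\<^sup>+ y. ennreal (F (c y)) \<partial>\<nu>) = ennreal (\<Sum>l\<in>C. F l * measure \<nu> (c -` {l} \<inter> space \<nu>))"
proof -
  interpret prob_space \<nu> by fact
  have [measurable]: "c -` {l} \<inter> space \<nu> \<in> sets \<nu>" for l using c by measurable
  have "(\<integral>\<^sup>+ y. ennreal (F (c y)) \<partial>\<nu>)
      = (\<integral>\<^sup>+ y. (\<Sum>l\<in>C. ennreal (F l) * indicator (c -` {l} \<inter> space \<nu>) y) \<partial>\<nu>)"
  proof (rule nn_integral_cong)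
    fix y assume y: "y \<in> space \<nu>"
    have "(\<Sum>l\<in>C. ennreal (F l) * indicator (c -` {l} \<inter> space \<nu>) y)
        = (\<Sum>l\<in>C. if l = c y then ennreal (F l) else 0)"
      using y by (intro sum.cong) (auto simp: indicator_def)
    also have "\<dots> = ennreal (F (c y))" using C y by auto
    finally show "ennreal (F (c y)) = (\<Sum>l\<in>C. ennreal (F l) * indicator (c -` {l} \<inter> space \<nu>) y)" ..
  qed
  also have "\<dots> = (\<Sum>l\<in>C. ennreal (F l) * emeasure \<nu> (c -` {l} \<inter> space \<nu>))"
    by (simp add: nn_integral_sum nn_integral_cmult)
  also have "\<dots> = (\<Sum>l\<in>C. ennreal (F l * measure \<nu> (c -` {l} \<inter> space \<nu>)))"
    using F by (intro sum.cong) (auto simp: emeasure_eq_measure ennreal_mult')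
  also have "\<dots> = ennreal (\<Sum>l\<in>C. F l * measure \<nu> (c -` {l} \<inter> space \<nu>))"
    using F by (intro sum_ennreal) auto
  finally show ?thesis .
qed

lemma sum_code_measure:
  assumes "prob_space \<nu>" and c: "c \<in> \<nu> \<rightarrow>\<^sub>M count_space UNIV" and C: "finite C" "c ` space \<nu> \<subseteq> C"
  shows "(\<Sum>l\<in>C. measure \<nu> (c -` {l :: nat} \<inter> space \<nu>)) = 1"
proof -
  interpret prob_space \<nu> by fact
  have "ennreal (\<Sum>l\<in>C. measure \<nu> (c -` {l} \<inter> space \<nu>)) = 1"
    using nn_integral_finite_code[OF assms, of "\<lambda>_. 1"] by (simp add: emeasure_space_1)
  then show ?thesis by (simp add: ennreal_eq_1)
qed

context separable_metric
begin

text \<open>The coupling puts as much mass as possible on pairs in the same cell, and couples the excess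
  masses independently.\<close>
lemma wasserstein_quantization:
  fixes c :: "'a \<Rightarrow> nat" and rep :: "nat \<Rightarrow> 'a"
  assumes p: "1 \<le> p" and \<mu>: "prob_space \<mu>" "sets \<mu> = sets (mborel m)"
    and \<nu>: "prob_space \<nu>" "sets \<nu> = sets (mborel m)"
    and c [measurable]: "c \<in> mborel m \<rightarrow>\<^sub>M count_space UNIV"
    and C: "finite C" "c ` mspace m \<subseteq> C" and rep: "\<And>k. rep k \<in> mspace m"
    and D: "\<And>k l. k \<in> C \<Longrightarrow> l \<in> C \<Longrightarrow> mdist m (rep k) (rep l) \<le> D" "0 \<le> D"
    and a: "Lp_le p \<mu> (\<lambda>x. mdist m x (rep (c x))) a"
    and b: "Lp_le p \<nu> (\<lambda>x. mdist m x (rep (c x))) b"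
  defines "mu k \<equiv> measure \<mu> (c -` {k} \<inter> mspace m)" and "nu k \<equiv> measure \<nu> (c -` {k} \<inter> mspace m)"
  shows "wasserstein p m \<mu> \<nu> \<le> a + b + D * (\<Sum>k\<in>C. max 0 (mu k - nu k)) powr (1 / p)"
proof -
  interpret M: prob_space \<mu> by fact
  interpret N: prob_space \<nu> by fact
  interpret pair_prob_space \<mu> \<nu> ..
  define r where "r = (\<Sum>k\<in>C. max 0 (mu k - nu k))"
  have sp: "space \<mu> = mspace m" "space \<nu> = mspace m"
    using sets_eq_imp_space_eq[OF \<mu>(2)] sets_eq_imp_space_eq[OF \<nu>(2)] by simp_all
  have cm [measurable]: "c \<in> \<mu> \<rightarrow>\<^sub>M count_space UNIV" "c \<in> \<nu> \<rightarrow>\<^sub>M count_space UNIV"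
    using c \<mu> \<nu> by (simp_all cong: measurable_cong_sets)
  have Cs: "c ` space \<mu> \<subseteq> C" "c ` space \<nu> \<subseteq> C" using C sp by auto
  have mass: "(\<Sum>k\<in>C. mu k) = 1" "(\<Sum>k\<in>C. nu k) = 1"
    using sum_code_measure[OF \<mu>(1) cm(1) C(1) Cs(1)] sum_code_measure[OF \<nu>(1) cm(2) C(1) Cs(2)]
    by (simp_all add: mu_def nu_def sp)
  have nn: "0 \<le> mu k" "0 \<le> nu k" for k by (simp_all add: mu_def nu_def)
  have "(\<Sum>k\<in>C. max 0 (mu k - nu k)) - (\<Sum>k\<in>C. max 0 (nu k - mu k)) = (\<Sum>k\<in>C. mu k) - (\<Sum>k\<in>C. nu k)"
    unfolding sum_subtractf[symmetric] by (rule sum.cong) auto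
  then have r': "(\<Sum>k\<in>C. max 0 (nu k - mu k)) = r" using mass by (simp add: r_def)
  have r0: "0 \<le> r" unfolding r_def by (rule sum_nonneg) auto
  \<comment> \<open>Here and in \<open>\<beta>\<close>: the share of a cell's mass that has to leave
    it, and the share that arrives from elsewhere. If a denominator is 0, so is its numerator, and
    \<open>\<alpha>m\<close> still holds.\<close>
  define \<alpha> where "\<alpha> k = max 0 (mu k - nu k) / mu k" for k
  define \<beta> where "\<beta> k = max 0 (nu k - mu k) / nu k" for k
  have \<alpha>0: "0 \<le> \<alpha> k" "0 \<le> \<beta> k" for k using nn by (auto simp: \<alpha>_def \<beta>_def)
  have \<alpha>m: "\<alpha> k * mu k = max 0 (mu k - nu k)" "\<beta> k * nu k = max 0 (nu k - mu k)" for k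
    using nn[of k] by (auto simp: \<alpha>_def \<beta>_def)
  have \<alpha>r: "\<alpha> k = 0 \<and> \<beta> k = 0" if "r = 0" "k \<in> C" for k
    using that C(1) r' sum_nonneg_eq_0_iff[of C "\<lambda>k. max 0 (mu k - nu k)"]
      sum_nonneg_eq_0_iff[of C "\<lambda>k. max 0 (nu k - mu k)"] by (auto simp: r_def \<alpha>_def \<beta>_def)
  \<comment> \<open>Density of the coupling on the pair of cells \<open>k\<close>, \<open>l\<close>:
    the common mass stays on the diagonal, the excess is spread as a product normalized by its total
    mass \<open>r\<close>. For \<open>r = 0\<close> there is no excess, and division by 0 gives
    0.\<close>
  define H where "H k l = (if k = l then min (mu k) (nu k) / (mu k * nu k) else 0) + \<alpha> k * \<beta> l / r" for k l
  have H0: "0 \<le> H k l" for k l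
    using nn[of k] nn[of l] \<alpha>0 r0 by (auto simp: H_def intro!: add_nonneg_nonneg divide_nonneg_nonneg)
  have row: "(\<Sum>l\<in>C. H k l * nu l) = 1" if k: "k \<in> C" "mu k \<noteq> 0" for k
  proof -
    have "(\<Sum>l\<in>C. H k l * nu l) = (\<Sum>l\<in>C. (if k = l then min (mu k) (nu k) / (mu k * nu k) * nu l else 0))
        + (\<Sum>l\<in>C. \<alpha> k / r * (\<beta> l * nu l))"
      unfolding sum.distrib[symmetric] by (rule sum.cong) (auto simp: H_def algebra_simps)
    also have "(\<Sum>l\<in>C. \<alpha> k / r * (\<beta> l * nu l)) = \<alpha> k / r * r"
      unfolding \<alpha>m sum_distrib_left[symmetric] r' ..
    also have "\<alpha> k / r * r = \<alpha> k" using \<alpha>r[OF _ k(1)] by (cases "r = 0") auto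
    also have "(\<Sum>l\<in>C. (if k = l then min (mu k) (nu k) / (mu k * nu k) * nu l else 0)) = min (mu k) (nu k) / mu k"
      using C(1) k nn[of k] by (auto simp: min_def)
    also have "min (mu k) (nu k) / mu k + \<alpha> k = (min (mu k) (nu k) + max 0 (mu k - nu k)) / mu k"
      by (simp add: \<alpha>_def add_divide_distrib)
    also have "\<dots> = 1" using k by (auto simp: min_def max_def)
    finally show ?thesis .
  qed
  have col: "(\<Sum>k\<in>C. H k l * mu k) = 1" if l: "l \<in> C" "nu l \<noteq> 0" for l
  proof -
    have "(\<Sum>k\<in>C. H k l * mu k) = (\<Sum>k\<in>C. (if k = l then min (mu l) (nu l) / (mu l * nu l) * mu k else 0))
        + (\<Sum>k\<in>C. \<beta> l / r * (\<alpha> k * mu k))"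
      unfolding sum.distrib[symmetric] by (rule sum.cong) (auto simp: H_def algebra_simps)
    also have "(\<Sum>k\<in>C. \<beta> l / r * (\<alpha> k * mu k)) = \<beta> l / r * r"
      unfolding \<alpha>m sum_distrib_left[symmetric] r_def ..
    also have "\<beta> l / r * r = \<beta> l" using \<alpha>r[OF _ l(1)] by (cases "r = 0") auto
    also have "(\<Sum>k\<in>C. (if k = l then min (mu l) (nu l) / (mu l * nu l) * mu k else 0)) = min (mu l) (nu l) / nu l"
      using C(1) l nn[of l] by (auto simp: min_def)
    also have "min (mu l) (nu l) / nu l + \<beta> l = (min (mu l) (nu l) + max 0 (nu l - mu l)) / nu l"
      by (simp add: \<beta>_def add_divide_distrib)
    also have "\<dots> = 1" using l by (auto simp: min_def max_def)
    finally show ?thesis .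
  qed
  have code_pos: "AE x in \<kappa>. measure \<kappa> (c -` {c x} \<inter> mspace m) \<noteq> 0"
    if \<kappa>: "prob_space \<kappa>" "sets \<kappa> = sets (mborel m)" for \<kappa>
  proof -
    interpret K: prob_space \<kappa> by fact
    have A: "c -` {k} \<inter> mspace m \<in> sets \<kappa>" for k
      using measurable_sets[OF c, of "{k}"] \<kappa> by simp
    have "AE x in \<kappa>. \<forall>k. measure \<kappa> (c -` {k} \<inter> mspace m) = 0 \<longrightarrow> x \<notin> c -` {k} \<inter> mspace m"
    proof (intro AE_all_countable[THEN iffD2] allI)
      fix k
      show "AE x in \<kappa>. measure \<kappa> (c -` {k} \<inter> mspace m) = 0 \<longrightarrow> x \<notin> c -` {k} \<inter> mspace m"
        using AE_not_in[of "c -` {k} \<inter> mspace m" \<kappa>] A[of k]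
        by (cases "measure \<kappa> (c -` {k} \<inter> mspace m) = 0") (simp_all add: null_sets_def K.emeasure_eq_measure)
    qed
    then show ?thesis
      using AE_space by eventually_elim (use sets_eq_imp_space_eq[OF \<kappa>(2)] in auto)
  qed
  define h where "h w = ennreal (H (c (fst w)) (c (snd w)))" for w :: "'a \<times> 'a"
  have [measurable]: "(\<lambda>w. (c (fst w), c (snd w))) \<in> \<mu> \<Otimes>\<^sub>M \<nu> \<rightarrow>\<^sub>M count_space UNIV"
  proof -
    have "(\<lambda>w. (c (fst w), c (snd w))) \<in> \<mu> \<Otimes>\<^sub>M \<nu> \<rightarrow>\<^sub>M count_space UNIV \<Otimes>\<^sub>M count_space UNIV"
      by measurable
    then show ?thesis by (simp add: pair_measure_countable)
  qed
  have codeF: "(\<lambda>w. ennreal (G (c (fst w)) (c (snd w)))) \<in> borel_measurable (\<mu> \<Otimes>\<^sub>M \<nu>)" for G :: "nat \<Rightarrow> nat \<Rightarrow> real"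
    by (rule measurable_compose[of "\<lambda>w. (c (fst w), c (snd w))" _ "count_space UNIV" "\<lambda>(k, l). ennreal (G k l)", simplified])
      measurable
  have h [measurable]: "h \<in> borel_measurable (\<mu> \<Otimes>\<^sub>M \<nu>)" unfolding h_def by (rule codeF)
  define \<Gamma> where "\<Gamma> = density (\<mu> \<Otimes>\<^sub>M \<nu>) h"
  have G1: "distr \<Gamma> \<mu> fst = \<mu>"
    unfolding \<Gamma>_def
  proof (rule distr_density_fst[OF N.sigma_finite_measure_axioms h])
    show "AE x in \<mu>. (\<integral>\<^sup>+ y. h (x, y) \<partial>\<nu>) = 1"
      using code_pos[OF \<mu>] AE_space
    proof eventually_elim
      case (elim x)
      have "(\<integral>\<^sup>+ y. h (x, y) \<partial>\<nu>) = ennreal (\<Sum>l\<in>C. H (c x) l * nu l)"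
        unfolding h_def nu_def using nn_integral_finite_code[OF \<nu>(1) cm(2) C(1) Cs(2), of "H (c x)"] H0 sp by simp
      then show ?case using row[of "c x"] elim C sp by (auto simp: mu_def)
    qed
  qed
  have G2: "distr \<Gamma> \<nu> snd = \<nu>"
    unfolding \<Gamma>_def
  proof (rule distr_density_snd[OF M.sigma_finite_measure_axioms N.sigma_finite_measure_axioms h])
    show "AE y in \<nu>. (\<integral>\<^sup>+ x. h (x, y) \<partial>\<mu>) = 1"
      using code_pos[OF \<nu>] AE_space
    proof eventually_elim
      case (elim y)
      have "(\<integral>\<^sup>+ x. h (x, y) \<partial>\<mu>) = ennreal (\<Sum>k\<in>C. H k (c y) * mu k)"
        unfolding h_def mu_def using nn_integral_finite_code[OF \<mu>(1) cm(1) C(1) Cs(1), of "\<lambda>k. H k (c y)"] H0 sp by simp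
      then show ?case using col[of "c y"] elim C sp by (auto simp: nu_def)
    qed
  qed
  have \<Gamma>: "\<Gamma> \<in> couplings \<mu> \<nu>"
    using G1 G2 by (simp add: couplings_def \<Gamma>_def)
  interpret G: prob_space \<Gamma> by (rule coupling_prob_space[OF \<Gamma> \<mu>(1)])
  \<comment> \<open>Bounds the distance of the two representatives. It vanishes on pairs in one
    cell, so only the excess part of the coupling contributes to its integral.\<close>
  define off where "off w = (if c (fst w) = c (snd w) then 0 else D)" for w
  have off_meas [measurable]: "off \<in> borel_measurable \<Gamma>"
  proof -
    have "(\<lambda>w. (\<lambda>(k, l). if k = l then 0 else D) (c (fst w), c (snd w))) \<in> borel_measurable (\<mu> \<Otimes>\<^sub>M \<nu>)"
      by (rule measurable_compose[of _ _ "count_space UNIV"]) measurable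
    then show ?thesis by (simp add: off_def[abs_def] \<Gamma>_def)
  qed
  have "(\<integral>\<^sup>+ w. ennreal (off w powr p) \<partial>\<Gamma>) = (\<integral>\<^sup>+ w. h w * ennreal (off w powr p) \<partial>(\<mu> \<Otimes>\<^sub>M \<nu>))"
    unfolding \<Gamma>_def using off_meas by (subst nn_integral_density) (auto simp: \<Gamma>_def)
  also have "\<dots> = (\<integral>\<^sup>+ w. ennreal (D powr p * (if c (fst w) = c (snd w) then 0 else H (c (fst w)) (c (snd w)))) \<partial>(\<mu> \<Otimes>\<^sub>M \<nu>))"
    using H0 by (intro nn_integral_cong) (auto simp: h_def off_def ennreal_mult' ac_simps)
  also have "\<dots> \<le> (\<integral>\<^sup>+ w. ennreal (D powr p * (\<alpha> (c (fst w)) * \<beta> (c (snd w)) / r)) \<partial>(\<mu> \<Otimes>\<^sub>M \<nu>))"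
    using \<alpha>0 r0 by (intro nn_integral_mono ennreal_leI mult_left_mono) (auto simp: H_def)
  also have "\<dots> = (\<integral>\<^sup>+ x. \<integral>\<^sup>+ y. ennreal (D powr p * (\<alpha> (c x) * \<beta> (c y) / r)) \<partial>\<nu> \<partial>\<mu>)"
    using codeF[of "\<lambda>k l. D powr p * (\<alpha> k * \<beta> l / r)"] by (subst N.nn_integral_fst[symmetric]) auto
  also have "\<dots> = (\<integral>\<^sup>+ x. ennreal (D powr p * \<alpha> (c x)) \<partial>\<mu>)"
  proof (rule nn_integral_cong)
    fix x assume x: "x \<in> space \<mu>"
    have "(\<integral>\<^sup>+ y. ennreal (D powr p * (\<alpha> (c x) * \<beta> (c y) / r)) \<partial>\<nu>)
        = ennreal (\<Sum>l\<in>C. D powr p * (\<alpha> (c x) * \<beta> l / r) * nu l)"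
      unfolding nu_def
      using nn_integral_finite_code[OF \<nu>(1) cm(2) C(1) Cs(2), of "\<lambda>l. D powr p * (\<alpha> (c x) * \<beta> l / r)"]
        \<alpha>0 r0 sp by simp
    also have "(\<Sum>l\<in>C. D powr p * (\<alpha> (c x) * \<beta> l / r) * nu l) = (\<Sum>l\<in>C. D powr p * \<alpha> (c x) / r * (\<beta> l * nu l))"
      by (rule sum.cong) auto
    also have "\<dots> = D powr p * \<alpha> (c x) / r * r"
      unfolding \<alpha>m sum_distrib_left[symmetric] r' ..
    also have "\<dots> = D powr p * \<alpha> (c x)"
      using \<alpha>r[of "c x"] C x sp by (cases "r = 0") auto
    finally show "(\<integral>\<^sup>+ y. ennreal (D powr p * (\<alpha> (c x) * \<beta> (c y) / r)) \<partial>\<nu>) = ennreal (D powr p * \<alpha> (c x))" .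
  qed
  also have "\<dots> = ennreal (\<Sum>k\<in>C. D powr p * \<alpha> k * mu k)"
    unfolding mu_def
    using nn_integral_finite_code[OF \<mu>(1) cm(1) C(1) Cs(1), of "\<lambda>l. D powr p * \<alpha> l"] \<alpha>0 sp by simp
  also have "(\<Sum>k\<in>C. D powr p * \<alpha> k * mu k) = D powr p * r"
    unfolding mult.assoc \<alpha>m sum_distrib_left[symmetric] r_def ..
  also have "\<dots> = (D * r powr (1 / p)) powr p"
    using D r0 p by (simp add: powr_mult powr_powr)
  finally have Loff: "Lp_le p \<Gamma> off (D * r powr (1 / p))"
    using D by (auto simp: Lp_le_def off_def)
  note Mc [measurable] = coupling_measurable[OF \<Gamma> \<mu>(2) \<nu>(2)]
  have rc: "(\<lambda>x. rep (c x)) \<in> mborel m \<rightarrow>\<^sub>M mborel m"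
    by (rule measurable_compose[OF c]) (use rep in auto)
  have dm: "(\<lambda>x. mdist m x (rep (c x))) \<in> borel_measurable (mborel m)"
    by (rule dist_measurable_comp[OF _ rc]) simp
  have La: "Lp_le p \<Gamma> (\<lambda>w. mdist m (fst w) (rep (c (fst w)))) a"
    using Lp_le_coupling_fst[OF \<Gamma>, of "\<lambda>x. mdist m x (rep (c x))"] dm \<mu> a by (simp cong: measurable_cong_sets)
  have Lb: "Lp_le p \<Gamma> (\<lambda>w. mdist m (snd w) (rep (c (snd w)))) b"
    using Lp_le_coupling_snd[OF \<Gamma>, of "\<lambda>x. mdist m x (rep (c x))"] dm \<nu> b by (simp cong: measurable_cong_sets)
  have "Lp_le p \<Gamma> (\<lambda>w. mdist m (fst w) (snd w)) (a + b + D * r powr (1 / p))"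
  proof (rule Lp_le_mono[OF Lp_le_add[OF Lp_le_add[OF La Lb p] Loff p]])
    show "AE w in \<Gamma>. mdist m (fst w) (snd w)
        \<le> mdist m (fst w) (rep (c (fst w))) + mdist m (snd w) (rep (c (snd w))) + off w"
    proof (rule AE_I2)
      fix w assume "w \<in> space \<Gamma>"
      then have w: "fst w \<in> mspace m" "snd w \<in> mspace m"
        using measurable_space[OF Mc(1)] measurable_space[OF Mc(2)] by auto
      have "mdist m (rep (c (fst w))) (rep (c (snd w))) \<le> off w"
        using D(1)[of "c (fst w)" "c (snd w)"] w C rep by (auto simp: off_def eq_refl)
      then show "mdist m (fst w) (snd w)
        \<le> mdist m (fst w) (rep (c (fst w))) + mdist m (snd w) (rep (c (snd w))) + off w"
        using mdist_triangle[OF w(1) rep w(2), of "c (fst w)"]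
          mdist_triangle[OF rep rep w(2), of "c (fst w)" "c (snd w)"] by (simp add: mdist_commute)
    qed
  qed (use p in auto)
  then show ?thesis unfolding r_def by (rule wasserstein_le[OF \<Gamma> _ p])
qed

end

section \<open>Entropy of densities\<close>

text \<open>The linear terms turn \<open>t * ln t\<close> into a nonnegative convex function with
  minimum 0 at \<open>t = 1\<close>; integrated over a probability measure they cancel for densities
  of mass 1. The value \<open>phi 0 = 1\<close> is the continuous extension.\<close>

definition phi :: "real \<Rightarrow> real" where
  "phi t = t * ln t - t + 1"

text \<open>Fenchel-Young inequality, \<open>exp h - 1\<close> being the convex conjugate of
  \<open>phi\<close>. It comes from \<open>ln y \<le> y - 1\<close> at
  \<open>y = exp h / t\<close>.\<close>

lemma phi_young:
  assumes "0 \<le> t" shows "t * h \<le> phi t + exp h - 1"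
proof (cases "t = 0")
  case True
  then show ?thesis by (simp add: phi_def)
next
  case False
  with assms have t: "0 < t" by simp
  have "ln (exp h / t) \<le> exp h / t - 1"
    using t by (intro ln_le_minus_one) auto
  then have "t * (h - ln t) \<le> t * (exp h / t - 1)"
    using t by (intro mult_left_mono) (auto simp: ln_div)
  then show ?thesis using t by (simp add: phi_def algebra_simps)
qed

lemma phi_nonneg: "0 \<le> t \<Longrightarrow> 0 \<le> phi t"
  using phi_young[of t 0] by simp

text \<open>The Bregman divergence of \<open>phi\<close>, whose derivative is \<open>ln\<close>,
  dominates the squared Hellinger distance: apply \<open>ln y \<le> y - 1\<close> at the square root
  of \<open>g / f\<close>.\<close>

lemma phi_bregman:
  assumes f: "0 \<le> f" and g: "0 < g"
  shows "phi g + ln g * (f - g) + (sqrt f - sqrt g)\<^sup>2 \<le> phi f"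
proof (cases "f = 0")
  case True
  then show ?thesis using g by (simp add: phi_def algebra_simps)
next
  case False
  with f have f: "0 < f" by simp
  have "ln (sqrt g / sqrt f) \<le> sqrt g / sqrt f - 1"
    using f g by (intro ln_le_minus_one) auto
  moreover have "ln (sqrt g / sqrt f) = (ln g - ln f) / 2"
    using f g by (simp add: ln_div ln_sqrt field_simps)
  ultimately have "f * ((ln g - ln f) / 2) \<le> f * (sqrt g / sqrt f - 1)"
    using f by (intro mult_left_mono) auto
  also have "f * (sqrt g / sqrt f - 1) = sqrt f * sqrt g - f"
    using f by (simp add: field_simps)
  finally have *: "f * (ln g - ln f) \<le> 2 * (sqrt f * sqrt g) - 2 * f" by simp
  have "(sqrt f - sqrt g)\<^sup>2 = f + g - 2 * (sqrt f * sqrt g)"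
    using f g by (simp add: power2_diff)
  then show ?thesis using * by (simp add: phi_def algebra_simps)
qed

text \<open>Factor \<open>f - g\<close> through square roots and separate the factors by Young's
  inequality with parameter \<open>s\<close>. The bound is linear in the divergence, so it can be
  integrated; \<open>s\<close> is chosen only afterwards.\<close>

lemma phi_bregman_abs:
  assumes f: "0 \<le> f" and g: "0 < g" and s: "0 < s"
  shows "\<bar>f - g\<bar> \<le> s / 2 * (phi f - phi g - ln g * (f - g)) + (f + g) / s"
proof -
  define u where "u = \<bar>sqrt f - sqrt g\<bar>"
  define v where "v = sqrt f + sqrt g"
  have uv: "\<bar>f - g\<bar> = u * v"
  proof -
    have "f - g = (sqrt f - sqrt g) * (sqrt f + sqrt g)" using f g by (simp add: algebra_simps)
    then show ?thesis using f g by (simp add: u_def v_def abs_mult)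
  qed
  have "0 \<le> (s * u - v)\<^sup>2" by simp
  then have "2 * s * (u * v) \<le> s\<^sup>2 * u\<^sup>2 + v\<^sup>2" by (simp add: power2_diff power_mult_distrib)
  moreover have "v\<^sup>2 \<le> 2 * (f + g)"
  proof -
    have "0 \<le> (sqrt f - sqrt g)\<^sup>2" by simp
    then show ?thesis using f g by (simp add: v_def power2_sum power2_diff)
  qed
  ultimately have "2 * s * (u * v) \<le> s\<^sup>2 * u\<^sup>2 + 2 * (f + g)" by linarith
  then have "u * v \<le> s / 2 * u\<^sup>2 + (f + g) / s" using s by (simp add: field_simps power2_eq_square)
  also have "s / 2 * u\<^sup>2 \<le> s / 2 * (phi f - phi g - ln g * (f - g))"
    using phi_bregman[OF f g] s by (intro mult_left_mono) (auto simp: u_def)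
  finally show ?thesis using uv by simp
qed

lemma phi_tendsto:
  assumes X: "X \<longlonglongrightarrow> x" and nonneg: "\<And>n. 0 \<le> X n"
  shows "(\<lambda>n. phi (X n)) \<longlonglongrightarrow> phi x"
proof -
  have x: "0 \<le> x" using LIMSEQ_le_const[OF X] nonneg by auto
  have "(\<lambda>n. X n * ln (X n)) \<longlonglongrightarrow> x * ln x"
  proof (cases "x = 0")
    case False
    then show ?thesis using X x by (intro tendsto_mult tendsto_ln) auto
  next
    case True
    \<comment> \<open>\<open>ln\<close> is not continuous at 0, so the limit at 0 needs a majorant
      that vanishes there.\<close>
    have bound: "\<bar>t * ln t\<bar> \<le> 2 * sqrt t + t\<^sup>2" if t: "0 \<le> t" for t :: real
    proof (cases "t = 0")
      case False
      with t have t: "0 < t" by simp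
      have "ln (1 / sqrt t) \<le> 1 / sqrt t - 1" using t by (intro ln_le_minus_one) auto
      moreover have "ln (1 / sqrt t) = - ln t / 2" using t by (simp add: ln_div ln_sqrt)
      ultimately have "t * (- ln t) \<le> t * (2 / sqrt t)"
        using t by (intro mult_left_mono) auto
      also have "t * (2 / sqrt t) = 2 * sqrt t" using t by (simp add: field_simps)
      finally have 1: "- (t * ln t) \<le> 2 * sqrt t" by simp
      have "t * ln t \<le> t * t" using t ln_le_minus_one[of t] by (intro mult_left_mono) auto
      then have 2: "t * ln t \<le> t\<^sup>2" by (simp add: power2_eq_square)
      have "0 \<le> sqrt t" "0 \<le> t\<^sup>2" using t by auto
      then show ?thesis using 1 2 by linarith
    qed simp
    have "(\<lambda>n. 2 * sqrt (X n) + (X n)\<^sup>2) \<longlonglongrightarrow> 2 * sqrt 0 + 0\<^sup>2"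
      using X True by (intro tendsto_intros) auto
    then have "(\<lambda>n. 2 * sqrt (X n) + (X n)\<^sup>2) \<longlonglongrightarrow> 0" by simp
    then have "(\<lambda>n. X n * ln (X n)) \<longlonglongrightarrow> 0"
      by (rule Lim_null_comparison[rotated]) (use bound nonneg in auto)
    then show ?thesis using True by simp
  qed
  from tendsto_add[OF tendsto_diff[OF this X] tendsto_const] show ?thesis unfolding phi_def .
qed

lemma phi_measurable [measurable]: "phi \<in> borel_measurable borel"
  unfolding phi_def[abs_def] by measurable

definition ent :: "'a measure \<Rightarrow> ('a \<Rightarrow> real) \<Rightarrow> ennreal" where
  "ent Q f = (\<integral>\<^sup>+ x. ennreal (phi (f x)) \<partial>Q)"

text \<open>Nonnegativity is demanded at every point, also outside the space, so that
  \<open>ennreal (f x)\<close> never truncates.\<close>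

definition is_dens :: "'a measure \<Rightarrow> ('a \<Rightarrow> real) \<Rightarrow> bool" where
  "is_dens Q f \<longleftrightarrow> f \<in> borel_measurable Q \<and> (\<forall>x. 0 \<le> f x) \<and> (\<integral>\<^sup>+ x. ennreal (f x) \<partial>Q) = 1"

lemma is_densD:
  assumes "is_dens Q f"
  shows "f \<in> borel_measurable Q" "0 \<le> f x" "(\<integral>\<^sup>+ x. ennreal (f x) \<partial>Q) = 1"
  using assms by (auto simp: is_dens_def)

lemma prob_space_density:
  assumes "is_dens Q f" shows "prob_space (density Q f)"
  using is_densD[OF assms] by (intro prob_spaceI) (auto simp: emeasure_density cong: nn_integral_cong)

lemma is_dens_integral:
  assumes "is_dens Q f" shows "integrable Q f" "(\<integral>x. f x \<partial>Q) = 1"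
proof -
  note D = is_densD[OF assms]
  show "integrable Q f" using D by (intro integrableI_nonneg) auto
  then have "ennreal (\<integral>x. f x \<partial>Q) = 1" using D by (subst nn_integral_eq_integral[symmetric]) auto
  then show "(\<integral>x. f x \<partial>Q) = 1" by (simp add: ennreal_eq_1)
qed

text \<open>The positive and negative parts of \<open>f ln f\<close> are compared with \<open>phi \<circ> f \<ge> 0\<close>.\<close>
lemma relative_entropy_density:
  assumes "prob_space Q" and f: "is_dens Q f"
  shows "relative_entropy (density Q f) Q = enn2ereal (ent Q f)"
proof -
  interpret Q: prob_space Q by fact
  note D [measurable] = is_densD(1)[OF f]
  let ?\<mu> = "density Q f"
  have ac: "absolutely_continuous Q ?\<mu>" by (rule absolutely_continuousI_density) measurable
  have "AE x in Q. ennreal (f x) = RN_deriv Q ?\<mu> x" by (rule Q.RN_deriv_unique) auto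
  then have RN: "AE x in ?\<mu>. ennreal (f x) = RN_deriv Q ?\<mu> x"
    by (intro absolutely_continuous_AE[OF _ ac]) auto
  define A where "A = (\<integral>\<^sup>+ x. ennreal (f x) * ennreal (ln (f x)) \<partial>Q)"
  define B where "B = (\<integral>\<^sup>+ x. ennreal (f x) * ennreal (- ln (f x)) \<partial>Q)"
  have eqA: "(\<integral>\<^sup>+ x. ennreal (ln (enn2real (RN_deriv Q ?\<mu> x))) \<partial>?\<mu>) = A"
  proof -
    have "(\<integral>\<^sup>+ x. ennreal (ln (enn2real (RN_deriv Q ?\<mu> x))) \<partial>?\<mu>) = (\<integral>\<^sup>+ x. ennreal (ln (f x)) \<partial>?\<mu>)"
      by (rule nn_integral_cong_AE)
        (use RN in eventually_elim, metis enn2real_ennreal is_densD(2)[OF f])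
    then show ?thesis by (simp add: nn_integral_density A_def)
  qed
  have eqB: "(\<integral>\<^sup>+ x. ennreal (- ln (enn2real (RN_deriv Q ?\<mu> x))) \<partial>?\<mu>) = B"
  proof -
    have "(\<integral>\<^sup>+ x. ennreal (- ln (enn2real (RN_deriv Q ?\<mu> x))) \<partial>?\<mu>) = (\<integral>\<^sup>+ x. ennreal (- ln (f x)) \<partial>?\<mu>)"
      by (rule nn_integral_cong_AE)
        (use RN in eventually_elim, metis enn2real_ennreal is_densD(2)[OF f])
    then show ?thesis by (simp add: nn_integral_density B_def)
  qed
  \<comment> \<open>The defining identity of \<open>phi\<close> with the positive and the negative
    part of the logarithm on opposite sides, so that no subtraction in \<open>ennreal\<close>
    occurs.\<close>
  have pt: "ennreal (phi t) + ennreal t + ennreal t * ennreal (- ln t) = ennreal t * ennreal (ln t) + 1"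
    if t: "0 \<le> t" for t
  proof (cases "0 \<le> ln t")
    case True
    then have "ennreal (phi t) + ennreal t = ennreal (t * ln t + 1)"
      using t phi_nonneg[OF t] by (simp add: ennreal_plus[symmetric] phi_def del: ennreal_plus)
    then show ?thesis using True t by (simp add: ennreal_neg ennreal_mult' ennreal_plus)
  next
    case False
    then have "ennreal (phi t) + ennreal t + ennreal t * ennreal (- ln t) = ennreal (phi t + t + t * (- ln t))"
      using t phi_nonneg[OF t] by (simp add: ennreal_mult'[symmetric] ennreal_plus[symmetric] add_nonneg_nonneg mult_nonneg_nonpos del: ennreal_plus)
    also have "phi t + t + t * (- ln t) = 1" by (simp add: phi_def)
    finally show ?thesis using False by (simp add: ennreal_neg)
  qed
  have "ent Q f + 1 + B = (\<integral>\<^sup>+ x. ennreal (phi (f x)) + ennreal (f x) + ennreal (f x) * ennreal (- ln (f x)) \<partial>Q)"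
    unfolding B_def ent_def is_densD(3)[OF f, symmetric] by (simp add: nn_integral_add)
  also have "\<dots> = (\<integral>\<^sup>+ x. ennreal (f x) * ennreal (ln (f x)) + 1 \<partial>Q)"
    using pt is_densD(2)[OF f] by simp
  also have "\<dots> = A + 1"
    unfolding A_def by (simp add: nn_integral_add Q.emeasure_space_1)
  finally have "1 + (ent Q f + B) = 1 + A" by (simp add: ac_simps)
  then have AB: "A = ent Q f + B" by (simp add: ennreal_add_left_cancel)
  \<comment> \<open>As \<open>phi\<close> is nonnegative, \<open>t * (- ln t)\<close> is at most 1.
    A finite negative part excludes a difference of infinities.\<close>
  have "B \<le> (\<integral>\<^sup>+ x. 1 \<partial>Q)"
    unfolding B_def
  proof (rule nn_integral_mono)
    fix x
    have fx: "0 \<le> f x" by (rule is_densD[OF f])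
    have "f x * (- ln (f x)) \<le> 1" using phi_nonneg[OF fx] fx by (simp add: phi_def)
    then show "ennreal (f x) * ennreal (- ln (f x)) \<le> 1"
      using fx by (simp add: ennreal_mult'[symmetric] ennreal_le_1)
  qed
  then have B: "B \<noteq> \<infinity>" using Q.emeasure_space_1 by (auto simp: top_unique)
  have "enn2ereal A - enn2ereal B = enn2ereal (ent Q f)"
    unfolding AB plus_ennreal.rep_eq using B by (cases "ent Q f"; cases B) (auto simp: enn2ereal_ennreal)
  then show ?thesis
    using ac by (simp add: relative_entropy_def eqA eqB)
qed

lemma relative_entropy_finiteE:
  assumes "prob_space Q" "prob_space \<mu>" "sets \<mu> = sets Q" "relative_entropy \<mu> Q \<noteq> \<infinity>"
  obtains f where "is_dens Q f" "\<mu> = density Q f"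
proof -
  interpret Q: prob_space Q by fact
  interpret M: prob_space \<mu> by fact
  have ac: "absolutely_continuous Q \<mu>" using assms by (auto simp: relative_entropy_def split: if_splits)
  obtain f where f: "f \<in> borel_measurable Q" "AE x in Q. RN_deriv Q \<mu> x = ennreal (f x)" "\<And>x. 0 \<le> f x"
    using Q.real_RN_deriv[OF M.finite_measure_axioms ac assms(3)] by metis
  have "\<mu> = density Q (RN_deriv Q \<mu>)" using Q.density_RN_deriv[OF ac assms(3)] by simp
  also have "\<dots> = density Q f" using f by (intro density_cong) auto
  finally have \<mu>: "\<mu> = density Q f" .
  have "(\<integral>\<^sup>+ x. ennreal (f x) \<partial>Q) = emeasure (density Q f) (space Q)"
    using f by (simp add: emeasure_density cong: nn_integral_cong)
  also have "\<dots> = 1" using M.emeasure_space_1 \<mu> by simp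
  finally have "is_dens Q f" using f by (simp add: is_dens_def)
  then show ?thesis using \<mu> by (rule that)
qed

lemma relative_entropy_nonneg:
  assumes "prob_space Q" "prob_space \<mu>" "sets \<mu> = sets Q"
  shows "0 \<le> relative_entropy \<mu> Q"
proof (cases "relative_entropy \<mu> Q = \<infinity>")
  case False
  then obtain f where "is_dens Q f" "\<mu> = density Q f" using relative_entropy_finiteE[OF assms] by blast
  then show ?thesis using relative_entropy_density[OF assms(1)] by simp
qed simp

text \<open>The easy half of the Donsker--Varadhan variational formula, without normalization.\<close>
lemma nn_integral_density_ent:
  assumes f: "is_dens Q f" and h: "h \<in> borel_measurable Q" "\<And>x. 0 \<le> h x"
  shows "(\<integral>\<^sup>+ x. ennreal (h x) \<partial>density Q f) \<le> ent Q f + (\<integral>\<^sup>+ x. ennreal (exp (h x) - 1) \<partial>Q)"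
proof -
  note D [measurable] = is_densD(1)[OF f] h(1)
  have "(\<integral>\<^sup>+ x. ennreal (h x) \<partial>density Q f) = (\<integral>\<^sup>+ x. ennreal (f x) * ennreal (h x) \<partial>Q)"
    by (simp add: nn_integral_density)
  also have "\<dots> \<le> (\<integral>\<^sup>+ x. ennreal (phi (f x)) + ennreal (exp (h x) - 1) \<partial>Q)"
  proof (rule nn_integral_mono)
    fix x
    have "f x * h x \<le> phi (f x) + (exp (h x) - 1)" using phi_young[OF is_densD(2)[OF f], of x "h x"] by simp
    then have "ennreal (f x * h x) \<le> ennreal (phi (f x) + (exp (h x) - 1))" by (rule ennreal_leI)
    then show "ennreal (f x) * ennreal (h x) \<le> ennreal (phi (f x)) + ennreal (exp (h x) - 1)"
      using is_densD(2)[OF f] h(2) phi_nonneg by (simp add: ennreal_mult' ennreal_plus)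
  qed
  also have "\<dots> = ent Q f + (\<integral>\<^sup>+ x. ennreal (exp (h x) - 1) \<partial>Q)"
    unfolding ent_def by (rule nn_integral_add) measurable
  finally show ?thesis .
qed

text \<open>\<open>nn_integral_density_ent\<close> applied to \<open>\<theta> * g x powr p\<close>
  and divided by \<open>\<theta>\<close>. With \<open>k\<close> under control, a large
  \<open>\<theta>\<close> makes the bound small, uniformly over densities of entropy at most
  \<open>c\<close>.\<close>

lemma Lp_le_density_ent:
  assumes f: "is_dens Q f" and g: "g \<in> borel_measurable Q" "\<And>x. 0 \<le> g x"
    and \<theta>: "0 < \<theta>" and k: "(\<integral>\<^sup>+ x. ennreal (exp (\<theta> * g x powr p) - 1) \<partial>Q) \<le> ennreal k"
    and c: "ent Q f \<le> ennreal c" "0 \<le> c" "0 \<le> k" and a: "c + k \<le> \<theta> * a powr p" "0 \<le> a"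
  shows "Lp_le p (density Q f) g a"
proof -
  note D [measurable] = is_densD(1)[OF f] g(1)
  have "ennreal \<theta> * (\<integral>\<^sup>+ x. ennreal (g x powr p) \<partial>density Q f) = (\<integral>\<^sup>+ x. ennreal (\<theta> * g x powr p) \<partial>density Q f)"
    using \<theta> by (simp add: nn_integral_cmult[symmetric] ennreal_mult')
  also have "\<dots> \<le> ent Q f + (\<integral>\<^sup>+ x. ennreal (exp (\<theta> * g x powr p) - 1) \<partial>Q)"
    using \<theta> by (intro nn_integral_density_ent[OF f]) auto
  also have "\<dots> \<le> ennreal (\<theta> * a powr p)"
    using add_mono[OF c(1) k] c(2,3) a by (simp add: ennreal_plus[symmetric] order_trans ennreal_leI del: ennreal_plus)
  also have "\<dots> = ennreal \<theta> * ennreal (a powr p)" using \<theta> by (simp add: ennreal_mult')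
  finally have "(\<integral>\<^sup>+ x. ennreal (g x powr p) \<partial>density Q f) \<le> ennreal (a powr p)"
    using \<theta> by (simp add: ennreal_mult_le_mult_iff)
  then show ?thesis using a g by (simp add: Lp_le_def)
qed

section \<open>Averaging a density over the cells of a finite code\<close>

text \<open>If \<open>w\<close> gives the cell masses of \<open>density Q f\<close>, this is the
  conditional expectation of \<open>f\<close> given the code. On cells of \<open>Q\<close>-mass 0
  the division gives 0.\<close>

definition avg :: "'a measure \<Rightarrow> ('a \<Rightarrow> nat) \<Rightarrow> (nat \<Rightarrow> real) \<Rightarrow> 'a \<Rightarrow> real" where
  "avg Q c w x = w (c x) / measure Q (c -` {c x} \<inter> space Q)"

abbreviation cell_mass :: "'a measure \<Rightarrow> ('a \<Rightarrow> nat) \<Rightarrow> nat \<Rightarrow> real" where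
  "cell_mass \<mu> c k \<equiv> measure \<mu> (c -` {k} \<inter> space \<mu>)"

locale finite_code = prob_space Q for Q :: "'a measure" +
  fixes c :: "'a \<Rightarrow> nat" and C :: "nat set"
  assumes c_meas [measurable]: "c \<in> Q \<rightarrow>\<^sub>M count_space UNIV"
    and C_finite: "finite C" and C_range: "c ` space Q \<subseteq> C"
begin

abbreviation "q k \<equiv> cell_mass Q c k"

lemma q_sum: "(\<Sum>k\<in>C. q k) = 1"
  by (rule sum_code_measure[OF prob_space_axioms c_meas C_finite C_range])

lemma code_comp_measurable [measurable]: "(\<lambda>x. F (c x)) \<in> borel_measurable Q"
  for F :: "nat \<Rightarrow> real"
  by (rule measurable_compose[OF c_meas]) simp

lemma nn_integral_code_density:
  assumes f: "is_dens Q f" and F: "\<And>k. k \<in> C \<Longrightarrow> 0 \<le> F k"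
  shows "(\<integral>\<^sup>+ x. ennreal (f x) * ennreal (F (c x)) \<partial>Q) = ennreal (\<Sum>k\<in>C. F k * cell_mass (density Q f) c k)"
proof -
  note [measurable] = is_densD(1)[OF f]
  have "(\<integral>\<^sup>+ x. ennreal (f x) * ennreal (F (c x)) \<partial>Q) = (\<integral>\<^sup>+ x. ennreal (F (c x)) \<partial>density Q f)"
    by (simp add: nn_integral_density)
  also have "\<dots> = ennreal (\<Sum>k\<in>C. F k * cell_mass (density Q f) c k)"
    using C_range F by (intro nn_integral_finite_code[OF prob_space_density[OF f] _ C_finite]) auto
  finally show ?thesis .
qed

lemma cell_mass_density_0:
  assumes f: "is_dens Q f" and "q k = 0"
  shows "cell_mass (density Q f) c k = 0"
proof -
  note [measurable] = is_densD(1)[OF f]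
  have A: "c -` {k} \<inter> space Q \<in> sets Q" by measurable
  then have "c -` {k} \<inter> space Q \<in> null_sets Q"
    using assms(2) by (simp add: null_sets_def emeasure_eq_measure)
  then have "c -` {k} \<inter> space Q \<in> null_sets (density Q f)"
    using absolutely_continuousI_density[of "\<lambda>x. ennreal (f x)" Q] by (auto simp: absolutely_continuous_def)
  then show ?thesis by (simp add: measure_def null_sets_def)
qed

lemma cell_mass_density_sum:
  assumes f: "is_dens Q f"
  shows "(\<Sum>k\<in>C. cell_mass (density Q f) c k) = 1"
  using C_range by (intro sum_code_measure[OF prob_space_density[OF f] _ C_finite]) auto

text \<open>Cell masses of a probability measure absolutely continuous with respect to
  \<open>Q\<close>. Vanishing on null cells ensures that no mass is lost where \<open>avg\<close>
  divides by 0.\<close>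

definition weights :: "(nat \<Rightarrow> real) \<Rightarrow> bool" where
  "weights w \<longleftrightarrow> (\<forall>k. 0 \<le> w k) \<and> (\<forall>k. q k = 0 \<longrightarrow> w k = 0) \<and> (\<Sum>k\<in>C. w k) = 1"

lemma weights_density: "is_dens Q f \<Longrightarrow> weights (cell_mass (density Q f) c)"
  unfolding weights_def using cell_mass_density_0 cell_mass_density_sum by simp

lemma avg_eq: "avg Q c w x = (\<lambda>k. w k / q k) (c x)"
  by (simp add: avg_def)

lemma nn_integral_avg:
  assumes w: "weights w" and F: "\<And>k. k \<in> C \<Longrightarrow> 0 \<le> F k"
  shows "(\<integral>\<^sup>+ x. ennreal (avg Q c w x) * ennreal (F (c x)) \<partial>Q) = ennreal (\<Sum>k\<in>C. F k * w k)"
proof -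
  have "(\<integral>\<^sup>+ x. ennreal (avg Q c w x) * ennreal (F (c x)) \<partial>Q) = (\<integral>\<^sup>+ x. ennreal ((\<lambda>k. w k / q k * F k) (c x)) \<partial>Q)"
    using w C_range F by (intro nn_integral_cong) (auto simp: avg_eq weights_def ennreal_mult''[symmetric])
  also have "\<dots> = ennreal (\<Sum>k\<in>C. w k / q k * F k * q k)"
    using w F by (intro nn_integral_finite_code[OF prob_space_axioms c_meas C_finite C_range]) (auto simp: weights_def)
  also have "(\<Sum>k\<in>C. w k / q k * F k * q k) = (\<Sum>k\<in>C. F k * w k)"
    using w by (intro sum.cong) (auto simp: weights_def)
  finally show ?thesis .
qed

lemma is_dens_avg:
  assumes w: "weights w" shows "is_dens Q (avg Q c w)"
  unfolding is_dens_def
proof (intro conjI allI)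
  show "avg Q c w \<in> borel_measurable Q" unfolding avg_eq[abs_def] by measurable
  show "0 \<le> avg Q c w x" for x using w by (simp add: avg_eq weights_def)
  show "(\<integral>\<^sup>+ x. ennreal (avg Q c w x) \<partial>Q) = 1"
    using nn_integral_avg[OF w, of "\<lambda>_. 1"] w by (simp add: weights_def)
qed

lemma q_outside: "k \<notin> C \<Longrightarrow> q k = 0"
  using C_range by (subst Int_emptyI) auto

lemma cell_mass_avg:
  assumes w: "weights w"
  shows "cell_mass (density Q (avg Q c w)) c k = w k"
proof (cases "k \<in> C")
  case False
  then show ?thesis using q_outside w cell_mass_density_0[OF is_dens_avg[OF w]] by (simp add: weights_def)
next
  case k: True
  note [measurable] = is_densD(1)[OF is_dens_avg[OF w]]
  have "emeasure (density Q (avg Q c w)) (c -` {k} \<inter> space Q)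
      = (\<integral>\<^sup>+ x. ennreal (avg Q c w x) * indicator (c -` {k} \<inter> space Q) x \<partial>Q)"
    by (subst emeasure_density) auto
  also have "\<dots> = (\<integral>\<^sup>+ x. ennreal (avg Q c w x) * ennreal ((\<lambda>l. if l = k then 1 else 0) (c x)) \<partial>Q)"
    by (intro nn_integral_cong) (auto simp: indicator_def)
  also have "\<dots> = ennreal (\<Sum>l\<in>C. (if l = k then 1 else 0) * w l)" by (rule nn_integral_avg[OF w]) auto
  also have "(\<Sum>l\<in>C. (if l = k then 1 else 0) * w l) = (\<Sum>l\<in>C. if l = k then w l else 0)"
    by (rule sum.cong) auto
  also have "\<dots> = w k" using k C_finite by simp
  finally show ?thesis using w by (simp add: measure_def weights_def)
qed

lemma ent_avg:
  assumes w: "weights w"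
  shows "ent Q (avg Q c w) = ennreal (\<Sum>k\<in>C. phi (w k / q k) * q k)"
  unfolding ent_def avg_eq
  using w by (intro nn_integral_finite_code[OF prob_space_axioms c_meas C_finite C_range])
    (auto simp: weights_def intro!: phi_nonneg)

lemma ent_avg_ln:
  assumes w: "weights w"
  shows "(\<Sum>k\<in>C. phi (w k / q k) * q k) = (\<Sum>k\<in>C. w k * ln (w k / q k))"
proof -
  have "(\<Sum>k\<in>C. phi (w k / q k) * q k) = (\<Sum>k\<in>C. w k * ln (w k / q k) - w k + q k)"
    using w by (intro sum.cong) (auto simp: phi_def weights_def algebra_simps)
  also have "\<dots> = (\<Sum>k\<in>C. w k * ln (w k / q k))"
    using w q_sum by (simp add: sum.distrib sum_subtractf weights_def)
  finally show ?thesis .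
qed

text \<open>The Bochner integral admits signed \<open>F\<close>; this is needed for logarithms of
  cell averages.\<close>

lemma integral_code_density:
  fixes F :: "nat \<Rightarrow> real"
  assumes f: "is_dens Q f"
  shows "integrable Q (\<lambda>x. f x * F (c x))"
    "(\<integral>x. f x * F (c x) \<partial>Q) = (\<Sum>k\<in>C. F k * cell_mass (density Q f) c k)"
proof -
  note [measurable] = is_densD(1)[OF f]
  have ind: "integrable Q (\<lambda>x. f x * (F k * indicator (c -` {k} \<inter> space Q) x)) \<and>
      (\<integral>x. f x * (F k * indicator (c -` {k} \<inter> space Q) x) \<partial>Q) = F k * cell_mass (density Q f) c k" for k
  proof -
    have A [measurable]: "c -` {k} \<inter> space Q \<in> sets Q" by measurable
    have i: "integrable Q (\<lambda>x. f x * indicator (c -` {k} \<inter> space Q) x)"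
      using is_dens_integral(1)[OF f] by (intro integrable_mult_indicator[of _ _ f, unfolded real_scaleR_def, simplified mult.commute]) auto
    have "ennreal (\<integral>x. f x * indicator (c -` {k} \<inter> space Q) x \<partial>Q)
        = (\<integral>\<^sup>+ x. ennreal (f x * indicator (c -` {k} \<inter> space Q) x) \<partial>Q)"
      using i is_densD(2)[OF f] by (intro nn_integral_eq_integral[symmetric]) auto
    also have "\<dots> = emeasure (density Q f) (c -` {k} \<inter> space Q)"
      by (subst emeasure_density) (auto intro!: nn_integral_cong simp: indicator_def)
    also have "\<dots> = ennreal (cell_mass (density Q f) c k)"
      using prob_space_density[OF f]
      by (simp add: finite_measure.emeasure_eq_measure prob_space.finite_measure)
    finally have eq: "(\<integral>x. f x * indicator (c -` {k} \<inter> space Q) x \<partial>Q) = cell_mass (density Q f) c k"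
      using is_densD(2)[OF f] by (subst (asm) ennreal_inj) auto
    have r: "(\<lambda>x. f x * (F k * indicator (c -` {k} \<inter> space Q) x)) = (\<lambda>x. F k * (f x * indicator (c -` {k} \<inter> space Q) x))"
      by (simp add: ac_simps)
    show ?thesis unfolding r using i eq by simp
  qed
  have eq: "f x * F (c x) = (\<Sum>k\<in>C. f x * (F k * indicator (c -` {k} \<inter> space Q) x))" if "x \<in> space Q" for x
  proof -
    have "(\<Sum>k\<in>C. f x * (F k * indicator (c -` {k} \<inter> space Q) x)) = (\<Sum>k\<in>C. if k = c x then f x * F k else 0)"
      using that by (intro sum.cong) (auto simp: indicator_def)
    then show ?thesis using C_finite C_range that by (auto simp: sum.delta)
  qed
  have "integrable Q (\<lambda>x. \<Sum>k\<in>C. f x * (F k * indicator (c -` {k} \<inter> space Q) x))"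
    using ind by (intro Bochner_Integration.integrable_sum) auto
  then show "integrable Q (\<lambda>x. f x * F (c x))"
    by (rule Bochner_Integration.integrable_cong[THEN iffD2, OF refl eq, rotated])
  have "(\<integral>x. f x * F (c x) \<partial>Q) = (\<integral>x. (\<Sum>k\<in>C. f x * (F k * indicator (c -` {k} \<inter> space Q) x)) \<partial>Q)"
    using eq by (intro Bochner_Integration.integral_cong) auto
  also have "\<dots> = (\<Sum>k\<in>C. F k * cell_mass (density Q f) c k)"
    using ind by (subst Bochner_Integration.integral_sum) auto
  finally show "(\<integral>x. f x * F (c x) \<partial>Q) = (\<Sum>k\<in>C. F k * cell_mass (density Q f) c k)" .
qed

section \<open>Bregman comparison of a density with its cell averages\<close>

context
  fixes f g :: "'a \<Rightarrow> real"
  assumes f: "is_dens Q f" and fin: "ent Q f \<noteq> \<infinity>"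
    and g_def: "g = avg Q c (cell_mass (density Q f) c)"
begin

lemma g_dens: "is_dens Q g"
  unfolding g_def by (rule is_dens_avg[OF weights_density[OF f]])

text \<open>\<open>phi_bregman\<close> requires \<open>0 < g\<close>; on the cells excluded by this,
  both functions vanish almost everywhere.\<close>

lemma g_zero_AE: "AE x in Q. g x = 0 \<longrightarrow> f x = 0"
proof -
  note [measurable] = is_densD(1)[OF f]
  let ?w = "cell_mass (density Q f) c"
  have "AE x in Q. \<forall>k. (c x = k \<and> ?w k = 0) \<longrightarrow> f x = 0"
  proof (intro AE_all_countable[THEN iffD2] allI)
    fix k
    have [measurable]: "c -` {k} \<inter> space Q \<in> sets Q" by measurable
    show "AE x in Q. (c x = k \<and> ?w k = 0) \<longrightarrow> f x = 0"
    proof (cases "?w k = 0")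
      case True
      then have "emeasure (density Q f) (c -` {k} \<inter> space Q) = 0"
        using prob_space_density[OF f]
        by (simp add: finite_measure.emeasure_eq_measure prob_space.finite_measure)
      then have "(\<integral>\<^sup>+ x. ennreal (f x) * indicator (c -` {k} \<inter> space Q) x \<partial>Q) = 0"
        by (subst (asm) emeasure_density) auto
      then have "AE x in Q. ennreal (f x) * indicator (c -` {k} \<inter> space Q) x = 0"
        by (subst (asm) nn_integral_0_iff_AE) auto
      then show ?thesis
        using AE_space
      proof eventually_elim
        case (elim x)
        then show ?case using is_densD(2)[OF f, of x] by (auto simp: indicator_def ennreal_eq_0_iff)
      qed
    qed simp
  qed
  moreover have "AE x in Q. \<forall>k. q k = 0 \<longrightarrow> c x \<noteq> k"
  proof (intro AE_all_countable[THEN iffD2] allI)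
    fix k
    show "AE x in Q. q k = 0 \<longrightarrow> c x \<noteq> k"
    proof (cases "q k = 0")
      case True
      have "c -` {k} \<inter> space Q \<in> null_sets Q"
        using True by (auto simp: null_sets_def emeasure_eq_measure)
      from AE_not_in[OF this] show ?thesis using AE_space by eventually_elim auto
    qed simp
  qed
  ultimately show ?thesis
    by eventually_elim (auto simp: g_def avg_eq)
qed

lemma phi_f_integrable: "integrable Q (\<lambda>x. phi (f x))" "(\<integral>x. phi (f x) \<partial>Q) = enn2real (ent Q f)"
proof -
  note [measurable] = is_densD(1)[OF f]
  show "integrable Q (\<lambda>x. phi (f x))"
    using fin phi_nonneg is_densD(2)[OF f]
    by (intro integrableI_nonneg) (auto simp: ent_def less_top)
  show "(\<integral>x. phi (f x) \<partial>Q) = enn2real (ent Q f)"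
    unfolding ent_def using phi_nonneg is_densD(2)[OF f] by (intro integral_eq_nn_integral) auto
qed

lemma phi_g_integrable: "integrable Q (\<lambda>x. phi (g x))" "(\<integral>x. phi (g x) \<partial>Q) = enn2real (ent Q g)"
  "ent Q g \<noteq> \<infinity>"
proof -
  note [measurable] = is_densD(1)[OF g_dens]
  show 1: "ent Q g \<noteq> \<infinity>" unfolding g_def ent_avg[OF weights_density[OF f]] by simp
  show "integrable Q (\<lambda>x. phi (g x))"
    using 1 phi_nonneg is_densD(2)[OF g_dens]
    by (intro integrableI_nonneg) (auto simp: ent_def less_top)
  show "(\<integral>x. phi (g x) \<partial>Q) = enn2real (ent Q g)"
    unfolding ent_def using phi_nonneg is_densD(2)[OF g_dens] by (intro integral_eq_nn_integral) auto
qed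

text \<open>\<open>ln (g x)\<close> depends only on the cell of \<open>x\<close>, and
  \<open>f\<close> and \<open>g\<close> have equal cell masses. So the integrated Bregman divergence
  is just the entropy difference.\<close>

lemma integral_ln_avg:
  "integrable Q (\<lambda>x. ln (g x) * (f x - g x))" "(\<integral>x. ln (g x) * (f x - g x) \<partial>Q) = 0"
proof -
  let ?w = "cell_mass (density Q f) c"
  let ?F = "\<lambda>k. ln (?w k / q k)"
  have eq: "(\<lambda>x. ln (g x) * (f x - g x)) = (\<lambda>x. f x * ?F (c x) - g x * ?F (c x))"
    by (auto simp: g_def avg_eq algebra_simps)
  note i = integral_code_density[OF f, of ?F] integral_code_density[OF g_dens, of ?F]
  show "integrable Q (\<lambda>x. ln (g x) * (f x - g x))" unfolding eq using i by auto
  have "(\<Sum>k\<in>C. ?F k * cell_mass (density Q g) c k) = (\<Sum>k\<in>C. ?F k * ?w k)"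
    unfolding g_def by (intro sum.cong refl arg_cong2[where f = "(*)"] cell_mass_avg weights_density f)
  then show "(\<integral>x. ln (g x) * (f x - g x) \<partial>Q) = 0"
    unfolding eq using i by (subst Bochner_Integration.integral_diff) auto
qed

lemma avg_pointwise:
  assumes s: "0 < s"
  shows "AE x in Q. \<bar>f x - g x\<bar> \<le> s / 2 * (phi (f x) - phi (g x) - ln (g x) * (f x - g x)) + (f x + g x) / s"
  using g_zero_AE
proof eventually_elim
  case (elim x)
  show ?case
  proof (cases "g x = 0")
    case True
    then show ?thesis using elim by simp
  next
    case False
    then have "0 < g x" using is_densD(2)[OF g_dens, of x] by simp
    then show ?thesis using phi_bregman_abs[OF is_densD(2)[OF f] _ s] by blast
  qed
qed

text \<open>A Pinsker-type inequality for the entropy lost by averaging, with \<open>s\<close> still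
  free; \<open>2 / s\<close> is the integral of \<open>(f + g) / s\<close>.\<close>

lemma L1_avg_le:
  assumes s: "0 < s"
  shows "(\<integral>x. \<bar>f x - g x\<bar> \<partial>Q) \<le> s / 2 * (enn2real (ent Q f) - enn2real (ent Q g)) + 2 / s"
proof -
  note I = phi_f_integrable phi_g_integrable integral_ln_avg is_dens_integral[OF f] is_dens_integral[OF g_dens]
  have "(\<integral>x. \<bar>f x - g x\<bar> \<partial>Q)
      \<le> (\<integral>x. s / 2 * (phi (f x) - phi (g x) - ln (g x) * (f x - g x)) + (f x + g x) / s \<partial>Q)"
    using I by (intro integral_mono_AE avg_pointwise s) (auto simp: mult.assoc)
  also have "\<dots> = s / 2 * (enn2real (ent Q f) - enn2real (ent Q g)) + 2 / s"
    using I by simp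
  finally show ?thesis .
qed

text \<open>Jensen's inequality for the conditional expectation \<open>g\<close>, read off from the
  nonnegativity of the Bregman divergence.\<close>

lemma ent_avg_le: "ent Q g \<le> ent Q f"
proof -
  have *: "0 \<le> enn2real (ent Q f) - enn2real (ent Q g)"
  proof -
    note I = phi_f_integrable phi_g_integrable integral_ln_avg
    have "0 \<le> (\<integral>x. phi (f x) - phi (g x) - ln (g x) * (f x - g x) \<partial>Q)"
    proof (rule integral_nonneg_AE)
      show "AE x in Q. 0 \<le> phi (f x) - phi (g x) - ln (g x) * (f x - g x)"
        using g_zero_AE
      proof eventually_elim
        case (elim x)
        show ?case
        proof (cases "g x = 0")
          case False
          then have "0 < g x" using is_densD(2)[OF g_dens, of x] by simp
          then show ?thesis
            using phi_bregman[OF is_densD(2)[OF f], of "g x" x] zero_le_power2[of "sqrt (f x) - sqrt (g x)"]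
            by linarith
        qed (use elim in simp)
      qed
    qed
    then show ?thesis using I by simp
  qed
  have "ent Q g = ennreal (enn2real (ent Q g))" using phi_g_integrable(3) by (simp add: less_top)
  also have "\<dots> \<le> ennreal (enn2real (ent Q f))" using * by (intro ennreal_leI) simp
  also have "\<dots> = ent Q f" using fin by (simp add: less_top)
  finally show ?thesis .
qed

end

end

section \<open>Refining finite codes of a separable metric space\<close>

context separable_metric
begin

text \<open>Index of a nearest point among \<open>e 0\<close>, ..., \<open>e n\<close>, the smallest
  one in case of a tie.\<close>

primrec idx :: "nat \<Rightarrow> 'a \<Rightarrow> nat" where
  "idx 0 x = 0"
| "idx (Suc n) x = (if mdist m x (e (Suc n)) < mdist m x (e (idx n x)) then Suc n else idx n x)"

text \<open>Nearest-point cells for different \<open>n\<close> are in general not nested. Recording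
  the indices of all stages makes them so, which the consistency of cell masses across levels
  requires.\<close>

primrec code :: "nat \<Rightarrow> 'a \<Rightarrow> nat" where
  "code 0 x = 0"
| "code (Suc n) x = prod_encode (code n x, idx (Suc n) x)"

text \<open>At level 0 the code is not a pair; its single cell is represented by \<open>e 0\<close>,
  in agreement with \<open>idx 0 x = 0\<close>.\<close>

definition rep :: "nat \<Rightarrow> nat \<Rightarrow> 'a" where
  "rep n k = e (case n of 0 \<Rightarrow> 0 | Suc _ \<Rightarrow> snd (prod_decode k))"

definition coarsen :: "nat \<Rightarrow> nat \<Rightarrow> nat" where
  "coarsen i = (fst \<circ> prod_decode) ^^ i"

abbreviation "codes n \<equiv> code n ` mspace m"

lemma rep_code: "rep n (code n x) = e (idx n x)"
  by (cases n) (simp_all add: rep_def)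

lemma rep_in [simp]: "rep n k \<in> mspace m"
  by (simp add: rep_def)

lemma coarsen_code: "coarsen i (code (n + i) x) = code n x"
  by (induction i) (simp_all add: coarsen_def funpow_Suc_right del: funpow.simps(2))

lemma idx_le: "idx n x \<le> n"
  by (induction n) (auto intro: le_SucI)

lemma finite_codes: "finite (codes n)"
proof (induction n)
  case (Suc n)
  have "codes (Suc n) \<subseteq> prod_encode ` (codes n \<times> {..Suc n})"
    using idx_le[of "Suc n"] by auto
  then show ?case using Suc by (auto dest: finite_subset)
qed (auto simp: image_constant_conv)

lemma idx_minimal: "k \<le> n \<Longrightarrow> mdist m x (e (idx n x)) \<le> mdist m x (e k)"
  by (induction n) (force simp: le_Suc_eq)+

lemma idx_tendsto:
  assumes "x \<in> mspace m"
  shows "(\<lambda>n. mdist m x (e (idx n x))) \<longlonglongrightarrow> 0"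
proof (rule LIMSEQ_I)
  fix r :: real assume "0 < r"
  then obtain k where "mdist m x (e k) < r" using e_dense[OF assms] by blast
  then show "\<exists>no. \<forall>n\<ge>no. norm (mdist m x (e (idx n x)) - 0) < r"
    using idx_minimal[of k] by (intro exI[of _ k]) (auto intro: le_less_trans)
qed

lemma idx_measurable [measurable]: "idx n \<in> mborel m \<rightarrow>\<^sub>M count_space UNIV"
proof (induction n)
  case (Suc n)
  note [measurable] = Suc
  have [measurable]: "(\<lambda>x. e (idx n x)) \<in> mborel m \<rightarrow>\<^sub>M mborel m"
    by (rule measurable_compose[OF Suc]) auto
  have [measurable]: "(\<lambda>x. e (Suc n)) \<in> mborel m \<rightarrow>\<^sub>M mborel m" by simp
  show ?case by simp measurable
qed simp

lemma code_measurable [measurable]: "code n \<in> mborel m \<rightarrow>\<^sub>M count_space UNIV"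
proof (induction n)
  case (Suc n)
  have "(\<lambda>x. (code n x, idx (Suc n) x)) \<in> mborel m \<rightarrow>\<^sub>M count_space UNIV \<Otimes>\<^sub>M count_space UNIV"
    using Suc idx_measurable[of "Suc n"] by measurable
  then have "(\<lambda>x. (code n x, idx (Suc n) x)) \<in> mborel m \<rightarrow>\<^sub>M count_space UNIV"
    by (simp add: pair_measure_countable)
  then show ?case
    by (simp only: code.simps) (rule measurable_compose, assumption, simp)
qed simp

lemma rep_code_measurable [measurable]: "(\<lambda>x. rep n (code n x)) \<in> mborel m \<rightarrow>\<^sub>M mborel m"
  by (rule measurable_compose[OF code_measurable]) auto

lemma dist_rep_measurable [measurable]: "(\<lambda>x. mdist m x (rep n (code n x))) \<in> borel_measurable (mborel m)"
  by (rule dist_measurable_comp) simp_all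

end

lemma diagonal_convergent:
  fixes X :: "nat \<Rightarrow> nat \<Rightarrow> real"
  assumes X: "\<And>i j. 0 \<le> X i j" "\<And>i j. X i j \<le> 1"
  obtains r where "strict_mono r" "\<And>i. convergent (\<lambda>j. X i (r j))"
proof -
  interpret subseqs "\<lambda>i s. convergent (\<lambda>j. X i (s j))"
  proof
    fix i and s :: "nat \<Rightarrow> nat"
    have "seq_compact {0..1::real}" by (simp add: compact_imp_seq_compact)
    then obtain l r where "l \<in> {0..1}" "strict_mono r" "((\<lambda>j. X i (s j)) \<circ> r) \<longlonglongrightarrow> l"
      by (rule seq_compactE[of _ "\<lambda>j. X i (s j)"]) (use X in auto)
    then show "\<exists>r. strict_mono r \<and> convergent (\<lambda>j. X i ((s \<circ> r) j))"
      by (auto simp: comp_def convergent_def)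
  qed
  have "convergent (\<lambda>j. X i (diagseq j))" for i
  proof -
    have "convergent (\<lambda>j. X i ((diagseq \<circ> (+) (Suc i)) j))"
    proof (rule diagseq_holds)
      fix r s n assume r: "strict_mono (r :: nat \<Rightarrow> nat)" and c: "convergent (\<lambda>j. X n (s j))"
      show "convergent (\<lambda>j. X n ((s \<circ> r) j))"
        using convergent_subseq_convergent[OF c r] by (simp add: comp_def)
    qed
    then have "convergent (\<lambda>j. X i (diagseq (j + Suc i)))" by (simp add: comp_def ac_simps)
    then show ?thesis by (subst (asm) convergent_ignore_initial_segment)
  qed
  then show ?thesis using that subseq_diagseq by blast
qed

section \<open>Quantization errors under exponential moments\<close>

locale exp_moment_space = separable_metric m e + prob_space Q
  for m :: "'a metric" and e :: "nat \<Rightarrow> 'a" and Q :: "'a measure" +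
  fixes p :: real
  assumes p: "1 \<le> p" and Q_sets [measurable_cong]: "sets Q = sets (mborel m)"
    and exp_moment: "0 < \<theta> \<Longrightarrow> (\<integral>\<^sup>+ x. ennreal (exp (\<theta> * mdist m x (e 0) powr p)) \<partial>Q) < \<infinity>"
begin

lemma Q_space: "space Q = mspace m"
  using sets_eq_imp_space_eq[OF Q_sets] by simp

lemma finite_code_code: "finite_code Q (code n) (codes n)"
  by unfold_locales (auto simp: finite_codes Q_space)

text \<open>Subtracting 1 gives the conjugate function of \<open>phi\<close>, as
  \<open>Lp_le_density_ent\<close> demands, and makes the quantity tend to 0 as the cells get
  finer.\<close>

definition kappa :: "real \<Rightarrow> nat \<Rightarrow> ennreal" where
  "kappa \<theta> n = (\<integral>\<^sup>+ x. ennreal (exp (\<theta> * mdist m x (rep n (code n x)) powr p) - 1) \<partial>Q)"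

lemma kappa_tendsto:
  assumes \<theta>: "0 < \<theta>" shows "kappa \<theta> \<longlonglongrightarrow> 0"
proof -
  have e0 [measurable]: "(\<lambda>x. mdist m x (e 0)) \<in> borel_measurable Q"
    using dist_const_measurable[of "e 0"] by measurable
  have [measurable]: "(\<lambda>x. mdist m x (rep n (code n x))) \<in> borel_measurable Q" for n
    using dist_rep_measurable by measurable
  have "(\<lambda>n. kappa \<theta> n) \<longlonglongrightarrow> (\<integral>\<^sup>+ x. 0 \<partial>Q)"
    unfolding kappa_def
  proof (rule nn_integral_dominated_convergence)
    show "AE x in Q. ennreal (exp (\<theta> * mdist m x (rep n (code n x)) powr p) - 1)
        \<le> ennreal (exp (\<theta> * mdist m x (e 0) powr p))" for n
    proof (rule AE_I2, rule ennreal_leI)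
      fix x
      \<comment> \<open>\<open>e 0\<close> competes in the choice of the nearest point, so its
        distance dominates at every level.\<close>
      have "mdist m x (rep n (code n x)) powr p \<le> mdist m x (e 0) powr p"
        using idx_minimal[of 0 n x] p by (intro powr_mono2) (auto simp: rep_code)
      then have "exp (\<theta> * mdist m x (rep n (code n x)) powr p) \<le> exp (\<theta> * mdist m x (e 0) powr p)"
        using \<theta> by simp
      then show "exp (\<theta> * mdist m x (rep n (code n x)) powr p) - 1 \<le> exp (\<theta> * mdist m x (e 0) powr p)"
        by linarith
    qed
    show "AE x in Q. (\<lambda>n. ennreal (exp (\<theta> * mdist m x (rep n (code n x)) powr p) - 1)) \<longlonglongrightarrow> 0"
    proof (rule AE_I2)
      fix x assume "x \<in> space Q"
      then have "(\<lambda>n. mdist m x (e (idx n x))) \<longlonglongrightarrow> 0" using idx_tendsto by (simp add: Q_space)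
      then have "(\<lambda>n. mdist m x (e (idx n x)) powr p) \<longlonglongrightarrow> 0"
        using p by (intro tendsto_zero_powrI[OF _ tendsto_const]) auto
      then have "(\<lambda>n. exp (\<theta> * mdist m x (e (idx n x)) powr p) - 1) \<longlonglongrightarrow> exp (\<theta> * 0) - 1"
        by (intro tendsto_intros)
      then have "(\<lambda>n. ennreal (exp (\<theta> * mdist m x (e (idx n x)) powr p) - 1)) \<longlonglongrightarrow> ennreal 0"
        by (intro tendsto_ennrealI) simp
      then show "(\<lambda>n. ennreal (exp (\<theta> * mdist m x (rep n (code n x)) powr p) - 1)) \<longlonglongrightarrow> 0"
        by (simp add: rep_code)
    qed
  qed (use exp_moment[OF \<theta>] in auto)
  then show ?thesis by simp
qed

lemma kappa_le_1:
  assumes "0 < \<theta>" obtains n where "kappa \<theta> n \<le> 1"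
proof -
  have "\<forall>\<^sub>F n in sequentially. kappa \<theta> n < 1"
    using order_tendstoD(2)[OF kappa_tendsto[OF assms], of 1] by simp
  then obtain n where "kappa \<theta> n < 1" by (meson eventually_happens' sequentially_bot)
  then show ?thesis using that less_imp_le by blast
qed

text \<open>The level \<open>n\<close> depends on \<open>c\<close> and \<open>a\<close> only through
  \<open>\<theta>\<close>, so one partition serves all densities of entropy at most
  \<open>c\<close>.\<close>

lemma Lp_le_rep:
  assumes f: "is_dens Q f" "ent Q f \<le> ennreal c" "0 \<le> c" and k: "kappa \<theta> n \<le> 1" and \<theta>: "0 < \<theta>"
    and a: "c + 1 \<le> \<theta> * a powr p" "0 \<le> a"
  shows "Lp_le p (density Q f) (\<lambda>x. mdist m x (rep n (code n x))) a"
  using f k \<theta> a dist_rep_measurable[of n]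
  by (intro Lp_le_density_ent[where c = c and k = 1 and \<theta> = \<theta>])
    (auto simp: kappa_def cong: measurable_cong_sets)

lemma density_finite_moment:
  assumes f: "is_dens Q f" and "ent Q f \<noteq> \<infinity>"
  shows "density Q f \<in> finite_moment_measures p m"
proof -
  define c where "c = enn2real (ent Q f)"
  have c: "0 \<le> c" "ent Q f \<le> ennreal c" using assms by (simp_all add: c_def less_top)
  have e0 [measurable]: "(\<lambda>x. mdist m x (e 0)) \<in> borel_measurable Q"
    using dist_const_measurable[of "e 0"] by measurable
  define k where "k = enn2real (\<integral>\<^sup>+ x. ennreal (exp (1 * mdist m x (e 0) powr p)) \<partial>Q)"
  have k: "0 \<le> k" "(\<integral>\<^sup>+ x. ennreal (exp (1 * mdist m x (e 0) powr p)) \<partial>Q) = ennreal k"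
    using exp_moment[of 1] by (simp_all add: k_def)
  have "(\<integral>\<^sup>+ x. ennreal (exp (1 * mdist m x (e 0) powr p) - 1) \<partial>Q) \<le> ennreal k"
    unfolding k(2)[symmetric] by (intro nn_integral_mono ennreal_leI) simp
  then have "Lp_le p (density Q f) (\<lambda>x. mdist m x (e 0)) ((c + k) powr (1 / p))"
    using c k p by (intro Lp_le_density_ent[OF f _ _ _ _ c(2), where \<theta> = 1 and k = k]) (auto simp: powr_powr)
  then show ?thesis
    unfolding finite_moment_iff[OF p e_in[of 0]]
    using prob_space_density[OF f] Q_sets by auto
qed

text \<open>The sum of all distances between representatives is a crude bound for the largest one;
  at a fixed level its finiteness is what matters.\<close>

lemma wasserstein_code_le:
  assumes \<mu>: "prob_space \<mu>" "sets \<mu> = sets (mborel m)" and \<nu>: "prob_space \<nu>" "sets \<nu> = sets (mborel m)"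
    and "Lp_le p \<mu> (\<lambda>x. mdist m x (rep n (code n x))) a" "Lp_le p \<nu> (\<lambda>x. mdist m x (rep n (code n x))) b"
    and D: "D = (\<Sum>k\<in>codes n. \<Sum>l\<in>codes n. mdist m (rep n k) (rep n l))"
  shows "wasserstein p m \<mu> \<nu> \<le> a + b
    + D * (\<Sum>k\<in>codes n. max 0 (cell_mass \<mu> (code n) k - cell_mass \<nu> (code n) k)) powr (1 / p)"
proof -
  have sp: "space \<mu> = mspace m" "space \<nu> = mspace m"
    using sets_eq_imp_space_eq[OF \<mu>(2)] sets_eq_imp_space_eq[OF \<nu>(2)] by simp_all
  have D1: "mdist m (rep n k) (rep n l) \<le> D" if "k \<in> codes n" "l \<in> codes n" for k l
  proof -
    have "mdist m (rep n k) (rep n l) \<le> (\<Sum>l\<in>codes n. mdist m (rep n k) (rep n l))"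
      by (rule member_le_sum[OF that(2)]) (auto simp: finite_codes)
    also have "\<dots> \<le> D" unfolding D
      by (rule member_le_sum[OF that(1)]) (auto simp: finite_codes intro!: sum_nonneg)
    finally show ?thesis .
  qed
  have "0 \<le> D" unfolding D by (intro sum_nonneg) simp
  then show ?thesis unfolding sp
    by (intro wasserstein_quantization[OF p \<mu> \<nu> code_measurable finite_codes subset_refl _ D1]) (use assms in auto)
qed

lemma cell_mass_coarsen:
  assumes f: "is_dens Q f"
  shows "cell_mass (density Q f) (code n) k
    = (\<Sum>l\<in>codes (n + i). (if coarsen i l = k then 1 else 0) * cell_mass (density Q f) (code (n + i)) l)"
proof -
  interpret C: finite_code Q "code (n + i)" "codes (n + i)" by (rule finite_code_code)
  interpret Cn: finite_code Q "code n" "codes n" by (rule finite_code_code)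
  note [measurable] = is_densD(1)[OF f]
  have A [measurable]: "code n -` {k} \<inter> space Q \<in> sets Q" by measurable
  have "emeasure (density Q f) (code n -` {k} \<inter> space Q)
      = (\<integral>\<^sup>+ x. ennreal (f x) * indicator (code n -` {k} \<inter> space Q) x \<partial>Q)"
    by (subst emeasure_density) auto
  also have "\<dots> = (\<integral>\<^sup>+ x. ennreal (f x) * ennreal ((\<lambda>l. if coarsen i l = k then 1 else 0) (code (n + i) x)) \<partial>Q)"
    by (intro nn_integral_cong) (auto simp: coarsen_code)
  also have "\<dots> = ennreal (\<Sum>l\<in>codes (n + i). (if coarsen i l = k then 1 else 0) * cell_mass (density Q f) (code (n + i)) l)"
    by (rule C.nn_integral_code_density[OF f]) auto
  finally show ?thesis
    by (simp add: measure_def sum_nonneg)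
qed

section \<open>Compactness of the entropy sublevel sets\<close>

lemma cell_mass_integral:
  assumes f: "is_dens Q f"
  shows "cell_mass (density Q f) (code n) k = (\<integral>x. f x * (if code n x = k then 1 else 0) \<partial>Q)"
proof -
  interpret C: finite_code Q "code n" "codes n" by (rule finite_code_code)
  have "(\<integral>x. f x * (if code n x = k then 1 else 0) \<partial>Q)
      = (\<Sum>l\<in>codes n. (if l = k then 1 else 0) * cell_mass (density Q f) (code n) l)"
    by (rule C.integral_code_density(2)[OF f, of "\<lambda>l. if l = k then 1 else 0"])
  also have "\<dots> = (\<Sum>l\<in>codes n. if l = k then cell_mass (density Q f) (code n) l else 0)"
    by (rule sum.cong) auto
  also have "\<dots> = (if k \<in> codes n then cell_mass (density Q f) (code n) k else 0)"
    using finite_codes by simp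
  also have "\<dots> = cell_mass (density Q f) (code n) k"
    using C.cell_mass_density_0[OF f C.q_outside] by auto
  finally show ?thesis ..
qed

text \<open>The cellwise averages of a consistent family of weights form a martingale; bounded entropy
  makes it \<open>L\<^sup>1\<close>-Cauchy through the Hellinger part of the Bregman divergence.\<close>
lemma consistent_weights_density:
  assumes w: "\<And>n. finite_code.weights Q (code n) (codes n) (w n)"
    and cons: "\<And>n i k. w n k = (\<Sum>l\<in>codes (n + i). (if coarsen i l = k then 1 else 0) * w (n + i) l)"
    and bound: "\<And>n. ent Q (avg Q (code n) (w n)) \<le> ennreal c" and c: "0 \<le> c"
  obtains G where "is_dens Q G" "ent Q G \<le> ennreal c"
    "\<And>n k. cell_mass (density Q G) (code n) k = w n k"
proof -
  define g where "g n = avg Q (code n) (w n)" for n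
  have g: "is_dens Q (g n)" for n
    unfolding g_def by (rule finite_code.is_dens_avg[OF finite_code_code w])
  note [measurable] = is_densD(1)[OF g]
  have g_mass': "cell_mass (density Q (g n)) (code n) k = w n k" for n k
    unfolding g_def by (rule finite_code.cell_mass_avg[OF finite_code_code w])
  have g_mass: "cell_mass (density Q (g (n + i))) (code n) k = w n k" for n i k
    unfolding cell_mass_coarsen[OF g, of _ n k i] g_mass' cons[of n k i] ..
  \<comment> \<open>The martingale property: averaging a finer density over the coarser cells
    returns the coarser one.\<close>
  have g_avg: "g n = avg Q (code n) (cell_mass (density Q (g (n + i))) (code n))" for n i
    unfolding g_mass by (simp add: g_def)
  have fin: "ent Q (g n) \<noteq> \<infinity>" for n using bound[of n] by (auto simp: g_def top_unique)
  define E where "E n = enn2real (ent Q (g n))" for n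
  have E_mono: "E n \<le> E (n + i)" for n i
    unfolding E_def using finite_code.ent_avg_le[OF finite_code_code g fin g_avg[of n i]] fin
    by (intro enn2real_mono) (auto simp: less_top)
  have E_bound: "E n \<le> c" for n
    unfolding E_def using bound[of n] c by (intro enn2real_leI) (auto simp: g_def)
  have "incseq E" using E_mono[of _ 1] by (intro incseq_SucI) simp
  then obtain L where "E \<longlonglongrightarrow> L" using incseq_convergent[of E c] E_bound by blast
  then have E_Cauchy: "Cauchy E" by (rule LIMSEQ_imp_Cauchy)
  have L1: "\<exists>N. \<forall>i\<ge>N. \<forall>j\<ge>N. (LINT x|Q. norm (g i x - g j x)) < \<epsilon>" if \<epsilon>: "0 < \<epsilon>" for \<epsilon>
  proof -
    \<comment> \<open>With \<open>s = 8 / \<epsilon>\<close> in \<open>L1_avg_le\<close>, an entropy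
      gap of \<open>\<epsilon>\<^sup>2 / 16\<close> contributes \<open>\<epsilon> / 4\<close> and
      the term \<open>2 / s\<close> another \<open>\<epsilon> / 4\<close>.\<close>
    obtain N where N: "\<And>i j. i \<ge> N \<Longrightarrow> j \<ge> N \<Longrightarrow> norm (E i - E j) < \<epsilon>\<^sup>2 / 16"
      using CauchyD[OF E_Cauchy, of "\<epsilon>\<^sup>2 / 16"] \<epsilon> by auto
    have *: "(LINT x|Q. norm (g j x - g i x)) < \<epsilon>" if "N \<le> i" "i \<le> j" for i j
    proof -
      have "(\<integral>x. \<bar>g j x - g i x\<bar> \<partial>Q) \<le> (8 / \<epsilon>) / 2 * (E j - E i) + 2 / (8 / \<epsilon>)"
        unfolding E_def
        using finite_code.L1_avg_le[OF finite_code_code g fin g_avg[of i "j - i"], of "8 / \<epsilon>"] \<epsilon> that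
        by simp
      also have "(8 / \<epsilon>) / 2 * (E j - E i) \<le> (8 / \<epsilon>) / 2 * (\<epsilon>\<^sup>2 / 16)"
      proof (rule mult_left_mono)
        show "E j - E i \<le> \<epsilon>\<^sup>2 / 16"
          using N[of j i] that abs_ge_self[of "E j - E i"] unfolding real_norm_def by linarith
      qed (use \<epsilon> in simp)
      also have "(8 / \<epsilon>) / 2 * (\<epsilon>\<^sup>2 / 16) + 2 / (8 / \<epsilon>) = \<epsilon> / 2"
        using \<epsilon> by (simp add: field_simps power2_eq_square)
      finally show ?thesis using \<epsilon> by simp
    qed
    have "(LINT x|Q. norm (g i x - g j x)) < \<epsilon>" if "N \<le> i" "N \<le> j" for i j
      using *[of i j] *[of j i] that by (cases "i \<le> j") (auto simp: abs_minus_commute)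
    then show ?thesis by blast
  qed
  obtain r where r: "strict_mono r" "AE x in Q. Cauchy (\<lambda>i. g (r i) x)"
    using cauchy_L1_AE_cauchy_subseq[OF is_dens_integral(1)[OF g] L1] by blast
  \<comment> \<open>The maximum keeps \<open>G\<close> nonnegative also where the subsequence does
    not converge.\<close>
  define G where "G x = max 0 (lim (\<lambda>i. g (r i) x))" for x
  have G_nonneg: "0 \<le> G x" for x by (simp add: G_def)
  have G_meas [measurable]: "G \<in> borel_measurable Q"
    unfolding G_def using borel_measurable_lim_metric[of "\<lambda>i. g (r i)" Q] by measurable
  have conv: "AE x in Q. (\<lambda>i. g (r i) x) \<longlonglongrightarrow> G x"
    using r(2)
  proof eventually_elim
    case (elim x)
    then have l: "(\<lambda>i. g (r i) x) \<longlonglongrightarrow> lim (\<lambda>i. g (r i) x)"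
      by (simp add: Cauchy_convergent_iff convergent_LIMSEQ_iff)
    then have "0 \<le> lim (\<lambda>i. g (r i) x)" using is_densD(2)[OF g] by (intro LIMSEQ_le_const) auto
    then show ?case using l by (simp add: G_def)
  qed
  have "(\<integral>\<^sup>+ x. ennreal (G x) \<partial>Q) = (\<integral>\<^sup>+ x. liminf (\<lambda>i. ennreal (g (r i) x)) \<partial>Q)"
    by (rule nn_integral_cong_AE)
      (use conv in eventually_elim, auto intro!: lim_imp_Liminf[symmetric] tendsto_ennrealI)
  also have "\<dots> \<le> liminf (\<lambda>i. \<integral>\<^sup>+ x. ennreal (g (r i) x) \<partial>Q)" by (rule nn_integral_liminf) measurable
  also have "\<dots> = 1" using is_densD(3)[OF g] by (simp add: Liminf_const)
  finally have "(\<integral>\<^sup>+ x. ennreal (G x) \<partial>Q) < \<infinity>" by (auto simp: le_less_trans)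
  then have G_int: "integrable Q G" by (intro integrableI_nonneg) (auto simp: G_def)
  have "ent Q G = (\<integral>\<^sup>+ x. liminf (\<lambda>i. ennreal (phi (g (r i) x))) \<partial>Q)"
    unfolding ent_def
    by (rule nn_integral_cong_AE)
      (use conv in eventually_elim, auto intro!: lim_imp_Liminf[symmetric] tendsto_ennrealI phi_tendsto is_densD(2)[OF g])
  also have "\<dots> \<le> liminf (\<lambda>i. ent Q (g (r i)))" unfolding ent_def by (rule nn_integral_liminf) measurable
  also have "\<dots> \<le> liminf (\<lambda>i. ennreal c)" using bound by (intro Liminf_mono) (auto simp: g_def)
  also have "\<dots> = ennreal c" by (simp add: Liminf_const)
  finally have G_ent: "ent Q G \<le> ennreal c" .
  have G_close: "\<exists>N. \<forall>n\<ge>N. (\<integral>x. \<bar>G x - g n x\<bar> \<partial>Q) \<le> \<epsilon>" if \<epsilon>: "0 < \<epsilon>" for \<epsilon>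
  proof -
    obtain N where N: "\<And>i j. i \<ge> N \<Longrightarrow> j \<ge> N \<Longrightarrow> (LINT x|Q. norm (g i x - g j x)) < \<epsilon>" using L1[OF \<epsilon>] by blast
    have "(\<integral>x. \<bar>G x - g n x\<bar> \<partial>Q) \<le> \<epsilon>" if n: "N \<le> n" for n
    proof -
      have "(\<integral>\<^sup>+ x. ennreal \<bar>G x - g n x\<bar> \<partial>Q) = (\<integral>\<^sup>+ x. liminf (\<lambda>i. ennreal \<bar>g (r i) x - g n x\<bar>) \<partial>Q)"
        by (rule nn_integral_cong_AE)
          (use conv in eventually_elim, auto intro!: lim_imp_Liminf[symmetric] tendsto_ennrealI tendsto_rabs tendsto_diff)
      also have "\<dots> \<le> liminf (\<lambda>i. \<integral>\<^sup>+ x. ennreal \<bar>g (r i) x - g n x\<bar> \<partial>Q)" by (rule nn_integral_liminf) measurable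
      also have "\<dots> \<le> liminf (\<lambda>i. ennreal \<epsilon>)"
      proof (rule Liminf_mono, rule eventually_sequentiallyI)
        fix i assume "N \<le> i"
        then have "N \<le> r i" using seq_suble[OF r(1)] order_trans by blast
        have "(\<integral>\<^sup>+ x. ennreal \<bar>g (r i) x - g n x\<bar> \<partial>Q) = ennreal (\<integral>x. \<bar>g (r i) x - g n x\<bar> \<partial>Q)"
          using is_dens_integral(1)[OF g] by (intro nn_integral_eq_integral) auto
        also have "\<dots> \<le> ennreal \<epsilon>" using N[OF \<open>N \<le> r i\<close> n] by (intro ennreal_leI) auto
        finally show "(\<integral>\<^sup>+ x. ennreal \<bar>g (r i) x - g n x\<bar> \<partial>Q) \<le> ennreal \<epsilon>" .
      qed
      also have "\<dots> = ennreal \<epsilon>" by (simp add: Liminf_const)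
      finally have "ennreal (\<integral>x. \<bar>G x - g n x\<bar> \<partial>Q) \<le> ennreal \<epsilon>"
        using G_int is_dens_integral(1)[OF g] by (subst (asm) nn_integral_eq_integral) auto
      then show ?thesis using \<epsilon> by (simp add: ennreal_le_iff)
    qed
    then show ?thesis by blast
  qed
  \<comment> \<open>Integrals against functions with values in \<open>[0, 1]\<close> that are
    constant from some level on survive the \<open>L\<^sup>1\<close> limit. The constant 1 gives the
    total mass, cell indicators give the cell masses.\<close>
  have G_test: "(\<integral>x. G x * F x \<partial>Q) = v"
    if F [measurable]: "F \<in> borel_measurable Q" and F01: "\<And>x. 0 \<le> F x \<and> F x \<le> 1"
      and v: "\<And>n. n \<ge> n0 \<Longrightarrow> (\<integral>x. g n x * F x \<partial>Q) = v" for F and v :: real and n0 :: nat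
  proof -
    have iF: "integrable Q (\<lambda>x. f x * F x)" if "integrable Q f" for f
      by (rule Bochner_Integration.integrable_bound[OF that])
        (use F01 borel_measurable_integrable[OF that] in \<open>auto simp: abs_mult intro!: mult_left_le\<close>)
    have "\<bar>(\<integral>x. G x * F x \<partial>Q) - v\<bar> \<le> \<epsilon>" if \<epsilon>: "0 < \<epsilon>" for \<epsilon>
    proof -
      obtain N where N: "\<And>n. n \<ge> N \<Longrightarrow> (\<integral>x. \<bar>G x - g n x\<bar> \<partial>Q) \<le> \<epsilon>" using G_close[OF \<epsilon>] by blast
      define n where "n = max N n0"
      have gi: "integrable Q (g n)" by (rule is_dens_integral[OF g])
      have "\<bar>(\<integral>x. G x * F x \<partial>Q) - v\<bar> = \<bar>\<integral>x. (G x - g n x) * F x \<partial>Q\<bar>"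
        using v[of n] iF[OF G_int] iF[OF gi] by (simp add: n_def left_diff_distrib)
      also have "\<dots> \<le> (\<integral>x. \<bar>(G x - g n x) * F x\<bar> \<partial>Q)" by (rule integral_abs_bound)
      also have "\<dots> \<le> (\<integral>x. \<bar>G x - g n x\<bar> \<partial>Q)"
      proof (rule integral_mono)
        show "integrable Q (\<lambda>x. \<bar>(G x - g n x) * F x\<bar>)"
          using iF[of "\<lambda>x. G x - g n x"] G_int gi by (intro Bochner_Integration.integrable_abs) auto
      qed (use G_int gi F01 in \<open>auto simp: abs_mult intro!: mult_left_le\<close>)
      also have "\<dots> \<le> \<epsilon>" by (rule N) (simp add: n_def)
      finally show ?thesis .
    qed
    then have "\<bar>(\<integral>x. G x * F x \<partial>Q) - v\<bar> \<le> 0" by (rule field_le_epsilon[of _ 0, simplified])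
    then show ?thesis by simp
  qed
  have "(\<integral>x. G x \<partial>Q) = 1"
    using G_test[of "\<lambda>_. 1" 0 1] is_dens_integral(2)[OF g] by simp
  then have "(\<integral>\<^sup>+ x. ennreal (G x) \<partial>Q) = 1"
    using G_int by (subst nn_integral_eq_integral) (simp_all add: G_nonneg)
  then have G_dens: "is_dens Q G" by (simp add: is_dens_def G_def[abs_def] G_meas[unfolded G_def[abs_def]])
  have "cell_mass (density Q G) (code n) k = w n k" for n k
    unfolding cell_mass_integral[OF G_dens]
  proof (rule G_test)
    show "(\<lambda>x. if code n x = k then 1 else 0 :: real) \<in> borel_measurable Q"
      using finite_code.code_comp_measurable[OF finite_code_code[of n], where F = "\<lambda>l. if l = k then 1 else 0"] .
    show "(\<integral>x. g i x * (if code n x = k then 1 else 0) \<partial>Q) = w n k" if "n \<le> i" for i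
      using g_mass[of n "i - n" k] that cell_mass_integral[OF g, of i n k] by simp
  qed auto
  then show ?thesis using that G_dens G_ent by blast
qed

lemma ent_sublevel_compact:
  assumes f: "\<And>j :: nat. is_dens Q (f j)" and bound: "\<And>j. ent Q (f j) \<le> ennreal c" and c: "0 \<le> c"
  obtains G r where "strict_mono r" "is_dens Q G" "ent Q G \<le> ennreal c"
    "(\<lambda>j. wasserstein p m (density Q (f (r j))) (density Q G)) \<longlonglongrightarrow> 0"
proof -
  have fin: "ent Q (f j) \<noteq> \<infinity>" for j using bound[of j] by (auto simp: top_unique)
  have pd: "prob_space (density Q (f j))" for j by (rule prob_space_density[OF f])
  \<comment> \<open>One index runs over all pairs of a level and a cell, so one diagonal sequence
    makes all cell masses converge.\<close>
  define X where "X i j = cell_mass (density Q (f j)) (code (fst (prod_decode i))) (snd (prod_decode i))" for i and j :: nat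
  obtain r where r: "strict_mono r" "\<And>i. convergent (\<lambda>j. X i (r j))"
    by (rule diagonal_convergent[of X]) (auto simp: X_def prob_space.prob_le_1[OF pd])
  define w where "w n k = lim (\<lambda>j. cell_mass (density Q (f (r j))) (code n) k)" for n k
  have lim: "(\<lambda>j. cell_mass (density Q (f (r j))) (code n) k) \<longlonglongrightarrow> w n k" for n k
    using r(2)[of "prod_encode (n, k)"] by (simp add: X_def w_def convergent_LIMSEQ_iff)
  have weights: "finite_code.weights Q (code n) (codes n) (w n)" for n
  proof -
    interpret C: finite_code Q "code n" "codes n" by (rule finite_code_code)
    note W = C.weights_density[OF f, unfolded C.weights_def]
    show ?thesis unfolding C.weights_def
    proof (intro conjI allI impI)
      show "0 \<le> w n k" for k by (rule LIMSEQ_le_const[OF lim]) auto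
      show "w n k = 0" if "C.q k = 0" for k
      proof -
        have "(\<lambda>j. cell_mass (density Q (f (r j))) (code n) k) \<longlonglongrightarrow> 0"
          using C.cell_mass_density_0[OF f that] by (intro tendsto_eventually) simp
        then show ?thesis by (rule LIMSEQ_unique[OF lim])
      qed
      have "(\<lambda>j. \<Sum>k\<in>codes n. cell_mass (density Q (f (r j))) (code n) k) \<longlonglongrightarrow> (\<Sum>k\<in>codes n. w n k)"
        by (intro tendsto_sum lim)
      moreover have "(\<lambda>j. \<Sum>k\<in>codes n. cell_mass (density Q (f (r j))) (code n) k) \<longlonglongrightarrow> 1"
        using C.cell_mass_density_sum[OF f] by simp
      ultimately show "(\<Sum>k\<in>codes n. w n k) = 1" by (rule LIMSEQ_unique)
    qed
  qed
  have cons: "w n k = (\<Sum>l\<in>codes (n + i). (if coarsen i l = k then 1 else 0) * w (n + i) l)" for n i k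
  proof (rule LIMSEQ_unique[OF lim])
    show "(\<lambda>j. cell_mass (density Q (f (r j))) (code n) k)
        \<longlonglongrightarrow> (\<Sum>l\<in>codes (n + i). (if coarsen i l = k then 1 else 0) * w (n + i) l)"
      unfolding cell_mass_coarsen[OF f, of _ n k i] by (intro tendsto_intros lim)
  qed
  \<comment> \<open>At a fixed level the entropy of the averages is a finite sum, continuous in the
    cell masses, and Jensen's inequality bounds it by \<open>c\<close> along the sequence.\<close>
  have gbound: "ent Q (avg Q (code n) (w n)) \<le> ennreal c" for n
  proof -
    interpret C: finite_code Q "code n" "codes n" by (rule finite_code_code)
    have "(\<lambda>j. \<Sum>k\<in>codes n. phi (cell_mass (density Q (f (r j))) (code n) k / C.q k) * C.q k)
        \<longlonglongrightarrow> (\<Sum>k\<in>codes n. phi (w n k / C.q k) * C.q k)"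
    proof (intro tendsto_sum tendsto_mult tendsto_const phi_tendsto)
      fix k
      show "(\<lambda>j. cell_mass (density Q (f (r j))) (code n) k / C.q k) \<longlonglongrightarrow> w n k / C.q k"
        using tendsto_mult[OF lim[of n k] tendsto_const[of "inverse (C.q k)"]] by (simp add: divide_inverse)
    qed auto
    moreover have "(\<Sum>k\<in>codes n. phi (cell_mass (density Q (f (r j))) (code n) k / C.q k) * C.q k) \<le> c" for j
    proof -
      have "ent Q (avg Q (code n) (cell_mass (density Q (f (r j))) (code n))) \<le> ennreal c"
        using C.ent_avg_le[OF f fin refl] bound order_trans by blast
      then show ?thesis unfolding C.ent_avg[OF C.weights_density[OF f]] using c by (simp add: ennreal_le_iff)
    qed
    ultimately have "(\<Sum>k\<in>codes n. phi (w n k / C.q k) * C.q k) \<le> c" by (intro LIMSEQ_le_const2) auto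
    then show ?thesis unfolding C.ent_avg[OF weights] by (rule ennreal_leI)
  qed
  obtain G where G: "is_dens Q G" "ent Q G \<le> ennreal c" "\<And>n k. cell_mass (density Q G) (code n) k = w n k"
    using consistent_weights_density[OF weights cons gbound c] by blast
  have "(\<lambda>j. wasserstein p m (density Q (f (r j))) (density Q G)) \<longlonglongrightarrow> 0"
  proof (rule LIMSEQ_I)
    fix \<eta> :: real assume \<eta>: "0 < \<eta>"
    \<comment> \<open>Makes the quantization errors of the sequence and of its limit at most
      \<open>\<eta> / 4\<close> each; the mismatch of cell masses takes another quarter.\<close>
    define \<theta> where "\<theta> = (c + 1) / (\<eta> / 4) powr p"
    have \<theta>: "0 < \<theta>" "c + 1 \<le> \<theta> * (\<eta> / 4) powr p" using \<eta> c by (auto simp: \<theta>_def)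
    obtain n where n: "kappa \<theta> n \<le> 1" by (rule kappa_le_1[OF \<theta>(1)])
    define D where "D = (\<Sum>k\<in>codes n. \<Sum>l\<in>codes n. mdist m (rep n k) (rep n l))"
    define S where "S j = (\<Sum>k\<in>codes n. max 0 (cell_mass (density Q (f (r j))) (code n) k - w n k))" for j
    have "S \<longlonglongrightarrow> (\<Sum>k\<in>codes n. max 0 (w n k - w n k))"
      unfolding S_def by (intro tendsto_sum tendsto_max tendsto_diff tendsto_const lim)
    then have "S \<longlonglongrightarrow> 0" by simp
    moreover have "0 \<le> S j" for j unfolding S_def by (intro sum_nonneg) simp
    ultimately have "(\<lambda>j. S j powr (1 / p)) \<longlonglongrightarrow> 0"
      using p by (intro tendsto_zero_powrI[OF _ tendsto_const]) (auto intro!: always_eventually)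
    then have "(\<lambda>j. D * S j powr (1 / p)) \<longlonglongrightarrow> 0" by (rule tendsto_mult_right_zero)
    then have "\<forall>\<^sub>F j in sequentially. D * S j powr (1 / p) < \<eta> / 4"
      using \<eta> by (intro order_tendstoD) auto
    then obtain N where N: "\<And>j. j \<ge> N \<Longrightarrow> D * S j powr (1 / p) < \<eta> / 4"
      by (auto simp: eventually_sequentially)
    have "norm (wasserstein p m (density Q (f (r j))) (density Q G) - 0) < \<eta>" if j: "j \<ge> N" for j
    proof -
      have "wasserstein p m (density Q (f (r j))) (density Q G) \<le> \<eta> / 4 + \<eta> / 4 + D * S j powr (1 / p)"
        unfolding S_def G(3)[symmetric] using \<eta> Q_sets
        by (intro wasserstein_code_le prob_space_density f G(1) D_def Lp_le_rep[OF _ _ c n \<theta>(1,2)] bound G(2)) auto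
      then show ?thesis using N[OF j] \<eta> wasserstein_nonneg[of p m "density Q (f (r j))" "density Q G"] by simp
    qed
    then show "\<exists>N. \<forall>j\<ge>N. norm (wasserstein p m (density Q (f (r j))) (density Q G) - 0) < \<eta>" by blast
  qed
  then show ?thesis using that r(1) G by blast
qed

end

section \<open>Empirical measures\<close>

lemma empirical_map_measurable:
  assumes "\<And>i. i \<in> {1..N} \<Longrightarrow> y i \<in> space B"
  shows "y \<in> uniform_count_measure {1..N} \<rightarrow>\<^sub>M B"
  using assms by (auto simp: measurable_def space_uniform_count_measure sets_uniform_count_measure)

lemma prob_space_count: "1 \<le> N \<Longrightarrow> prob_space (uniform_count_measure {1..N::nat})"
  by (rule prob_space_uniform_count_measure) auto

lemma empirical_measure_basic:
  assumes y: "\<And>i. i \<in> {1..N} \<Longrightarrow> y i \<in> space B" and N: "1 \<le> N"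
  shows "prob_space (empirical_measure B N y)" "sets (empirical_measure B N y) = sets B"
    "space (empirical_measure B N y) = space B"
  using prob_space.prob_space_distr[OF prob_space_count[OF N] empirical_map_measurable[OF y]]
  by (auto simp: empirical_measure_def)

lemma nn_integral_empirical_measure:
  assumes y: "\<And>i. i \<in> {1..N} \<Longrightarrow> y i \<in> space B" and N: "1 \<le> N"
    and f: "f \<in> borel_measurable B" "\<And>x. x \<in> space B \<Longrightarrow> 0 \<le> f x"
  shows "(\<integral>\<^sup>+ x. ennreal (f x) \<partial>empirical_measure B N y) = ennreal ((\<Sum>i=1..N. f (y i)) / real N)"
proof -
  have "(\<integral>\<^sup>+ x. ennreal (f x) \<partial>empirical_measure B N y)
      = (\<integral>\<^sup>+ i. ennreal (f (y i)) \<partial>uniform_count_measure {1..N})"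
    unfolding empirical_measure_def using f
    by (intro nn_integral_distr empirical_map_measurable y) auto
  also have "\<dots> = (\<Sum>i=1..N. ennreal (1 / real N) * ennreal (f (y i)))"
    unfolding uniform_count_measure_def by (subst nn_integral_point_measure_finite) (auto simp: mult.commute)
  also have "\<dots> = (\<Sum>i=1..N. ennreal (f (y i) / real N))"
    using f y by (intro sum.cong) (auto simp: ennreal_mult'[symmetric])
  also have "\<dots> = ennreal (\<Sum>i=1..N. f (y i) / real N)"
    using f y by (intro sum_ennreal) auto
  finally show ?thesis by (simp add: sum_divide_distrib)
qed

lemma Lp_le_empirical_measure:
  assumes y: "\<And>i. i \<in> {1..N} \<Longrightarrow> y i \<in> space B" and N: "1 \<le> N"
    and f: "f \<in> borel_measurable B" "\<And>x. x \<in> space B \<Longrightarrow> 0 \<le> f x" and a: "0 \<le> a"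
    and le: "(\<Sum>i=1..N. f (y i) powr p) \<le> real N * a powr p"
  shows "Lp_le p (empirical_measure B N y) f a"
proof -
  have "(\<integral>\<^sup>+ x. ennreal (f x powr p) \<partial>empirical_measure B N y) = ennreal ((\<Sum>i=1..N. f (y i) powr p) / real N)"
    using f by (intro nn_integral_empirical_measure y N) auto
  also have "\<dots> \<le> ennreal (a powr p)"
    using le N by (intro ennreal_leI) (simp add: field_simps)
  finally show ?thesis
    using f a empirical_measure_basic[OF y N] by (auto simp: Lp_le_def cong: measurable_cong_sets)
qed

context separable_metric
begin

lemma wasserstein_empirical_le:
  assumes p: "1 \<le> p" and N: "1 \<le> N"
    and y: "\<And>i. i \<in> {1..N} \<Longrightarrow> y i \<in> mspace m" and z: "\<And>i. i \<in> {1..N} \<Longrightarrow> z i \<in> mspace m"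
    and r: "\<And>i. i \<in> {1..N} \<Longrightarrow> mdist m (y i) (z i) \<le> r" "0 \<le> r"
  shows "wasserstein p m (empirical_measure (mborel m) N y) (empirical_measure (mborel m) N z) \<le> r"
  unfolding empirical_measure_def
proof (rule wasserstein_distr_le[OF prob_space_count[OF N] p])
  let ?U = "uniform_count_measure {1..N}"
  show ym: "y \<in> ?U \<rightarrow>\<^sub>M mborel m" and zm: "z \<in> ?U \<rightarrow>\<^sub>M mborel m"
    by (rule empirical_map_measurable, use y z in simp)+
  show "Lp_le p ?U (\<lambda>i. mdist m (y i) (z i)) r"
    by (rule Lp_le_mono[OF Lp_le_const[OF prob_space_count[OF N] r(2)]])
      (use r p dist_measurable_comp[OF ym zm] in \<open>auto intro!: AE_I2 simp: space_uniform_count_measure\<close>)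
qed

lemma empirical_finite_moment:
  assumes p: "1 \<le> p" and N: "1 \<le> N" and y: "\<And>i. i \<in> {1..N} \<Longrightarrow> y i \<in> mspace m"
  shows "empirical_measure (mborel m) N y \<in> finite_moment_measures p m"
proof -
  define s where "s = (\<Sum>i=1..N. mdist m (y i) (e 0) powr p)"
  have s: "0 \<le> s" unfolding s_def by (rule sum_nonneg) simp
  have "s = real N * ((s / real N) powr (1 / p)) powr p"
    using s p N by (simp add: powr_powr)
  then have "Lp_le p (empirical_measure (mborel m) N y) (\<lambda>x. mdist m x (e 0)) ((s / real N) powr (1 / p))"
    unfolding s_def using y by (intro Lp_le_empirical_measure N) auto
  then show ?thesis
    unfolding finite_moment_iff[OF p e_in[of 0]]
    using empirical_measure_basic[of N y "mborel m"] y N by auto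
qed

end

text \<open>The limit lies in an open \<open>U\<close> exactly if, for some \<open>k\<close>, the
  approximants eventually stay in the set of points whose ball of radius \<open>1 / Suc k\<close> is
  inside \<open>U\<close>. Approximants with few values have measurable preimages of all sets, so
  the Borel sets of a Wasserstein space need not be described.\<close>

lemma measurable_limit_finite_range:
  assumes "Metric_space E d"
    and Y: "\<And>n \<omega>. \<omega> \<in> space M \<Longrightarrow> Y n \<omega> \<in> E" "\<And>\<omega>. \<omega> \<in> space M \<Longrightarrow> Y' \<omega> \<in> E"
    and meas: "\<And>n F. {\<omega> \<in> space M. Y n \<omega> \<in> F} \<in> sets M"
    and lim: "\<And>\<omega>. \<omega> \<in> space M \<Longrightarrow> (\<lambda>n. d (Y n \<omega>) (Y' \<omega>)) \<longlonglongrightarrow> 0"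
  shows "Y' \<in> M \<rightarrow>\<^sub>M borel_of (Metric_space.mtopology E d)"
proof -
  interpret Metric_space E d by fact
  have "Y' \<in> measurable M (measure_of (topspace mtopology) {U. openin mtopology U} (\<lambda>_. 0))"
  proof (rule measurable_measure_of)
    show "{U. openin mtopology U} \<subseteq> Pow (topspace mtopology)"
      using openin_subset by fastforce
    show "Y' \<in> space M \<rightarrow> topspace mtopology" using Y by auto
    fix U assume "U \<in> {U. openin mtopology U}"
    then have U: "openin mtopology U" by simp
    define F where "F k = {x \<in> E. mball x (1 / Suc k) \<subseteq> U}" for k :: nat
    have "Y' -` U \<inter> space M = (\<Union>k. \<Union>n0. \<Inter>n\<in>{n0..}. {\<omega> \<in> space M. Y n \<omega> \<in> F k})"
    proof (intro equalityI subsetI)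
      fix \<omega> assume "\<omega> \<in> Y' -` U \<inter> space M"
      then have w: "\<omega> \<in> space M" "Y' \<omega> \<in> U" by auto
      obtain r where r: "0 < r" "mball (Y' \<omega>) r \<subseteq> U" using U w unfolding openin_mtopology by blast
      obtain k where k: "1 / real (Suc k) < r / 2" using nat_approx_posE[of "r / 2"] r by auto
      have "\<forall>\<^sub>F n in sequentially. d (Y n \<omega>) (Y' \<omega>) < r / 2"
        using r by (intro order_tendstoD[OF lim[OF w(1)]]) auto
      then obtain n0 where n0: "\<And>n. n \<ge> n0 \<Longrightarrow> d (Y n \<omega>) (Y' \<omega>) < r / 2"
        by (auto simp: eventually_sequentially)
      have "Y n \<omega> \<in> F k" if "n \<ge> n0" for n
      proof -
        have "mball (Y n \<omega>) (1 / Suc k) \<subseteq> mball (Y' \<omega>) r"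
        proof
          fix x assume x: "x \<in> mball (Y n \<omega>) (1 / Suc k)"
          then have "d (Y' \<omega>) x \<le> d (Y' \<omega>) (Y n \<omega>) + d (Y n \<omega>) x"
            using Y[OF w(1)] by (intro triangle) auto
          also have "\<dots> < r / 2 + r / 2" using n0[OF that] x k by (intro add_strict_mono) (auto simp: commute)
          finally show "x \<in> mball (Y' \<omega>) r" using x Y[OF w(1)] by auto
        qed
        then show ?thesis using r Y[OF w(1)] by (auto simp: F_def)
      qed
      then show "\<omega> \<in> (\<Union>k. \<Union>n0. \<Inter>n\<in>{n0..}. {\<omega> \<in> space M. Y n \<omega> \<in> F k})" using w by blast
    next
      fix \<omega> assume "\<omega> \<in> (\<Union>k. \<Union>n0. \<Inter>n\<in>{n0..}. {\<omega> \<in> space M. Y n \<omega> \<in> F k})"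
      then obtain k n0 where *: "\<And>n. n \<ge> n0 \<Longrightarrow> \<omega> \<in> space M \<and> Y n \<omega> \<in> F k" by auto
      then have w: "\<omega> \<in> space M" by auto
      have "\<forall>\<^sub>F n in sequentially. d (Y n \<omega>) (Y' \<omega>) < 1 / Suc k"
        by (intro order_tendstoD[OF lim[OF w]]) auto
      then obtain n1 where "\<And>n. n \<ge> n1 \<Longrightarrow> d (Y n \<omega>) (Y' \<omega>) < 1 / Suc k"
        by (auto simp: eventually_sequentially)
      then have "Y' \<omega> \<in> mball (Y (max n0 n1) \<omega>) (1 / Suc k)" using Y[OF w] by auto
      then show "\<omega> \<in> Y' -` U \<inter> space M" using *[of "max n0 n1"] w unfolding F_def by auto
    qed
    also have "\<dots> \<in> sets M" using meas by (intro sets.countable_UN' sets.countable_INT') auto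
    finally show "Y' -` U \<inter> space M \<in> sets M" .
  qed
  then show ?thesis by (simp add: borel_of_def)
qed

lemma exp_le_quadratic:
  fixes x :: real assumes "\<bar>x\<bar> \<le> 1" shows "exp x \<le> 1 + x + x\<^sup>2"
proof (cases "0 \<le> x")
  case True
  then show ?thesis using exp_bound[of x] assms by simp
next
  case False
  have "1 - x \<le> exp (- x)" using exp_ge_add_one_self[of "- x"] by simp
  then have "exp x \<le> 1 / (1 - x)"
    using False by (simp add: exp_minus field_simps)
  also have "\<dots> \<le> 1 + x + x\<^sup>2"
  proof -
    have "x * x\<^sup>2 \<le> 0" using False by (intro mult_nonpos_nonneg) auto
    then have "1 \<le> (1 + x + x\<^sup>2) * (1 - x)" by (simp add: algebra_simps power2_eq_square)
    then show ?thesis using False by (simp add: divide_le_eq)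
  qed
  finally show ?thesis .
qed

section \<open>Large deviation estimates\<close>

locale iid_sample = exp_moment_space m e Q p + M: prob_space M
  for m :: "'a metric" and e and Q and p and M :: "'w measure" +
  fixes Z :: "nat \<Rightarrow> 'w \<Rightarrow> 'a"
  assumes Z_indep: "M.indep_vars (\<lambda>_. mborel m) Z {1..}"
    and Z_law: "1 \<le> i \<Longrightarrow> distr M (mborel m) (Z i) = Q"
begin

lemma Z_meas [measurable]: "1 \<le> i \<Longrightarrow> Z i \<in> M \<rightarrow>\<^sub>M mborel m"
  using Z_indep by (auto simp: M.indep_vars_def)

lemma Z_in: "\<omega> \<in> space M \<Longrightarrow> i \<in> {1..N} \<Longrightarrow> Z i \<omega> \<in> mspace m"
  using measurable_space[OF Z_meas, of i \<omega>] by auto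

definition L :: "nat \<Rightarrow> 'w \<Rightarrow> 'a measure" where
  "L N \<omega> = empirical_measure (mborel m) N (\<lambda>i. Z i \<omega>)"

lemma L_basic:
  assumes "1 \<le> N" "\<omega> \<in> space M"
  shows "prob_space (L N \<omega>)" "sets (L N \<omega>) = sets (mborel m)" "space (L N \<omega>) = mspace m"
    "L N \<omega> \<in> finite_moment_measures p m"
proof -
  have "Z i \<omega> \<in> space (mborel m)" if "i \<in> {1..N}" for i using Z_in[OF assms(2) that] by simp
  from empirical_measure_basic[OF this assms(1)] empirical_finite_moment[OF p assms(1) Z_in[OF assms(2)]]
  show "prob_space (L N \<omega>)" "sets (L N \<omega>) = sets (mborel m)" "space (L N \<omega>) = mspace m"
    "L N \<omega> \<in> finite_moment_measures p m" by (simp_all add: L_def)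
qed

lemma nn_integral_prod:
  fixes G :: "'a \<Rightarrow> ennreal"
  assumes G: "G \<in> borel_measurable (mborel m)"
  shows "(\<integral>\<^sup>+ \<omega>. (\<Prod>i=1..N. G (Z i \<omega>)) \<partial>M) = (\<integral>\<^sup>+ x. G x \<partial>Q) ^ N"
proof -
  have ind: "M.indep_vars (\<lambda>_. borel) (\<lambda>i \<omega>. G (Z i \<omega>)) {1..N}"
    using G by (intro M.indep_vars_compose2[OF M.indep_vars_subset[OF Z_indep]]) auto
  have "(\<integral>\<^sup>+ \<omega>. (\<Prod>i=1..N. G (Z i \<omega>)) \<partial>M) = (\<Prod>i=1..N. \<integral>\<^sup>+ \<omega>. G (Z i \<omega>) \<partial>M)"
    by (rule M.indep_vars_nn_integral[OF _ ind]) auto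
  also have "\<dots> = (\<Prod>i=1..N. \<integral>\<^sup>+ x. G x \<partial>Q)"
  proof (rule prod.cong)
    fix i assume "i \<in> {1..N}"
    then have i: "1 \<le> i" by simp
    have "(\<integral>\<^sup>+ \<omega>. G (Z i \<omega>) \<partial>M) = (\<integral>\<^sup>+ x. G x \<partial>distr M (mborel m) (Z i))"
      using G Z_meas[OF i] by (subst nn_integral_distr) auto
    then show "(\<integral>\<^sup>+ \<omega>. G (Z i \<omega>) \<partial>M) = (\<integral>\<^sup>+ x. G x \<partial>Q)" using Z_law[OF i] by simp
  qed simp
  finally show ?thesis by simp
qed

lemma prod_measurable [measurable]:
  fixes G :: "'a \<Rightarrow> ennreal"
  assumes G [measurable]: "G \<in> borel_measurable (mborel m)"
  shows "(\<lambda>\<omega>. \<Prod>i=1..N. G (Z i \<omega>)) \<in> borel_measurable M"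
proof -
  have "(\<lambda>\<omega>. G (Z i \<omega>)) \<in> borel_measurable M" if "i \<in> {1..N}" for i
    using measurable_compose[OF Z_meas G] that by simp
  then show ?thesis by (rule borel_measurable_prod_ennreal)
qed

text \<open>Markov's inequality for the product, whose expectation factorizes by
  independence.\<close>

lemma chernoff:
  assumes G: "G \<in> borel_measurable (mborel m)" "(\<integral>\<^sup>+ x. ennreal (G x) \<partial>Q) \<le> ennreal (exp b)"
    and G0: "\<And>x. 0 \<le> G x"
    and S: "\<And>\<omega>. \<omega> \<in> S \<Longrightarrow> \<omega> \<in> space M \<and> exp (real N * t) \<le> (\<Prod>i=1..N. G (Z i \<omega>))"
  shows "M.prob S \<le> exp (real N * (b - t))"
\<comment> \<open>\<open>measure\<close> is 0 on sets that are not measurable.\<close>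
proof (cases "S \<in> sets M")
  case False
  then show ?thesis by (simp add: measure_notin_sets)
next
  case True
  have "ennreal (exp (real N * t) * M.prob S) = ennreal (exp (real N * t)) * emeasure M S"
    by (simp add: M.emeasure_eq_measure ennreal_mult')
  also have "\<dots> = (\<integral>\<^sup>+ \<omega>. ennreal (exp (real N * t)) * indicator S \<omega> \<partial>M)"
    using True by (simp add: nn_integral_cmult_indicator)
  also have "\<dots> \<le> (\<integral>\<^sup>+ \<omega>. (\<Prod>i=1..N. ennreal (G (Z i \<omega>))) \<partial>M)"
  proof (rule nn_integral_mono)
    fix \<omega>
    show "ennreal (exp (real N * t)) * indicator S \<omega> \<le> (\<Prod>i=1..N. ennreal (G (Z i \<omega>)))"
      using S[of \<omega>] G0 by (cases "\<omega> \<in> S") (auto simp: prod_ennreal intro: ennreal_leI)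
  qed
  also have "\<dots> = (\<integral>\<^sup>+ x. ennreal (G x) \<partial>Q) ^ N" using G by (intro nn_integral_prod) auto
  also have "\<dots> \<le> ennreal (exp b) ^ N" using G by (intro power_mono) auto
  also have "\<dots> = ennreal (exp (real N * b))" by (simp add: ennreal_power exp_of_nat_mult)
  finally have "exp (real N * t) * M.prob S \<le> exp (real N * b)" by (simp add: ennreal_le_iff)
  then have "M.prob S \<le> exp (real N * b) / exp (real N * t)" by (simp add: field_simps)
  then show ?thesis by (simp add: exp_diff[symmetric] right_diff_distrib)
qed

abbreviation dist_rep :: "nat \<Rightarrow> 'a \<Rightarrow> real" where
  "dist_rep n x \<equiv> mdist m x (rep n (code n x))"

definition bad :: "nat \<Rightarrow> nat \<Rightarrow> real \<Rightarrow> 'w set" where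
  "bad N n a = {\<omega> \<in> space M. real N * a powr p < (\<Sum>i=1..N. dist_rep n (Z i \<omega>) powr p)}"

lemma bad_sets [measurable]: "bad N n a \<in> sets M"
proof -
  have "(\<lambda>\<omega>. dist_rep n (Z i \<omega>)) \<in> borel_measurable M" if "i \<in> {1..N}" for i
    using measurable_compose[OF Z_meas dist_rep_measurable[of n], of i] that by simp
  then have [measurable]: "(\<lambda>\<omega>. \<Sum>i=1..N. dist_rep n (Z i \<omega>) powr p) \<in> borel_measurable M"
    by (intro borel_measurable_sum) auto
  show ?thesis unfolding bad_def by measurable
qed

lemma prob_bad:
  assumes \<theta>: "0 < \<theta>" and k: "kappa \<theta> n \<le> 1" and c: "c + 1 \<le> \<theta> * a powr p"
  shows "M.prob (bad N n a) \<le> exp (- real N * c)"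
proof -
  note [measurable] = dist_rep_measurable[of n]
  have "(\<integral>\<^sup>+ x. ennreal (exp (\<theta> * dist_rep n x powr p)) \<partial>Q)
      = (\<integral>\<^sup>+ x. ennreal (exp (\<theta> * dist_rep n x powr p) - 1) + 1 \<partial>Q)"
    using \<theta> by (intro nn_integral_cong) (simp flip: ennreal_1 ennreal_plus)
  also have "\<dots> = kappa \<theta> n + 1" unfolding kappa_def by (simp add: nn_integral_add emeasure_space_1)
  \<comment> \<open>The moment is at most 2, hence at most \<open>exp 1\<close>; this exponent 1 is
    the \<open>+ 1\<close> in the hypothesis on \<open>c\<close>.\<close>
  also have "\<dots> \<le> ennreal 1 + ennreal 1" using k by (intro add_mono) auto
  also have "\<dots> = ennreal 2" by (simp flip: ennreal_plus)
  also have "\<dots> \<le> ennreal (exp 1)" using exp_ge_add_one_self[of 1] by (intro ennreal_leI) simp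
  finally have "M.prob (bad N n a) \<le> exp (real N * (1 - \<theta> * a powr p))"
  proof (intro chernoff[of "\<lambda>x. exp (\<theta> * dist_rep n x powr p)"])
    fix \<omega> assume \<omega>: "\<omega> \<in> bad N n a"
    then have "\<theta> * (real N * a powr p) \<le> \<theta> * (\<Sum>i=1..N. dist_rep n (Z i \<omega>) powr p)"
      using \<theta> by (intro mult_left_mono) (auto simp: bad_def)
    then have "exp (real N * (\<theta> * a powr p)) \<le> exp (\<Sum>i=1..N. \<theta> * dist_rep n (Z i \<omega>) powr p)"
      by (simp add: sum_distrib_left ac_simps)
    then show "\<omega> \<in> space M \<and> exp (real N * (\<theta> * a powr p)) \<le> (\<Prod>i=1..N. exp (\<theta> * dist_rep n (Z i \<omega>) powr p))"
      using \<omega> by (auto simp: bad_def exp_sum)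
  qed auto
  also have "\<dots> \<le> exp (- real N * c)"
    using mult_left_mono[OF c, of "real N"] by (simp add: algebra_simps)
  finally show ?thesis .
qed

lemma Lp_le_not_bad:
  assumes "1 \<le> N" "\<omega> \<in> space M" "\<omega> \<notin> bad N n a" "0 \<le> a"
  shows "Lp_le p (L N \<omega>) (dist_rep n) a"
  unfolding L_def using assms Z_in dist_rep_measurable[of n]
  by (intro Lp_le_empirical_measure) (auto simp: bad_def)

definition cnt :: "nat \<Rightarrow> nat \<Rightarrow> nat \<Rightarrow> 'w \<Rightarrow> nat" where
  "cnt N n k \<omega> = card {i \<in> {1..N}. code n (Z i \<omega>) = k}"

lemma cnt_sum: "real (cnt N n k \<omega>) = (\<Sum>i=1..N. if code n (Z i \<omega>) = k then 1 else 0)"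
  by (simp add: cnt_def sum.If_cases Int_def)

lemma cnt_measurable [measurable]: "(\<lambda>\<omega>. real (cnt N n k \<omega>)) \<in> borel_measurable M"
  unfolding cnt_sum
proof (rule borel_measurable_sum)
  fix i assume "i \<in> {1..N}"
  then have "(\<lambda>\<omega>. code n (Z i \<omega>)) \<in> M \<rightarrow>\<^sub>M count_space UNIV"
    using measurable_compose[OF Z_meas code_measurable[of n], of i] by simp
  then show "(\<lambda>\<omega>. if code n (Z i \<omega>) = k then 1 else 0 :: real) \<in> borel_measurable M"
    by (rule measurable_compose) simp
qed

lemma cell_mass_L:
  assumes N: "1 \<le> N" and \<omega>: "\<omega> \<in> space M"
  shows "cell_mass (L N \<omega>) (code n) k = real (cnt N n k \<omega>) / real N"
proof -
  have A: "code n -` {k} \<inter> mspace m \<in> sets (mborel m)"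
    using measurable_sets[OF code_measurable, of "{k}" n] by simp
  have "emeasure (L N \<omega>) (code n -` {k} \<inter> mspace m)
      = ennreal ((\<Sum>i=1..N. indicator (code n -` {k} \<inter> mspace m) (Z i \<omega>)) / real N)"
    unfolding L_def using A Z_in[OF \<omega>, of _ N] by (intro emeasure_empirical_measure) auto
  also have "(\<Sum>i=1..N. indicator (code n -` {k} \<inter> mspace m) (Z i \<omega>)) = real (cnt N n k \<omega>)"
    unfolding cnt_sum using Z_in[OF \<omega>, of _ N] by (intro sum.cong) (auto simp: indicator_def)
  finally show ?thesis using L_basic(3)[OF N \<omega>] by (simp add: measure_def)
qed

lemma sum_code_cnt:
  assumes \<omega>: "\<omega> \<in> space M"
  shows "(\<Sum>i=1..N. F (code n (Z i \<omega>))) = (\<Sum>k\<in>codes n. F k * real (cnt N n k \<omega>))"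
proof -
  have "(\<Sum>k\<in>codes n. F k * real (cnt N n k \<omega>))
      = (\<Sum>k\<in>codes n. \<Sum>i=1..N. if code n (Z i \<omega>) = k then F k else 0)"
    unfolding cnt_sum sum_distrib_left by (intro sum.cong) auto
  also have "\<dots> = (\<Sum>i=1..N. \<Sum>k\<in>codes n. if code n (Z i \<omega>) = k then F k else 0)"
    by (rule sum.swap)
  also have "\<dots> = (\<Sum>i=1..N. F (code n (Z i \<omega>)))"
    using Z_in[OF \<omega>, of _ N] finite_codes by (intro sum.cong) auto
  finally show ?thesis ..
qed

text \<open>The empirical measure of the quantized sample is a function of \<open>N\<close> codes
  with finitely many values each, and it converges because each of the \<open>N\<close> quantized
  points does.\<close>

lemma L_measurable:
  assumes N: "1 \<le> N"
  shows "L N \<in> M \<rightarrow>\<^sub>M borel_of (wasserstein_topology p m)"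
  unfolding wasserstein_topology_def
proof (rule measurable_limit_finite_range[OF Metric_space_wasserstein[OF p]])
  let ?Y = "\<lambda>n \<omega>. empirical_measure (mborel m) N (\<lambda>i. rep n (code n (Z i \<omega>)))"
  show "?Y n \<omega> \<in> finite_moment_measures p m" for n \<omega>
    by (rule empirical_finite_moment[OF p N]) simp
  show "L N \<omega> \<in> finite_moment_measures p m" if "\<omega> \<in> space M" for \<omega>
    using L_basic[OF N that] by simp
  show "{\<omega> \<in> space M. ?Y n \<omega> \<in> F} \<in> sets M" for n F
  proof -
    define U where "U = {u \<in> {1..N} \<rightarrow>\<^sub>E codes n. empirical_measure (mborel m) N (\<lambda>i. rep n (u i)) \<in> F}"
    have "{\<omega> \<in> space M. ?Y n \<omega> \<in> F} = (\<Union>u\<in>U. {\<omega> \<in> space M. \<forall>i\<in>{1..N}. code n (Z i \<omega>) = u i})"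
    proof (intro equalityI subsetI)
      fix \<omega> assume \<omega>: "\<omega> \<in> {\<omega> \<in> space M. ?Y n \<omega> \<in> F}"
      let ?u = "restrict (\<lambda>i. code n (Z i \<omega>)) {1..N}"
      have "empirical_measure (mborel m) N (\<lambda>i. rep n (?u i)) = ?Y n \<omega>"
        unfolding empirical_measure_def by (rule distr_cong) (auto simp: space_uniform_count_measure)
      then have "?u \<in> U" using \<omega> Z_in[of \<omega> _ N] by (auto simp: U_def)
      then show "\<omega> \<in> (\<Union>u\<in>U. {\<omega> \<in> space M. \<forall>i\<in>{1..N}. code n (Z i \<omega>) = u i})"
        using \<omega> by (intro UN_I[of ?u]) auto
    next
      fix \<omega> assume "\<omega> \<in> (\<Union>u\<in>U. {\<omega> \<in> space M. \<forall>i\<in>{1..N}. code n (Z i \<omega>) = u i})"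
      then obtain u where u: "u \<in> U" "\<omega> \<in> space M" "\<And>i. i \<in> {1..N} \<Longrightarrow> code n (Z i \<omega>) = u i" by auto
      have "?Y n \<omega> = empirical_measure (mborel m) N (\<lambda>i. rep n (u i))"
        unfolding empirical_measure_def by (rule distr_cong) (auto simp: space_uniform_count_measure u)
      then show "\<omega> \<in> {\<omega> \<in> space M. ?Y n \<omega> \<in> F}" using u by (auto simp: U_def)
    qed
    moreover have "finite U"
      unfolding U_def by (rule finite_subset[OF _ finite_PiE[of "{1..N}" "\<lambda>_. codes n"]]) (auto simp: finite_codes)
    moreover have "{\<omega> \<in> space M. \<forall>i\<in>{1..N}. code n (Z i \<omega>) = u i} \<in> sets M" for u
    proof (rule sets.sets_Collect_finite_All)
      fix i assume i: "i \<in> {1..N}"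
      have "(\<lambda>\<omega>. code n (Z i \<omega>)) \<in> M \<rightarrow>\<^sub>M count_space UNIV"
        using measurable_compose[OF Z_meas code_measurable[of n], of i] i by simp
      from measurable_sets[OF this, of "{u i}"]
      show "{\<omega> \<in> space M. code n (Z i \<omega>) = u i} \<in> sets M" by (simp add: vimage_def Int_def conj_commute)
    qed simp
    ultimately show ?thesis by (auto intro!: sets.finite_UN)
  qed
  show "(\<lambda>n. wasserstein p m (?Y n \<omega>) (L N \<omega>)) \<longlonglongrightarrow> 0" if \<omega>: "\<omega> \<in> space M" for \<omega>
  proof (rule LIMSEQ_I)
    fix r :: real assume r: "0 < r"
    have "\<forall>\<^sub>F n in sequentially. mdist m (Z i \<omega>) (e (idx n (Z i \<omega>))) < r / 2" if "i \<in> {1..N}" for i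
      using idx_tendsto[OF Z_in[OF \<omega> that]] r by (intro order_tendstoD) auto
    then have "\<forall>\<^sub>F n in sequentially. \<forall>i\<in>{1..N}. mdist m (Z i \<omega>) (e (idx n (Z i \<omega>))) < r / 2"
      by (intro eventually_ball_finite) auto
    then obtain n0 where n0: "\<And>n i. n \<ge> n0 \<Longrightarrow> i \<in> {1..N} \<Longrightarrow> mdist m (Z i \<omega>) (e (idx n (Z i \<omega>))) < r / 2"
      unfolding eventually_sequentially by blast
    have "norm (wasserstein p m (?Y n \<omega>) (L N \<omega>) - 0) < r" if n: "n \<ge> n0" for n
    proof -
      have "wasserstein p m (?Y n \<omega>) (L N \<omega>) \<le> r / 2"
        unfolding L_def
        by (rule wasserstein_empirical_le[OF p N])
          (use n0[OF n] r Z_in[OF \<omega>, of _ N] in \<open>auto simp: rep_code mdist_commute less_imp_le\<close>)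
      then show ?thesis using r wasserstein_nonneg[of p m] by simp
    qed
    then show "\<exists>no. \<forall>n\<ge>no. norm (wasserstein p m (?Y n \<omega>) (L N \<omega>) - 0) < r" by blast
  qed
qed

lemma AE_code_pos:
  "AE \<omega> in M. \<forall>i\<in>{1..N}. cell_mass Q (code n) (code n (Z i \<omega>)) \<noteq> 0"
proof (rule AE_finite_allI)
  interpret C: finite_code Q "code n" "codes n" by (rule finite_code_code)
  fix i assume i: "i \<in> {1..N}"
  have "AE x in Q. \<forall>k. C.q k = 0 \<longrightarrow> code n x \<noteq> k"
  proof (intro AE_all_countable[THEN iffD2] allI)
    fix k
    show "AE x in Q. C.q k = 0 \<longrightarrow> code n x \<noteq> k"
    proof (cases "C.q k = 0")
      case True
      have "code n -` {k} \<inter> space Q \<in> null_sets Q"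
        using True by (auto simp: null_sets_def emeasure_eq_measure)
      from AE_not_in[OF this] show ?thesis using AE_space by eventually_elim auto
    qed simp
  qed
  then have "AE x in Q. C.q (code n x) \<noteq> 0" by eventually_elim auto
  moreover have "distr M (mborel m) (Z i) = Q" using i by (intro Z_law) simp
  ultimately have "AE x in distr M (mborel m) (Z i). C.q (code n x) \<noteq> 0" by (simp only:)
  then show "AE \<omega> in M. C.q (code n (Z i \<omega>)) \<noteq> 0"
    by (rule AE_distrD[rotated]) (use i in auto)
qed simp

text \<open>Extended by 0 because \<open>weights\<close> speaks about all indices, while the count
  vectors \<open>v\<close> are specified on \<open>codes n\<close> only.\<close>

definition freq :: "nat \<Rightarrow> nat \<Rightarrow> (nat \<Rightarrow> nat) \<Rightarrow> nat \<Rightarrow> real" where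
  "freq N n v k = (if k \<in> codes n then real (v k) / real N else 0)"

text \<open>Chernoff's bound with the averaged density of the type itself, whose integral is 1: on
  the event, the product of its values at the sample is \<open>exp\<close> of \<open>N\<close> times
  its entropy.\<close>

lemma prob_type_le:
  assumes N: "1 \<le> N" and w: "finite_code.weights Q (code n) (codes n) (freq N n v)"
    and c: "ennreal c \<le> ent Q (avg Q (code n) (freq N n v))"
  shows "M.prob {\<omega> \<in> space M. \<forall>k\<in>codes n. real (cnt N n k \<omega>) = real (v k)} \<le> exp (- real N * c)"
proof -
  interpret C: finite_code Q "code n" "codes n" by (rule finite_code_code)
  let ?w = "freq N n v" and ?f = "avg Q (code n) (freq N n v)"
  note dens = C.is_dens_avg[OF w]
  have c': "c \<le> (\<Sum>k\<in>codes n. ?w k * ln (?w k / C.q k))"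
  proof -
    have "0 \<le> (\<Sum>k\<in>codes n. phi (?w k / C.q k) * C.q k)"
      using w by (intro sum_nonneg mult_nonneg_nonneg phi_nonneg divide_nonneg_nonneg) (auto simp: C.weights_def)
    then show ?thesis
      using c unfolding C.ent_avg[OF w] C.ent_avg_ln[OF w, symmetric] by (simp add: ennreal_le_iff)
  qed
  have "M.prob {\<omega> \<in> space M. \<forall>k\<in>codes n. real (cnt N n k \<omega>) = real (v k)} \<le> exp (real N * (0 - c))"
  proof (rule chernoff[of ?f])
    show "?f \<in> borel_measurable (mborel m)" using is_densD(1)[OF dens] Q_sets by (simp cong: measurable_cong_sets)
    show "(\<integral>\<^sup>+ x. ennreal (?f x) \<partial>Q) \<le> ennreal (exp 0)" using is_densD(3)[OF dens] by simp
    show "0 \<le> ?f x" for x by (rule is_densD(2)[OF dens])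
    fix \<omega> assume "\<omega> \<in> {\<omega> \<in> space M. \<forall>k\<in>codes n. real (cnt N n k \<omega>) = real (v k)}"
    then have \<omega>: "\<omega> \<in> space M" "\<And>k. k \<in> codes n \<Longrightarrow> real (cnt N n k \<omega>) = real N * ?w k"
      using N by (auto simp: freq_def)
    have pos: "0 < ?f (Z i \<omega>)" if i: "i \<in> {1..N}" for i
    proof -
      let ?k = "code n (Z i \<omega>)"
      have k: "?k \<in> codes n" using Z_in[OF \<omega>(1) i] by simp
      have "i \<in> {i \<in> {1..N}. code n (Z i \<omega>) = ?k}" using i by simp
      then have "0 < cnt N n ?k \<omega>" unfolding cnt_def by (intro card_gt_0_iff[THEN iffD2]) auto
      then have "?w ?k \<noteq> 0" using \<omega>(2)[OF k] by auto
      then have "C.q ?k \<noteq> 0" "0 < ?w ?k" using w by (auto simp: C.weights_def less_le)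
      then show ?thesis by (simp add: avg_def zero_less_measure_iff less_le)
    qed
    have "real N * c \<le> real N * (\<Sum>k\<in>codes n. ?w k * ln (?w k / C.q k))"
      using c' by (intro mult_left_mono) auto
    also have "\<dots> = (\<Sum>k\<in>codes n. ln (?w k / C.q k) * real (cnt N n k \<omega>))"
      unfolding sum_distrib_left using \<omega>(2) by (intro sum.cong) auto
    also have "\<dots> = (\<Sum>i=1..N. ln (?f (Z i \<omega>)))"
      unfolding avg_def by (rule sum_code_cnt[OF \<omega>(1), symmetric])
    finally have "exp (real N * c) \<le> exp (\<Sum>i=1..N. ln (?f (Z i \<omega>)))" by simp
    also have "\<dots> = (\<Prod>i=1..N. ?f (Z i \<omega>))" using pos by (simp add: exp_sum)
    finally show "\<omega> \<in> space M \<and> exp (real N * c) \<le> (\<Prod>i=1..N. ?f (Z i \<omega>))" using \<omega> by simp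
  qed
  then show ?thesis by simp
qed

text \<open>Method of types: if the cell frequencies of the sample have small entropy, the corresponding
  averaged density is close to the empirical measure.\<close>
lemma upper_estimate:
  assumes c: "0 \<le> c" and \<delta>: "0 < \<delta>"
    and A: "\<And>\<mu> f. \<mu> \<in> A \<Longrightarrow> is_dens Q f \<Longrightarrow> ent Q f \<le> ennreal c \<Longrightarrow> \<delta> \<le> wasserstein p m \<mu> (density Q f)"
  obtains K :: nat where "\<And>N. 1 \<le> N \<Longrightarrow>
    M.prob {\<omega> \<in> space M. L N \<omega> \<in> A} \<le> (1 + (real N + 1) ^ K) * exp (- real N * c)"
proof -
  \<comment> \<open>Two quantization errors of size \<open>a\<close> must stay below
    \<open>\<delta>\<close>.\<close>
  define a where "a = \<delta> / 4"
  define \<theta> where "\<theta> = (c + 1) / a powr p"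
  have a: "0 < a" using \<delta> by (simp add: a_def)
  have \<theta>: "0 < \<theta>" "c + 1 \<le> \<theta> * a powr p" using a c by (auto simp: \<theta>_def)
  obtain n where n: "kappa \<theta> n \<le> 1" by (rule kappa_le_1[OF \<theta>(1)])
  interpret C: finite_code Q "code n" "codes n" by (rule finite_code_code)
  have main: "M.prob {\<omega> \<in> space M. L N \<omega> \<in> A} \<le> (1 + (real N + 1) ^ card (codes n)) * exp (- real N * c)"
    if N: "1 \<le> N" for N
  proof -
    \<comment> \<open>The possible count vectors whose averaged density has entropy at least
      \<open>c\<close>; counting all vectors gives the polynomial factor.\<close>
    define V where "V = {v \<in> codes n \<rightarrow>\<^sub>E {0..N}. C.weights (freq N n v) \<and> ennreal c \<le> ent Q (avg Q (code n) (freq N n v))}"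
    define T where "T v = {\<omega> \<in> space M. \<forall>k\<in>codes n. real (cnt N n k \<omega>) = real (v k)}" for v
    have finP: "finite (codes n \<rightarrow>\<^sub>E {0..N})" using finite_codes by (intro finite_PiE) auto
    then have V: "finite V" by (simp add: V_def)
    have T [measurable]: "T v \<in> sets M" for v
      unfolding T_def by (rule sets.sets_Collect_finite_All) (measurable, rule finite_codes)
    have UT: "(\<Union>v\<in>V. T v) \<in> sets M" using V T by (intro sets.finite_UN) auto
    \<comment> \<open>Only almost surely, since a sample point in a null cell would give frequencies
      that belong to no density.\<close>
    have "AE \<omega> in M. \<omega> \<in> {\<omega> \<in> space M. L N \<omega> \<in> A} \<longrightarrow> \<omega> \<in> bad N n a \<union> (\<Union>v\<in>V. T v)"
      using AE_code_pos[of N n]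
    proof eventually_elim
      case (elim \<omega>)
      show ?case
      proof (intro impI, rule ccontr)
        assume "\<omega> \<in> {\<omega> \<in> space M. L N \<omega> \<in> A}" and *: "\<omega> \<notin> bad N n a \<union> (\<Union>v\<in>V. T v)"
        then have \<omega>: "\<omega> \<in> space M" "L N \<omega> \<in> A" by auto
        note LB = L_basic[OF N \<omega>(1)]
        define v where "v = restrict (\<lambda>k. cnt N n k \<omega>) (codes n)"
        have cnt0: "cnt N n k \<omega> = 0" if "k \<notin> codes n \<or> C.q k = 0" for k
          using that elim Z_in[OF \<omega>(1), of _ N] unfolding cnt_def by (intro card_eq_0_iff[THEN iffD2]) auto
        have freq: "freq N n v k = cell_mass (L N \<omega>) (code n) k" for k
          using cell_mass_L[OF N \<omega>(1), of n k] cnt0[of k] by (simp add: freq_def v_def)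
        have sum1: "(\<Sum>k\<in>codes n. cell_mass (L N \<omega>) (code n) k) = 1"
          using LB finite_codes by (intro sum_code_measure) (auto cong: measurable_cong_sets)
        have w: "C.weights (freq N n v)"
          unfolding C.weights_def
        proof (intro conjI allI impI)
          show "freq N n v k = 0" if "C.q k = 0" for k
            using cnt0[of k] that by (simp add: freq_def v_def)
          show "(\<Sum>k\<in>codes n. freq N n v k) = 1" unfolding freq by (rule sum1)
        qed (simp add: freq_def)
        have vP: "v \<in> codes n \<rightarrow>\<^sub>E {0..N}"
        proof -
          have "cnt N n k \<omega> \<le> N" for k
            unfolding cnt_def
            by (rule order_trans[OF card_mono[of "{1..N}" "{i \<in> {1..N}. code n (Z i \<omega>) = k}"]]) auto
          then show ?thesis by (simp add: v_def restrict_PiE_iff)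
        qed
        have "\<omega> \<in> T v" using \<omega> by (simp add: T_def v_def)
        then have "v \<notin> V" using * by auto
        then have ent: "ent Q (avg Q (code n) (freq N n v)) \<le> ennreal c"
          using vP w by (auto simp: V_def)
        let ?f = "avg Q (code n) (freq N n v)"
        note dens = C.is_dens_avg[OF w]
        have "wasserstein p m (L N \<omega>) (density Q ?f) \<le> a + a
            + (\<Sum>k\<in>codes n. \<Sum>l\<in>codes n. mdist m (rep n k) (rep n l))
              * (\<Sum>k\<in>codes n. max 0 (cell_mass (L N \<omega>) (code n) k - cell_mass (density Q ?f) (code n) k)) powr (1 / p)"
          using * \<omega> a Q_sets
          by (intro wasserstein_code_le LB prob_space_density dens Lp_le_not_bad[OF N]
              Lp_le_rep[OF dens ent c n \<theta>] refl) auto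
        \<comment> \<open>The averaged density has the cell masses of the sample, so the mismatch
          term vanishes.\<close>
        also have "\<dots> = a + a"
          unfolding C.cell_mass_avg[OF w] freq by simp
        also have "\<dots> < \<delta>" using \<delta> by (simp add: a_def)
        finally show False using A[OF \<omega>(2) dens ent] by simp
      qed
    qed
    then have "M.prob {\<omega> \<in> space M. L N \<omega> \<in> A} \<le> M.prob (bad N n a \<union> (\<Union>v\<in>V. T v))"
      using UT by (intro M.finite_measure_mono_AE sets.Un bad_sets)
    also have "\<dots> \<le> M.prob (bad N n a) + M.prob (\<Union>v\<in>V. T v)"
      using UT by (intro measure_Un_le bad_sets)
    also have "\<dots> \<le> exp (- real N * c) + (\<Sum>v\<in>V. M.prob (T v))"
      using V T by (intro add_mono prob_bad[OF \<theta>(1) n \<theta>(2)] measure_UNION_le) auto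
    also have "(\<Sum>v\<in>V. M.prob (T v)) \<le> (\<Sum>v\<in>V. exp (- real N * c))"
      unfolding T_def using N by (intro sum_mono prob_type_le) (auto simp: V_def)
    also have "(\<Sum>v\<in>V. exp (- real N * c)) = real (card V) * exp (- real N * c)" by simp
    also have "\<dots> \<le> (real N + 1) ^ card (codes n) * exp (- real N * c)"
    proof (rule mult_right_mono)
      have "card V \<le> card (codes n \<rightarrow>\<^sub>E {0..N})" unfolding V_def using finP by (intro card_mono) auto
      also have "\<dots> = (N + 1) ^ card (codes n)" using finite_codes by (simp add: card_PiE)
      finally have "real (card V) \<le> real ((N + 1) ^ card (codes n))" by (rule of_nat_mono)
      then show "real (card V) \<le> (real N + 1) ^ card (codes n)" by (simp add: add.commute)
    qed simp
    finally show ?thesis by (simp add: algebra_simps)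
  qed
  then show ?thesis by (rule that)
qed

section \<open>Tilting the sample towards the cell masses of a density\<close>

context
  fixes n :: nat and f :: "'a \<Rightarrow> real" and mm :: "nat \<Rightarrow> real" and g :: "'a \<Rightarrow> real"
  assumes f: "is_dens Q f"
    and mm_def: "mm = cell_mass (density Q f) (code n)" and g_def: "g = avg Q (code n) mm"
begin

interpretation C: finite_code Q "code n" "codes n" by (rule finite_code_code)

lemma mm_weights: "C.weights mm"
  unfolding mm_def by (rule C.weights_density[OF f])

lemma g_dens': "is_dens Q g"
  unfolding g_def by (rule C.is_dens_avg[OF mm_weights])

lemma g_meas [measurable]: "g \<in> borel_measurable (mborel m)"
  using is_densD(1)[OF g_dens'] Q_sets by (simp cong: measurable_cong_sets)

lemma mm_bounds: "0 \<le> mm k" "k \<in> codes n \<Longrightarrow> mm k \<le> 1"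
proof -
  show 0: "0 \<le> mm k" for k by (simp add: mm_def)
  show "k \<in> codes n \<Longrightarrow> mm k \<le> 1"
    using member_le_sum[of k "codes n" mm] 0 mm_weights finite_codes by (simp add: C.weights_def)
qed

text \<open>\<open>\<sigma>\<close> will be 1 or -1 and selects upward or downward
  deviations.\<close>

definition dev :: "nat \<Rightarrow> real \<Rightarrow> real \<Rightarrow> nat \<Rightarrow> 'w set" where
  "dev N t \<sigma> k = {\<omega> \<in> space M. t < \<sigma> * (real (cnt N n k \<omega>) / real N - mm k)}"

lemma dev_sets [measurable]: "dev N t \<sigma> k \<in> sets M"
  unfolding dev_def by measurable

text \<open>Chernoff bound for the cell frequencies under the tilted law with density
  \<open>\<Prod>i. g (Z i)\<close>.\<close>
lemma tilted_deviation:
  assumes N: "1 \<le> N" and k: "k \<in> codes n" and \<sigma>: "\<bar>\<sigma>\<bar> = 1" and t: "0 < t" "t \<le> 1"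
  shows "(\<integral>\<^sup>+ \<omega>. (\<Prod>i=1..N. ennreal (g (Z i \<omega>))) * indicator (dev N t \<sigma> k) \<omega> \<partial>M)
    \<le> ennreal (exp (- (t\<^sup>2 / 4)) ^ N)"
proof -
  \<comment> \<open>The minimizer of \<open>s\<^sup>2 - s * t\<close>, with value
    \<open>- (t\<^sup>2 / 4)\<close>.\<close>
  define s where "s = t / 2"
  have s: "0 < s" "s \<le> 1" using t by (auto simp: s_def)
  define F where "F l = exp (s * (\<sigma> * ((if l = k then 1 else 0) - mm k) - t))" for l
  have [measurable]: "(\<lambda>x. F (code n x)) \<in> borel_measurable (mborel m)"
    by (rule measurable_compose[OF code_measurable]) simp
  define G where "G x = ennreal (g x) * ennreal (F (code n x))" for x
  have G_meas: "G \<in> borel_measurable (mborel m)" unfolding G_def by measurable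
  have "(\<integral>\<^sup>+ x. G x \<partial>Q) = ennreal (\<Sum>l\<in>codes n. F l * mm l)"
    unfolding G_def g_def by (rule C.nn_integral_avg[OF mm_weights]) (simp add: F_def)
  also have "\<dots> \<le> ennreal (exp (- (t\<^sup>2 / 4)))"
  proof (rule ennreal_leI)
    have quad: "exp (s * (\<sigma> * ((if l = k then 1 else 0) - mm k)))
        \<le> 1 + s * \<sigma> * ((if l = k then 1 else 0) - mm k) + s\<^sup>2" for l
    proof -
      define u where "u = \<sigma> * ((if l = k then 1 else 0) - mm k)"
      have "\<bar>u\<bar> \<le> 1" using \<sigma> mm_bounds[of k] k by (auto simp: u_def abs_mult)
      then have "\<bar>s * u\<bar> \<le> 1" using s by (auto simp: abs_mult intro: mult_le_one)
      then have "exp (s * u) \<le> 1 + s * u + (s * u)\<^sup>2" by (rule exp_le_quadratic)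
      moreover have "(s * u)\<^sup>2 \<le> s\<^sup>2"
        using \<open>\<bar>u\<bar> \<le> 1\<close> by (simp add: power_mult_distrib abs_square_le_1 mult_left_le)
      ultimately show ?thesis by (simp add: u_def ac_simps)
    qed
    have "(\<Sum>l\<in>codes n. F l * mm l)
        = exp (- (s * t)) * (\<Sum>l\<in>codes n. exp (s * (\<sigma> * ((if l = k then 1 else 0) - mm k))) * mm l)"
    proof -
      have "F l = exp (- (s * t)) * exp (s * (\<sigma> * ((if l = k then 1 else 0) - mm k)))" for l
        unfolding F_def exp_add[symmetric] by (simp add: right_diff_distrib)
      then show ?thesis by (simp add: sum_distrib_left mult.assoc)
    qed
    also have "\<dots> \<le> exp (- (s * t)) * (\<Sum>l\<in>codes n. (1 + s * \<sigma> * ((if l = k then 1 else 0) - mm k) + s\<^sup>2) * mm l)"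
      using mm_bounds(1) by (intro mult_left_mono sum_mono mult_right_mono quad) auto
    also have "(\<Sum>l\<in>codes n. (1 + s * \<sigma> * ((if l = k then 1 else 0) - mm k) + s\<^sup>2) * mm l)
        = (1 - s * \<sigma> * mm k + s\<^sup>2) * (\<Sum>l\<in>codes n. mm l) + (\<Sum>l\<in>codes n. if l = k then s * \<sigma> * mm l else 0)"
      unfolding sum_distrib_left sum.distrib[symmetric] by (intro sum.cong refl) (auto simp: algebra_simps)
    also have "\<dots> = 1 + s\<^sup>2" using mm_weights k finite_codes by (simp add: C.weights_def)
    also have "exp (- (s * t)) * (1 + s\<^sup>2) \<le> exp (- (s * t)) * exp (s\<^sup>2)"
      using exp_ge_add_one_self[of "s\<^sup>2"] by (intro mult_left_mono) auto
    also have "\<dots> = exp (- (t\<^sup>2 / 4))"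
      by (simp add: s_def exp_add[symmetric] power2_eq_square field_simps)
    finally show "(\<Sum>l\<in>codes n. F l * mm l) \<le> exp (- (t\<^sup>2 / 4))" .
  qed
  finally have GQ: "(\<integral>\<^sup>+ x. G x \<partial>Q) \<le> ennreal (exp (- (t\<^sup>2 / 4)))" .
  have "(\<integral>\<^sup>+ \<omega>. (\<Prod>i=1..N. ennreal (g (Z i \<omega>))) * indicator (dev N t \<sigma> k) \<omega> \<partial>M)
      \<le> (\<integral>\<^sup>+ \<omega>. (\<Prod>i=1..N. G (Z i \<omega>)) \<partial>M)"
  proof (rule nn_integral_mono)
    fix \<omega> assume \<omega>: "\<omega> \<in> space M"
    show "(\<Prod>i=1..N. ennreal (g (Z i \<omega>))) * indicator (dev N t \<sigma> k) \<omega> \<le> (\<Prod>i=1..N. G (Z i \<omega>))"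
    proof (cases "\<omega> \<in> dev N t \<sigma> k")
      case True
      have "(\<Sum>i=1..N. s * (\<sigma> * ((if code n (Z i \<omega>) = k then 1 else 0) - mm k) - t))
          = s * (\<sigma> * (real (cnt N n k \<omega>) - real N * mm k) - real N * t)"
        by (simp add: sum_distrib_left[symmetric] sum_subtractf cnt_sum)
      also have "\<dots> = s * real N * (\<sigma> * (real (cnt N n k \<omega>) / real N - mm k) - t)"
        using N by (simp add: field_simps)
      also have "0 \<le> \<dots>" using True s by (auto simp: dev_def)
      finally have "1 \<le> (\<Prod>i=1..N. F (code n (Z i \<omega>)))" by (simp add: F_def exp_sum[symmetric])
      then have "1 \<le> (\<Prod>i=1..N. ennreal (F (code n (Z i \<omega>))))"
        by (subst prod_ennreal) (auto simp: F_def intro: prod_nonneg)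
      then have "(\<Prod>i=1..N. ennreal (g (Z i \<omega>))) * 1
          \<le> (\<Prod>i=1..N. ennreal (g (Z i \<omega>))) * (\<Prod>i=1..N. ennreal (F (code n (Z i \<omega>))))"
        by (intro mult_left_mono) auto
      then show ?thesis using True by (simp add: G_def prod.distrib)
    qed simp
  qed
  also have "\<dots> = (\<integral>\<^sup>+ x. G x \<partial>Q) ^ N" by (rule nn_integral_prod[OF G_meas])
  also have "\<dots> \<le> ennreal (exp (- (t\<^sup>2 / 4))) ^ N" by (intro power_mono GQ) auto
  also have "\<dots> = ennreal (exp (- (t\<^sup>2 / 4)) ^ N)" by (simp add: ennreal_power)
  finally show ?thesis .
qed

definition near :: "nat \<Rightarrow> real \<Rightarrow> 'w set" where
  "near N t = {\<omega> \<in> space M. \<forall>k\<in>codes n. \<bar>real (cnt N n k \<omega>) / real N - mm k\<bar> \<le> t}"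

lemma near_sets [measurable]: "near N t \<in> sets M"
  unfolding near_def by (rule sets.sets_Collect_finite_All) (measurable, rule finite_codes)

text \<open>Bounds the density of the tilted law where the frequencies are close to
  \<open>mm\<close>: its logarithm is linear in the frequencies, and at \<open>mm\<close> itself it
  is \<open>N\<close> times an entropy that Jensen's inequality bounds by \<open>H\<close>.\<close>

lemma tilted_product_le:
  assumes N: "1 \<le> N" and \<omega>: "\<omega> \<in> near N t"
    and H: "ent Q f \<noteq> \<infinity>" "H = enn2real (ent Q f)"
    and t: "0 \<le> t" "t * (\<Sum>k\<in>codes n. \<bar>ln (mm k / C.q k)\<bar>) \<le> \<epsilon>"
  shows "(\<Prod>i=1..N. ennreal (g (Z i \<omega>))) \<le> ennreal (exp (real N * (H + \<epsilon>)))"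
proof (cases "\<exists>i\<in>{1..N}. g (Z i \<omega>) = 0")
  case True
  then obtain i where "i \<in> {1..N}" "g (Z i \<omega>) = 0" by blast
  then have "(\<Prod>i=1..N. ennreal (g (Z i \<omega>))) = 0" by (intro prod_zero bexI[of _ i]) auto
  then show ?thesis by (simp only: zero_le)
next
  case False
  then have pos: "0 < g (Z i \<omega>)" if "i \<in> {1..N}" for i
    using is_densD(2)[OF g_dens', of "Z i \<omega>"] that by (auto simp: less_le)
  have \<omega>M: "\<omega> \<in> space M" using \<omega> by (simp add: near_def)
  let ?l = "\<lambda>k. ln (mm k / C.q k)"
  have entg: "(\<Sum>k\<in>codes n. mm k * ?l k) \<le> H"
  proof -
    have "ennreal (\<Sum>k\<in>codes n. phi (mm k / C.q k) * C.q k) \<le> ent Q f"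
      using C.ent_avg_le[OF f H(1) refl] unfolding mm_def[symmetric] C.ent_avg[OF mm_weights] .
    also have "\<dots> = ennreal H" using H by (simp add: less_top)
    finally show ?thesis unfolding C.ent_avg_ln[OF mm_weights, symmetric] using H by (simp add: ennreal_le_iff)
  qed
  have "(\<Sum>i=1..N. ln (g (Z i \<omega>))) = (\<Sum>k\<in>codes n. ?l k * real (cnt N n k \<omega>))"
    unfolding g_def avg_def by (rule sum_code_cnt[OF \<omega>M])
  also have "\<dots> \<le> (\<Sum>k\<in>codes n. real N * (mm k * ?l k + t * \<bar>?l k\<bar>))"
  proof (rule sum_mono)
    fix k assume k: "k \<in> codes n"
    let ?d = "real (cnt N n k \<omega>) / real N - mm k"
    have "?l k * ?d \<le> \<bar>?l k\<bar> * \<bar>?d\<bar>" by (metis abs_ge_self abs_mult)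
    also have "\<dots> \<le> \<bar>?l k\<bar> * t" using \<omega> k by (intro mult_left_mono) (auto simp: near_def)
    finally have "real N * (?l k * ?d) \<le> real N * (\<bar>?l k\<bar> * t)" by (intro mult_left_mono) auto
    moreover have "real N * (?l k * ?d) = ?l k * real (cnt N n k \<omega>) - real N * (mm k * ?l k)"
      using N by (simp add: field_simps)
    ultimately show "?l k * real (cnt N n k \<omega>) \<le> real N * (mm k * ?l k + t * \<bar>?l k\<bar>)"
      by (simp add: algebra_simps)
  qed
  also have "\<dots> = real N * ((\<Sum>k\<in>codes n. mm k * ?l k) + t * (\<Sum>k\<in>codes n. \<bar>?l k\<bar>))"
    by (simp add: sum_distrib_left[symmetric] sum.distrib)
  also have "\<dots> \<le> real N * (H + \<epsilon>)" using entg t by (intro mult_left_mono add_mono) auto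
  finally have "exp (\<Sum>i=1..N. ln (g (Z i \<omega>))) \<le> exp (real N * (H + \<epsilon>))" by simp
  moreover have "exp (\<Sum>i=1..N. ln (g (Z i \<omega>))) = (\<Prod>i=1..N. g (Z i \<omega>))" using pos by (simp add: exp_sum)
  ultimately have "(\<Prod>i=1..N. g (Z i \<omega>)) \<le> exp (real N * (H + \<epsilon>))" by (simp only:)
  then show ?thesis
    using is_densD(2)[OF g_dens'] by (simp add: prod_ennreal ennreal_leI)
qed

text \<open>The tilted law has mass 1. Its deviations, two for each cell, are exponentially small,
  and on \<open>near N t\<close> its density is at most
  \<open>exp (real N * (H + \<epsilon>))\<close>.\<close>

lemma prob_near_ge:
  assumes N: "1 \<le> N" and H: "ent Q f \<noteq> \<infinity>" "H = enn2real (ent Q f)"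
    and t: "0 < t" "t \<le> 1" "t * (\<Sum>k\<in>codes n. \<bar>ln (mm k / C.q k)\<bar>) \<le> \<epsilon>"
  shows "1 - 2 * real (card (codes n)) * exp (- (t\<^sup>2 / 4)) ^ N \<le> exp (real N * (H + \<epsilon>)) * M.prob (near N t)"
proof -
  let ?P = "\<lambda>\<omega>. \<Prod>i=1..N. ennreal (g (Z i \<omega>))"
  let ?r = "exp (- (t\<^sup>2 / 4)) ^ N"
  have P [measurable]: "?P \<in> borel_measurable M" by (rule prod_measurable) measurable
  have cover: "(1::ennreal) \<le> indicator (near N t) \<omega> + (\<Sum>k\<in>codes n. indicator (dev N t 1 k) \<omega> + indicator (dev N t (- 1) k) \<omega>)"
    if \<omega>M: "\<omega> \<in> space M" for \<omega>
  proof (cases "\<omega> \<in> near N t")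
    case True then show ?thesis by simp
  next
    case False
    then obtain k where k: "k \<in> codes n" "t < \<bar>real (cnt N n k \<omega>) / real N - mm k\<bar>"
      using \<omega>M by (auto simp: near_def not_le)
    then have "\<omega> \<in> dev N t 1 k \<or> \<omega> \<in> dev N t (- 1) k" using \<omega>M by (auto simp: dev_def abs_if split: if_splits)
    then have "(1::ennreal) \<le> indicator (dev N t 1 k) \<omega> + indicator (dev N t (- 1) k) \<omega>"
      by (auto simp: indicator_def)
    also have "\<dots> \<le> (\<Sum>k\<in>codes n. indicator (dev N t 1 k) \<omega> + indicator (dev N t (- 1) k) \<omega>)"
      by (rule member_le_sum[OF k(1)]) (auto simp: finite_codes)
    finally show ?thesis by (simp add: add_increasing)
  qed
  have "1 = (\<integral>\<^sup>+ x. ennreal (g x) \<partial>Q) ^ N" using is_densD(3)[OF g_dens'] by simp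
  also have "\<dots> = (\<integral>\<^sup>+ \<omega>. ?P \<omega> \<partial>M)" by (rule nn_integral_prod[symmetric]) measurable
  also have "\<dots> \<le> (\<integral>\<^sup>+ \<omega>. ?P \<omega> * (indicator (near N t) \<omega>
      + (\<Sum>k\<in>codes n. indicator (dev N t 1 k) \<omega> + indicator (dev N t (- 1) k) \<omega>)) \<partial>M)"
    using mult_left_mono[OF cover, of _ "?P _"] by (intro nn_integral_mono) auto
  also have "\<dots> = (\<integral>\<^sup>+ \<omega>. ?P \<omega> * indicator (near N t) \<omega> \<partial>M)
      + (\<Sum>k\<in>codes n. (\<integral>\<^sup>+ \<omega>. ?P \<omega> * indicator (dev N t 1 k) \<omega> \<partial>M)
          + (\<integral>\<^sup>+ \<omega>. ?P \<omega> * indicator (dev N t (- 1) k) \<omega> \<partial>M))"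
    by (simp add: distrib_left sum_distrib_left nn_integral_add nn_integral_sum)
  also have "\<dots> \<le> ennreal (exp (real N * (H + \<epsilon>)) * M.prob (near N t)) + (\<Sum>k\<in>codes n. ennreal ?r + ennreal ?r)"
  proof (intro add_mono sum_mono tilted_deviation N t)
    have "(\<integral>\<^sup>+ \<omega>. ?P \<omega> * indicator (near N t) \<omega> \<partial>M)
        \<le> (\<integral>\<^sup>+ \<omega>. ennreal (exp (real N * (H + \<epsilon>))) * indicator (near N t) \<omega> \<partial>M)"
      using tilted_product_le[OF N _ H _ t(3)] t by (intro nn_integral_mono) (auto simp: indicator_def)
    also have "\<dots> = ennreal (exp (real N * (H + \<epsilon>)) * M.prob (near N t))"
      by (simp add: nn_integral_cmult_indicator M.emeasure_eq_measure ennreal_mult')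
    finally show "(\<integral>\<^sup>+ \<omega>. ?P \<omega> * indicator (near N t) \<omega> \<partial>M)
        \<le> ennreal (exp (real N * (H + \<epsilon>)) * M.prob (near N t))" .
  qed auto
  also have "(\<Sum>k\<in>codes n. ennreal ?r + ennreal ?r) = ennreal (real (card (codes n)) * (2 * ?r))"
    by (simp add: ennreal_plus[symmetric] ennreal_mult' ennreal_of_nat_eq_real_of_nat del: ennreal_plus)
  also have "ennreal (exp (real N * (H + \<epsilon>)) * M.prob (near N t)) + ennreal (real (card (codes n)) * (2 * ?r))
      = ennreal (exp (real N * (H + \<epsilon>)) * M.prob (near N t) + real (card (codes n)) * (2 * ?r))"
    by (simp add: ennreal_plus)
  finally have "1 \<le> exp (real N * (H + \<epsilon>)) * M.prob (near N t) + real (card (codes n)) * (2 * ?r)"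
    by (simp only: ennreal_1[symmetric] ennreal_le_iff2) auto
  then show ?thesis by (simp add: ac_simps)
qed

lemma wasserstein_near:
  assumes N: "1 \<le> N" and \<omega>: "\<omega> \<in> near N t" "\<omega> \<notin> bad N n a" and t: "0 \<le> t"
    and a: "0 \<le> a" "Lp_le p (density Q f) (dist_rep n) a"
  shows "wasserstein p m (L N \<omega>) (density Q f) \<le> a + a
    + (\<Sum>k\<in>codes n. \<Sum>l\<in>codes n. mdist m (rep n k) (rep n l)) * (real (card (codes n)) * t) powr (1 / p)"
proof -
  have \<omega>M: "\<omega> \<in> space M" using \<omega> by (simp add: near_def)
  note LB = L_basic[OF N \<omega>M]
  have "(\<Sum>k\<in>codes n. max 0 (cell_mass (L N \<omega>) (code n) k - cell_mass (density Q f) (code n) k))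
      \<le> (\<Sum>k\<in>codes n. t)"
  proof (rule sum_mono)
    fix k assume k: "k \<in> codes n"
    have "\<bar>real (cnt N n k \<omega>) / real N - mm k\<bar> \<le> t" using \<omega>(1) k unfolding near_def by blast
    then show "max 0 (cell_mass (L N \<omega>) (code n) k - cell_mass (density Q f) (code n) k) \<le> t"
      unfolding cell_mass_L[OF N \<omega>M] mm_def using t by (simp add: abs_le_iff)
  qed
  then have "(\<Sum>k\<in>codes n. max 0 (cell_mass (L N \<omega>) (code n) k - cell_mass (density Q f) (code n) k)) powr (1 / p)
      \<le> (real (card (codes n)) * t) powr (1 / p)"
    using p by (intro powr_mono2) (auto intro: sum_nonneg)
  then have "(\<Sum>k\<in>codes n. \<Sum>l\<in>codes n. mdist m (rep n k) (rep n l)) * (\<Sum>k\<in>codes n. max 0 (cell_mass (L N \<omega>) (code n) k - cell_mass (density Q f) (code n) k)) powr (1 / p)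
      \<le> (\<Sum>k\<in>codes n. \<Sum>l\<in>codes n. mdist m (rep n k) (rep n l)) * (real (card (codes n)) * t) powr (1 / p)"
    by (intro mult_left_mono sum_nonneg) auto
  moreover have "wasserstein p m (L N \<omega>) (density Q f) \<le> a + a
      + (\<Sum>k\<in>codes n. \<Sum>l\<in>codes n. mdist m (rep n k) (rep n l)) * (\<Sum>k\<in>codes n. max 0 (cell_mass (L N \<omega>) (code n) k - cell_mass (density Q f) (code n) k)) powr (1 / p)"
    using \<omega> \<omega>M a Q_sets
    by (intro wasserstein_code_le LB prob_space_density f Lp_le_not_bad[OF N] refl) auto
  ultimately show ?thesis by linarith
qed

end

lemma lower_estimate:
  assumes f: "is_dens Q f" and H: "ent Q f \<noteq> \<infinity>" "H = enn2real (ent Q f)"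
    and \<eta>: "0 < \<eta>" and \<epsilon>: "0 < \<epsilon>"
    and A: "\<And>\<omega> N. 1 \<le> N \<Longrightarrow> \<omega> \<in> space M \<Longrightarrow> wasserstein p m (L N \<omega>) (density Q f) < \<eta> \<Longrightarrow> L N \<omega> \<in> A"
    and A_meas: "\<And>N. 1 \<le> N \<Longrightarrow> {\<omega> \<in> space M. L N \<omega> \<in> A} \<in> sets M"
  shows "\<forall>\<^sub>F N in sequentially. exp (- real N * (H + \<epsilon>)) \<le> M.prob {\<omega> \<in> space M. L N \<omega> \<in> A}"
proof -
  \<comment> \<open>The bound 1/2 keeps \<open>H + \<epsilon>'\<close> below the rate
    \<open>H + 1\<close> of the bad event; \<open>\<epsilon>' < \<epsilon>\<close> leaves room for
    the constant factors.\<close>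
  define \<epsilon>' where "\<epsilon>' = min (1 / 2) (\<epsilon> / 2)"
  have \<epsilon>': "0 < \<epsilon>'" "\<epsilon>' \<le> 1 / 2" "\<epsilon>' < \<epsilon>" using \<epsilon> by (auto simp: \<epsilon>'_def)
  have H0: "0 \<le> H" "ent Q f \<le> ennreal H" using H by (simp_all add: less_top)
  \<comment> \<open>Three errors of size \<open>a\<close> stay below \<open>\<eta>\<close>. In
    \<open>\<theta>\<close>, the constant \<open>H + 2\<close> gives the bad event the rate
    \<open>H + 1\<close>.\<close>
  define a where "a = \<eta> / 5"
  define \<theta> where "\<theta> = (H + 2) / a powr p"
  have a: "0 < a" using \<eta> by (simp add: a_def)
  have \<theta>: "0 < \<theta>" "(H + 1) + 1 \<le> \<theta> * a powr p" "H + 1 \<le> \<theta> * a powr p" using a H0 by (auto simp: \<theta>_def)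
  obtain n where n: "kappa \<theta> n \<le> 1" by (rule kappa_le_1[OF \<theta>(1)])
  define mm where "mm = cell_mass (density Q f) (code n)"
  define \<Lambda> where "\<Lambda> = (\<Sum>k\<in>codes n. \<bar>ln (mm k / cell_mass Q (code n) k)\<bar>)"
  define D where "D = (\<Sum>k\<in>codes n. \<Sum>l\<in>codes n. mdist m (rep n k) (rep n l))"
  define c where "c = real (card (codes n))"
  have \<Lambda>: "0 \<le> \<Lambda>" unfolding \<Lambda>_def by (intro sum_nonneg) simp
  have D: "0 \<le> D" unfolding D_def by (intro sum_nonneg) simp
  have c: "0 \<le> c" by (simp add: c_def)
  \<comment> \<open>The three bounds serve Chernoff's estimate, the entropy error
    \<open>\<epsilon>'\<close> and the mismatch error \<open>a\<close>; adding 1 keeps the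
    denominators positive.\<close>
  define t where "t = min 1 (min (\<epsilon>' / (\<Lambda> + 1)) ((a / (D + 1)) powr p / (c + 1)))"
  have t: "0 < t" "t \<le> 1" using \<epsilon>' \<Lambda> a D c by (auto simp: t_def)
  have t\<Lambda>: "t * \<Lambda> \<le> \<epsilon>'"
  proof -
    have "t * \<Lambda> \<le> \<epsilon>' / (\<Lambda> + 1) * (\<Lambda> + 1)" using \<Lambda> \<epsilon>' by (intro mult_mono) (auto simp: t_def)
    then show ?thesis using \<Lambda> by simp
  qed
  have tD: "D * (c * t) powr (1 / p) \<le> a"
  proof -
    have "c * t \<le> (c + 1) * ((a / (D + 1)) powr p / (c + 1))"
      using c t by (intro mult_mono) (auto simp: t_def)
    then have "c * t \<le> (a / (D + 1)) powr p" using c by simp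
    then have "(c * t) powr (1 / p) \<le> ((a / (D + 1)) powr p) powr (1 / p)"
      using p c t by (intro powr_mono2) auto
    then have "(c * t) powr (1 / p) \<le> a / (D + 1)" using p a D by (simp add: powr_powr)
    then have "D * (c * t) powr (1 / p) \<le> D * (a / (D + 1))" using D by (rule mult_left_mono)
    also have "\<dots> \<le> a" using a D by (simp add: field_simps)
    finally show ?thesis .
  qed
  have Lf: "Lp_le p (density Q f) (dist_rep n) a"
    using a by (intro Lp_le_rep[OF f H0(2,1) n \<theta>(1,3)]) auto
  define r where "r = exp (- (t\<^sup>2 / 4))"
  have r: "0 < r" "r < 1" using t by (auto simp: r_def)
  have key: "exp (- real N * (H + \<epsilon>')) * (1 - 2 * c * r ^ N - exp (- (1 / 2)) ^ N) \<le> M.prob {\<omega> \<in> space M. L N \<omega> \<in> A}"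
    if N: "1 \<le> N" for N
  proof -
    let ?G = "near n mm N t"
    have "1 - 2 * c * r ^ N \<le> exp (real N * (H + \<epsilon>')) * M.prob ?G"
      unfolding c_def r_def using t\<Lambda> t unfolding \<Lambda>_def mm_def
      by (intro prob_near_ge[OF f refl refl N H]) auto
    then have "exp (- real N * (H + \<epsilon>')) * (1 - 2 * c * r ^ N)
        \<le> exp (- real N * (H + \<epsilon>')) * (exp (real N * (H + \<epsilon>')) * M.prob ?G)" by (intro mult_left_mono) auto
    also have "\<dots> = M.prob ?G" by (simp add: mult.assoc[symmetric] exp_add[symmetric])
    also have "\<dots> \<le> M.prob (bad N n a \<union> {\<omega> \<in> space M. L N \<omega> \<in> A})"
    proof (rule M.finite_measure_mono)
      show "?G \<subseteq> bad N n a \<union> {\<omega> \<in> space M. L N \<omega> \<in> A}"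
      proof
        fix \<omega> assume \<omega>: "\<omega> \<in> ?G"
        then have \<omega>M: "\<omega> \<in> space M" by (simp add: near_def[OF f mm_def refl])
        show "\<omega> \<in> bad N n a \<union> {\<omega> \<in> space M. L N \<omega> \<in> A}"
        proof (cases "\<omega> \<in> bad N n a")
          case False
          have "wasserstein p m (L N \<omega>) (density Q f) \<le> a + a + D * (c * t) powr (1 / p)"
            unfolding D_def c_def using a t by (intro wasserstein_near[OF f mm_def refl N \<omega> False _ _ Lf]) auto
          also have "\<dots> < \<eta>" using tD a by (simp add: a_def)
          finally show ?thesis using A[OF N \<omega>M] \<omega>M by simp
        qed simp
      qed
    qed (use A_meas[OF N] in auto)
    also have "\<dots> \<le> M.prob (bad N n a) + M.prob {\<omega> \<in> space M. L N \<omega> \<in> A}"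
      using A_meas[OF N] by (intro measure_Un_le) auto
    also have "M.prob (bad N n a) \<le> exp (- real N * (H + 1))" by (rule prob_bad[OF \<theta>(1) n \<theta>(2)])
    also have "exp (- real N * (H + 1)) \<le> exp (- real N * (H + \<epsilon>')) * exp (- (1 / 2)) ^ N"
    proof -
      have "real N * \<epsilon>' \<le> real N * (1 / 2)" using \<epsilon>' by (intro mult_left_mono) auto
      then have "- real N * (H + 1) \<le> - real N * (H + \<epsilon>') + real N * (- (1 / 2))" by (simp add: algebra_simps)
      then have "exp (- real N * (H + 1)) \<le> exp (- real N * (H + \<epsilon>') + real N * (- (1 / 2)))" by simp
      then show ?thesis by (simp only: exp_add exp_of_nat_mult)
    qed
    finally show ?thesis by (simp add: algebra_simps)
  qed
  \<comment> \<open>The limit 1 is positive, so the bracket in \<open>key\<close> eventually exceeds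
    \<open>exp (- (\<epsilon> - \<epsilon>')) ^ N\<close>.\<close>
  have "(\<lambda>N. 1 - 2 * c * r ^ N - exp (- (1 / 2)) ^ N - exp (- (\<epsilon> - \<epsilon>')) ^ N) \<longlonglongrightarrow> 1 - 2 * c * 0 - 0 - 0"
    using r \<epsilon>' by (intro tendsto_intros LIMSEQ_realpow_zero) auto
  then have "\<forall>\<^sub>F N in sequentially. 0 < 1 - 2 * c * r ^ N - exp (- (1 / 2)) ^ N - exp (- (\<epsilon> - \<epsilon>')) ^ N"
    by (intro order_tendstoD(1)[of _ 1]) auto
  then show ?thesis
    using eventually_ge_at_top[of 1]
  proof eventually_elim
    case (elim N)
    have "exp (- real N * (H + \<epsilon>)) = exp (- real N * (H + \<epsilon>')) * exp (real N * - (\<epsilon> - \<epsilon>'))"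
      by (simp add: exp_add[symmetric] algebra_simps)
    also have "\<dots> = exp (- real N * (H + \<epsilon>')) * exp (- (\<epsilon> - \<epsilon>')) ^ N" by (simp only: exp_of_nat_mult)
    also have "\<dots> \<le> exp (- real N * (H + \<epsilon>')) * (1 - 2 * c * r ^ N - exp (- (1 / 2)) ^ N)"
      using elim by (intro mult_left_mono) auto
    finally show ?case using key[OF elim(2)] by linarith
  qed
qed

end

section \<open>Sanov's theorem in the Wasserstein topology\<close>

lemma extended_ln_ge:
  assumes "exp t \<le> P" shows "ereal t \<le> extended_ln (ennreal P)"
proof -
  have P: "0 < P" using assms exp_gt_zero less_le_trans by blast
  have "t \<le> ln P" using assms P by (simp add: ln_ge_iff)
  then show ?thesis using P by (simp add: extended_ln_def ennreal_eq_0_iff)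
qed

lemma extended_ln_le:
  assumes "P \<le> exp t" shows "extended_ln (ennreal P) \<le> ereal t"
proof (cases "0 < P")
  case True
  then have "ln P \<le> t" using assms by (metis ln_exp ln_le_cancel_iff exp_gt_zero)
  then show ?thesis using True by (simp add: extended_ln_def ennreal_eq_0_iff)
next
  case False
  then show ?thesis by (simp add: extended_ln_def ennreal_neg)
qed

lemma limsup_extended_ln_le:
  assumes P: "\<And>N. 1 \<le> N \<Longrightarrow> P N \<le> (1 + (real N + 1) ^ K) * exp (- real N * c)"
  shows "limsup (\<lambda>N. extended_ln (ennreal (P N)) / ereal (real N)) \<le> - ereal c"
proof -
  \<comment> \<open>For \<open>1 \<le> N\<close> the polynomial factor is at most
    \<open>(2 * real N) ^ Suc K\<close>, whose logarithm divided by \<open>N\<close> tends to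
    0.\<close>
  define u where "u N = real (Suc K) * (ln 2 / real N + ln (real N) / real N) - c" for N :: nat
  have "(\<lambda>N. real (Suc K) * (ln 2 / real N + ln (real N) / real N) - c) \<longlonglongrightarrow> real (Suc K) * (0 + 0) - c"
    by (intro tendsto_intros lim_const_over_n lim_ln_over_n)
  then have u: "(\<lambda>N. ereal (u N)) \<longlonglongrightarrow> ereal (- c)" by (simp add: u_def)
  have "\<forall>\<^sub>F N in sequentially. extended_ln (ennreal (P N)) / ereal (real N) \<le> ereal (u N)"
    using eventually_ge_at_top[of 1]
  proof eventually_elim
    case (elim N)
    define x where "x = (real N + 1) ^ K"
    have x: "1 \<le> x" unfolding x_def by (rule one_le_power) simp
    have "1 + x \<le> (real N + 1) * x"
    proof -
      have "1 * x \<le> real N * x" using elim x by (intro mult_right_mono) auto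
      then show ?thesis using x unfolding distrib_right by linarith
    qed
    also have "\<dots> = (real N + 1) ^ Suc K" by (simp add: x_def)
    also have "\<dots> \<le> (2 * real N) ^ Suc K" using elim by (intro power_mono) auto
    also have "\<dots> = exp (real (Suc K) * (ln 2 + ln (real N)))"
    proof -
      have "2 * real N = exp (ln 2 + ln (real N))" using elim by (simp add: exp_add)
      then show ?thesis by (simp only: exp_of_nat_mult)
    qed
    finally have "1 + x \<le> exp (real (Suc K) * (ln 2 + ln (real N)))" .
    then have "(1 + x) * exp (- real N * c) \<le> exp (real (Suc K) * (ln 2 + ln (real N))) * exp (- real N * c)"
      by (intro mult_right_mono) auto
    also have "\<dots> = exp (real N * u N)"
      unfolding exp_add[symmetric] u_def using elim by (simp add: field_simps)
    finally have "P N \<le> exp (real N * u N)" using P[OF elim] by (simp add: x_def)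
    then have "extended_ln (ennreal (P N)) \<le> ereal (real N * u N)" by (rule extended_ln_le)
    then have "extended_ln (ennreal (P N)) \<le> ereal (real N) * ereal (u N)" by simp
    then show ?case using elim by (subst ereal_divide_le_pos) auto
  qed
  then have "limsup (\<lambda>N. extended_ln (ennreal (P N)) / ereal (real N)) \<le> limsup (\<lambda>N. ereal (u N))"
    by (rule Limsup_mono)
  also have "\<dots> = ereal (- c)" using u by (intro lim_imp_Limsup) auto
  finally show ?thesis by simp
qed

lemma liminf_extended_ln_ge:
  assumes P: "\<And>\<epsilon>. 0 < \<epsilon> \<Longrightarrow> \<forall>\<^sub>F N in sequentially. exp (- real N * (h + \<epsilon>)) \<le> P N"
  shows "- ereal h \<le> liminf (\<lambda>N. extended_ln (ennreal (P N)) / ereal (real N))"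
proof (rule ereal_le_epsilon2)
  fix \<epsilon> :: real assume \<epsilon>: "0 < \<epsilon>"
  have "\<forall>\<^sub>F N in sequentially. ereal (- (h + \<epsilon>)) \<le> extended_ln (ennreal (P N)) / ereal (real N)"
    using P[OF \<epsilon>] eventually_ge_at_top[of 1]
  proof eventually_elim
    case (elim N)
    have "ereal (- real N * (h + \<epsilon>)) \<le> extended_ln (ennreal (P N))" by (rule extended_ln_ge[OF elim(1)])
    then have "ereal (real N) * ereal (- (h + \<epsilon>)) \<le> extended_ln (ennreal (P N))"
      by (simp only: times_ereal.simps mult_minus_left mult_minus_right)
    then show ?case using elim(2) by (subst ereal_le_divide_pos) auto
  qed
  then have "ereal (- (h + \<epsilon>)) \<le> liminf (\<lambda>N. extended_ln (ennreal (P N)) / ereal (real N))"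
    by (rule Liminf_bounded)
  then have "ereal (- (h + \<epsilon>)) + ereal \<epsilon> \<le> liminf (\<lambda>N. extended_ln (ennreal (P N)) / ereal (real N)) + ereal \<epsilon>"
    by (rule add_right_mono)
  then show "- ereal h \<le> liminf (\<lambda>N. extended_ln (ennreal (P N)) / ereal (real N)) + ereal \<epsilon>" by simp
qed

lemma rate_function_of_compact:
  assumes H: "Hausdorff_space E" and nonneg: "\<And>x. x \<in> topspace E \<Longrightarrow> 0 \<le> I x"
    and comp: "\<And>c :: real. compactin E {x \<in> topspace E. I x \<le> ereal c}"
  shows "rate_function E I" "good_rate_function E I"
proof -
  have "closedin E {x \<in> topspace E. I x \<le> c}" for c
  proof (cases c)
    case (real r)
    then show ?thesis using comp[of r] H by (simp add: compactin_imp_closedin)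
  next
    case PInf
    then show ?thesis by simp
  next
    case MInf
    have "\<not> I x \<le> - \<infinity>" if "x \<in> topspace E" for x using nonneg[OF that] by auto
    then have "{x \<in> topspace E. I x \<le> c} = {}" unfolding MInf by blast
    then show ?thesis by (simp only: closedin_empty)
  qed
  then show "rate_function E I" using nonneg by (simp add: rate_function_def)
  then show "good_rate_function E I" using comp by (simp add: good_rate_function_def)
qed

context exp_moment_space
begin

abbreviation "J \<equiv> \<lambda>\<mu>. relative_entropy \<mu> Q"

lemma J_le_iff:
  assumes \<mu>: "\<mu> \<in> finite_moment_measures p m" and c: "0 \<le> c"
  shows "J \<mu> \<le> ereal c \<longleftrightarrow> (\<exists>f. is_dens Q f \<and> ent Q f \<le> ennreal c \<and> \<mu> = density Q f)"
proof
  assume *: "J \<mu> \<le> ereal c"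
  have "J \<mu> \<noteq> \<infinity>" using * by auto
  then obtain f where f: "is_dens Q f" "\<mu> = density Q f"
    using relative_entropy_finiteE[OF prob_space_axioms finite_momentD(1)[OF \<mu>]] finite_momentD(2)[OF \<mu>] Q_sets
    by metis
  then have "enn2ereal (ent Q f) \<le> ereal c" using * relative_entropy_density[OF prob_space_axioms f(1)] by simp
  then have "ent Q f \<le> ennreal c" using c by (simp add: less_eq_ennreal.rep_eq enn2ereal_ennreal)
  then show "\<exists>f. is_dens Q f \<and> ent Q f \<le> ennreal c \<and> \<mu> = density Q f" using f by blast
next
  assume "\<exists>f. is_dens Q f \<and> ent Q f \<le> ennreal c \<and> \<mu> = density Q f"
  then show "J \<mu> \<le> ereal c"
    using relative_entropy_density[OF prob_space_axioms] c
    by (auto simp: less_eq_ennreal.rep_eq enn2ereal_ennreal)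
qed

lemma J_nonneg: "\<mu> \<in> finite_moment_measures p m \<Longrightarrow> 0 \<le> J \<mu>"
  using finite_momentD[of \<mu> p] Q_sets by (intro relative_entropy_nonneg prob_space_axioms) auto

lemma J_good: "rate_function (wasserstein_topology p m) J" "good_rate_function (wasserstein_topology p m) J"
proof -
  interpret W: Metric_space "finite_moment_measures p m" "wasserstein p m"
    by (rule Metric_space_wasserstein[OF p])
  have H: "Hausdorff_space (wasserstein_topology p m)"
    unfolding wasserstein_topology_def by (rule W.Hausdorff_space_mtopology)
  have top: "topspace (wasserstein_topology p m) = finite_moment_measures p m"
    by (simp add: wasserstein_topology_def)
  have "compactin (wasserstein_topology p m) {\<mu> \<in> topspace (wasserstein_topology p m). J \<mu> \<le> ereal c}" for c :: real
  proof (cases "0 \<le> c")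
    case False
    have "\<not> J \<mu> \<le> ereal c" if "\<mu> \<in> finite_moment_measures p m" for \<mu>
    proof
      assume "J \<mu> \<le> ereal c"
      then have "0 \<le> ereal c" using J_nonneg[OF that] order_trans by blast
      then show False using False by simp
    qed
    then have "{\<mu> \<in> topspace (wasserstein_topology p m). J \<mu> \<le> ereal c} = {}" unfolding top by blast
    then show ?thesis by (simp only: compactin_empty)
  next
    case c: True
    show ?thesis
      unfolding top unfolding wasserstein_topology_def W.compactin_sequentially
    proof (intro conjI allI impI)
      fix \<sigma> :: "nat \<Rightarrow> 'a measure" assume \<sigma>: "range \<sigma> \<subseteq> {\<mu> \<in> finite_moment_measures p m. J \<mu> \<le> ereal c}"
      then have "\<forall>j. \<exists>f. is_dens Q f \<and> ent Q f \<le> ennreal c \<and> \<sigma> j = density Q f"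
        using J_le_iff[OF _ c] by blast
      from choice[OF this] obtain f
        where "\<forall>j. is_dens Q (f j) \<and> ent Q (f j) \<le> ennreal c \<and> \<sigma> j = density Q (f j)" by (elim exE)
      then have f: "is_dens Q (f j)" "ent Q (f j) \<le> ennreal c" "\<sigma> j = density Q (f j)" for j
        by simp_all
      obtain G r where G: "strict_mono r" "is_dens Q G" "ent Q G \<le> ennreal c"
          "(\<lambda>j. wasserstein p m (density Q (f (r j))) (density Q G)) \<longlonglongrightarrow> 0"
        by (rule ent_sublevel_compact[OF f(1,2) c])
      have fin: "ent Q G \<noteq> \<infinity>" using G(3) by (auto simp: top_unique)
      have GP: "density Q G \<in> finite_moment_measures p m" by (rule density_finite_moment[OF G(2) fin])
      have "limitin W.mtopology (\<sigma> \<circ> r) (density Q G) sequentially"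
      proof -
        have "\<sigma> j \<in> finite_moment_measures p m" for j using \<sigma> by auto
        then show ?thesis
          unfolding W.limitin_metric_dist_null using GP G(4) by (simp add: comp_def f(3))
      qed
      moreover have "J (density Q G) \<le> ereal c" using J_le_iff[OF GP c] G by blast
      ultimately show "\<exists>l r. l \<in> {\<mu> \<in> finite_moment_measures p m. J \<mu> \<le> ereal c} \<and> strict_mono r \<and>
          limitin W.mtopology (\<sigma> \<circ> r) l sequentially" using G(1) GP by blast
    qed auto
  qed
  then show "rate_function (wasserstein_topology p m) J" "good_rate_function (wasserstein_topology p m) J"
    using rate_function_of_compact[OF H] J_nonneg by (auto simp: top)
qed

text \<open>A closed set and a disjoint compact sublevel set have positive distance: otherwise pairs
  at distance tending to 0 would have, along a subsequence, a common limit in both.\<close>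

lemma sublevel_distance:
  assumes A: "closedin (wasserstein_topology p m) A" and c: "0 \<le> c"
    and disj: "\<And>\<mu>. \<mu> \<in> A \<Longrightarrow> ereal c < J \<mu>"
  obtains \<delta> where "0 < \<delta>" "\<And>\<mu> f. \<mu> \<in> A \<Longrightarrow> is_dens Q f \<Longrightarrow> ent Q f \<le> ennreal c \<Longrightarrow>
    \<delta> \<le> wasserstein p m \<mu> (density Q f)"
proof (rule ccontr)
  assume "\<not> thesis"
  interpret W: Metric_space "finite_moment_measures p m" "wasserstein p m"
    by (rule Metric_space_wasserstein[OF p])
  have AP: "A \<subseteq> finite_moment_measures p m" using closedin_subset[OF A] by (simp add: wasserstein_topology_def)
  have "\<exists>z. fst z \<in> A \<and> is_dens Q (snd z) \<and> ent Q (snd z) \<le> ennreal c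
      \<and> wasserstein p m (fst z) (density Q (snd z)) < 1 / real (Suc j)" for j
  proof (rule ccontr)
    assume no: "\<not> ?thesis"
    have "1 / real (Suc j) \<le> wasserstein p m \<mu> (density Q f)"
      if "\<mu> \<in> A" "is_dens Q f" "ent Q f \<le> ennreal c" for \<mu> f
    proof (rule ccontr)
      assume "\<not> ?thesis"
      moreover have "\<not> (fst (\<mu>, f) \<in> A \<and> is_dens Q (snd (\<mu>, f)) \<and> ent Q (snd (\<mu>, f)) \<le> ennreal c
          \<and> wasserstein p m (fst (\<mu>, f)) (density Q (snd (\<mu>, f))) < 1 / real (Suc j))"
        using no by blast
      ultimately show False using that by (simp only: fst_conv snd_conv not_le) blast
    qed
    then show False using that[of "1 / real (Suc j)"] \<open>\<not> thesis\<close> by simp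
  qed
  then obtain z where z: "\<And>j. fst (z j) \<in> A \<and> is_dens Q (snd (z j)) \<and> ent Q (snd (z j)) \<le> ennreal c
      \<and> wasserstein p m (fst (z j)) (density Q (snd (z j))) < 1 / real (Suc j)"
    using choice[of "\<lambda>j z. fst z \<in> A \<and> is_dens Q (snd z) \<and> ent Q (snd z) \<le> ennreal c
      \<and> wasserstein p m (fst z) (density Q (snd z)) < 1 / real (Suc j)"] by blast
  define \<mu> where "\<mu> j = fst (z j)" for j
  define f where "f j = snd (z j)" for j
  have f: "\<mu> j \<in> A" "is_dens Q (f j)" "ent Q (f j) \<le> ennreal c"
      "wasserstein p m (\<mu> j) (density Q (f j)) < 1 / real (Suc j)" for j
    using z[of j] by (simp_all add: \<mu>_def f_def)
  obtain G r where G: "strict_mono r" "is_dens Q G" "ent Q G \<le> ennreal c"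
      "(\<lambda>j. wasserstein p m (density Q (f (r j))) (density Q G)) \<longlonglongrightarrow> 0"
    by (rule ent_sublevel_compact[OF f(2,3) c])
  have P: "density Q h \<in> finite_moment_measures p m" if "is_dens Q h" "ent Q h \<le> ennreal c" for h
    using that by (intro density_finite_moment) (auto simp: top_unique)
  have "(\<lambda>j. wasserstein p m (\<mu> (r j)) (density Q G)) \<longlonglongrightarrow> 0"
  proof (rule tendsto_sandwich[of "\<lambda>_. 0"])
    show "\<forall>\<^sub>F j in sequentially. wasserstein p m (\<mu> (r j)) (density Q G)
        \<le> 1 / real (Suc j) + wasserstein p m (density Q (f (r j))) (density Q G)"
    proof (rule always_eventually, rule allI)
      fix j
      have "1 / real (Suc (r j)) \<le> 1 / real (Suc j)"
        using seq_suble[OF G(1), of j] by (intro divide_left_mono) auto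
      moreover have "wasserstein p m (\<mu> (r j)) (density Q G)
          \<le> wasserstein p m (\<mu> (r j)) (density Q (f (r j))) + wasserstein p m (density Q (f (r j))) (density Q G)"
        by (rule W.triangle[OF subsetD[OF AP f(1)] P[OF f(2,3)] P[OF G(2,3)]])
      ultimately show "wasserstein p m (\<mu> (r j)) (density Q G)
          \<le> 1 / real (Suc j) + wasserstein p m (density Q (f (r j))) (density Q G)"
        using f(4)[of "r j"] by linarith
    qed
    have "(\<lambda>j. 1 / real (Suc j) + wasserstein p m (density Q (f (r j))) (density Q G)) \<longlonglongrightarrow> 0 + 0"
      by (intro tendsto_add G(4)) (rule LIMSEQ_Suc[OF lim_const_over_n])
    then show "(\<lambda>j. 1 / real (Suc j) + wasserstein p m (density Q (f (r j))) (density Q G)) \<longlonglongrightarrow> 0" by simp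
  qed (auto simp: wasserstein_nonneg)
  then have "limitin W.mtopology (\<lambda>j. \<mu> (r j)) (density Q G) sequentially"
    unfolding W.limitin_metric_dist_null using P[OF G(2,3)] subsetD[OF AP f(1)] by simp
  then have "density Q G \<in> A"
    using A f(1) limitin_closedin[of W.mtopology "\<lambda>j. \<mu> (r j)" "density Q G" sequentially A]
    by (simp add: wasserstein_topology_def)
  then show False using disj[of "density Q G"] J_le_iff[OF P[OF G(2,3)] c] G by fastforce
qed

end

context iid_sample
begin

theorem sanov_wasserstein:
  "satisfies_LDP M (wasserstein_topology p m) L (\<lambda>N. real N) J"
  unfolding satisfies_LDP_def
proof (intro conjI ballI allI impI)
  let ?WT = "wasserstein_topology p m"
  interpret W: Metric_space "finite_moment_measures p m" "wasserstein p m"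
    by (rule Metric_space_wasserstein[OF p])
  show "rate_function ?WT J" by (rule J_good)
  show "0 < real N" if "1 \<le> N" for N using that by simp
  show "filterlim (\<lambda>N. real N) at_top sequentially" by (rule filterlim_real_sequentially)
  show "L N \<in> M \<rightarrow>\<^sub>M borel_of ?WT" if "1 \<le> N" for N by (rule L_measurable[OF that])
  fix A assume A: "A \<in> sets (borel_of ?WT)"
  define P where "P N = M.prob {\<omega> \<in> space M. L N \<omega> \<in> A}" for N
  have Lmeas: "{\<omega> \<in> space M. L N \<omega> \<in> B} \<in> sets M" if "1 \<le> N" "B \<in> sets (borel_of ?WT)" for N B
    using measurable_sets[OF L_measurable[OF that(1)] that(2)] by (simp add: vimage_def Int_def conj_commute)
  have "emeasure (distr M (borel_of ?WT) (L N)) A = ennreal (P N)" if "1 \<le> N" for N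
    unfolding P_def emeasure_distr[OF L_measurable[OF that] A]
    by (simp add: M.emeasure_eq_measure vimage_def Int_def conj_commute)
  then have ev: "\<forall>\<^sub>F N in sequentially. extended_ln (emeasure (distr M (borel_of ?WT) (L N)) A) / ereal (real N)
      = extended_ln (ennreal (P N)) / ereal (real N)"
    by (intro eventually_mono[OF eventually_ge_at_top[of 1]]) simp
  note eqs = Liminf_eq[OF ev] Limsup_eq[OF ev]
  show "- (INF x\<in>?WT interior_of A. J x)
      \<le> liminf (\<lambda>N. extended_ln (emeasure (distr M (borel_of ?WT) (L N)) A) / ereal (real N))"
    unfolding eqs
  proof (subst ereal_uminus_le_reorder, rule INF_greatest)
    fix x assume x: "x \<in> ?WT interior_of A"
    then obtain U where U: "openin W.mtopology U" "x \<in> U" "U \<subseteq> A"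
      by (auto simp: interior_of_def wasserstein_topology_def)
    then obtain \<eta> where \<eta>: "0 < \<eta>" "W.mball x \<eta> \<subseteq> A" unfolding W.openin_mtopology by blast
    have xP: "x \<in> finite_moment_measures p m" using openin_subset[OF U(1)] U(2) by auto
    show "- liminf (\<lambda>N. extended_ln (ennreal (P N)) / ereal (real N)) \<le> J x"
    proof (cases "J x")
      case (real h)
      have h: "0 \<le> h" using J_nonneg[OF xP] real by simp
      obtain f where f: "is_dens Q f" "ent Q f \<le> ennreal h" "x = density Q f"
        using J_le_iff[OF xP h] real by auto
      have fin: "ent Q f \<noteq> \<infinity>" using f(2) by (auto simp: top_unique)
      have H: "h = enn2real (ent Q f)"
        using relative_entropy_density[OF prob_space_axioms f(1)] real f(3) fin
        by (cases "ent Q f") (auto simp: enn2ereal_ennreal)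
      have "- ereal h \<le> liminf (\<lambda>N. extended_ln (ennreal (P N)) / ereal (real N))"
      proof (rule liminf_extended_ln_ge)
        fix \<epsilon> :: real assume "0 < \<epsilon>"
        then show "\<forall>\<^sub>F N in sequentially. exp (- real N * (h + \<epsilon>)) \<le> P N"
          unfolding P_def
        proof (rule lower_estimate[OF f(1) fin H \<eta>(1)])
          fix \<omega> N assume "1 \<le> N" "\<omega> \<in> space M" "wasserstein p m (L N \<omega>) (density Q f) < \<eta>"
          then have "L N \<omega> \<in> W.mball x \<eta>"
            using L_basic(4) xP f(3) by (auto simp: W.commute)
          then show "L N \<omega> \<in> A" using \<eta> by auto
        qed (rule Lmeas[OF _ A])
      qed
      then show ?thesis using real by (simp add: ereal_uminus_le_reorder)
    next
      case PInf then show ?thesis by simp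
    next
      case MInf then show ?thesis using J_nonneg[OF xP] by simp
    qed
  qed
  show "liminf (\<lambda>N. extended_ln (emeasure (distr M (borel_of ?WT) (L N)) A) / ereal (real N))
      \<le> limsup (\<lambda>N. extended_ln (emeasure (distr M (borel_of ?WT) (L N)) A) / ereal (real N))"
    by (rule Liminf_le_Limsup) simp
  \<comment> \<open>\<open>sublevel_distance\<close> needs a finite level strictly below the
    infimum, which may be infinite; \<open>dense_le\<close> passes to the infimum at the
    end.\<close>
  have ub: "limsup (\<lambda>N. extended_ln (ennreal (P N)) / ereal (real N)) \<le> - w"
    if w: "w < (INF x\<in>?WT closure_of A. J x)" for w
  proof -
    have AT: "A \<subseteq> topspace ?WT" using sets.sets_into_space[OF A] by simp
    then have Acl: "A \<subseteq> ?WT closure_of A" by (rule closure_of_subset)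
    have real_case: "limsup (\<lambda>N. extended_ln (ennreal (P N)) / ereal (real N)) \<le> - ereal c"
      if c: "0 \<le> c" "ereal c < (INF x\<in>?WT closure_of A. J x)" for c
    proof -
      have "ereal c < J \<mu>" if "\<mu> \<in> ?WT closure_of A" for \<mu>
        using c(2) INF_lower[OF that, of J] by (rule less_le_trans)
      then obtain \<delta> where \<delta>: "0 < \<delta>" "\<And>\<mu> f. \<mu> \<in> ?WT closure_of A \<Longrightarrow> is_dens Q f \<Longrightarrow> ent Q f \<le> ennreal c \<Longrightarrow>
          \<delta> \<le> wasserstein p m \<mu> (density Q f)"
        using sublevel_distance[OF closedin_closure_of c(1), of A] by blast
      obtain K where "\<And>N. 1 \<le> N \<Longrightarrow> P N \<le> (1 + (real N + 1) ^ K) * exp (- real N * c)"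
        unfolding P_def using upper_estimate[OF c(1) \<delta>(1), of A] \<delta>(2) Acl by blast
      then show ?thesis by (rule limsup_extended_ln_le)
    qed
    \<comment> \<open>Covers negative levels: probabilities are at most 1.\<close>
    have triv: "limsup (\<lambda>N. extended_ln (ennreal (P N)) / ereal (real N)) \<le> - ereal 0"
      by (rule limsup_extended_ln_le[of P 0]) (auto simp: P_def intro: order_trans[OF M.prob_le_1])
    show ?thesis
    proof (cases w)
      case (real c)
      show ?thesis
      proof (cases "0 \<le> c")
        case True
        then show ?thesis using real_case[OF True] w real by simp
      next
        case False
        then have "- ereal 0 \<le> - w" using real by simp
        then show ?thesis using triv order_trans by blast
      qed
    qed (use w in auto)
  qed
  show "limsup (\<lambda>N. extended_ln (emeasure (distr M (borel_of ?WT) (L N)) A) / ereal (real N))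
      \<le> - (INF x\<in>?WT closure_of A. J x)"
  proof -
    have "(INF x\<in>?WT closure_of A. J x) \<le> - limsup (\<lambda>N. extended_ln (ennreal (P N)) / ereal (real N))"
    proof (rule dense_le)
      fix w assume "w < (INF x\<in>?WT closure_of A. J x)"
      from ub[OF this] show "w \<le> - limsup (\<lambda>N. extended_ln (ennreal (P N)) / ereal (real N))"
        by (metis ereal_minus_le_minus ereal_uminus_uminus)
    qed
    then show ?thesis unfolding eqs by (metis ereal_minus_le_minus ereal_uminus_uminus)
  qed
qed

end

section \<open>Contraction along a continuous bijection\<close>

lemma borel_of_measurable_continuous:
  assumes "continuous_map E E' \<Psi>" shows "\<Psi> \<in> borel_of E \<rightarrow>\<^sub>M borel_of E'"
proof -
  have "\<Psi> \<in> measurable (borel_of E) (measure_of (topspace E') {U. openin E' U} (\<lambda>_. 0))"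
  proof (rule measurable_measure_of)
    show "{U. openin E' U} \<subseteq> Pow (topspace E')" using openin_subset by fastforce
    show "\<Psi> \<in> space (borel_of E) \<rightarrow> topspace E'" using continuous_map_funspace[OF assms] by simp
    fix U assume "U \<in> {U. openin E' U}"
    then have "openin E {x \<in> topspace E. \<Psi> x \<in> U}" using assms openin_continuous_map_preimage by fastforce
    then show "\<Psi> -` U \<inter> space (borel_of E) \<in> sets (borel_of E)"
      by (simp add: sets_borel_of vimage_def Int_def conj_commute sigma_sets.Basic)
  qed
  then show ?thesis by (simp add: borel_of_def)
qed

text \<open>Injectivity reduces the infimum over a fibre to the single value at
  \<open>\<Theta> y\<close>. By continuity of \<open>\<Psi>\<close>, preimages of open sets are open
  and images of closures lie in closures, which transfers the two bounds; sublevel sets are images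
  of compact sets.\<close>

lemma LDP_contraction_bijective:
  assumes LDP: "satisfies_LDP M E Y a J" and good: "good_rate_function E J"
    and cont: "continuous_map E E' \<Psi>" and H: "Hausdorff_space E'"
    and \<Theta>: "\<And>y. y \<in> topspace E' \<Longrightarrow> \<Theta> y \<in> topspace E \<and> \<Psi> (\<Theta> y) = y"
    and \<Theta>\<Psi>: "\<And>x. x \<in> topspace E \<Longrightarrow> \<Theta> (\<Psi> x) = x"
    and Y': "\<And>N \<omega>. 1 \<le> N \<Longrightarrow> \<omega> \<in> space M \<Longrightarrow> Y' N \<omega> = \<Psi> (Y N \<omega>)"
    and I: "\<And>y. y \<in> topspace E' \<Longrightarrow> I y = J (\<Theta> y)"
  shows "satisfies_LDP M E' Y' a I \<and> good_rate_function E' I"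
proof -
  have \<Psi>in: "\<Psi> x \<in> topspace E'" if "x \<in> topspace E" for x
    using continuous_map_funspace[OF cont] that by auto
  have I\<Psi>: "I (\<Psi> x) = J x" if "x \<in> topspace E" for x using that I[OF \<Psi>in] \<Theta>\<Psi> by simp
  have sub: "{y \<in> topspace E'. I y \<le> c} = \<Psi> ` {x \<in> topspace E. J x \<le> c}" for c
  proof (intro equalityI subsetI)
    fix y assume "y \<in> {y \<in> topspace E'. I y \<le> c}"
    then show "y \<in> \<Psi> ` {x \<in> topspace E. J x \<le> c}" using \<Theta>[of y] I[of y] by (intro image_eqI[of _ _ "\<Theta> y"]) auto
  qed (use \<Psi>in I\<Psi> in auto)
  have comp: "compactin E' {y \<in> topspace E'. I y \<le> ereal c}" for c
    unfolding sub using good cont by (intro image_compactin) (auto simp: good_rate_function_def)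
  have "0 \<le> I y" if "y \<in> topspace E'" for y
    using good \<Theta>[OF that] I[OF that] by (simp add: good_rate_function_def rate_function_def)
  note rate = rate_function_of_compact[OF H this comp]
  note L = LDP[unfolded satisfies_LDP_def]
  have \<Psi>m: "\<Psi> \<in> borel_of E \<rightarrow>\<^sub>M borel_of E'" by (rule borel_of_measurable_continuous[OF cont])
  have Ym: "Y N \<in> M \<rightarrow>\<^sub>M borel_of E" if "1 \<le> N" for N using L that by blast
  have Y'm: "Y' N \<in> M \<rightarrow>\<^sub>M borel_of E'" if "1 \<le> N" for N
    using measurable_compose[OF Ym[OF that] \<Psi>m] Y'[OF that] by (simp cong: measurable_cong)
  have "- (INF x\<in>E' interior_of A. I x)
          \<le> liminf (\<lambda>N. extended_ln (emeasure (distr M (borel_of E') (Y' N)) A) / ereal (a N)) \<and>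
        liminf (\<lambda>N. extended_ln (emeasure (distr M (borel_of E') (Y' N)) A) / ereal (a N))
          \<le> limsup (\<lambda>N. extended_ln (emeasure (distr M (borel_of E') (Y' N)) A) / ereal (a N)) \<and>
        limsup (\<lambda>N. extended_ln (emeasure (distr M (borel_of E') (Y' N)) A) / ereal (a N))
          \<le> - (INF x\<in>E' closure_of A. I x)" if A: "A \<in> sets (borel_of E')" for A
  proof -
    define B where "B = {x \<in> topspace E. \<Psi> x \<in> A}"
    have B: "B \<in> sets (borel_of E)"
      using measurable_sets[OF \<Psi>m A] by (simp add: B_def vimage_def Int_def conj_commute)
    have AT: "A \<subseteq> topspace E'" using sets.sets_into_space[OF A] by simp
    have "emeasure (distr M (borel_of E') (Y' N)) A = emeasure (distr M (borel_of E) (Y N)) B" if N: "1 \<le> N" for N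
    proof -
      have "Y' N -` A \<inter> space M = Y N -` B \<inter> space M"
        using Y'[OF N] measurable_space[OF Ym[OF N]] by (auto simp: B_def)
      then show ?thesis by (simp add: emeasure_distr[OF Ym[OF N] B] emeasure_distr[OF Y'm[OF N] A])
    qed
    then have ev: "\<forall>\<^sub>F N in sequentially. extended_ln (emeasure (distr M (borel_of E') (Y' N)) A) / ereal (a N)
        = extended_ln (emeasure (distr M (borel_of E) (Y N)) B) / ereal (a N)"
      by (intro eventually_mono[OF eventually_ge_at_top[of 1]]) simp
    note eqs = Liminf_eq[OF ev] Limsup_eq[OF ev]
    have 1: "(INF x\<in>E interior_of B. J x) \<le> (INF y\<in>E' interior_of A. I y)"
    proof (rule INF_greatest)
      fix y assume y: "y \<in> E' interior_of A"
      then obtain U where U: "openin E' U" "y \<in> U" "U \<subseteq> A" by (auto simp: interior_of_def)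
      then have yT: "y \<in> topspace E'" using openin_subset by blast
      have "openin E {x \<in> topspace E. \<Psi> x \<in> U}" by (rule openin_continuous_map_preimage[OF cont U(1)])
      moreover have "{x \<in> topspace E. \<Psi> x \<in> U} \<subseteq> B" using U by (auto simp: B_def)
      moreover have "\<Theta> y \<in> {x \<in> topspace E. \<Psi> x \<in> U}" using \<Theta>[OF yT] U by auto
      ultimately have "\<Theta> y \<in> E interior_of B" by (auto simp: interior_of_def)
      then show "(INF x\<in>E interior_of B. J x) \<le> I y" using I[OF yT] by (simp add: INF_lower)
    qed
    have 2: "(INF y\<in>E' closure_of A. I y) \<le> (INF x\<in>E closure_of B. J x)"
    proof (rule INF_greatest)
      fix x assume x: "x \<in> E closure_of B"
      have "\<Psi> ` (E closure_of B) \<subseteq> E' closure_of (\<Psi> ` B)" using cont by (rule continuous_map_image_closure_subset)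
      also have "\<dots> \<subseteq> E' closure_of A" by (rule closure_of_mono) (auto simp: B_def)
      finally have "\<Psi> x \<in> E' closure_of A" using x by auto
      moreover have "x \<in> topspace E" using x by (meson closure_of_subset_topspace subsetD)
      ultimately show "(INF y\<in>E' closure_of A. I y) \<le> J x" using I\<Psi>[of x] by (metis INF_lower)
    qed
    have LB: "- (INF x\<in>E interior_of B. J x)
          \<le> liminf (\<lambda>N. extended_ln (emeasure (distr M (borel_of E) (Y N)) B) / ereal (a N))"
        "liminf (\<lambda>N. extended_ln (emeasure (distr M (borel_of E) (Y N)) B) / ereal (a N))
          \<le> limsup (\<lambda>N. extended_ln (emeasure (distr M (borel_of E) (Y N)) B) / ereal (a N))"
        "limsup (\<lambda>N. extended_ln (emeasure (distr M (borel_of E) (Y N)) B) / ereal (a N))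
          \<le> - (INF x\<in>E closure_of B. J x)"
      using L B by blast+
    show ?thesis unfolding eqs
      using LB 1 2 by (meson ereal_minus_le_minus order_trans)
  qed
  then show ?thesis using L rate Y'm unfolding satisfies_LDP_def by blast
qed

section \<open>Separability of the spaces of paths and of data\<close>

text \<open>One point is picked from each \<open>F i\<close> that meets the space. Prescribing
  \<open>e 0\<close> allows the exponential moment to be centred there.\<close>

lemma separable_metric_cells:
  fixes F :: "'i::countable \<Rightarrow> 'a set"
  assumes x0: "x0 \<in> mspace m"
    and F: "\<And>x r. x \<in> mspace m \<Longrightarrow> 0 < r \<Longrightarrow> \<exists>i. x \<in> F i \<and> (\<forall>y\<in>F i \<inter> mspace m. mdist m x y < r)"
  obtains e where "separable_metric m e" "e 0 = x0"
proof -
  define g where "g i = (if F i \<inter> mspace m = {} then x0 else SOME y. y \<in> F i \<inter> mspace m)" for i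
  have g: "g i \<in> mspace m" "F i \<inter> mspace m \<noteq> {} \<Longrightarrow> g i \<in> F i" for i
  proof -
    have "(SOME y. y \<in> F i \<inter> mspace m) \<in> F i \<inter> mspace m" if "F i \<inter> mspace m \<noteq> {}"
      using that by (metis some_in_eq)
    then show "g i \<in> mspace m" "F i \<inter> mspace m \<noteq> {} \<Longrightarrow> g i \<in> F i" using x0 by (auto simp: g_def)
  qed
  define e where "e k = (case k of 0 \<Rightarrow> x0 | Suc j \<Rightarrow> g (from_nat j))" for k
  have "separable_metric m e"
  proof
    show "e k \<in> mspace m" for k using x0 g by (simp add: e_def split: nat.split)
    fix x and r :: real assume "x \<in> mspace m" "0 < r"
    then obtain i where i: "x \<in> F i" "\<forall>y\<in>F i \<inter> mspace m. mdist m x y < r" using F by blast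
    have "e (Suc (to_nat i)) = g i" by (simp add: e_def)
    moreover have "mdist m x (g i) < r" using i g[of i] \<open>x \<in> mspace m\<close> by blast
    ultimately show "\<exists>k. mdist m x (e k) < r" by metis
  qed
  moreover have "e 0 = x0" by (simp add: e_def)
  ultimately show ?thesis by (rule that)
qed

text \<open>The dense points may lie outside \<open>S\<close>, so new points are chosen from the
  traces of balls around them.\<close>

lemma separable_metric_subspace:
  assumes "separable_metric m e" and x0: "x0 \<in> S \<inter> mspace m"
  obtains e' where "separable_metric (submetric m S) e'" "e' 0 = x0"
proof (rule separable_metric_cells[of x0 "submetric m S" "\<lambda>(k, j). {x \<in> mspace m. mdist m x (e k) < 1 / real (Suc j)}"])
  interpret separable_metric m e by fact
  show "x0 \<in> mspace (submetric m S)" using x0 by simp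
  fix x r assume x: "x \<in> mspace (submetric m S)" and r: "(0::real) < r"
  obtain j where j: "1 / real (Suc j) < r / 2" using nat_approx_posE[of "r / 2"] r by auto
  obtain k where k: "mdist m x (e k) < 1 / real (Suc j)" using e_dense[of x "1 / real (Suc j)"] x by auto
  have "mdist m x y < r" if "y \<in> mspace m" "mdist m y (e k) < 1 / real (Suc j)" for y
    using mdist_triangle[of x m "e k" y] that x j k by (simp add: mdist_commute)
  then have "x \<in> (case (k, j) of (k, j) \<Rightarrow> {x \<in> mspace m. mdist m x (e k) < 1 / real (Suc j)}) \<and>
      (\<forall>y\<in>(case (k, j) of (k, j) \<Rightarrow> {x \<in> mspace m. mdist m x (e k) < 1 / real (Suc j)}) \<inter> mspace (submetric m S).
        mdist (submetric m S) x y < r)"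
    using x k by auto
  then show "\<exists>i. x \<in> (case i of (k, j) \<Rightarrow> {x \<in> mspace m. mdist m x (e k) < 1 / real (Suc j)}) \<and>
      (\<forall>y\<in>(case i of (k, j) \<Rightarrow> {x \<in> mspace m. mdist m x (e k) < 1 / real (Suc j)}) \<inter> mspace (submetric m S).
        mdist (submetric m S) x y < r)" by blast
qed (use that in blast)

lemma separable_metric_sum:
  assumes "separable_metric m1 e1" "separable_metric m2 e2" and x0: "x0 \<in> mspace m1" "y0 \<in> mspace m2"
  obtains e where "separable_metric (sum_metric m1 m2) e" "e 0 = (x0, y0)"
proof (rule separable_metric_cells[of "(x0, y0)" "sum_metric m1 m2"
      "\<lambda>(k, l, j). {x \<in> mspace m1. mdist m1 x (e1 k) < 1 / real (Suc j)} \<times> {y \<in> mspace m2. mdist m2 y (e2 l) < 1 / real (Suc j)}"])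
  interpret A: separable_metric m1 e1 by fact
  interpret B: separable_metric m2 e2 by fact
  show "(x0, y0) \<in> mspace (sum_metric m1 m2)" using x0 by simp
  fix z r assume z: "z \<in> mspace (sum_metric m1 m2)" and r: "(0::real) < r"
  obtain x y where xy: "z = (x, y)" "x \<in> mspace m1" "y \<in> mspace m2" using z by auto
  obtain j where j: "1 / real (Suc j) < r / 4" using nat_approx_posE[of "r / 4"] r by auto
  obtain k where k: "mdist m1 x (e1 k) < 1 / real (Suc j)" using A.e_dense[of x "1 / real (Suc j)"] xy by auto
  obtain l where l: "mdist m2 y (e2 l) < 1 / real (Suc j)" using B.e_dense[of y "1 / real (Suc j)"] xy by auto
  let ?F = "\<lambda>(k, l, j). {x \<in> mspace m1. mdist m1 x (e1 k) < 1 / real (Suc j)} \<times> {y \<in> mspace m2. mdist m2 y (e2 l) < 1 / real (Suc j)}"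
  have "mdist (sum_metric m1 m2) z w < r" if w: "w \<in> ?F (k, l, j)" for w
  proof -
    obtain x' y' where w': "w = (x', y')" "x' \<in> mspace m1" "y' \<in> mspace m2"
        "mdist m1 x' (e1 k) < 1 / real (Suc j)" "mdist m2 y' (e2 l) < 1 / real (Suc j)" using w by auto
    have "mdist m1 x x' \<le> mdist m1 x (e1 k) + mdist m1 (e1 k) x'" using xy w' by (intro mdist_triangle) auto
    moreover have "mdist m2 y y' \<le> mdist m2 y (e2 l) + mdist m2 (e2 l) y'" using xy w' by (intro mdist_triangle) auto
    ultimately show ?thesis using w' xy k l j by (simp add: mdist_commute)
  qed
  moreover have "z \<in> ?F (k, l, j)" using xy k l by auto
  ultimately show "\<exists>i. z \<in> ?F i \<and> (\<forall>y\<in>?F i \<inter> mspace (sum_metric m1 m2). mdist (sum_metric m1 m2) z y < r)"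
    by blast
qed (use that in blast)

lemma separable_metric_euclidean:
  fixes x0 :: "'a::{metric_space, second_countable_topology}"
  obtains e where "separable_metric (euclidean_metric :: 'a metric) e" "e 0 = x0"
proof -
  obtain D :: "'a set" where D: "countable D" "\<And>X. open X \<Longrightarrow> X \<noteq> {} \<Longrightarrow> \<exists>d\<in>D. d \<in> X"
    using countable_dense_setE by blast
  define e where "e k = (case k of 0 \<Rightarrow> x0 | Suc j \<Rightarrow> from_nat_into D j)" for k
  have "separable_metric euclidean_metric e"
  proof
    fix x :: 'a and r :: real assume r: "0 < r"
    obtain d where d: "d \<in> D" "d \<in> ball x r" using D(2)[of "ball x r"] r by auto
    then obtain j where "from_nat_into D j = d" using from_nat_into_surj[OF D(1)] by blast
    then have "mdist euclidean_metric x (e (Suc j)) < r" using d by (simp add: e_def)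
    then show "\<exists>k. mdist euclidean_metric x (e k) < r" by blast
  qed simp
  then show ?thesis using that[of e] by (simp add: e_def)
qed

text \<open>Continuous functions on a compact interval are bounded, so the boundedness built into
  \<open>cfunspace\<close> disappears.\<close>

lemma mspace_path:
  assumes "0 < T"
  shows "x \<in> mspace (path_metric T) \<longleftrightarrow> continuous_on {0..T} x \<and> x \<in> extensional {0..T}"
  unfolding path_metric_def
  by (subst compactin_mspace_cfunspace) (auto simp: compactin_subtopology)

lemma mdist_path_le:
  assumes "0 < T" "x \<in> mspace (path_metric T)" "y \<in> mspace (path_metric T)"
  shows "mdist (path_metric T) x y \<le> a \<longleftrightarrow> (\<forall>t\<in>{0..T}. norm (x t - y t) \<le> a)"
  using cfunspace_mdist_le[of x "top_of_set {0..T}" euclidean_metric y a] assms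
  unfolding path_metric_def by (simp add: dist_norm)

lemma mdist_path_ge:
  assumes "0 < T" "x \<in> mspace (path_metric T)" "y \<in> mspace (path_metric T)" "t \<in> {0..T}"
  shows "norm (x t - y t) \<le> mdist (path_metric T) x y"
  using mdist_path_le[OF assms(1-3), of "mdist (path_metric T) x y"] assms(4) by auto

lemma continuous_on_restrict: "continuous_on S f \<Longrightarrow> continuous_on S (restrict f S)"
  by (rule continuous_on_eq) auto

definition zero_path :: "real \<Rightarrow> real \<Rightarrow> real^'d" where
  "zero_path T = restrict (\<lambda>_. 0) {0..T}"

lemma zero_path_in:
  "0 < T \<Longrightarrow> zero_path T \<in> mspace (path_metric T :: (real \<Rightarrow> real^'d) metric)"
  "0 < T \<Longrightarrow> zero_path T \<in> mspace (path0_metric T :: (real \<Rightarrow> real^'d) metric)"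
proof -
  have c: "continuous_on {0..T} (zero_path T :: real \<Rightarrow> real^'d)"
    unfolding zero_path_def by (intro continuous_on_restrict continuous_on_const)
  show 1: "0 < T \<Longrightarrow> zero_path T \<in> mspace (path_metric T :: (real \<Rightarrow> real^'d) metric)"
    using c by (simp add: mspace_path) (simp add: zero_path_def)
  show "0 < T \<Longrightarrow> zero_path T \<in> mspace (path0_metric T :: (real \<Rightarrow> real^'d) metric)"
    using 1 by (simp add: path0_metric_def) (simp add: zero_path_def)
qed

text \<open>Paths with the same modulus of continuity and nearly the same values on a grid are close.\<close>
lemma separable_metric_path:
  assumes T: "0 < T"
  obtains e where "separable_metric (path_metric T :: (real \<Rightarrow> real^'d) metric) e"
proof -
  obtain d :: "nat \<Rightarrow> real^'d" where d: "separable_metric euclidean_metric d"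
    using separable_metric_euclidean by blast
  \<comment> \<open>A cell fixes a tolerance \<open>1 / Suc n\<close>, a grid of mesh
    \<open>T / Suc K\<close> on which the path oscillates little, and indices of dense points near
    its values on the grid. There are countably many such triples.\<close>
  define F where "F = (\<lambda>(n::nat, K::nat, l::nat list). {x :: real \<Rightarrow> real^'d.
      (\<forall>s\<in>{0..T}. \<forall>t\<in>{0..T}. \<bar>s - t\<bar> \<le> T / real (Suc K) \<longrightarrow> norm (x s - x t) \<le> 1 / real (Suc n)) \<and>
      (\<forall>j\<le>Suc K. norm (x (real j * (T / real (Suc K))) - d (l ! j)) < 1 / real (Suc n))})"
  show ?thesis
  proof (rule separable_metric_cells[of "zero_path T" "path_metric T" F])
    show "zero_path T \<in> mspace (path_metric T)" by (rule zero_path_in[OF T])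
    fix x :: "real \<Rightarrow> real^'d" and r :: real assume x: "x \<in> mspace (path_metric T)" and r: "0 < r"
    \<comment> \<open>Two oscillations and two grid errors amount to four tolerances; a fifth is
      kept as margin for strictness.\<close>
    obtain n where n: "1 / real (Suc n) < r / 5" using nat_approx_posE[of "r / 5"] r by auto
    let ?n = "1 / real (Suc n)"
    have n0: "0 < ?n" by simp
    have "uniformly_continuous_on {0..T} x" using x T by (intro compact_uniformly_continuous) (auto simp: mspace_path)
    then obtain \<delta> where \<delta>: "0 < \<delta>" "\<And>s t. s \<in> {0..T} \<Longrightarrow> t \<in> {0..T} \<Longrightarrow> dist s t < \<delta> \<Longrightarrow> dist (x s) (x t) < ?n"
      using n0 unfolding uniformly_continuous_on_def by metis
    obtain K where K: "1 / real (Suc K) < \<delta> / T" using nat_approx_posE[of "\<delta> / T"] \<delta> T by auto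
    then have K': "T / real (Suc K) < \<delta>" using T by (simp add: field_simps)
    have "\<exists>k. norm (v - d k) < ?n" for v
      using separable_metric.e_dense[OF d, of v ?n] n0 by (auto simp: dist_norm)
    then obtain \<kappa> where \<kappa>: "\<And>v. norm (v - d (\<kappa> v)) < ?n" by metis
    \<comment> \<open>The grid has \<open>K + 2\<close> points, with index from 0 to
      \<open>Suc K\<close>.\<close>
    define l where "l = map (\<lambda>j. \<kappa> (x (real j * (T / real (Suc K))))) [0..<K + 2]"
    have l: "l ! j = \<kappa> (x (real j * (T / real (Suc K))))" if "j \<le> Suc K" for j
      using that by (simp add: l_def del: upt_Suc)
    have xF: "x \<in> F (n, K, l)"
      unfolding F_def using \<delta>(2) K' \<kappa> l by (force simp: dist_norm intro: less_imp_le)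
    have "mdist (path_metric T) x y < r" if y: "y \<in> F (n, K, l)" "y \<in> mspace (path_metric T)" for y
    proof -
      have "norm (x t - y t) \<le> 4 * ?n" if t: "t \<in> {0..T}" for t
      proof -
        define h where "h = T / real (Suc K)"
        have h: "0 < h" using T by (simp add: h_def)
        define j where "j = nat \<lfloor>t / h\<rfloor>"
        have "0 \<le> t / h" using t h by simp
        then have rj: "real j = of_int \<lfloor>t / h\<rfloor>" by (simp add: j_def)
        have jt: "real j * h \<le> t" "t - real j * h \<le> h"
        proof -
          have "real j \<le> t / h" "t / h < real j + 1" unfolding rj by linarith+
          then show "real j * h \<le> t" "t - real j * h \<le> h" using h by (simp_all add: field_simps)
        qed
        have "real j * h \<le> real (Suc K) * h" using jt(1) t by (simp add: h_def)
        then have jK: "j \<le> Suc K" using h by (metis mult_le_cancel_right_pos of_nat_le_iff)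
        have tj: "real j * h \<in> {0..T}" using jt t h by auto
        have *: "norm (z t - z (real j * h)) \<le> ?n" "norm (z (real j * h) - d (l ! j)) \<le> ?n"
          if "z \<in> F (n, K, l)" for z
        proof -
          have 1: "norm (z s - z t) \<le> ?n" if "s \<in> {0..T}" "t \<in> {0..T}" "\<bar>s - t\<bar> \<le> h" for s t
            using \<open>z \<in> F (n, K, l)\<close> that unfolding F_def h_def by blast
          have 2: "norm (z (real j * h) - d (l ! j)) < ?n" if "j \<le> Suc K" for j
            using \<open>z \<in> F (n, K, l)\<close> that unfolding F_def h_def by blast
          show "norm (z t - z (real j * h)) \<le> ?n" using 1[OF t tj] jt by simp
          show "norm (z (real j * h) - d (l ! j)) \<le> ?n" using 2[OF jK] by simp
        qed
        have "norm (x t - y t) = norm ((x t - x (real j * h)) + (x (real j * h) - d (l ! j))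
            - (y (real j * h) - d (l ! j)) - (y t - y (real j * h)))" by simp
        also have "\<dots> \<le> norm (x t - x (real j * h)) + norm (x (real j * h) - d (l ! j))
            + norm (y (real j * h) - d (l ! j)) + norm (y t - y (real j * h))"
          by (intro order_trans[OF norm_triangle_ineq4] add_right_mono norm_triangle_ineq)
        also have "\<dots> \<le> ?n + ?n + ?n + ?n" by (intro add_mono * xF y)
        finally show ?thesis by simp
      qed
      then have "mdist (path_metric T) x y \<le> 4 * ?n" using mdist_path_le[OF T x y(2)] by blast
      then show ?thesis using n r by linarith
    qed
    then show "\<exists>i. x \<in> F i \<and> (\<forall>y\<in>F i \<inter> mspace (path_metric T). mdist (path_metric T) x y < r)"
      using xF by blast
  qed (use that in blast)
qed

lemma separable_metric_data:
  assumes T: "0 < T" and "\<gamma> \<in> mspace (path0_metric T)"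
  obtains e where "separable_metric (data_metric T :: ((real^'d) \<times> (real \<Rightarrow> real^'d)) metric) e" "e 0 = (x0, \<gamma>)"
proof -
  obtain d :: "nat \<Rightarrow> real^'d" where d: "separable_metric euclidean_metric d"
    using separable_metric_euclidean by blast
  obtain e where e: "separable_metric (path_metric T :: (real \<Rightarrow> real^'d) metric) e"
    using separable_metric_path[OF T] .
  obtain e' where e': "separable_metric (path0_metric T :: (real \<Rightarrow> real^'d) metric) e'"
    unfolding path0_metric_def
    using separable_metric_subspace[OF e, of \<gamma> "{\<gamma>. \<gamma> 0 = 0}"] assms(2) by (auto simp: path0_metric_def)
  show ?thesis by (rule separable_metric_sum[OF d e', of x0 \<gamma>]) (use assms that in auto)
qed

lemma mcomplete_path: "mcomplete_of (path_metric T :: (real \<Rightarrow> real^'d) metric)"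
proof -
  have "Met_TC.Self = (euclidean_metric :: (real^'d) metric)"
    by (simp add: Met_TC.Self_def euclidean_metric_def)
  then show ?thesis
    unfolding path_metric_def
    using Met_TC.mcomplete_cfunspace[where ?'a = "real^'d", of "top_of_set {0..T}"] complete_UNIV
    by (simp add: mcomplete_iff_complete)
qed

lemma Lipschitz_measurable:
  assumes "\<And>x. x \<in> mspace m1 \<Longrightarrow> f x \<in> mspace m2"
    and "\<And>x y. x \<in> mspace m1 \<Longrightarrow> y \<in> mspace m1 \<Longrightarrow> mdist m2 (f x) (f y) \<le> B * mdist m1 x y"
  shows "f \<in> mborel m1 \<rightarrow>\<^sub>M mborel m2"
  using assms by (intro borel_of_measurable_continuous Lipschitz_continuous_imp_continuous_map)
    (auto simp: Lipschitz_continuous_map_def)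

lemma measurable_mborel_euclidean: "measurable M (mborel euclidean_metric) = measurable M borel"
  "measurable (mborel euclidean_metric) M = measurable borel M"
  by (intro measurable_cong_sets; simp add: sets_borel_of_euclidean)+

lemma eval_measurable:
  assumes "0 < T" "t \<in> {0..T}"
  shows "(\<lambda>x. x t) \<in> mborel (path_metric T) \<rightarrow>\<^sub>M mborel (euclidean_metric :: (real^'d) metric)"
  by (rule Lipschitz_measurable[where B = 1]) (use mdist_path_ge[OF assms(1) _ _ assms(2)] in \<open>auto simp: dist_norm\<close>)

lemma time_marginal_eq: "time_marginal \<mu> t = distr \<mu> (mborel euclidean_metric) (\<lambda>x. x t)"
  unfolding time_marginal_def by (rule distr_cong) (simp_all add: sets_borel_of_euclidean)

lemma time_marginal_distr:
  assumes "0 < T" "t \<in> {0..T}" "Y \<in> P \<rightarrow>\<^sub>M mborel (path_metric T)"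
  shows "time_marginal (distr P (mborel (path_metric T)) Y) t = distr P (mborel euclidean_metric) (\<lambda>z. Y z t)"
  unfolding time_marginal_eq
  by (subst distr_distr) (use eval_measurable[OF assms(1,2)] assms(3) in \<open>auto simp: comp_def\<close>)

section \<open>The drift equation along a flow of measures\<close>

lemma set_integral_exp:
  fixes l t C :: real
  assumes l: "0 < l" and t: "0 \<le> t"
  shows "set_integrable lborel {0..t} (\<lambda>s. C * exp (l * s))"
    "(LINT s:{0..t}|lborel. C * exp (l * s)) = C / l * (exp (l * t) - 1)"
proof -
  show 1: "set_integrable lborel {0..t} (\<lambda>s. C * exp (l * s))"
    by (intro borel_integrable_atLeastAtMost') (intro continuous_intros)
  have "((\<lambda>s. C * exp (l * s)) has_integral C / l * exp (l * t) - C / l * exp (l * 0)) {0..t}"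
  proof (rule fundamental_theorem_of_calculus[OF t])
    fix x
    have "((\<lambda>s. C / l * exp (l * s)) has_real_derivative C * exp (l * x)) (at x within {0..t})"
      using l by (auto intro!: derivative_eq_intros)
    then show "((\<lambda>s. C / l * exp (l * s)) has_vector_derivative C * exp (l * x)) (at x within {0..t})"
      by (simp add: has_real_derivative_iff_has_vector_derivative)
  qed
  from integral_unique[OF this] show "(LINT s:{0..t}|lborel. C * exp (l * s)) = C / l * (exp (l * t) - 1)"
    unfolding set_borel_integral_eq_integral(2)[OF 1] by (simp only: right_diff_distrib) simp
qed

text \<open>Integrating \<open>C * exp (l * s)\<close> gains the factor \<open>1 / l\<close>. With
  \<open>C\<close> proportional to the Lipschitz constant, a large rate \<open>l\<close> makes the
  drift term contractive in the exponentially weighted norm.\<close>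

lemma set_integral_diff_exp_le:
  fixes f g :: "real \<Rightarrow> real^'d"
  assumes f: "set_integrable lborel {0..T} f" and g: "set_integrable lborel {0..T} g"
    and t: "t \<in> {0..T}" and l: "0 < l" and C: "0 \<le> C"
    and le: "\<And>s. s \<in> {0..T} \<Longrightarrow> norm (f s - g s) \<le> C * exp (l * s)"
  shows "norm ((LINT s:{0..t}|lborel. f s) - (LINT s:{0..t}|lborel. g s)) \<le> C / l * exp (l * t)"
proof -
  have sub: "set_integrable lborel {0..t} f" "set_integrable lborel {0..t} g"
    using t by (auto intro: set_integrable_subset[OF f] set_integrable_subset[OF g])
  have "(LINT s:{0..t}|lborel. f s) - (LINT s:{0..t}|lborel. g s) = (LINT s:{0..t}|lborel. f s - g s)"
    using sub by (rule set_integral_diff(2)[symmetric])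
  then have "norm ((LINT s:{0..t}|lborel. f s) - (LINT s:{0..t}|lborel. g s))
      \<le> (LINT s:{0..t}|lborel. norm (f s - g s))"
    using set_integral_norm_bound[OF set_integral_diff(1)[OF sub]] by simp
  also have "\<dots> \<le> (LINT s:{0..t}|lborel. C * exp (l * s))"
    using t l le by (intro set_integral_mono set_integrable_norm set_integral_diff(1) sub set_integral_exp(1)) auto
  also have "\<dots> = C / l * (exp (l * t) - 1)" using t l by (intro set_integral_exp) auto
  also have "\<dots> \<le> C / l * exp (l * t)" using l C by (intro mult_left_mono) auto
  finally show ?thesis .
qed

lemma continuous_on_indefinite_set_integral:
  fixes f :: "real \<Rightarrow> real^'d"
  assumes "set_integrable lborel {0..T} f"
  shows "continuous_on {0..T} (\<lambda>t. LINT s:{0..t}|lborel. f s)"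
proof -
  have "f integrable_on {0..T}" by (rule set_borel_integral_eq_integral(1)[OF assms])
  then have "continuous_on {0..T} (\<lambda>t. integral {0..t} f)" by (rule indefinite_integral_continuous_1)
  then show ?thesis
  proof (rule continuous_on_eq)
    fix t assume "t \<in> {0..T}"
    then have "set_integrable lborel {0..t} f" by (intro set_integrable_subset[OF assms]) auto
    from set_borel_integral_eq_integral(2)[OF this]
    show "integral {0..t} f = (LINT s:{0..t}|lborel. f s)" ..
  qed
qed

lemma set_integrable_dominated:
  fixes f g :: "real \<Rightarrow> real^'d"
  assumes f: "set_integrable lborel {0..T} f" and g: "g \<in> borel_measurable (restrict_space borel {0..T})"
    and le: "\<And>s. s \<in> {0..T} \<Longrightarrow> norm (g s) \<le> norm (f s) + C"
  shows "set_integrable lborel {0..T} g"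
  unfolding set_integrable_def
proof (rule Bochner_Integration.integrable_bound)
  have "set_integrable lborel {0..T} (\<lambda>s. C)"
    by (intro borel_integrable_atLeastAtMost' continuous_on_const)
  from set_integral_add(1)[OF set_integrable_norm[OF f] this]
  show "integrable lborel (\<lambda>s. indicator {0..T} s *\<^sub>R (norm (f s) + C))"
    unfolding set_integrable_def .
  show "(\<lambda>s. indicator {0..T} s *\<^sub>R g s) \<in> borel_measurable lborel"
    using g by (simp add: borel_measurable_restrict_space_iff)
  show "AE s in lborel. norm (indicator {0..T} s *\<^sub>R g s) \<le> norm (indicator {0..T} s *\<^sub>R (norm (f s) + C))"
    using le by (auto simp: indicator_def intro!: AE_I2 order_trans[OF le abs_ge_self])
qed

text \<open>What follows from the hypotheses on \<open>b\<close> alone. These bound differences of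
  the drift and not its size, so solvability of the drift equation is not yet available. The
  Lipschitz bound is taken without powers, in the form that \<open>lipschitz_root\<close>
  provides.\<close>

locale drift_base =
  fixes T p L :: real and b :: "real \<Rightarrow> real^'d \<Rightarrow> (real^'d) measure \<Rightarrow> real^'d"
  assumes T: "0 < T" and p: "1 \<le> p" and L: "0 < L"
    and b_meas: "(\<lambda>(t, x, \<mu>). b t x \<mu>) \<in>
      restrict_space borel {0..T} \<Otimes>\<^sub>M borel \<Otimes>\<^sub>M borel_of (wasserstein_topology p euclidean_metric)
        \<rightarrow>\<^sub>M borel"
    and b_lip: "t \<in> {0..T} \<Longrightarrow> \<mu> \<in> finite_moment_measures p euclidean_metric \<Longrightarrow>
      \<mu>' \<in> finite_moment_measures p euclidean_metric \<Longrightarrow>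
      norm (b t x \<mu> - b t x' \<mu>') \<le> L * (norm (x - x') + wasserstein p euclidean_metric \<mu> \<mu>')"
begin

abbreviation "Pd \<equiv> finite_moment_measures p (euclidean_metric :: (real^'d) metric)"
abbreviation "Wd \<equiv> wasserstein p (euclidean_metric :: (real^'d) metric)"
abbreviation "\<delta>0 \<equiv> return (mborel (euclidean_metric :: (real^'d) metric)) 0"
abbreviation "PT \<equiv> path_metric T :: (real \<Rightarrow> real^'d) metric"

text \<open>What makes \<open>b s (x s) (mm s)\<close> measurable in \<open>s\<close> and, by the
  Lipschitz bound, different from \<open>b s 0 \<delta>0\<close> by a bounded amount only.\<close>

definition flow :: "(real \<Rightarrow> (real^'d) measure) \<Rightarrow> bool" where
  "flow mm \<longleftrightarrow> (\<forall>s\<in>{0..T}. mm s \<in> Pd) \<and>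
     mm \<in> restrict_space borel {0..T} \<rightarrow>\<^sub>M borel_of (wasserstein_topology p euclidean_metric) \<and>
     (\<exists>B. \<forall>s\<in>{0..T}. Wd (mm s) \<delta>0 \<le> B)"

lemma Wd_metric: "Metric_space Pd Wd"
proof -
  obtain e :: "nat \<Rightarrow> real^'d" where "separable_metric euclidean_metric e" using separable_metric_euclidean by blast
  then interpret separable_metric "euclidean_metric :: (real^'d) metric" e .
  show ?thesis by (rule Metric_space_wasserstein[OF p])
qed

sublocale Wd: Metric_space Pd Wd by (rule Wd_metric)

lemma delta0: "\<delta>0 \<in> Pd"
proof -
  have "(\<integral>\<^sup>+ x. ennreal (mdist euclidean_metric x 0 powr p) \<partial>\<delta>0) = 0"
  proof (subst nn_integral_return)
    show "(\<lambda>x :: real^'d. ennreal (mdist euclidean_metric x 0 powr p)) \<in> borel_measurable (mborel euclidean_metric)"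
      unfolding measurable_mborel_euclidean by simp
  qed (use p in auto)
  then have "(\<integral>\<^sup>+ x. ennreal (mdist euclidean_metric x 0 powr p) \<partial>\<delta>0) < \<infinity>" by simp
  then show ?thesis
    unfolding finite_moment_measures_def
    by (intro CollectI conjI bexI[of _ "0 :: real^'d"] prob_space_return) simp_all
qed

lemma flow_dist:
  assumes "flow mm" "flow mm'"
  obtains B where "0 \<le> B" "\<And>s. s \<in> {0..T} \<Longrightarrow> Wd (mm s) (mm' s) \<le> B"
proof -
  obtain B1 B2 where B: "\<And>s. s \<in> {0..T} \<Longrightarrow> Wd (mm s) \<delta>0 \<le> B1" "\<And>s. s \<in> {0..T} \<Longrightarrow> Wd (mm' s) \<delta>0 \<le> B2"
    using assms unfolding flow_def by blast
  have "Wd (mm s) (mm' s) \<le> max 0 (B1 + B2)" if "s \<in> {0..T}" for s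
    using Wd.triangle[of "mm s" \<delta>0 "mm' s"] B[OF that] that assms delta0
    by (auto simp: flow_def Wd.commute)
  then show ?thesis using that[of "max 0 (B1 + B2)"] by simp
qed

lemma drift_meas:
  assumes mm: "flow mm" and x: "continuous_on {0..T} x"
  shows "(\<lambda>s. b s (x s) (mm s)) \<in> borel_measurable (restrict_space borel {0..T})"
proof -
  have "(\<lambda>s. (s, x s, mm s)) \<in> restrict_space borel {0..T} \<rightarrow>\<^sub>M
      restrict_space borel {0..T} \<Otimes>\<^sub>M borel \<Otimes>\<^sub>M borel_of (wasserstein_topology p euclidean_metric)"
    using mm borel_measurable_continuous_on_restrict[OF x] by (intro measurable_Pair) (auto simp: flow_def)
  from measurable_compose[OF this b_meas] show ?thesis by simp
qed

lemma path_bound: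
  assumes "x \<in> mspace PT" "y \<in> mspace PT"
  obtains B where "\<And>s. s \<in> {0..T} \<Longrightarrow> norm (x s - y s) \<le> B"
  using mdist_path_ge[OF T assms] by blast

text \<open>Drifts along two flows and two paths differ by a bounded function of time, so they are
  integrable together. This is used in both directions: to spread integrability from
  \<open>b s 0 \<delta>0\<close>, and to recover it from one known solution.\<close>

lemma drift_int_transfer:
  assumes f: "flow mm" "flow mm'" and x: "x \<in> mspace PT" "x' \<in> mspace PT"
    and int: "set_integrable lborel {0..T} (\<lambda>s. b s (x' s) (mm' s))"
  shows "set_integrable lborel {0..T} (\<lambda>s. b s (x s) (mm s))"
proof -
  obtain B1 where B1: "\<And>s. s \<in> {0..T} \<Longrightarrow> Wd (mm s) (mm' s) \<le> B1" using flow_dist[OF f] by metis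
  obtain B2 where B2: "\<And>s. s \<in> {0..T} \<Longrightarrow> norm (x s - x' s) \<le> B2" using path_bound[OF x] by metis
  show ?thesis
  proof (rule set_integrable_dominated[OF int drift_meas[OF f(1)]])
    show "continuous_on {0..T} x" using x T by (simp add: mspace_path)
    fix s assume s: "s \<in> {0..T}"
    have "norm (b s (x s) (mm s) - b s (x' s) (mm' s)) \<le> L * (norm (x s - x' s) + Wd (mm s) (mm' s))"
      using s f by (intro b_lip) (auto simp: flow_def)
    also have "\<dots> \<le> L * (B2 + B1)" using B1[OF s] B2[OF s] L by (intro mult_left_mono) auto
    finally show "norm (b s (x s) (mm s)) \<le> norm (b s (x' s) (mm' s)) + L * (B2 + B1)"
      using norm_triangle_sub[of "b s (x s) (mm s)" "b s (x' s) (mm' s)"] by linarith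
  qed
qed

lemma flow_const: "flow (\<lambda>_. \<delta>0)"
  unfolding flow_def using delta0
  by (auto simp: wasserstein_topology_def intro!: exI[of _ "Wd \<delta>0 \<delta>0"])

lemma solves_cong:
  assumes "\<And>s. s \<in> {0..T} \<Longrightarrow> f s (x s) = g s (x s)"
  shows "solves_integral_equation T f x0 \<gamma> x \<longleftrightarrow> solves_integral_equation T g x0 \<gamma> x"
proof -
  have "set_integrable lborel {0..T} (\<lambda>s. f s (x s)) \<longleftrightarrow> set_integrable lborel {0..T} (\<lambda>s. g s (x s))"
    using assms by (intro set_integrable_cong) auto
  moreover have "(LINT s:{0..t}|lborel. f s (x s)) = (LINT s:{0..t}|lborel. g s (x s))" if "t \<in> {0..T}" for t
    using assms that by (intro set_lebesgue_integral_cong) auto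
  ultimately show ?thesis by (auto simp: solves_integral_equation_def)
qed

end

text \<open>The added assumption is not among the hypotheses of the theorem; there it is derived
  from the solution of the system with one particle.\<close>

locale drift = drift_base T p L b
  for T p L :: real and b :: "real \<Rightarrow> real^'d \<Rightarrow> (real^'d) measure \<Rightarrow> real^'d" +
  assumes b_int: "set_integrable lborel {0..T} (\<lambda>s. b s 0 \<delta>0)"
begin

lemma drift_int:
  assumes "flow mm" "x \<in> mspace PT"
  shows "set_integrable lborel {0..T} (\<lambda>s. b s (x s) (mm s))"
proof (rule drift_int_transfer[OF assms(1) flow_const assms(2) zero_path_in(1)[OF T]])
  have "set_integrable lborel {0..T} (\<lambda>s. b s (zero_path T s) \<delta>0) \<longleftrightarrow> set_integrable lborel {0..T} (\<lambda>s. b s 0 \<delta>0)"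
    by (intro set_integrable_cong) (auto simp: zero_path_def)
  then show "set_integrable lborel {0..T} (\<lambda>s. b s (zero_path T s) \<delta>0)" using b_int by simp
qed

abbreviation solves :: "(real \<Rightarrow> (real^'d) measure) \<Rightarrow> real^'d \<Rightarrow> (real \<Rightarrow> real^'d) \<Rightarrow> (real \<Rightarrow> real^'d) \<Rightarrow> bool" where
  "solves mm \<equiv> solves_integral_equation T (\<lambda>s y. b s y (mm s))"

text \<open>The exponential weight with rate \<open>4 L\<close> turns Gronwall's inequality into a contraction
  with factor \<open>1/4\<close>.\<close>
lemma solves_stability:
  assumes f: "flow mm" "flow mm'" and s: "solves mm x0 \<gamma> x" "solves mm' x0' \<gamma>' x'"
    and \<xi>: "\<And>t. t \<in> {0..T} \<Longrightarrow> norm (x0 - x0') + norm (\<gamma> t - \<gamma>' t) \<le> \<xi>"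
    and R: "0 \<le> R" "\<And>t. t \<in> {0..T} \<Longrightarrow> Wd (mm t) (mm' t) \<le> R * exp (4 * L * t)"
    and t: "t \<in> {0..T}"
  shows "norm (x t - x' t) \<le> exp (4 * L * t) * (4 / 3 * \<xi> + R / 3)"
proof -
  let ?l = "4 * L"
  have l: "0 < ?l" using L by simp
  have x: "x \<in> mspace PT" "x' \<in> mspace PT" using s by (auto simp: solves_integral_equation_def)
  define w where "w t = exp (- (?l * t)) * norm (x t - x' t)" for t
  have "continuous_on {0..T} w"
    unfolding w_def using x T by (intro continuous_intros) (auto simp: mspace_path)
  then obtain t0 where t0: "t0 \<in> {0..T}" "\<And>t. t \<in> {0..T} \<Longrightarrow> w t \<le> w t0"
    using continuous_attains_sup[of "{0..T}" w] T by (auto simp: compact_Icc)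
  define W where "W = w t0"
  have W0: "0 \<le> W" by (simp add: W_def w_def)
  have xW: "norm (x t - x' t) \<le> W * exp (?l * t)" if "t \<in> {0..T}" for t
  proof -
    have "exp (?l * t) * w t \<le> exp (?l * t) * W" using t0(2)[OF that] by (intro mult_left_mono) (auto simp: W_def)
    moreover have "exp (?l * t) * w t = norm (x t - x' t)"
      unfolding w_def mult.assoc[symmetric] exp_add[symmetric] by simp
    ultimately show ?thesis by (simp only: mult.commute[of W])
  qed
  have \<xi>0: "0 \<le> \<xi>" using \<xi>[OF t] by (meson add_nonneg_nonneg norm_ge_zero order_trans)
  have main: "w t \<le> \<xi> + (W + R) / 4" if t: "t \<in> {0..T}" for t
  proof -
    let ?I = "\<lambda>x mm. LINT s:{0..t}|lborel. b s (x s) (mm s)"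
    have I: "norm (?I x mm - ?I x' mm') \<le> L * (W + R) / ?l * exp (?l * t)"
    proof (rule set_integral_diff_exp_le[OF drift_int[OF f(1) x(1)] drift_int[OF f(2) x(2)] t l])
      show "0 \<le> L * (W + R)" using L W0 R by simp
      fix s assume s: "s \<in> {0..T}"
      have "norm (b s (x s) (mm s) - b s (x' s) (mm' s)) \<le> L * (norm (x s - x' s) + Wd (mm s) (mm' s))"
        using s f by (intro b_lip) (auto simp: flow_def)
      also have "\<dots> \<le> L * (W * exp (?l * s) + R * exp (?l * s))"
        using xW[OF s] R(2)[OF s] L by (intro mult_left_mono add_mono) auto
      finally show "norm (b s (x s) (mm s) - b s (x' s) (mm' s)) \<le> L * (W + R) * exp (?l * s)"
        by (simp add: algebra_simps)
    qed
    have "x t - x' t = (x0 - x0') + (?I x mm - ?I x' mm') + (\<gamma> t - \<gamma>' t)"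
      using s t by (simp add: solves_integral_equation_def)
    then have "norm (x t - x' t) \<le> norm (x0 - x0') + norm (?I x mm - ?I x' mm') + norm (\<gamma> t - \<gamma>' t)"
      using norm_triangle_ineq[of "(x0 - x0') + (?I x mm - ?I x' mm')" "\<gamma> t - \<gamma>' t"]
        norm_triangle_ineq[of "x0 - x0'" "?I x mm - ?I x' mm'"] by simp
    also have "\<dots> \<le> \<xi> + (W + R) / 4 * exp (?l * t)" using I \<xi>[OF t] L by simp
    finally have "w t \<le> exp (- (?l * t)) * (\<xi> + (W + R) / 4 * exp (?l * t))"
      unfolding w_def by (intro mult_left_mono) auto
    also have "\<dots> = exp (- (?l * t)) * \<xi> + (W + R) / 4"
      by (simp add: distrib_left exp_minus)
    also have "exp (- (?l * t)) * \<xi> \<le> 1 * \<xi>" using t l \<xi>0 by (intro mult_right_mono) auto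
    finally show ?thesis by simp
  qed
  \<comment> \<open>At the maximizer \<open>t0\<close> the estimate bounds \<open>W\<close> by a
    quarter of itself plus the data; solving for \<open>W\<close> produces the constants 4/3 and
    1/3.\<close>
  have "W \<le> \<xi> + (W + R) / 4" using main[OF t0(1)] by (simp only: W_def)
  then have "4 * W \<le> 4 * \<xi> + (W + R)" by (simp add: field_simps)
  then have "W \<le> 4 / 3 * \<xi> + R / 3" by (simp add: field_simps)
  then have "W * exp (?l * t) \<le> (4 / 3 * \<xi> + R / 3) * exp (?l * t)" by (intro mult_right_mono) auto
  from order_trans[OF xW[OF t] this] show ?thesis by (simp only: mult.commute)
qed

lemma solves_unique:
  assumes f: "flow mm" and s: "solves mm x0 \<gamma> x" "solves mm x0 \<gamma> y"
  shows "x = y"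
proof -
  have x: "x \<in> mspace PT" "y \<in> mspace PT" using s by (auto simp: solves_integral_equation_def)
  have "norm (x t - y t) \<le> exp (4 * L * t) * (4 / 3 * 0 + 0 / 3)" if t: "t \<in> {0..T}" for t
    by (rule solves_stability[OF f f s _ _ _ t]) (use f in \<open>auto simp: flow_def\<close>)
  then have "x t = y t" if "t \<in> {0..T}" for t using that by fastforce
  then show ?thesis using x T by (intro extensionalityI[of x "{0..T}"]) (auto simp: mspace_path)
qed

lemma solves_exists:
  assumes f: "flow mm" and \<gamma>: "\<gamma> \<in> mspace PT"
  obtains x where "solves mm x0 \<gamma> x"
proof -
  let ?l = "4 * L"
  have l: "0 < ?l" using L by simp
  interpret P: Metric_space "mspace PT" "mdist PT" by simp
  \<comment> \<open>\<open>E\<close> removes the exponential weight from the unknown, so that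
    \<open>Op\<close> is a contraction for the plain supremum metric of the complete space
    \<open>PT\<close>.\<close>
  define E where "E z = restrict (\<lambda>s. exp (?l * s) *\<^sub>R z s) {0..T}" for z :: "real \<Rightarrow> real^'d"
  define I where "I z t = (LINT s:{0..t}|lborel. b s (E z s) (mm s))" for z t
  define Op where "Op z = restrict (\<lambda>t. exp (- (?l * t)) *\<^sub>R (x0 + I z t + \<gamma> t)) {0..T}" for z
  have c\<gamma>: "continuous_on {0..T} \<gamma>" using \<gamma> T by (simp add: mspace_path)
  have E: "E z \<in> mspace PT" if "z \<in> mspace PT" for z
  proof -
    have "continuous_on {0..T} z" using that T by (simp add: mspace_path)
    then have "continuous_on {0..T} (E z)" unfolding E_def by (intro continuous_on_restrict continuous_intros)
    then show ?thesis using T by (simp add: mspace_path) (simp add: E_def)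
  qed
  have int: "set_integrable lborel {0..T} (\<lambda>s. b s (E z s) (mm s))" if "z \<in> mspace PT" for z
    by (rule drift_int[OF f E[OF that]])
  have cI: "continuous_on {0..T} (I z)" if "z \<in> mspace PT" for z
    unfolding I_def by (rule continuous_on_indefinite_set_integral[OF int[OF that]])
  have Op: "Op z \<in> mspace PT" if "z \<in> mspace PT" for z
  proof -
    have "continuous_on {0..T} (Op z)"
      unfolding Op_def by (intro continuous_on_restrict continuous_intros cI that c\<gamma>)
    then show ?thesis using T by (simp add: mspace_path) (simp add: Op_def)
  qed
  have contr: "mdist PT (Op z) (Op z') \<le> 1 / 4 * mdist PT z z'" if z: "z \<in> mspace PT" "z' \<in> mspace PT" for z z'
  proof -
    let ?d = "mdist PT z z'"
    have "norm (Op z t - Op z' t) \<le> 1 / 4 * ?d" if t: "t \<in> {0..T}" for t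
    proof -
      have "norm (I z t - I z' t) \<le> L * ?d / ?l * exp (?l * t)"
        unfolding I_def
      proof (rule set_integral_diff_exp_le[OF int[OF z(1)] int[OF z(2)] t l])
        show "0 \<le> L * ?d" using L by simp
        fix s assume s: "s \<in> {0..T}"
        have "norm (b s (E z s) (mm s) - b s (E z' s) (mm s)) \<le> L * (norm (E z s - E z' s) + Wd (mm s) (mm s))"
          using s f by (intro b_lip) (auto simp: flow_def)
        also have "Wd (mm s) (mm s) = 0" using f s by (simp add: flow_def)
        also have "norm (E z s - E z' s) = exp (?l * s) * norm (z s - z' s)"
          using s by (simp add: E_def scaleR_diff_right[symmetric])
        also have "L * (exp (?l * s) * norm (z s - z' s) + 0) \<le> L * (exp (?l * s) * ?d + 0)"
          using mdist_path_ge[OF T z s] L by (intro mult_left_mono add_mono) auto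
        finally show "norm (b s (E z s) (mm s) - b s (E z' s) (mm s)) \<le> L * ?d * exp (?l * s)"
          by (simp add: ac_simps)
      qed
      then have "exp (- (?l * t)) * norm (I z t - I z' t) \<le> exp (- (?l * t)) * (?d / 4 * exp (?l * t))"
        using L by (intro mult_left_mono) auto
      also have "\<dots> = 1 / 4 * ?d" by (simp add: exp_minus)
      also have "exp (- (?l * t)) * norm (I z t - I z' t) = norm (Op z t - Op z' t)"
        using t by (simp add: Op_def scaleR_diff_right[symmetric])
      finally show ?thesis .
    qed
    then show ?thesis using mdist_path_le[OF T Op[OF z(1)] Op[OF z(2)]] by blast
  qed
  have "P.mcomplete" using mcomplete_path by (simp add: mcomplete_of_def)
  moreover have "mspace PT \<noteq> {}" using zero_path_in(1)[OF T] by blast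
  ultimately obtain z where z: "z \<in> mspace PT" "Op z = z"
    using P.Banach_fixedpoint_thm[of Op "1 / 4"] Op contr by auto
  have "solves mm x0 \<gamma> (E z)"
    unfolding solves_integral_equation_def
  proof (intro conjI ballI)
    fix t assume t: "t \<in> {0..T}"
    have "E z t = exp (?l * t) *\<^sub>R Op z t" using t z(2) by (simp add: E_def)
    also have "\<dots> = x0 + I z t + \<gamma> t" using t by (simp add: Op_def exp_add[symmetric])
    finally show "E z t = x0 + (LINT s:{0..t}|lborel. b s (E z s) (mm s)) + \<gamma> t" by (simp add: I_def)
  qed (use E int z in auto)
  then show ?thesis by (rule that)
qed

end

section \<open>The McKean--Vlasov map as a homeomorphism of Wasserstein spaces\<close>

context drift_base
begin

abbreviation "DD \<equiv> data_metric T :: ((real^'d) \<times> (real \<Rightarrow> real^'d)) metric"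
abbreviation "PP \<equiv> finite_moment_measures p PT"
abbreviation "PDt \<equiv> finite_moment_measures p DD"
abbreviation "WP \<equiv> wasserstein p PT"
abbreviation "WD \<equiv> wasserstein p DD"

definition "eP = (SOME e. separable_metric PT e)"
definition "eD = (SOME e. separable_metric DD e)"
definition "eE = (SOME e. separable_metric (euclidean_metric :: (real^'d) metric) e)"

lemma sep_PT: "separable_metric PT eP"
  unfolding eP_def using separable_metric_path[OF T] someI_ex by metis

lemma sep_DD: "separable_metric DD eD"
  unfolding eD_def using separable_metric_data[OF T zero_path_in(2)[OF T]] someI_ex by metis

lemma sep_E: "separable_metric (euclidean_metric :: (real^'d) metric) eE"
  unfolding eE_def using separable_metric_euclidean someI_ex by metis

lemmas marginal_distr = time_marginal_distr[OF T]

lemma WP_metric: "Metric_space PP WP"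
  by (rule separable_metric.Metric_space_wasserstein[OF sep_PT p])

lemma WD_metric: "Metric_space PDt WD"
  by (rule separable_metric.Metric_space_wasserstein[OF sep_DD p])

lemma DD_in: "(x, \<gamma>) \<in> mspace DD \<longleftrightarrow> \<gamma> \<in> mspace PT \<and> \<gamma> 0 = 0"
  by (auto simp: path0_metric_def)

lemma mdist_DD: "mdist DD (x, \<gamma>) (x', \<gamma>') = norm (x - x') + mdist PT \<gamma> \<gamma>'"
  by (simp add: path0_metric_def dist_norm)

lemma PP_D:
  assumes "\<mu> \<in> PP"
  shows "prob_space \<mu>" "sets \<mu> = sets (mborel PT)" "space \<mu> = mspace PT"
  using separable_metric.finite_momentD[OF sep_PT assms] by auto

lemma PDt_D:
  assumes "\<nu> \<in> PDt"
  shows "prob_space \<nu>" "sets \<nu> = sets (mborel DD)" "space \<nu> = mspace DD"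
  using separable_metric.finite_momentD[OF sep_DD assms] by auto

lemma PP_Lp:
  assumes "\<mu> \<in> PP" "y \<in> mspace PT"
  obtains a where "Lp_le p \<mu> (\<lambda>x. mdist PT x y) a"
  using separable_metric.finite_moment_iff[OF sep_PT p assms(2)] assms(1) by blast

lemma eval_meas: "t \<in> {0..T} \<Longrightarrow> sets \<mu> = sets (mborel PT) \<Longrightarrow> (\<lambda>x. x t) \<in> \<mu> \<rightarrow>\<^sub>M mborel euclidean_metric"
  using eval_measurable[OF T] by (simp cong: measurable_cong_sets)

lemma eval_meas': "t \<in> {0..T} \<Longrightarrow> sets \<mu> = sets (mborel PT) \<Longrightarrow> (\<lambda>x. x t) \<in> \<mu> \<rightarrow>\<^sub>M borel"
  using eval_meas[of t \<mu>] unfolding measurable_mborel_euclidean .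

lemma Wd_marginal_le:
  assumes P: "prob_space P" and Y: "Y \<in> P \<rightarrow>\<^sub>M mborel PT" "Y' \<in> P \<rightarrow>\<^sub>M mborel PT" and t: "t \<in> {0..T}"
    and L: "Lp_le p P (\<lambda>z. norm (Y z t - Y' z t)) a"
  shows "Wd (time_marginal (distr P (mborel PT) Y) t) (time_marginal (distr P (mborel PT) Y') t) \<le> a"
  unfolding marginal_distr[OF t Y(1)] marginal_distr[OF t Y(2)]
  using L measurable_compose[OF Y(1) eval_meas[OF t refl]] measurable_compose[OF Y(2) eval_meas[OF t refl]]
  by (intro separable_metric.wasserstein_distr_le[OF sep_E P p]) (simp_all add: dist_norm)

lemma Lp_norm_eval:
  assumes \<mu>: "\<mu> \<in> PP" and t: "t \<in> {0..T}" and a: "Lp_le p \<mu> (\<lambda>x. mdist PT x (zero_path T)) a"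
  shows "Lp_le p \<mu> (\<lambda>x. dist (x t) 0) a"
proof (rule Lp_le_mono[OF a])
  have [measurable]: "(\<lambda>x. x t) \<in> \<mu> \<rightarrow>\<^sub>M borel" by (rule eval_meas'[OF t PP_D(2)[OF \<mu>]])
  show "(\<lambda>x. dist (x t) 0) \<in> borel_measurable \<mu>" by measurable
  show "AE x in \<mu>. dist (x t) 0 \<le> mdist PT x (zero_path T)"
    using mdist_path_ge[OF T _ zero_path_in(1)[OF T] t] PP_D[OF \<mu>] t
    by (intro AE_I2) (auto simp: zero_path_def)
qed (use p in auto)

lemma marginal_in:
  assumes \<mu>: "\<mu> \<in> PP" and t: "t \<in> {0..T}"
  shows "time_marginal \<mu> t \<in> Pd"
proof -
  obtain a where a: "Lp_le p \<mu> (\<lambda>x. mdist PT x (zero_path T)) a" using PP_Lp[OF \<mu> zero_path_in(1)[OF T]] .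
  show ?thesis
    unfolding time_marginal_eq
    using Lp_norm_eval[OF \<mu> t a]
    by (intro separable_metric.finite_moment_distr[OF sep_E PP_D(1)[OF \<mu>] p eval_meas[OF t PP_D(2)[OF \<mu>]], of 0 a]) simp_all
qed

lemma Wd_marginal_times:
  assumes \<mu>: "\<mu> \<in> PP" and s: "s \<in> {0..T}" "t \<in> {0..T}"
    and L: "Lp_le p \<mu> (\<lambda>x. norm (x s - x t)) a"
  shows "Wd (time_marginal \<mu> s) (time_marginal \<mu> t) \<le> a"
  unfolding time_marginal_eq
  using L eval_meas[OF s(1) PP_D(2)[OF \<mu>]] eval_meas[OF s(2) PP_D(2)[OF \<mu>]]
  by (intro separable_metric.wasserstein_distr_le[OF sep_E PP_D(1)[OF \<mu>] p]) (simp_all add: dist_norm)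

text \<open>Evaluating one random path at \<open>s n\<close> and at \<open>t\<close> couples the two
  marginals. The cost tends to 0 by dominated convergence, with twice the distance to the zero path
  as majorant before taking powers.\<close>

lemma marginal_continuous:
  assumes \<mu>: "\<mu> \<in> PP" and s: "\<And>n. s n \<in> {0..T}" "t \<in> {0..T}" "s \<longlonglongrightarrow> t"
  shows "(\<lambda>n. Wd (time_marginal \<mu> (s n)) (time_marginal \<mu> t)) \<longlonglongrightarrow> 0"
proof -
  let ?Z = "zero_path T :: real \<Rightarrow> real^'d"
  obtain a where a: "Lp_le p \<mu> (\<lambda>x. mdist PT x ?Z) a" using PP_Lp[OF \<mu> zero_path_in(1)[OF T]] .
  note D = PP_D[OF \<mu>]
  have dm [measurable]: "(\<lambda>x. mdist PT x ?Z) \<in> borel_measurable \<mu>" using a by (simp add: Lp_le_def)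
  have em [measurable]: "(\<lambda>x. x u) \<in> \<mu> \<rightarrow>\<^sub>M borel" if "u \<in> {0..T}" for u by (rule eval_meas'[OF that D(2)])
  have nm: "(\<lambda>x. norm (x (s n) - x t)) \<in> borel_measurable \<mu>" for n
    using em[OF s(1)] em[OF s(2)] by measurable
  have L2: "Lp_le p \<mu> (\<lambda>x. 2 * mdist PT x ?Z) (2 * a)" by (rule Lp_le_cmult[OF a]) simp
  have "(\<lambda>n. \<integral>\<^sup>+ x. ennreal (norm (x (s n) - x t) powr p) \<partial>\<mu>) \<longlonglongrightarrow> (\<integral>\<^sup>+ x. 0 \<partial>\<mu>)"
  proof (rule nn_integral_dominated_convergence)
    show "(\<lambda>x. ennreal (norm (x (s n) - x t) powr p)) \<in> borel_measurable \<mu>" for n using nm[of n] by measurable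
    show "AE x in \<mu>. ennreal (norm (x (s n) - x t) powr p) \<le> ennreal ((2 * mdist PT x ?Z) powr p)" for n
    proof (rule AE_I2, rule ennreal_leI, rule powr_mono2)
      fix x assume "x \<in> space \<mu>"
      then have x: "x \<in> mspace PT" using D by simp
      have "norm (x u) \<le> mdist PT x ?Z" if "u \<in> {0..T}" for u
        using mdist_path_ge[OF T x zero_path_in(1)[OF T] that] that by (simp add: zero_path_def)
      from this[OF s(1)[of n]] this[OF s(2)] show "norm (x (s n) - x t) \<le> 2 * mdist PT x ?Z"
        using norm_triangle_ineq4[of "x (s n)" "x t"] by linarith
    qed (use p in auto)
    show "(\<integral>\<^sup>+ x. ennreal ((2 * mdist PT x ?Z) powr p) \<partial>\<mu>) < \<infinity>"
      using L2 by (auto simp: Lp_le_def intro: le_less_trans)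
    show "AE x in \<mu>. (\<lambda>n. ennreal (norm (x (s n) - x t) powr p)) \<longlonglongrightarrow> 0"
    proof (rule AE_I2)
      fix x assume "x \<in> space \<mu>"
      then have "continuous_on {0..T} x" using D T by (simp add: mspace_path)
      then have "(\<lambda>n. x (s n)) \<longlonglongrightarrow> x t" using s by (intro continuous_on_tendsto_compose[of "{0..T}" x]) auto
      then have "(\<lambda>n. norm (x (s n) - x t)) \<longlonglongrightarrow> 0" using LIM_zero tendsto_norm_zero by blast
      then have "(\<lambda>n. norm (x (s n) - x t) powr p) \<longlonglongrightarrow> 0"
        using p by (intro tendsto_zero_powrI[OF _ tendsto_const]) auto
      from tendsto_ennrealI[OF this] show "(\<lambda>n. ennreal (norm (x (s n) - x t) powr p)) \<longlonglongrightarrow> 0" by simp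
    qed
  qed simp_all
  then have lim: "(\<lambda>n. \<integral>\<^sup>+ x. ennreal (norm (x (s n) - x t) powr p) \<partial>\<mu>) \<longlonglongrightarrow> 0" by simp
  show ?thesis
  proof (rule LIMSEQ_I)
    fix r :: real assume r: "0 < r"
    have "\<forall>\<^sub>F n in sequentially. (\<integral>\<^sup>+ x. ennreal (norm (x (s n) - x t) powr p) \<partial>\<mu>) < ennreal ((r / 2) powr p)"
      using r by (intro order_tendstoD(2)[OF lim]) auto
    then obtain n0 where n0: "\<And>n. n \<ge> n0 \<Longrightarrow> (\<integral>\<^sup>+ x. ennreal (norm (x (s n) - x t) powr p) \<partial>\<mu>) < ennreal ((r / 2) powr p)"
      unfolding eventually_sequentially by blast
    have "norm (Wd (time_marginal \<mu> (s n)) (time_marginal \<mu> t) - 0) < r" if n: "n \<ge> n0" for n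
    proof -
      have "Lp_le p \<mu> (\<lambda>x. norm (x (s n) - x t)) (r / 2)"
        using n0[OF n] r nm[of n] by (simp add: Lp_le_def less_imp_le)
      from Wd_marginal_times[OF \<mu> s(1) s(2) this] show ?thesis
        using r wasserstein_nonneg[of p euclidean_metric "time_marginal \<mu> (s n)" "time_marginal \<mu> t"] by simp
    qed
    then show "\<exists>n0. \<forall>n\<ge>n0. norm (Wd (time_marginal \<mu> (s n)) (time_marginal \<mu> t) - 0) < r" by blast
  qed
qed

lemma marginal_flow:
  assumes \<mu>: "\<mu> \<in> PP" shows "flow (time_marginal \<mu>)"
  unfolding flow_def
proof (intro conjI ballI)
  show "time_marginal \<mu> s \<in> Pd" if "s \<in> {0..T}" for s by (rule marginal_in[OF \<mu> that])
  interpret M: prob_space \<mu> by (rule PP_D[OF \<mu>])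
  obtain a where a: "Lp_le p \<mu> (\<lambda>x. mdist PT x (zero_path T)) a" using PP_Lp[OF \<mu> zero_path_in(1)[OF T]] .
  have "Wd (time_marginal \<mu> s) \<delta>0 \<le> a" if s: "s \<in> {0..T}" for s
  proof -
    have "distr \<mu> (mborel euclidean_metric) (\<lambda>_. 0 :: real^'d) = \<delta>0" by (rule M.distr_const) simp
    then show ?thesis
      using Lp_norm_eval[OF \<mu> s a] eval_meas[OF s PP_D(2)[OF \<mu>]]
        separable_metric.wasserstein_distr_le[OF sep_E PP_D(1)[OF \<mu>] p, of "\<lambda>x. x s" "\<lambda>_. 0" a]
      by (simp add: time_marginal_eq)
  qed
  then show "\<exists>B. \<forall>s\<in>{0..T}. Wd (time_marginal \<mu> s) \<delta>0 \<le> B" by blast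
  \<comment> \<open>Rounds time down to a grid of mesh \<open>1 / Suc n\<close>: the values stay in
    \<open>[0, T]\<close>, and the marginal at a grid time depends on an integer only, so all
    preimages are measurable.\<close>
  define g where "g n s = of_int \<lfloor>s * real (Suc n)\<rfloor> / real (Suc n)" for n and s :: real
  have g: "g n s \<le> s" "s - 1 / real (Suc n) \<le> g n s" "0 \<le> s \<Longrightarrow> 0 \<le> g n s" for n s
  proof -
    have "of_int \<lfloor>s * real (Suc n)\<rfloor> \<le> s * real (Suc n)" by simp
    then show "g n s \<le> s" by (simp add: g_def field_simps)
    have "s * real (Suc n) \<le> of_int \<lfloor>s * real (Suc n)\<rfloor> + 1" by linarith
    then have "s * real (Suc n) / real (Suc n) \<le> (of_int \<lfloor>s * real (Suc n)\<rfloor> + 1) / real (Suc n)"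
      by (intro divide_right_mono) auto
    then show "s - 1 / real (Suc n) \<le> g n s" by (simp add: g_def add_divide_distrib)
    show "0 \<le> s \<Longrightarrow> 0 \<le> g n s" by (simp add: g_def)
  qed
  have gT: "g n s \<in> {0..T}" if "s \<in> {0..T}" for n s
    using that by (auto intro: g(3) order_trans[OF g(1)])
  show "time_marginal \<mu> \<in> restrict_space borel {0..T} \<rightarrow>\<^sub>M borel_of (wasserstein_topology p euclidean_metric)"
    unfolding wasserstein_topology_def
  proof (rule measurable_limit_finite_range[OF Wd_metric, where Y = "\<lambda>n s. time_marginal \<mu> (g n s)"])
    show "time_marginal \<mu> (g n s) \<in> Pd" if "s \<in> space (restrict_space borel {0..T})" for n s
      using that gT by (intro marginal_in[OF \<mu>]) auto
    show "time_marginal \<mu> s \<in> Pd" if "s \<in> space (restrict_space borel {0..T})" for s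
      using that by (intro marginal_in[OF \<mu>]) auto
    show "{s \<in> space (restrict_space borel {0..T}). time_marginal \<mu> (g n s) \<in> F} \<in> sets (restrict_space borel {0..T})" for n F
    proof -
      have fl: "(\<lambda>s. \<lfloor>s * real (Suc n)\<rfloor>) \<in> restrict_space borel {0..T} \<rightarrow>\<^sub>M count_space UNIV"
        by (rule measurable_restrict_space1) measurable
      have "{s \<in> space (restrict_space borel {0..T}). time_marginal \<mu> (g n s) \<in> F}
          = (\<lambda>s. \<lfloor>s * real (Suc n)\<rfloor>) -` {k. time_marginal \<mu> (of_int k / real (Suc n)) \<in> F} \<inter> space (restrict_space borel {0..T})"
        by (auto simp: g_def)
      also have "\<dots> \<in> sets (restrict_space borel {0..T})" by (rule measurable_sets[OF fl]) simp
      finally show ?thesis .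
    qed
    show "(\<lambda>n. Wd (time_marginal \<mu> (g n s)) (time_marginal \<mu> s)) \<longlonglongrightarrow> 0"
      if s: "s \<in> space (restrict_space borel {0..T})" for s
    proof (rule marginal_continuous[OF \<mu>])
      have s': "s \<in> {0..T}" using s by simp
      show "g n s \<in> {0..T}" for n by (rule gT[OF s'])
      show "s \<in> {0..T}" by (rule s')
      have l: "(\<lambda>n. s - 1 / real (Suc n)) \<longlonglongrightarrow> s - 0"
        by (intro tendsto_diff tendsto_const LIMSEQ_Suc[OF lim_const_over_n])
      show "(\<lambda>n. g n s) \<longlonglongrightarrow> s"
        by (rule tendsto_sandwich[OF _ _ l[simplified] tendsto_const]) (use g in \<open>auto intro!: always_eventually\<close>)
    qed
  qed
qed

end

context drift
begin

abbreviation "S \<equiv> solution_map T b"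
abbreviation "\<Lambda> \<equiv> exp (4 * L * T)"

lemma exp_le_Lam: "t \<in> {0..T} \<Longrightarrow> exp (4 * L * t) \<le> \<Lambda>"
  using L by simp

lemma S_solves:
  assumes \<mu>: "\<mu> \<in> PP" and z: "(x0, \<gamma>) \<in> mspace DD"
  shows "solves (time_marginal \<mu>) x0 \<gamma> (S \<mu> (x0, \<gamma>))"
proof -
  note f = marginal_flow[OF \<mu>]
  have "\<gamma> \<in> mspace PT" using z unfolding DD_in by blast
  then obtain x where "solves (time_marginal \<mu>) x0 \<gamma> x" using solves_exists[OF f, of \<gamma> x0] by blast
  then have "\<exists>!x. solves (time_marginal \<mu>) x0 \<gamma> x" using solves_unique[OF f] by blast
  then show ?thesis unfolding solution_map_def by (simp add: theI')
qed

lemma S_eqI: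
  assumes \<mu>: "\<mu> \<in> PP" and z: "(x0, \<gamma>) \<in> mspace DD" and x: "solves (time_marginal \<mu>) x0 \<gamma> x"
  shows "S \<mu> (x0, \<gamma>) = x"
  by (rule solves_unique[OF marginal_flow[OF \<mu>] S_solves[OF \<mu> z] x])

lemma S_in: "\<mu> \<in> PP \<Longrightarrow> z \<in> mspace DD \<Longrightarrow> S \<mu> z \<in> mspace PT"
  using S_solves by (cases z) (auto simp: solves_integral_equation_def)

lemma S_stability:
  assumes \<mu>: "\<mu> \<in> PP" "\<mu>' \<in> PP" and z: "z \<in> mspace DD" "z' \<in> mspace DD"
    and R: "0 \<le> R" "\<And>t. t \<in> {0..T} \<Longrightarrow> Wd (time_marginal \<mu> t) (time_marginal \<mu>' t) \<le> R * exp (4 * L * t)"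
    and t: "t \<in> {0..T}"
  shows "norm (S \<mu> z t - S \<mu>' z' t) \<le> exp (4 * L * t) * (4 / 3 * mdist DD z z' + R / 3)"
proof -
  obtain x0 \<gamma> x0' \<gamma>' where zz: "z = (x0, \<gamma>)" "z' = (x0', \<gamma>')" by (cases z, cases z')
  have g: "\<gamma> \<in> mspace PT" "\<gamma>' \<in> mspace PT" using z unfolding zz DD_in by auto
  have \<xi>: "norm (x0 - x0') + norm (\<gamma> t - \<gamma>' t) \<le> mdist DD (x0, \<gamma>) (x0', \<gamma>')" if "t \<in> {0..T}" for t
    unfolding mdist_DD using mdist_path_ge[OF T g that] by simp
  show ?thesis
    unfolding zz
    by (rule solves_stability[OF marginal_flow[OF \<mu>(1)] marginal_flow[OF \<mu>(2)]
          S_solves[OF \<mu>(1) z(1)[unfolded zz]] S_solves[OF \<mu>(2) z(2)[unfolded zz]] \<xi> R t])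
qed

lemma S_Lipschitz:
  assumes \<mu>: "\<mu> \<in> PP" and z: "z \<in> mspace DD" "z' \<in> mspace DD"
  shows "mdist PT (S \<mu> z) (S \<mu> z') \<le> (\<Lambda> * (4 / 3)) * mdist DD z z'"
  unfolding mdist_path_le[OF T S_in[OF \<mu> z(1)] S_in[OF \<mu> z(2)]]
proof
  fix t assume t: "t \<in> {0..T}"
  have "norm (S \<mu> z t - S \<mu> z' t) \<le> exp (4 * L * t) * (4 / 3 * mdist DD z z' + 0 / 3)"
    using marginal_in[OF \<mu>] by (intro S_stability[OF \<mu> \<mu> z _ _ t]) auto
  also have "\<dots> \<le> \<Lambda> * (4 / 3 * mdist DD z z' + 0 / 3)" using exp_le_Lam[OF t] by (intro mult_right_mono) auto
  finally show "norm (S \<mu> z t - S \<mu> z' t) \<le> (\<Lambda> * (4 / 3)) * mdist DD z z'" by (simp add: mult.assoc)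
qed

lemma S_meas: "\<mu> \<in> PP \<Longrightarrow> S \<mu> \<in> mborel DD \<rightarrow>\<^sub>M mborel PT"
  by (rule Lipschitz_measurable[OF S_in S_Lipschitz])

definition G :: "(real \<Rightarrow> real^'d) measure \<Rightarrow> (real \<Rightarrow> real^'d) \<Rightarrow> (real^'d) \<times> (real \<Rightarrow> real^'d)" where
  "G \<mu> x = (x 0, restrict (\<lambda>t. x t - x 0 - (LINT s:{0..t}|lborel. b s (x s) (time_marginal \<mu> s))) {0..T})"

lemma set_integral_at_0: "(LINT s:{0..0::real}|lborel. f s) = (0 :: real^'d)"
proof -
  have "AE s in lborel. indicator {0::real} s *\<^sub>R f s = (0 :: real^'d)"
    using AE_lborel_singleton[of "0::real"] by eventually_elim auto
  then show ?thesis unfolding set_lebesgue_integral_def by (simp add: integral_eq_zero_AE)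
qed

lemma G_in:
  assumes \<mu>: "\<mu> \<in> PP" and x: "x \<in> mspace PT"
  shows "G \<mu> x \<in> mspace DD"
proof -
  let ?g = "restrict (\<lambda>t. x t - x 0 - (LINT s:{0..t}|lborel. b s (x s) (time_marginal \<mu> s))) {0..T}"
  have "continuous_on {0..T} ?g"
    using x T by (intro continuous_on_restrict continuous_intros
        continuous_on_indefinite_set_integral drift_int marginal_flow[OF \<mu>]) (auto simp: mspace_path)
  then have "?g \<in> mspace PT" using T by (simp add: mspace_path)
  moreover have "?g 0 = 0" using T set_integral_at_0 by simp
  ultimately show ?thesis unfolding G_def DD_in by blast
qed

lemma S_G:
  assumes \<mu>: "\<mu> \<in> PP" and x: "x \<in> mspace PT"
  shows "S \<mu> (G \<mu> x) = x"
  unfolding G_def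
proof (rule S_eqI[OF \<mu> G_in[OF \<mu> x, unfolded G_def]])
  show "solves (time_marginal \<mu>) (x 0)
      (restrict (\<lambda>t. x t - x 0 - (LINT s:{0..t}|lborel. b s (x s) (time_marginal \<mu> s))) {0..T}) x"
    using x drift_int[OF marginal_flow[OF \<mu>] x] by (auto simp: solves_integral_equation_def)
qed

lemma G_S:
  assumes \<mu>: "\<mu> \<in> PP" and z: "z \<in> mspace DD"
  shows "G \<mu> (S \<mu> z) = z"
proof -
  obtain x0 \<gamma> where zz: "z = (x0, \<gamma>)" by (cases z)
  let ?x = "S \<mu> z"
  have g: "\<gamma> \<in> mspace PT" "\<gamma> 0 = 0" using z unfolding zz DD_in by auto
  have s: "?x t = x0 + (LINT s:{0..t}|lborel. b s (?x s) (time_marginal \<mu> s)) + \<gamma> t" if "t \<in> {0..T}" for t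
    using S_solves[OF \<mu> z[unfolded zz]] that unfolding zz by (simp add: solves_integral_equation_def)
  have x0: "?x 0 = x0" using s[of 0] T g set_integral_at_0 by simp
  have "restrict (\<lambda>t. ?x t - ?x 0 - (LINT s:{0..t}|lborel. b s (?x s) (time_marginal \<mu> s))) {0..T} = \<gamma>"
  proof (rule extensionalityI[of _ "{0..T}"])
    show "\<gamma> \<in> extensional {0..T}" using g T by (simp add: mspace_path)
    fix t assume t: "t \<in> {0..T}"
    have "?x t - ?x 0 - (LINT s:{0..t}|lborel. b s (?x s) (time_marginal \<mu> s)) = \<gamma> t"
      unfolding x0 by (subst s[OF t]) simp
    then show "restrict (\<lambda>t. ?x t - ?x 0 - (LINT s:{0..t}|lborel. b s (?x s) (time_marginal \<mu> s))) {0..T} t = \<gamma> t"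
      using t by simp
  qed simp
  then show ?thesis unfolding G_def x0 by (simp add: zz)
qed

text \<open>The path component contributes 2 from \<open>x t - x 0\<close> and
  \<open>\<Lambda> / 4\<close> from the integral, the starting point 1 more. The bound yields
  measurability of \<open>G \<mu>\<close> and finite moments of \<open>Theta \<mu>\<close>.\<close>

lemma G_Lipschitz:
  assumes \<mu>: "\<mu> \<in> PP" and x: "x \<in> mspace PT" "x' \<in> mspace PT"
  shows "mdist DD (G \<mu> x) (G \<mu> x') \<le> (3 + \<Lambda> / 4) * mdist PT x x'"
proof -
  let ?d = "mdist PT x x'"
  let ?I = "\<lambda>x t. LINT s:{0..t}|lborel. b s (x s) (time_marginal \<mu> s)"
  let ?g = "\<lambda>x. restrict (\<lambda>t. x t - x 0 - ?I x t) {0..T}"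
  note ge = mdist_path_ge[OF T x]
  have g: "?g x \<in> mspace PT" "?g x' \<in> mspace PT"
    using G_in[OF \<mu> x(1)] G_in[OF \<mu> x(2)] unfolding G_def DD_in by auto
  have "mdist PT (?g x) (?g x') \<le> (2 + \<Lambda> / 4) * ?d"
    unfolding mdist_path_le[OF T g]
  proof
    fix t assume t: "t \<in> {0..T}"
    have "norm (?I x t - ?I x' t) \<le> L * ?d / (4 * L) * exp (4 * L * t)"
    proof (rule set_integral_diff_exp_le[OF drift_int[OF marginal_flow[OF \<mu>] x(1)] drift_int[OF marginal_flow[OF \<mu>] x(2)] t])
      fix s assume s: "s \<in> {0..T}"
      have "norm (b s (x s) (time_marginal \<mu> s) - b s (x' s) (time_marginal \<mu> s))
          \<le> L * (norm (x s - x' s) + Wd (time_marginal \<mu> s) (time_marginal \<mu> s))"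
        using s marginal_in[OF \<mu>] by (intro b_lip) auto
      also have "\<dots> \<le> L * ?d" using ge[OF s] marginal_in[OF \<mu> s] L by simp
      also have "\<dots> \<le> L * ?d * exp (4 * L * s)"
        using mult_left_mono[of 1 "exp (4 * L * s)" "L * ?d"] L s by simp
      finally show "norm (b s (x s) (time_marginal \<mu> s) - b s (x' s) (time_marginal \<mu> s)) \<le> L * ?d * exp (4 * L * s)" .
    qed (use L in auto)
    also have "\<dots> = ?d / 4 * exp (4 * L * t)" using L by simp
    also have "\<dots> \<le> ?d / 4 * \<Lambda>" using exp_le_Lam[OF t] by (intro mult_left_mono) auto
    finally have I: "norm (?I x t - ?I x' t) \<le> ?d / 4 * \<Lambda>" .
    have "norm (?g x t - ?g x' t) = norm ((x t - x' t) - (x 0 - x' 0) - (?I x t - ?I x' t))"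
      using t by (simp add: algebra_simps)
    also have "\<dots> \<le> norm (x t - x' t) + norm (x 0 - x' 0) + norm (?I x t - ?I x' t)"
      using norm_triangle_ineq4[of "(x t - x' t) - (x 0 - x' 0)" "?I x t - ?I x' t"]
        norm_triangle_ineq4[of "x t - x' t" "x 0 - x' 0"] by linarith
    also have "\<dots> \<le> ?d + ?d + ?d / 4 * \<Lambda>" using ge[OF t] ge[of 0] T I by (intro add_mono) auto
    finally show "norm (?g x t - ?g x' t) \<le> (2 + \<Lambda> / 4) * ?d" by (simp add: algebra_simps)
  qed
  moreover have "norm (x 0 - x' 0) \<le> ?d" using ge[of 0] T by simp
  ultimately show ?thesis unfolding G_def mdist_DD by (simp add: algebra_simps)
qed

lemma G_meas: "\<mu> \<in> PP \<Longrightarrow> G \<mu> \<in> mborel PT \<rightarrow>\<^sub>M mborel DD"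
  by (rule Lipschitz_measurable[OF G_in G_Lipschitz])

definition Theta :: "(real \<Rightarrow> real^'d) measure \<Rightarrow> ((real^'d) \<times> (real \<Rightarrow> real^'d)) measure" where
  "Theta \<mu> = distr \<mu> (mborel DD) (G \<mu>)"

lemma finite_moment_Lipschitz_image:
  assumes "separable_metric m1 e1" "separable_metric m2 e2" and \<mu>: "\<mu> \<in> finite_moment_measures p m1"
    and f: "\<And>x. x \<in> mspace m1 \<Longrightarrow> f x \<in> mspace m2"
    and B: "\<And>x y. x \<in> mspace m1 \<Longrightarrow> y \<in> mspace m1 \<Longrightarrow> mdist m2 (f x) (f y) \<le> B * mdist m1 x y" "0 \<le> B"
  shows "distr \<mu> (mborel m2) f \<in> finite_moment_measures p m2"
proof -
  interpret A: separable_metric m1 e1 by fact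
  interpret B: separable_metric m2 e2 by fact
  let ?y = "e1 0"
  have y: "?y \<in> mspace m1" by simp
  note D = A.finite_momentD[OF \<mu>]
  obtain a where "Lp_le p \<mu> (\<lambda>x. mdist m1 x ?y) a" using \<mu> A.finite_moment_iff[OF p y] by blast
  then have L: "Lp_le p \<mu> (\<lambda>x. B * mdist m1 x ?y) (B * a)" using B(2) by (rule Lp_le_cmult)
  have fm: "f \<in> \<mu> \<rightarrow>\<^sub>M mborel m2" using Lipschitz_measurable[OF f B(1)] D(2) by (simp cong: measurable_cong_sets)
  have "Lp_le p \<mu> (\<lambda>x. mdist m2 (f x) (f ?y)) (B * a)"
    by (rule Lp_le_mono[OF L])
      (use B(1)[OF _ y] D p measurable_compose[OF fm B.dist_const_measurable[OF f[OF y]]] in \<open>auto intro!: AE_I2\<close>)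
  then show ?thesis using B.finite_moment_distr[OF D(1) p fm f[OF y]] by blast
qed

lemma Theta_in: "\<mu> \<in> PP \<Longrightarrow> Theta \<mu> \<in> PDt"
  unfolding Theta_def
  by (rule finite_moment_Lipschitz_image[OF sep_PT sep_DD _ G_in G_Lipschitz]) auto

lemma Phi_in: "\<nu> \<in> PDt \<Longrightarrow> \<mu> \<in> PP \<Longrightarrow> Phi T b \<nu> \<mu> \<in> PP"
  unfolding Phi_def
  by (rule finite_moment_Lipschitz_image[OF sep_DD sep_PT _ S_in S_Lipschitz]) auto

lemma Phi_Theta:
  assumes \<mu>: "\<mu> \<in> PP" shows "Phi T b (Theta \<mu>) \<mu> = \<mu>"
proof -
  note D = PP_D[OF \<mu>]
  have Gm: "G \<mu> \<in> \<mu> \<rightarrow>\<^sub>M mborel DD" using G_meas[OF \<mu>] D by (simp cong: measurable_cong_sets)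
  have "Phi T b (Theta \<mu>) \<mu> = distr \<mu> (mborel PT) (S \<mu> \<circ> G \<mu>)"
    unfolding Phi_def Theta_def by (rule distr_distr[OF S_meas[OF \<mu>] Gm])
  also have "\<dots> = distr \<mu> (mborel PT) (\<lambda>x. x)" using S_G[OF \<mu>] D by (intro distr_cong) auto
  also have "\<dots> = \<mu>" using D by (intro distr_id2) simp
  finally show ?thesis .
qed

lemma Theta_Phi:
  assumes \<mu>: "\<mu> \<in> PP" and \<nu>: "\<nu> \<in> PDt" and fp: "Phi T b \<nu> \<mu> = \<mu>"
  shows "Theta \<mu> = \<nu>"
proof -
  note D = PDt_D[OF \<nu>]
  have Sm: "S \<mu> \<in> \<nu> \<rightarrow>\<^sub>M mborel PT" using S_meas[OF \<mu>] D by (simp cong: measurable_cong_sets)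
  have "Theta \<mu> = distr (distr \<nu> (mborel PT) (S \<mu>)) (mborel DD) (G \<mu>)"
    unfolding Theta_def using fp by (simp add: Phi_def)
  also have "\<dots> = distr \<nu> (mborel DD) (G \<mu> \<circ> S \<mu>)" by (rule distr_distr[OF G_meas[OF \<mu>] Sm])
  also have "\<dots> = distr \<nu> (mborel DD) (\<lambda>x. x)" using G_S[OF \<mu>] D by (intro distr_cong) auto
  also have "\<dots> = \<nu>" using D by (intro distr_id2) simp
  finally show ?thesis .
qed

text \<open>\<open>R\<close> is the supremum of \<open>exp (- (4 * L * t))\<close> times the
  distance of the marginals. Its minimality allows an inequality for these distances to be fed back
  into itself.\<close>

lemma marginal_dist_bound:
  assumes "\<mu> \<in> PP" "\<mu>' \<in> PP"
  obtains R where "0 \<le> R" "\<And>t. t \<in> {0..T} \<Longrightarrow> Wd (time_marginal \<mu> t) (time_marginal \<mu>' t) \<le> R * exp (4 * L * t)"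
    "\<And>R'. 0 \<le> R' \<Longrightarrow> (\<And>t. t \<in> {0..T} \<Longrightarrow> Wd (time_marginal \<mu> t) (time_marginal \<mu>' t) \<le> R' * exp (4 * L * t)) \<Longrightarrow> R \<le> R'"
proof -
  define r where "r t = exp (- (4 * L * t)) * Wd (time_marginal \<mu> t) (time_marginal \<mu>' t)" for t
  have r: "Wd (time_marginal \<mu> t) (time_marginal \<mu>' t) = r t * exp (4 * L * t)" for t
    unfolding r_def by (simp add: exp_minus)
  obtain B where B: "0 \<le> B" "\<And>s. s \<in> {0..T} \<Longrightarrow> Wd (time_marginal \<mu> s) (time_marginal \<mu>' s) \<le> B"
    using flow_dist[OF marginal_flow[OF assms(1)] marginal_flow[OF assms(2)]] by blast
  have "r t \<le> B" if t: "t \<in> {0..T}" for t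
  proof -
    have "r t \<le> 1 * Wd (time_marginal \<mu> t) (time_marginal \<mu>' t)"
      unfolding r_def using L t by (intro mult_right_mono) (auto simp: wasserstein_nonneg)
    then show ?thesis using B(2)[OF t] by linarith
  qed
  then have bdd: "bdd_above (r ` {0..T})" by (intro bdd_aboveI2[of _ _ B])
  define R where "R = (SUP t\<in>{0..T}. r t)"
  have R: "r t \<le> R" if "t \<in> {0..T}" for t unfolding R_def by (rule cSUP_upper[OF that bdd])
  have "0 \<le> r 0" by (simp add: r_def wasserstein_nonneg)
  then have "0 \<le> R" using R[of 0] T by simp
  moreover have "Wd (time_marginal \<mu> t) (time_marginal \<mu>' t) \<le> R * exp (4 * L * t)" if "t \<in> {0..T}" for t
    unfolding r using R[OF that] by (intro mult_right_mono) auto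
  moreover have "R \<le> R'" if "\<And>t. t \<in> {0..T} \<Longrightarrow> Wd (time_marginal \<mu> t) (time_marginal \<mu>' t) \<le> R' * exp (4 * L * t)" for R'
    unfolding R_def
  proof (rule cSUP_least)
    show "{0..T} \<noteq> {}" using T by simp
    fix t assume "t \<in> {0..T}"
    from that[OF this] show "r t \<le> R'" unfolding r by simp
  qed
  ultimately show ?thesis using that by blast
qed

text \<open>A nearly optimal coupling of the data, pushed through the two solution maps, couples the
  two fixed points.\<close>

lemma fixed_point_Lipschitz:
  assumes \<nu>: "\<nu> \<in> PDt" "\<nu>' \<in> PDt" and \<mu>: "\<mu> \<in> PP" "\<mu>' \<in> PP"
    and fp: "Phi T b \<nu> \<mu> = \<mu>" "Phi T b \<nu>' \<mu>' = \<mu>'"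
  shows "WP \<mu> \<mu>' \<le> 2 * \<Lambda> * WD \<nu> \<nu>'"
proof (rule dense_ge)
  fix w assume w: "2 * \<Lambda> * WD \<nu> \<nu>' < w"
  define a where "a = w / (2 * \<Lambda>)"
  have a: "WD \<nu> \<nu>' < a" "2 * \<Lambda> * a = w" using w by (simp_all add: a_def field_simps)
  have a0: "0 \<le> a" using a(1) wasserstein_nonneg[of p DD \<nu> \<nu>'] by linarith
  obtain \<pi> where \<pi>: "\<pi> \<in> couplings \<nu> \<nu>'" "Lp_le p \<pi> (\<lambda>z. mdist DD (fst z) (snd z)) a"
    using separable_metric.wasserstein_less[OF sep_DD p \<nu> a(1)] by blast
  note D = PDt_D[OF \<nu>(1)] PDt_D[OF \<nu>(2)]
  have P: "prob_space \<pi>" by (rule coupling_prob_space[OF \<pi>(1) D(1)])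
  note m = separable_metric.coupling_measurable[OF sep_DD \<pi>(1) D(2) D(5)]
  have sp: "fst z \<in> mspace DD" "snd z \<in> mspace DD" if "z \<in> space \<pi>" for z
    using measurable_space[OF m(1) that] measurable_space[OF m(2) that] by auto
  define Y where "Y z = S \<mu> (fst z)" for z :: "((real^'d) \<times> (real \<Rightarrow> real^'d)) \<times> ((real^'d) \<times> (real \<Rightarrow> real^'d))"
  define Y' where "Y' z = S \<mu>' (snd z)" for z :: "((real^'d) \<times> (real \<Rightarrow> real^'d)) \<times> ((real^'d) \<times> (real \<Rightarrow> real^'d))"
  have Ym: "Y \<in> \<pi> \<rightarrow>\<^sub>M mborel PT" "Y' \<in> \<pi> \<rightarrow>\<^sub>M mborel PT"
    unfolding Y_def Y'_def using measurable_compose[OF m(1) S_meas[OF \<mu>(1)]] measurable_compose[OF m(2) S_meas[OF \<mu>(2)]] by auto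
  have Yin: "Y z \<in> mspace PT" "Y' z \<in> mspace PT" if "z \<in> space \<pi>" for z
    using S_in sp[OF that] \<mu> by (auto simp: Y_def Y'_def)
  have law: "distr \<pi> (mborel PT) Y = \<mu>" "distr \<pi> (mborel PT) Y' = \<mu>'"
  proof -
    have S1: "S \<mu> \<in> \<nu> \<rightarrow>\<^sub>M mborel PT" using S_meas[OF \<mu>(1)] D by (simp cong: measurable_cong_sets)
    have S2: "S \<mu>' \<in> \<nu>' \<rightarrow>\<^sub>M mborel PT" using S_meas[OF \<mu>(2)] D by (simp cong: measurable_cong_sets)
    have "distr \<pi> (mborel PT) Y = distr (distr \<pi> \<nu> fst) (mborel PT) (S \<mu>)"
      by (subst distr_distr[OF S1 coupling_sets(2)[OF \<pi>(1)]]) (simp add: Y_def[abs_def] comp_def)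
    then show "distr \<pi> (mborel PT) Y = \<mu>" using coupling_sets(4)[OF \<pi>(1)] fp(1) by (simp add: Phi_def)
    have "distr \<pi> (mborel PT) Y' = distr (distr \<pi> \<nu>' snd) (mborel PT) (S \<mu>')"
      by (subst distr_distr[OF S2 coupling_sets(3)[OF \<pi>(1)]]) (simp add: Y'_def[abs_def] comp_def)
    then show "distr \<pi> (mborel PT) Y' = \<mu>'" using coupling_sets(5)[OF \<pi>(1)] fp(2) by (simp add: Phi_def)
  qed
  obtain R where R: "0 \<le> R" "\<And>t. t \<in> {0..T} \<Longrightarrow> Wd (time_marginal \<mu> t) (time_marginal \<mu>' t) \<le> R * exp (4 * L * t)"
    "\<And>R'. 0 \<le> R' \<Longrightarrow> (\<And>t. t \<in> {0..T} \<Longrightarrow> Wd (time_marginal \<mu> t) (time_marginal \<mu>' t) \<le> R' * exp (4 * L * t)) \<Longrightarrow> R \<le> R'"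
    using marginal_dist_bound[OF \<mu>] by metis
  have Lp: "Lp_le p \<pi> (\<lambda>z. 4 / 3 * mdist DD (fst z) (snd z) + R / 3) (4 / 3 * a + R / 3)"
    using R(1) by (intro Lp_le_add Lp_le_cmult \<pi>(2) Lp_le_const P p) auto
  have stab: "norm (Y z t - Y' z t) \<le> exp (4 * L * t) * (4 / 3 * mdist DD (fst z) (snd z) + R / 3)"
    if "z \<in> space \<pi>" "t \<in> {0..T}" for z t
    unfolding Y_def Y'_def by (rule S_stability[OF \<mu> sp(1)[OF that(1)] sp(2)[OF that(1)] R(1,2) that(2)])
  have "R \<le> 4 / 3 * a + R / 3"
  proof (rule R(3))
    show "0 \<le> 4 / 3 * a + R / 3" using a0 R(1) by simp
    fix t assume t: "t \<in> {0..T}"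
    have "Lp_le p \<pi> (\<lambda>z. norm (Y z t - Y' z t)) (exp (4 * L * t) * (4 / 3 * a + R / 3))"
    proof (rule Lp_le_mono[OF Lp_le_cmult[OF Lp, of "exp (4 * L * t)"]])
      show "(\<lambda>z. norm (Y z t - Y' z t)) \<in> borel_measurable \<pi>"
        using measurable_compose[OF Ym(1) eval_meas'[OF t refl]] measurable_compose[OF Ym(2) eval_meas'[OF t refl]]
        by measurable
    qed (use stab[OF _ t] p in \<open>auto intro!: AE_I2\<close>)
    from Wd_marginal_le[OF P Ym t this]
    show "Wd (time_marginal \<mu> t) (time_marginal \<mu>' t) \<le> (4 / 3 * a + R / 3) * exp (4 * L * t)"
      unfolding law by (simp add: mult.commute)
  qed
  \<comment> \<open>\<open>R \<le> 4 / 3 * a + R / 3\<close> means \<open>R \<le> 2 * a\<close>;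
    hence the factor 2 in the Lipschitz constant.\<close>
  then have R2: "4 / 3 * a + R / 3 \<le> 2 * a" by simp
  have "Lp_le p \<pi> (\<lambda>z. mdist PT (Y z) (Y' z)) (\<Lambda> * (4 / 3 * a + R / 3))"
  proof (rule Lp_le_mono[OF Lp_le_cmult[OF Lp, of \<Lambda>]])
    show "(\<lambda>z. mdist PT (Y z) (Y' z)) \<in> borel_measurable \<pi>"
      by (rule separable_metric.dist_measurable_comp[OF sep_PT Ym])
    show "AE z in \<pi>. mdist PT (Y z) (Y' z) \<le> \<Lambda> * (4 / 3 * mdist DD (fst z) (snd z) + R / 3)"
    proof (rule AE_I2)
      fix z assume z: "z \<in> space \<pi>"
      have "norm (Y z t - Y' z t) \<le> \<Lambda> * (4 / 3 * mdist DD (fst z) (snd z) + R / 3)" if t: "t \<in> {0..T}" for t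
        by (rule order_trans[OF stab[OF z t] mult_right_mono[OF exp_le_Lam[OF t]]]) (use R(1) in simp)
      then show "mdist PT (Y z) (Y' z) \<le> \<Lambda> * (4 / 3 * mdist DD (fst z) (snd z) + R / 3)"
        using mdist_path_le[OF T Yin[OF z]] by blast
    qed
  qed (use p in auto)
  from separable_metric.wasserstein_distr_le[OF sep_PT P p Ym this]
  have "WP \<mu> \<mu>' \<le> \<Lambda> * (4 / 3 * a + R / 3)" unfolding law .
  also have "\<dots> \<le> \<Lambda> * (2 * a)" using R2 by (intro mult_left_mono) auto
  finally show "WP \<mu> \<mu>' \<le> w" using a(2) by (simp add: ac_simps)
qed

end

section \<open>Invariance of the relative entropy under measurable isomorphisms\<close>

lemma relative_entropy_distr_density:
  assumes Q: "prob_space Q" and f: "is_dens Q f"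
    and T: "T \<in> Q \<rightarrow>\<^sub>M N" and T': "T' \<in> N \<rightarrow>\<^sub>M Q" and inv: "\<And>x. x \<in> space Q \<Longrightarrow> T' (T x) = x"
  shows "relative_entropy (distr (density Q f) N T) (distr Q N T) = relative_entropy (density Q f) Q"
proof -
  note fm [measurable] = is_densD(1)[OF f]
  have fT: "(\<lambda>y. f (T' y)) \<in> borel_measurable N" using measurable_compose[OF T' fm] .
  have dens: "is_dens (distr Q N T) (\<lambda>y. f (T' y))"
    unfolding is_dens_def
  proof (intro conjI allI)
    show "(\<lambda>y. f (T' y)) \<in> borel_measurable (distr Q N T)" using fT by simp
    show "0 \<le> f (T' y)" for y by (rule is_densD(2)[OF f])
    have "(\<integral>\<^sup>+ y. ennreal (f (T' y)) \<partial>distr Q N T) = (\<integral>\<^sup>+ x. ennreal (f (T' (T x))) \<partial>Q)"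
      using T fT by (intro nn_integral_distr) auto
    also have "\<dots> = (\<integral>\<^sup>+ x. ennreal (f x) \<partial>Q)" using inv by (intro nn_integral_cong) simp
    finally show "(\<integral>\<^sup>+ y. ennreal (f (T' y)) \<partial>distr Q N T) = 1" using is_densD(3)[OF f] by simp
  qed
  have "density (distr Q N T) (\<lambda>y. ennreal (f (T' y))) = distr (density Q (\<lambda>x. ennreal (f (T' (T x))))) N T"
    using T fT by (intro density_distr) auto
  also have "density Q (\<lambda>x. ennreal (f (T' (T x)))) = density Q f"
    using inv T fT measurable_compose[OF T fT] by (intro density_cong) auto
  finally have eq: "distr (density Q f) N T = density (distr Q N T) (\<lambda>y. ennreal (f (T' y)))" ..
  have ent: "ent (distr Q N T) (\<lambda>y. f (T' y)) = ent Q f"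
  proof -
    have "ent (distr Q N T) (\<lambda>y. f (T' y)) = (\<integral>\<^sup>+ x. ennreal (phi (f (T' (T x)))) \<partial>Q)"
      unfolding ent_def using T measurable_compose[OF fT phi_measurable] by (intro nn_integral_distr) auto
    then show ?thesis unfolding ent_def using inv by (simp cong: nn_integral_cong)
  qed
  show ?thesis
    unfolding eq relative_entropy_density[OF prob_space.prob_space_distr[OF Q T] dens]
      relative_entropy_density[OF Q f] ent ..
qed

text \<open>A density is at hand as soon as one of the two entropies is finite. If it is that of the
  images, the previous lemma is applied to the inverse map.\<close>

lemma relative_entropy_distr_iso:
  assumes Q: "prob_space Q" and \<mu>: "prob_space \<mu>" "sets \<mu> = sets Q"
    and T: "T \<in> Q \<rightarrow>\<^sub>M N" and T': "T' \<in> N \<rightarrow>\<^sub>M Q"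
    and inv: "\<And>x. x \<in> space Q \<Longrightarrow> T' (T x) = x" "\<And>y. y \<in> space N \<Longrightarrow> T (T' y) = y"
  shows "relative_entropy (distr \<mu> N T) (distr Q N T) = relative_entropy \<mu> Q"
proof -
  have T\<mu>: "T \<in> \<mu> \<rightarrow>\<^sub>M N" using T \<mu>(2) by (simp cong: measurable_cong_sets)
  have T'd: "T' \<in> distr Q N T \<rightarrow>\<^sub>M Q" using T' by simp
  have pull: "distr (distr \<kappa> N T) Q T' = \<kappa>" if "sets \<kappa> = sets Q" for \<kappa>
  proof -
    have T\<kappa>: "T \<in> \<kappa> \<rightarrow>\<^sub>M N" using T that by (simp cong: measurable_cong_sets)
    have "distr (distr \<kappa> N T) Q T' = distr \<kappa> Q (T' \<circ> T)" by (rule distr_distr[OF T' T\<kappa>])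
    also have "\<dots> = distr \<kappa> Q (\<lambda>x. x)" using inv(1) sets_eq_imp_space_eq[OF that] by (intro distr_cong) auto
    also have "\<dots> = \<kappa>" using that by (intro distr_id2) simp
    finally show ?thesis .
  qed
  show ?thesis
  proof (cases "relative_entropy \<mu> Q = \<infinity> \<and> relative_entropy (distr \<mu> N T) (distr Q N T) = \<infinity>")
    case False
    then consider "relative_entropy \<mu> Q \<noteq> \<infinity>" | "relative_entropy (distr \<mu> N T) (distr Q N T) \<noteq> \<infinity>" by blast
    then show ?thesis
    proof cases
      case 1
      then obtain f where "is_dens Q f" "\<mu> = density Q f" using relative_entropy_finiteE[OF Q \<mu>] by blast
      then show ?thesis using relative_entropy_distr_density[OF Q _ T T' inv(1)] by simp
    next
      case 2
      have PQ: "prob_space (distr Q N T)" by (rule prob_space.prob_space_distr[OF Q T])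
      have PM: "prob_space (distr \<mu> N T)" by (rule prob_space.prob_space_distr[OF \<mu>(1) T\<mu>])
      obtain f where f: "is_dens (distr Q N T) f" "distr \<mu> N T = density (distr Q N T) f"
        using relative_entropy_finiteE[OF PQ PM _ 2] by auto
      have "relative_entropy (distr (density (distr Q N T) f) Q T') (distr (distr Q N T) Q T')
          = relative_entropy (density (distr Q N T) f) (distr Q N T)"
        using inv(2) T by (intro relative_entropy_distr_density[OF PQ f(1) T'd, of T]) auto
      then show ?thesis unfolding f(2)[symmetric] pull[OF \<mu>(2)] pull[OF refl] by simp
    qed
  qed simp
qed

context drift_base
begin

lemma PP_nonempty: "empirical_measure (mborel PT) 1 (\<lambda>_. zero_path T) \<in> PP"
  by (rule separable_metric.empirical_finite_moment[OF sep_PT p]) (use zero_path_in(1)[OF T] in auto)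

lemma empirical_marginal:
  assumes y: "\<And>i. i \<in> {1..N} \<Longrightarrow> y i \<in> mspace PT" and t: "t \<in> {0..T}"
  shows "time_marginal (empirical_measure (mborel PT) N y) t = empirical_measure borel N (\<lambda>j. y j t)"
proof -
  have ym: "y \<in> uniform_count_measure {1..N} \<rightarrow>\<^sub>M mborel PT"
    by (rule empirical_map_measurable) (use y in simp)
  show ?thesis
    unfolding time_marginal_def empirical_measure_def
    by (subst distr_distr[OF eval_meas'[OF t refl] ym]) (simp add: comp_def)
qed

end

section \<open>Fixed points of the McKean--Vlasov map and the particle system\<close>

context drift
begin

text \<open>Picard iteration of the solution maps on the fixed data space: the paths converge
  pointwise in the complete space \<open>PT\<close>, and the law of the limit map is the fixed
  point. Completeness is thus used for paths and not for measures.\<close>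

lemma fixed_point_exists:
  assumes \<nu>: "\<nu> \<in> PDt"
  obtains \<mu> where "\<mu> \<in> PP" "Phi T b \<nu> \<mu> = \<mu>"
proof -
  interpret P: Metric_space "mspace PT" "mdist PT" by simp
  note D = PDt_D[OF \<nu>]
  define \<mu>s where "\<mu>s n = (Phi T b \<nu> ^^ n) (empirical_measure (mborel PT) 1 (\<lambda>_. zero_path T))" for n
  have \<mu>s_Suc: "\<mu>s (Suc n) = Phi T b \<nu> (\<mu>s n)" for n by (simp add: \<mu>s_def)
  have \<mu>s: "\<mu>s n \<in> PP" for n
  proof (induction n)
    case 0
    show ?case unfolding \<mu>s_def using PP_nonempty by simp
  next
    case (Suc n)
    then show ?case unfolding \<mu>s_Suc by (rule Phi_in[OF \<nu>])
  qed
  define Y where "Y n = S (\<mu>s n)" for n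
  have Ym: "Y n \<in> \<nu> \<rightarrow>\<^sub>M mborel PT" for n
    unfolding Y_def using S_meas[OF \<mu>s] D by (simp cong: measurable_cong_sets)
  have Yin: "Y n z \<in> mspace PT" if "z \<in> mspace DD" for n z unfolding Y_def by (rule S_in[OF \<mu>s that])
  \<comment> \<open>The index shifts: \<open>Y n\<close> has the law of the next iterate.\<close>
  have law: "\<mu>s (Suc n) = distr \<nu> (mborel PT) (Y n)" for n by (simp add: \<mu>s_Suc Phi_def Y_def)
  obtain R where R: "0 \<le> R" "\<And>t. t \<in> {0..T} \<Longrightarrow> Wd (time_marginal (\<mu>s (Suc 0)) t) (time_marginal (\<mu>s 0) t) \<le> R * exp (4 * L * t)"
    using marginal_dist_bound[OF \<mu>s \<mu>s] by metis
  have close: "Wd (time_marginal (distr \<nu> (mborel PT) Z) t) (time_marginal (distr \<nu> (mborel PT) Z') t) \<le> r"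
    if Z: "Z \<in> \<nu> \<rightarrow>\<^sub>M mborel PT" "Z' \<in> \<nu> \<rightarrow>\<^sub>M mborel PT" and t: "t \<in> {0..T}" and r: "0 \<le> r"
      and le: "\<And>z. z \<in> mspace DD \<Longrightarrow> norm (Z z t - Z' z t) \<le> r" for Z Z' t r
  proof (rule Wd_marginal_le[OF D(1) Z t])
    show "Lp_le p \<nu> (\<lambda>z. norm (Z z t - Z' z t)) r"
    proof (rule Lp_le_mono[OF Lp_le_const[OF D(1) r]])
      show "(\<lambda>z. norm (Z z t - Z' z t)) \<in> borel_measurable \<nu>"
        using measurable_compose[OF Z(1) eval_meas'[OF t refl]] measurable_compose[OF Z(2) eval_meas'[OF t refl]]
        by measurable
    qed (use le D p in \<open>auto intro!: AE_I2\<close>)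
  qed
  \<comment> \<open>With identical data only the term \<open>R / 3\<close> of the stability estimate
    remains, hence the ratio 1/3.\<close>
  have step: "norm (Y (Suc n) z t - Y n z t) \<le> exp (4 * L * t) * (R / 3 ^ Suc n)"
    if "\<And>t. t \<in> {0..T} \<Longrightarrow> Wd (time_marginal (\<mu>s (Suc n)) t) (time_marginal (\<mu>s n) t) \<le> R / 3 ^ n * exp (4 * L * t)"
      and z: "z \<in> mspace DD" and t: "t \<in> {0..T}" for n z t
  proof -
    have "norm (Y (Suc n) z t - Y n z t) \<le> exp (4 * L * t) * (4 / 3 * mdist DD z z + R / 3 ^ n / 3)"
      unfolding Y_def by (rule S_stability[OF \<mu>s \<mu>s z z _ that(1) t]) (use R(1) in auto)
    moreover have "mdist DD z z = 0" using z by (subst mdist_zero) auto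
    ultimately show ?thesis by (simp add: mult.commute[of 3])
  qed
  have W: "Wd (time_marginal (\<mu>s (Suc n)) t) (time_marginal (\<mu>s n) t) \<le> R / 3 ^ n * exp (4 * L * t)"
    if "t \<in> {0..T}" for n t
    using that
  proof (induction n arbitrary: t)
    case 0
    then show ?case using R(2) by simp
  next
    case (Suc n)
    have "Wd (time_marginal (\<mu>s (Suc (Suc n))) t) (time_marginal (\<mu>s (Suc n)) t) \<le> exp (4 * L * t) * (R / 3 ^ Suc n)"
      unfolding law[of "Suc n"] unfolding law[of n]
      by (rule close[OF Ym Ym Suc.prems _ step[OF Suc.IH _ Suc.prems]]) (use R(1) in auto)
    then show ?case by (simp add: mult.commute)
  qed
  define C where "C = \<Lambda> * R"
  have C: "0 \<le> C" using R(1) by (simp add: C_def)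
  have dY: "mdist PT (Y (Suc n) z) (Y n z) \<le> C / 3 ^ Suc n" if z: "z \<in> mspace DD" for n z
    unfolding mdist_path_le[OF T Yin[OF z] Yin[OF z]]
  proof
    fix t assume t: "t \<in> {0..T}"
    have "norm (Y (Suc n) z t - Y n z t) \<le> exp (4 * L * t) * (R / 3 ^ Suc n)" by (rule step[OF W z t])
    also have "\<dots> \<le> \<Lambda> * (R / 3 ^ Suc n)" using exp_le_Lam[OF t] R(1) by (intro mult_right_mono) auto
    finally show "norm (Y (Suc n) z t - Y n z t) \<le> C / 3 ^ Suc n" by (simp add: C_def)
  qed
  \<comment> \<open>The partial sum of the geometric series in closed form, so that the induction on
    \<open>k\<close> closes.\<close>
  have dY': "mdist PT (Y (n + k) z) (Y n z) \<le> C / 2 * (1 / 3 ^ n - 1 / 3 ^ (n + k))" if z: "z \<in> mspace DD" for n k z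
  proof (induction k)
    case 0
    then show ?case using Yin[OF z] by simp
  next
    case (Suc k)
    have "mdist PT (Y (n + Suc k) z) (Y n z) \<le> mdist PT (Y (Suc (n + k)) z) (Y (n + k) z) + mdist PT (Y (n + k) z) (Y n z)"
      using Yin[OF z] by (simp add: P.triangle)
    also have "\<dots> \<le> C / 3 ^ Suc (n + k) + C / 2 * (1 / 3 ^ n - 1 / 3 ^ (n + k))"
      by (intro add_mono dY[OF z] Suc)
    also have "\<dots> = C / 2 * (1 / 3 ^ n - 1 / 3 ^ (n + Suc k))" by (simp add: field_simps)
    finally show ?case .
  qed
  have dYn: "mdist PT (Y (n + k) z) (Y n z) \<le> C / 3 ^ n" if z: "z \<in> mspace DD" for n k z
  proof -
    have "(1::real) / 3 ^ (n + k) \<le> 1 / 3 ^ n"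
      by (intro divide_left_mono power_increasing) auto
    then have "C / 2 * (1 / 3 ^ n - 1 / 3 ^ (n + k)) \<le> C * (1 / 3 ^ n)"
      using C by (intro mult_mono) auto
    then show ?thesis using dY'[OF z, of n k] by simp
  qed
  define \<epsilon> where "\<epsilon> n = C / 3 ^ n" for n :: nat
  have \<epsilon>: "0 \<le> \<epsilon> n" for n using C by (simp add: \<epsilon>_def)
  have \<epsilon>lim: "\<epsilon> \<longlonglongrightarrow> 0"
  proof -
    have "(\<lambda>n. C * (1 / 3) ^ n) \<longlonglongrightarrow> C * 0" by (intro tendsto_intros LIMSEQ_realpow_zero) auto
    then show ?thesis by (simp add: \<epsilon>_def[abs_def] power_one_over)
  qed
  have "\<exists>y. y \<in> mspace PT \<and> (\<forall>n. mdist PT (Y n z) y \<le> \<epsilon> n)" if z: "z \<in> mspace DD" for z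
  proof -
    have "P.MCauchy (\<lambda>n. Y n z)"
      unfolding P.MCauchy_def
    proof (intro conjI allI impI)
      fix r :: real assume r: "0 < r"
      have "\<forall>\<^sub>F n in sequentially. \<epsilon> n < r / 2" using r by (intro order_tendstoD[OF \<epsilon>lim]) simp
      then obtain N where N: "\<epsilon> N < r / 2" by (auto simp: eventually_sequentially)
      have "mdist PT (Y n z) (Y n' z) < r" if "N \<le> n" "N \<le> n'" for n n'
      proof -
        have "mdist PT (Y n z) (Y N z) \<le> \<epsilon> N" "mdist PT (Y n' z) (Y N z) \<le> \<epsilon> N"
          using dYn[OF z, of N "n - N"] dYn[OF z, of N "n' - N"] that by (simp_all add: \<epsilon>_def)
        moreover have "mdist PT (Y n z) (Y n' z) \<le> mdist PT (Y n z) (Y N z) + mdist PT (Y N z) (Y n' z)"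
          by (rule P.triangle[OF Yin[OF z] Yin[OF z] Yin[OF z]])
        ultimately show ?thesis using N P.commute[of "Y n' z" "Y N z"] by linarith
      qed
      then show "\<exists>N. \<forall>n n'. N \<le> n \<longrightarrow> N \<le> n' \<longrightarrow> mdist PT (Y n z) (Y n' z) < r" by blast
    qed (use Yin[OF z] in auto)
    moreover have "P.mcomplete" using mcomplete_path by (simp add: mcomplete_of_def)
    ultimately obtain y where y: "limitin P.mtopology (\<lambda>n. Y n z) y sequentially"
      unfolding P.mcomplete_def by metis
    then have yin: "y \<in> mspace PT" and ylim: "(\<lambda>n. mdist PT (Y n z) y) \<longlonglongrightarrow> 0"
      by (auto simp: P.limitin_metric_dist_null)
    have "mdist PT (Y n z) y \<le> \<epsilon> n" for n
    proof (rule LIMSEQ_le_const)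
      have "(\<lambda>k. \<epsilon> n + mdist PT (Y (k + n) z) y) \<longlonglongrightarrow> \<epsilon> n + 0"
        by (intro tendsto_add tendsto_const LIMSEQ_ignore_initial_segment[OF ylim])
      then show "(\<lambda>k. \<epsilon> n + mdist PT (Y (k + n) z) y) \<longlonglongrightarrow> \<epsilon> n" by simp
      have "mdist PT (Y n z) y \<le> \<epsilon> n + mdist PT (Y (k + n) z) y" for k
      proof -
        have "mdist PT (Y n z) y \<le> mdist PT (Y n z) (Y (k + n) z) + mdist PT (Y (k + n) z) y"
          by (rule P.triangle[OF Yin[OF z] Yin[OF z] yin])
        moreover have "mdist PT (Y n z) (Y (k + n) z) \<le> \<epsilon> n"
          using dYn[OF z, of n k] unfolding \<epsilon>_def P.commute[of "Y n z"] add.commute[of k] .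
        ultimately show ?thesis by linarith
      qed
      then show "\<exists>N. \<forall>k\<ge>N. mdist PT (Y n z) y \<le> \<epsilon> n + mdist PT (Y (k + n) z) y" by blast
    qed
    then show ?thesis using yin by blast
  qed
  then obtain Y' where Y': "\<And>z. z \<in> mspace DD \<Longrightarrow> Y' z \<in> mspace PT" "\<And>z n. z \<in> mspace DD \<Longrightarrow> mdist PT (Y n z) (Y' z) \<le> \<epsilon> n"
    by metis
  \<comment> \<open>The common Lipschitz constant of the maps \<open>Y n\<close> survives the limit;
    it gives the limit map measurability and its law finite moments.\<close>
  have Lip: "mdist PT (Y' z) (Y' z') \<le> (\<Lambda> * (4 / 3)) * mdist DD z z'" if z: "z \<in> mspace DD" "z' \<in> mspace DD" for z z'
  proof (rule LIMSEQ_le_const)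
    have "(\<lambda>n. \<epsilon> n + (\<Lambda> * (4 / 3)) * mdist DD z z' + \<epsilon> n) \<longlonglongrightarrow> 0 + (\<Lambda> * (4 / 3)) * mdist DD z z' + 0"
      by (intro tendsto_add tendsto_const \<epsilon>lim)
    then show "(\<lambda>n. \<epsilon> n + (\<Lambda> * (4 / 3)) * mdist DD z z' + \<epsilon> n) \<longlonglongrightarrow> (\<Lambda> * (4 / 3)) * mdist DD z z'" by simp
    have "mdist PT (Y' z) (Y' z') \<le> \<epsilon> n + (\<Lambda> * (4 / 3)) * mdist DD z z' + \<epsilon> n" for n
    proof -
      have "mdist PT (Y' z) (Y' z') \<le> mdist PT (Y' z) (Y n z) + mdist PT (Y n z) (Y' z')"
        by (rule P.triangle[OF Y'(1)[OF z(1)] Yin[OF z(1)] Y'(1)[OF z(2)]])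
      moreover have "mdist PT (Y n z) (Y' z') \<le> mdist PT (Y n z) (Y n z') + mdist PT (Y n z') (Y' z')"
        by (rule P.triangle[OF Yin[OF z(1)] Yin[OF z(2)] Y'(1)[OF z(2)]])
      moreover have "mdist PT (Y n z) (Y n z') \<le> (\<Lambda> * (4 / 3)) * mdist DD z z'"
        unfolding Y_def by (rule S_Lipschitz[OF \<mu>s z])
      ultimately show ?thesis
        using Y'(2)[OF z(1), of n] Y'(2)[OF z(2), of n] P.commute[of "Y' z" "Y n z"] by linarith
    qed
    then show "\<exists>N. \<forall>n\<ge>N. mdist PT (Y' z) (Y' z') \<le> \<epsilon> n + (\<Lambda> * (4 / 3)) * mdist DD z z' + \<epsilon> n" by blast
  qed
  define \<mu> where "\<mu> = distr \<nu> (mborel PT) Y'"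
  have \<mu>: "\<mu> \<in> PP"
    unfolding \<mu>_def by (rule finite_moment_Lipschitz_image[OF sep_DD sep_PT \<nu> Y'(1) Lip]) auto
  have Y'm: "Y' \<in> \<nu> \<rightarrow>\<^sub>M mborel PT" using Lipschitz_measurable[OF Y'(1) Lip] D by (simp cong: measurable_cong_sets)
  have Wlim: "Wd (time_marginal \<mu> t) (time_marginal (\<mu>s (Suc n)) t) \<le> \<epsilon> n * exp (4 * L * t)" if t: "t \<in> {0..T}" for n t
  proof -
    have "Wd (time_marginal \<mu> t) (time_marginal (\<mu>s (Suc n)) t) \<le> \<epsilon> n"
      unfolding \<mu>_def law
    proof (rule close[OF Y'm Ym t \<epsilon>])
      fix z assume z: "z \<in> mspace DD"
      show "norm (Y' z t - Y n z t) \<le> \<epsilon> n"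
        using mdist_path_ge[OF T Y'(1)[OF z] Yin[OF z] t, of n] Y'(2)[OF z, of n] by (simp add: P.commute)
    qed
    also have "\<dots> \<le> \<epsilon> n * exp (4 * L * t)" using mult_left_mono[of 1 "exp (4 * L * t)" "\<epsilon> n"] \<epsilon> L t by simp
    finally show ?thesis .
  qed
  \<comment> \<open>Stability compares \<open>S \<mu>\<close> with the iterates: their flows
    approach that of \<open>\<mu>\<close>, so they converge to \<open>S \<mu>\<close> as well as to
    \<open>Y'\<close>.\<close>
  have "S \<mu> z = Y' z" if z: "z \<in> mspace DD" for z
  proof -
    have "mdist PT (S \<mu> z) (Y' z) \<le> 0"
    proof (rule LIMSEQ_le_const)
      have "(\<lambda>n. \<Lambda> * (\<epsilon> n / 3) + \<epsilon> (Suc n)) \<longlonglongrightarrow> \<Lambda> * (0 / 3) + 0"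
        by (intro tendsto_intros \<epsilon>lim LIMSEQ_Suc[OF \<epsilon>lim]) simp
      then show "(\<lambda>n. \<Lambda> * (\<epsilon> n / 3) + \<epsilon> (Suc n)) \<longlonglongrightarrow> 0" by simp
      have "mdist PT (S \<mu> z) (Y' z) \<le> \<Lambda> * (\<epsilon> n / 3) + \<epsilon> (Suc n)" for n
      proof -
        have "mdist PT (S \<mu> z) (Y (Suc n) z) \<le> \<Lambda> * (\<epsilon> n / 3)"
          unfolding mdist_path_le[OF T S_in[OF \<mu> z] Yin[OF z]]
        proof
          fix t assume t: "t \<in> {0..T}"
          have "norm (S \<mu> z t - Y (Suc n) z t) \<le> exp (4 * L * t) * (4 / 3 * mdist DD z z + \<epsilon> n / 3)"
            unfolding Y_def by (rule S_stability[OF \<mu> \<mu>s z z \<epsilon> Wlim t])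
          also have "mdist DD z z = 0" using z by simp
          also have "exp (4 * L * t) * (4 / 3 * 0 + \<epsilon> n / 3) \<le> \<Lambda> * (4 / 3 * 0 + \<epsilon> n / 3)"
            using exp_le_Lam[OF t] \<epsilon>[of n] by (intro mult_right_mono) auto
          finally show "norm (S \<mu> z t - Y (Suc n) z t) \<le> \<Lambda> * (\<epsilon> n / 3)" by simp
        qed
        then show ?thesis
          using P.triangle[OF S_in[OF \<mu> z] Yin[OF z] Y'(1)[OF z], of "Suc n"] Y'(2)[OF z, of "Suc n"] by linarith
      qed
      then show "\<exists>N. \<forall>n\<ge>N. mdist PT (S \<mu> z) (Y' z) \<le> \<Lambda> * (\<epsilon> n / 3) + \<epsilon> (Suc n)" by blast
    qed
    then have "mdist PT (S \<mu> z) (Y' z) = 0" by (simp add: antisym)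
    then show ?thesis using S_in[OF \<mu> z] Y'(1)[OF z] by simp
  qed
  then have "Phi T b \<nu> \<mu> = \<mu>" unfolding Phi_def \<mu>_def using D by (intro distr_cong) auto
  then show ?thesis using \<mu> that by blast
qed

definition Psi :: "((real^'d) \<times> (real \<Rightarrow> real^'d)) measure \<Rightarrow> (real \<Rightarrow> real^'d) measure" where
  "Psi \<nu> = (SOME \<mu>. \<mu> \<in> PP \<and> Phi T b \<nu> \<mu> = \<mu>)"

lemma Psi_fixed: "\<nu> \<in> PDt \<Longrightarrow> Psi \<nu> \<in> PP \<and> Phi T b \<nu> (Psi \<nu>) = Psi \<nu>"
  unfolding Psi_def using fixed_point_exists someI_ex[of "\<lambda>\<mu>. \<mu> \<in> PP \<and> Phi T b \<nu> \<mu> = \<mu>"] by blast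

lemma Psi_Lipschitz:
  assumes "\<nu> \<in> PDt" "\<nu>' \<in> PDt" shows "WP (Psi \<nu>) (Psi \<nu>') \<le> 2 * \<Lambda> * WD \<nu> \<nu>'"
  using fixed_point_Lipschitz[OF assms] Psi_fixed assms by blast

text \<open>Uniqueness of the fixed point is the Lipschitz estimate for equal data.\<close>

lemma Psi_eqI:
  assumes \<nu>: "\<nu> \<in> PDt" and \<mu>: "\<mu> \<in> PP" "Phi T b \<nu> \<mu> = \<mu>"
  shows "Psi \<nu> = \<mu>"
proof -
  interpret WP: Metric_space PP WP by (rule WP_metric)
  interpret WD: Metric_space PDt WD by (rule WD_metric)
  have "WP (Psi \<nu>) \<mu> \<le> 2 * \<Lambda> * WD \<nu> \<nu>"
    using fixed_point_Lipschitz[OF \<nu> \<nu> _ \<mu>(1) _ \<mu>(2)] Psi_fixed[OF \<nu>] by blast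
  then have "WP (Psi \<nu>) \<mu> = 0" using \<nu> WP.nonneg[of "Psi \<nu>" \<mu>] by simp
  then show ?thesis using WP.zero[of "Psi \<nu>" \<mu>] Psi_fixed[OF \<nu>] \<mu> by blast
qed

lemma Theta_Psi: "\<nu> \<in> PDt \<Longrightarrow> Theta (Psi \<nu>) = \<nu>"
  using Theta_Phi Psi_fixed by blast

lemma Psi_Theta: "\<mu> \<in> PP \<Longrightarrow> Psi (Theta \<mu>) = \<mu>"
  by (rule Psi_eqI[OF Theta_in _ Phi_Theta])

lemma Psi_continuous: "continuous_map (wasserstein_topology p DD) (wasserstein_topology p PT) Psi"
proof -
  interpret WP: Metric_space PP WP by (rule WP_metric)
  interpret WD: Metric_space PDt WD by (rule WD_metric)
  have "Lipschitz_continuous_map (metric (PDt, WD)) (metric (PP, WP)) Psi"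
    unfolding Lipschitz_continuous_map_def using Psi_fixed Psi_Lipschitz by auto
  from Lipschitz_continuous_imp_continuous_map[OF this] show ?thesis by (simp add: wasserstein_topology_def)
qed

lemma relative_entropy_Theta:
  assumes \<mu>: "\<mu> \<in> PP" and \<nu>: "prob_space \<nu>" "sets \<nu> = sets (mborel DD)"
  shows "relative_entropy \<mu> (Phi T b \<nu> \<mu>) = relative_entropy (Theta \<mu>) \<nu>"
proof -
  note D = PDt_D[OF Theta_in[OF \<mu>]]
  have sp: "space \<nu> = mspace DD" using sets_eq_imp_space_eq[OF \<nu>(2)] by simp
  have "relative_entropy (distr (Theta \<mu>) (mborel PT) (S \<mu>)) (distr \<nu> (mborel PT) (S \<mu>)) = relative_entropy (Theta \<mu>) \<nu>"
  proof (rule relative_entropy_distr_iso[OF \<nu>(1) D(1), where T' = "G \<mu>"])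
    show "sets (Theta \<mu>) = sets \<nu>" using D \<nu> by simp
    show "S \<mu> \<in> \<nu> \<rightarrow>\<^sub>M mborel PT" using S_meas[OF \<mu>] \<nu> by (simp cong: measurable_cong_sets)
    show "G \<mu> \<in> mborel PT \<rightarrow>\<^sub>M \<nu>" using G_meas[OF \<mu>] \<nu> by (simp cong: measurable_cong_sets)
  qed (use S_G[OF \<mu>] G_S[OF \<mu>] sp in auto)
  then show ?thesis using Phi_Theta[OF \<mu>] by (simp add: Phi_def)
qed

text \<open>The measures in the particle system are the marginals of the empirical measure of the
  paths. By uniqueness each particle is therefore the solution map at its own data, and the
  empirical measure of the paths is the image of that of the data.\<close>

lemma particle_system_fixed_point:
  assumes N: "1 \<le> N" and z: "\<And>i. i \<in> {1..N} \<Longrightarrow> (z i, w i) \<in> mspace DD"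
    and sol: "particle_system_solution T b N z w x"
  shows "Psi (empirical_measure (mborel DD) N (\<lambda>i. (z i, w i))) = empirical_measure (mborel PT) N x"
proof -
  let ?\<nu> = "empirical_measure (mborel DD) N (\<lambda>i. (z i, w i))"
  let ?\<mu> = "empirical_measure (mborel PT) N x"
  have x: "x i \<in> mspace PT" if "i \<in> {1..N}" for i
    using sol that by (auto simp: particle_system_solution_def solves_integral_equation_def)
  have \<nu>: "?\<nu> \<in> PDt" by (rule separable_metric.empirical_finite_moment[OF sep_DD p N z])
  have \<mu>: "?\<mu> \<in> PP" by (rule separable_metric.empirical_finite_moment[OF sep_PT p N x])
  have eq: "S ?\<mu> (z i, w i) = x i" if i: "i \<in> {1..N}" for i
  proof (rule S_eqI[OF \<mu> z[OF i]])
    have "solves_integral_equation T (\<lambda>s y. b s y (empirical_measure borel N (\<lambda>j. x j s))) (z i) (w i) (x i)"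
      using sol i by (simp add: particle_system_solution_def)
    then show "solves (time_marginal ?\<mu>) (z i) (w i) (x i)"
      using empirical_marginal[OF x] by (subst solves_cong) auto
  qed
  have zm: "(\<lambda>i. (z i, w i)) \<in> uniform_count_measure {1..N} \<rightarrow>\<^sub>M mborel DD"
    by (rule empirical_map_measurable) (use z in simp)
  have "Phi T b ?\<nu> ?\<mu> = distr (uniform_count_measure {1..N}) (mborel PT) (S ?\<mu> \<circ> (\<lambda>i. (z i, w i)))"
    unfolding Phi_def unfolding empirical_measure_def[of "mborel DD"] by (rule distr_distr[OF S_meas[OF \<mu>] zm])
  also have "\<dots> = ?\<mu>"
    unfolding empirical_measure_def[of "mborel PT" N x]
  proof (rule distr_cong)
    fix i assume "i \<in> space (uniform_count_measure {1..N})"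
    then show "(S (distr (uniform_count_measure {1..N}) (mborel PT) x) \<circ> (\<lambda>i. (z i, w i))) i = x i"
      using eq[of i] by (simp add: space_uniform_count_measure empirical_measure_def)
  qed auto
  finally show ?thesis by (rule Psi_eqI[OF \<nu> \<mu>])
qed

end

text \<open>\<open>max K 1\<close> keeps the resulting constant positive whatever the sign of
  \<open>K\<close>; the 2 comes from bounding both \<open>a\<close> and \<open>w\<close> by
  \<open>a + w\<close>.\<close>

lemma lipschitz_root:
  assumes p: "1 \<le> p" and le: "(n :: real) powr p \<le> K * (a powr p + w powr p)"
    and nonneg: "0 \<le> n" "0 \<le> a" "0 \<le> w"
  shows "n \<le> (2 * max K 1) powr (1 / p) * (a + w)"
proof -
  have "n powr p \<le> max K 1 * (a powr p + w powr p)"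
    using le by (rule order_trans) (auto intro!: mult_right_mono)
  also have "\<dots> \<le> max K 1 * ((a + w) powr p + (a + w) powr p)"
    using nonneg p by (intro mult_left_mono add_mono powr_mono2) auto
  finally have "n powr p \<le> 2 * max K 1 * (a + w) powr p" by simp
  then have "(n powr p) powr (1 / p) \<le> (2 * max K 1 * (a + w) powr p) powr (1 / p)"
    using p by (intro powr_mono2) auto
  then show ?thesis using nonneg p by (simp add: powr_powr powr_mult)
qed

theorem theorem34:
  fixes T p :: real
    and b :: "real \<Rightarrow> real^'d \<Rightarrow> (real^'d) measure \<Rightarrow> real^'d"
    and M :: "'w measure"
    and \<zeta> :: "nat \<Rightarrow> 'w \<Rightarrow> real^'d"
    and W :: "nat \<Rightarrow> 'w \<Rightarrow> real \<Rightarrow> real^'d"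
    and \<nu> :: "((real^'d) \<times> (real \<Rightarrow> real^'d)) measure"
    and X :: "nat \<Rightarrow> nat \<Rightarrow> 'w \<Rightarrow> real \<Rightarrow> real^'d"
  assumes "0 < T" and "1 \<le> p"
    and b_measurable: "(\<lambda>(t, x, \<mu>). b t x \<mu>) \<in>
      restrict_space borel {0..T} \<Otimes>\<^sub>M borel \<Otimes>\<^sub>M borel_of (wasserstein_topology p euclidean_metric)
        \<rightarrow>\<^sub>M borel"
    and b_lipschitz: "\<exists>K. \<forall>t\<in>{0..T}. \<forall>x x'.
      \<forall>\<mu>\<in>finite_moment_measures p euclidean_metric. \<forall>\<mu>'\<in>finite_moment_measures p euclidean_metric.
        norm (b t x \<mu> - b t x' \<mu>') powr p
          \<le> K * (norm (x - x') powr p + wasserstein p euclidean_metric \<mu> \<mu>' powr p)"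
    and "prob_space M"
    and Lp: "\<forall>i\<ge>1. Lp_random_variable p M (data_metric T) (\<lambda>\<omega>. (\<zeta> i \<omega>, W i \<omega>))"
    and indep: "prob_space.indep_vars M (\<lambda>_. mborel (data_metric T)) (\<lambda>i \<omega>. (\<zeta> i \<omega>, W i \<omega>)) {1..}"
    and law: "\<forall>i\<ge>1. distr M (mborel (data_metric T)) (\<lambda>\<omega>. (\<zeta> i \<omega>, W i \<omega>)) = \<nu>"
    and exp_moment: "\<exists>x0. \<exists>\<gamma>0\<in>mspace (path0_metric T). \<forall>\<theta>::real. \<theta> > 0 \<longrightarrow>
      extended_ln (\<integral>\<^sup>+ (x, \<gamma>).
        ennreal (exp (\<theta> * (norm (x - x0) + mdist (path0_metric T) \<gamma> \<gamma>0) powr p)) \<partial>\<nu>) < \<infinity>"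
    and solution: "\<forall>N\<ge>1. \<forall>\<omega>\<in>space M.
      particle_system_solution T b N (\<lambda>i. \<zeta> i \<omega>) (\<lambda>i. W i \<omega>) (\<lambda>i. X N i \<omega>)"
  shows "satisfies_LDP M (wasserstein_topology p (path_metric T))
           (\<lambda>N \<omega>. empirical_measure (mborel (path_metric T)) N (\<lambda>i. X N i \<omega>))
           (\<lambda>N. real N)
           (\<lambda>\<mu>. relative_entropy \<mu> (Phi T b \<nu> \<mu>))
       \<and> good_rate_function (wasserstein_topology p (path_metric T))
           (\<lambda>\<mu>. relative_entropy \<mu> (Phi T b \<nu> \<mu>))"
proof -
  interpret M: prob_space M by fact
  obtain K where K: "norm (b t x \<mu> - b t x' \<mu>') powr p
      \<le> K * (norm (x - x') powr p + wasserstein p euclidean_metric \<mu> \<mu>' powr p)"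
    if "t \<in> {0..T}" "\<mu> \<in> finite_moment_measures p euclidean_metric" "\<mu>' \<in> finite_moment_measures p euclidean_metric"
    for t x x' \<mu> \<mu>'
    using b_lipschitz by blast
  define L where "L = (2 * max K 1) powr (1 / p)"
  interpret drift_base T p L b
  proof
    show "0 < L" by (simp add: L_def)
    show "norm (b t x \<mu> - b t x' \<mu>') \<le> L * (norm (x - x') + wasserstein p euclidean_metric \<mu> \<mu>')"
      if "t \<in> {0..T}" "\<mu> \<in> finite_moment_measures p euclidean_metric" "\<mu>' \<in> finite_moment_measures p euclidean_metric"
      for t x x' \<mu> \<mu>'
      unfolding L_def by (rule lipschitz_root[OF \<open>1 \<le> p\<close> K[OF that]]) (auto simp: wasserstein_nonneg)
  qed fact+
  define Z where "Z i \<omega> = (\<zeta> i \<omega>, W i \<omega>)" for i \<omega>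
  have Zm: "Z i \<in> M \<rightarrow>\<^sub>M mborel DD" if "1 \<le> i" for i
    using Lp that by (simp add: Lp_random_variable_def Z_def[abs_def])
  have Zlaw: "distr M (mborel DD) (Z i) = \<nu>" if "1 \<le> i" for i
    using law that by (simp add: Z_def[abs_def])
  have Zin: "(\<zeta> i \<omega>, W i \<omega>) \<in> mspace DD" if "1 \<le> i" "\<omega> \<in> space M" for i \<omega>
    using measurable_space[OF Zm[OF that(1)] that(2)] by (simp add: Z_def)
  have \<nu>: "prob_space \<nu>" "sets \<nu> = sets (mborel DD)"
    using M.prob_space_distr[OF Zm[of 1]] Zlaw[of 1, symmetric] by simp_all
  \<comment> \<open>For \<open>N = 1\<close> and any point \<open>\<omega>\<close> of the
    probability space, the particle solves its equation, so its drift is integrable. Integrability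
    is then transferred to the zero path and the constant Dirac flow.\<close>
  interpret drift T p L b
  proof
    obtain \<omega> where \<omega>: "\<omega> \<in> space M" using M.not_empty by blast
    let ?x = "\<lambda>i. X 1 i \<omega>"
    let ?\<mu> = "empirical_measure (mborel PT) 1 ?x"
    have s: "solves_integral_equation T (\<lambda>s y. b s y (empirical_measure borel 1 (\<lambda>j. ?x j s))) (\<zeta> 1 \<omega>) (W 1 \<omega>) (?x 1)"
      using solution[rule_format, of 1 \<omega>] \<omega> by (simp add: particle_system_solution_def)
    then have x: "?x i \<in> mspace PT" if "i \<in> {1..1}" for i
      using that by (simp add: solves_integral_equation_def)
    have \<mu>: "?\<mu> \<in> PP" by (rule separable_metric.empirical_finite_moment[OF sep_PT p _ x]) auto
    have "set_integrable lborel {0..T} (\<lambda>s. b s (?x 1 s) (time_marginal ?\<mu> s))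
        \<longleftrightarrow> set_integrable lborel {0..T} (\<lambda>s. b s (?x 1 s) (empirical_measure borel 1 (\<lambda>j. ?x j s)))"
      using empirical_marginal[OF x] by (intro set_integrable_cong) auto
    then have "set_integrable lborel {0..T} (\<lambda>s. b s (?x 1 s) (time_marginal ?\<mu> s))"
      using s by (simp add: solves_integral_equation_def)
    then have "set_integrable lborel {0..T} (\<lambda>s. b s (zero_path T s) \<delta>0)"
      using x by (intro drift_int_transfer[OF flow_const marginal_flow[OF \<mu>] zero_path_in(1)[OF T]]) auto
    moreover have "set_integrable lborel {0..T} (\<lambda>s. b s (zero_path T s) \<delta>0) \<longleftrightarrow> set_integrable lborel {0..T} (\<lambda>s. b s 0 \<delta>0)"
      by (intro set_integrable_cong) (auto simp: zero_path_def)
    ultimately show "set_integrable lborel {0..T} (\<lambda>s. b s 0 \<delta>0)" by simp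
  qed
  obtain x0 \<gamma>0 where \<gamma>0: "\<gamma>0 \<in> mspace (path0_metric T :: (real \<Rightarrow> real^'d) metric)"
    and ex: "\<And>\<theta>::real. 0 < \<theta> \<Longrightarrow> extended_ln (\<integral>\<^sup>+ (x, \<gamma>).
        ennreal (exp (\<theta> * (norm (x - x0) + mdist (path0_metric T) \<gamma> \<gamma>0) powr p)) \<partial>\<nu>) < \<infinity>"
    using exp_moment by blast
  \<comment> \<open>Starting the dense sequence at \<open>(x0, \<gamma>0)\<close> makes
    \<open>e 0\<close> the centre of the assumed exponential moment.\<close>
  obtain e where e: "separable_metric DD e" "e 0 = (x0, \<gamma>0)" using separable_metric_data[OF T \<gamma>0] by blast
  interpret iid_sample DD e \<nu> p M Z
  proof (intro iid_sample.intro exp_moment_space.intro e(1) \<nu>(1) \<open>prob_space M\<close>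
      exp_moment_space_axioms.intro iid_sample_axioms.intro p \<nu>(2) Zlaw)
    fix \<theta> :: real assume \<theta>: "0 < \<theta>"
    have "(\<integral>\<^sup>+ (x, \<gamma>). ennreal (exp (\<theta> * (norm (x - x0) + mdist (path0_metric T) \<gamma> \<gamma>0) powr p)) \<partial>\<nu>) < \<infinity>"
      using ex[OF \<theta>] by (auto simp: extended_ln_def less_top split: if_splits)
    moreover have "mdist DD z (x0, \<gamma>0) = norm (fst z - x0) + mdist (path0_metric T) (snd z) \<gamma>0" for z
      by (cases z) (simp add: dist_norm)
    ultimately show "(\<integral>\<^sup>+ z. ennreal (exp (\<theta> * mdist DD z (e 0) powr p)) \<partial>\<nu>) < \<infinity>"
      unfolding e(2) by (simp only: case_prod_beta')
  next
    show "M.indep_vars (\<lambda>_. mborel DD) Z {1..}" using indep by (simp add: Z_def[abs_def])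
  qed
  interpret WP: Metric_space PP WP by (rule WP_metric)
  have top: "topspace (wasserstein_topology p PT) = PP" "topspace (wasserstein_topology p DD) = PDt"
    using WP.topspace_mtopology Metric_space.topspace_mtopology[OF WD_metric]
    by (simp_all add: wasserstein_topology_def)
  show ?thesis
  proof (rule LDP_contraction_bijective[OF sanov_wasserstein J_good(2) Psi_continuous, where \<Theta> = Theta])
    show "Hausdorff_space (wasserstein_topology p PT)"
      unfolding wasserstein_topology_def by (rule WP.Hausdorff_space_mtopology)
    show "Theta \<mu> \<in> topspace (wasserstein_topology p DD) \<and> Psi (Theta \<mu>) = \<mu>"
      if "\<mu> \<in> topspace (wasserstein_topology p PT)" for \<mu>
      using that Theta_in Psi_Theta unfolding top by blast
    show "Theta (Psi \<nu>') = \<nu>'" if "\<nu>' \<in> topspace (wasserstein_topology p DD)" for \<nu>'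
      using that Theta_Psi unfolding top by blast
    show "empirical_measure (mborel PT) N (\<lambda>i. X N i \<omega>) = Psi (iid_sample.L DD Z N \<omega>)"
      if "1 \<le> N" "\<omega> \<in> space M" for N \<omega>
      unfolding L_def Z_def
      using that solution Zin by (intro particle_system_fixed_point[symmetric, where z = "\<lambda>i. \<zeta> i \<omega>" and w = "\<lambda>i. W i \<omega>"]) auto
    show "relative_entropy \<mu> (Phi T b \<nu> \<mu>) = relative_entropy (Theta \<mu>) \<nu>"
      if "\<mu> \<in> topspace (wasserstein_topology p PT)" for \<mu>
      using that relative_entropy_Theta[OF _ \<nu>] unfolding top by blast
  qed
qed

end
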